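(* Let $(\mathcal{N},[\cdot,\dots,\cdot])$ be an $n$-ary-Nambu-Lie superalgebra, let $(V,[\cdot,\dots,\cdot]_V)$ be an $\mathcal{N}$-module, and let $\mathcal{L}(\mathcal{N})$, $W$, $C^k(\mathcal{N},V)$, $C^k(\mathcal{L}(\mathcal{N}),W)$, $d^k$ and $\Delta^k$ be as defined in the context. For $k\ge 0$ define $\delta^{k+1}:C^{k}(\mathcal{N},V)\to C^{k+1}(\mathcal{N},V)$ on homogeneous $f$ and homogeneous arguments $x_j=x_j^1\wedge\dots\wedge x_j^{n-1}\in\mathcal{L}(\mathcal{N})$, $z\in\mathcal{N}$, by $$\begin{aligned} \delta^{k+1}(f)(x_0,\dots,x_k,z)=&-\sum_{0\le s<t\le k}(-1)^{s+|x_s|(|x_{s+1}|+\dots+|x_{t-1}|)}f(x_0,\dots,\widehat{x_s},\dots,x_{t-1},[x_s,x_t]_L,x_{t+1},\dots,x_k,z)\\ &-\sum_{s=0}^{k}(-1)^{s+|x_s|(|x_{s+1}|+\dots+|x_k|)}f(x_0,\dots,\widehat{x_s},\dots,x_k,ad(x_s)(z))\\ &+\sum_{s=0}^{k}(-1)^{s+|x_s|(|f|+|x_0|+\dots+|x_{s-1}|)}\big[x_s,f(x_0,\dots,\widehat{x_s},\dots,x_k,z)\big]_V\\ &+\sum_{i=1}^{n-1}(-1)^{k-i+\epsilon_i}\big[z\wedge x_k^1\wedge\dots\wedge\widehat{x_k^i}\wedge\dots\wedge x_k^{n-1},\,f(x_0,\dots,x_{k-1},x_k^i)\big]_V, \end{aligned}$$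 where $$\epsilon_i=\big(|f|+|x_0|+\dots+|x_{k-1}|+|x_k^{i+1}|+\dots+|x_k^{n-1}|\big)\big(|x_k^i|+|x_k|\big)+|z|\big(|f|+|x_0|+\dots+|x_k|\big)+|x_k|\big(|x_k^{i+1}|+\dots+|x_k^{n-1}|\big).$$ Then the spaces $C^k(\mathcal{N},V)$, $k\ge0$, with the maps $\delta^{k+1}$ form a cochain complex, i.e. $\delta^{k+2}\circ\delta^{k+1}=0$ for all $k\ge 0$, and $$d^{k+1}\circ\Delta^{k}=\Delta^{k+1}\circ\delta^{k+1}\qquad\text{for all }k\ge 0 .$$
   Context: All spaces are over a field $\mathbb{K}$ and $\mathbb{Z}_2$-graded; $|x|$ is the parity of a homogeneous element, $|(x_1,\dots,x_m)|=|x_1|+\dots+|x_m|$; a hat denotes omission; formulas are stated for homogeneous elements and extended by linearity; $|f|$ is the parity of a homogeneous (multi)linear map $f$. An $n$-ary-Nambu-Lie superalgebra is a vector superspace $\mathcal{N}=\mathcal{N}_0\oplus\mathcal{N}_1$ with an even $n$-linear map $[\cdot,\dots,\cdot]:\mathcal{N}^n\to\mathcal{N}$ that is super skew-symmetric, $[x_1,\dots,x_{i-1},x_i,\dots,x_n]=-(-1)^{|x_{i-1}||x_i|}[x_1,\dots,x_i,x_{i-1},\dots,x_n]$, and satisfies the Nambu identity $$[y_2,\dots,y_n,[x_1,\dots,x_n]]=\sum_{i=1}^n(-1)^{(|y_2|+\dots+|y_n|)(|x_1|+\dots+|x_{i-1}|)}[x_1,\dots,[y_2,\dots,y_n,x_i],\dots,x_n].$$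 $\mathcal{L}(\mathcal{N})=\wedge^{n-1}\mathcal{N}$ is the super exterior power ($u\wedge v=-(-1)^{|u||v|}v\wedge u$). For $x=x_1\wedge\dots\wedge x_{n-1}\in\mathcal{L}(\mathcal{N})$ and $z\in\mathcal{N}$, $ad(x)(z)=[x_1,\dots,x_{n-1},z]$. For $x,y\in\mathcal{L}(\mathcal{N})$, $y=y_1\wedge\dots\wedge y_{n-1}$, $$[x,y]_L=\sum_{i=1}^{n-1}(-1)^{|x|(|y_1|+\dots+|y_{i-1}|)}y_1\wedge\dots\wedge ad(x)(y_i)\wedge\dots\wedge y_{n-1}.$$ An $\mathcal{N}$-module is a vector superspace $V$ with an even multilinear map $[\cdot,\dots,\cdot]_V:\mathcal{N}^{n-1}\times V\to V$, super skew-symmetric in the $\mathcal{N}$-arguments (so it is defined on $\mathcal{L}(\mathcal{N})\times V$), such that for homogeneous $x=(x_1,\dots,x_{n-1})$, $y=(y_1,\dots,y_{n-1})$ in $\mathcal{N}^{n-1}$, $x_n\in\mathcal{N}$ and $v\in V$: $$[ad(x)(x_n),y_2,\dots,y_{n-1},v]_V=\sum_{i=1}^n(-1)^{n-i+|x_i|(|x_{i+1}|+\dots+|x_n|)}\big[x_1,\dots,\widehat{x_i},\dots,x_n,[x_i,y_2,\dots,y_{n-1},v]_V\big]_V,$$ $$\sum_{i=1}^{n-1}(-1)^{|y|(|x_1|+\dots+|x_{i-1}|)}[x_1,\dots,ad(y)(x_i),\dots,x_{n-1},v]_V=[y,[x,v]_V]_V-(-1)^{|y||x|}[x,[y,v]_V]_V.$$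 Write $ad(x)(v)=[x,v]_V$ for $x\in\mathcal{L}(\mathcal{N})$, $v\in V$. $W=\mathcal{L}(\mathcal{N},V)$ is the space spanned by the elements $x_1\wedge\dots\wedge x_{n-2}\wedge v$ ($x_i\in\mathcal{N}$, $v\in V$), where the wedge symbol is super skew-symmetric and the factor from $V$ may be placed in any position using $u_1\wedge\dots\wedge u_{j-1}\wedge u_j\wedge\dots\wedge u_{n-1}=-(-1)^{|u_{j-1}||u_j|}u_1\wedge\dots\wedge u_j\wedge u_{j-1}\wedge\dots\wedge u_{n-1}$. For $x\in\mathcal{L}(\mathcal{N})$, $$[x,y_1\wedge\dots\wedge y_{n-2}\wedge v]_W=\sum_{i=1}^{n-2}(-1)^{|x|(|y_1|+\dots+|y_{i-1}|)}y_1\wedge\dots\wedge ad(x)(y_i)\wedge\dots\wedge y_{n-2}\wedge v+(-1)^{|x|(|y_1|+\dots+|y_{n-2}|)}y_1\wedge\dots\wedge y_{n-2}\wedge ad(x)(v),$$ and for $y=y_1\wedge\dots\wedge y_{n-1}\in\mathcal{L}(\mathcal{N})$, $$[x_1\wedge\dots\wedge x_{n-2}\wedge v,\,y]'_W=-\sum_{i=1}^{n-1}(-1)^{(|x_1|+\dots+|x_{n-2}|+|v|)(|y_1|+\dots+|y_{i-1}|)+|v||y_i|}y_1\wedge\dots\wedge ad(x_1\wedge\dots\wedge x_{n-2}\wedge y_i)(v)\wedge\dots\wedge y_{n-1},$$ the factor $ad(\cdots)(v)$ standing in position $i$. $C^k(\mathcal{N},V)$ is the space of multilinear maps $\mathcal{L}(\mathcal{N})^k\times\mathcal{N}\to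 V$, and $C^k(\mathcal{L}(\mathcal{N}),W)$ the space of multilinear maps $\mathcal{L}(\mathcal{N})^k\to W$ (with $C^0(\mathcal{L}(\mathcal{N}),W)=W$). The map $d^k:C^k(\mathcal{L}(\mathcal{N}),W)\to C^{k+1}(\mathcal{L}(\mathcal{N}),W)$ is $d^0f(x)=-[x,f]_W$ and, for $k\ge1$, $$\begin{aligned}d^k(f)(x_0,\dots,x_k)=&-\sum_{0\le s<t\le k}(-1)^{s+|x_s|(|x_{s+1}|+\dots+|x_{t-1}|)}f(x_0,\dots,\widehat{x_s},\dots,x_{t-1},[x_s,x_t]_L,x_{t+1},\dots,x_k)\\&+\sum_{s=0}^{k-1}(-1)^{s+|x_s|(|f|+|x_0|+\dots+|x_{s-1}|)}[x_s,f(x_0,\dots,\widehat{x_s},\dots,x_k)]_W+(-1)^{k+1}[f(x_0,\dots,x_{k-1}),x_k]'_W.\end{aligned}$$ The linear map $\Delta^k:C^k(\mathcal{N},V)\to C^{k+1}(\mathcal{L}(\mathcal{N}),W)$, $k\ge0$, is $$\Delta^k(f)(x_0,\dots,x_k)=\sum_{i=1}^{n-1}(-1)^{(|f|+|x_0|+\dots+|x_{k-1}|)(|x_k^1|+\dots+|x_k^{i-1}|)}x_k^1\wedge\dots\wedge x_k^{i-1}\wedge f(x_0,\dots,x_{k-1},x_k^i)\wedge x_k^{i+1}\wedge\dots\wedge x_k^{n-1},$$ where $x_j=x_j^1\wedge\dots\wedge x_j^{n-1}$. *)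

theory Defs
  imports Complex_Main "HOL-Library.Poly_Mapping" "HOL-Library.Function_Algebras"
    "HOL-Library.Product_Plus"
begin

section \<open>Linear and multilinear maps on subspaces\<close>

definition linear_on ::
  "('k \<Rightarrow> 'a::ab_group_add \<Rightarrow> 'a) \<Rightarrow> 'a set \<Rightarrow> ('k \<Rightarrow> 'b::ab_group_add \<Rightarrow> 'b) \<Rightarrow> 'b set \<Rightarrow> ('a \<Rightarrow> 'b) \<Rightarrow> bool"
  where "linear_on sA A sB B h \<longleftrightarrow>
    (\<forall>x\<in>A. h x \<in> B) \<and>
    (\<forall>x\<in>A. \<forall>y\<in>A. h (x + y) = h x + h y) \<and>
    (\<forall>c. \<forall>x\<in>A. h (sA c x) = sB c (h x))"

definition bilinear_on ::
  "('k \<Rightarrow> 'a::ab_group_add \<Rightarrow> 'a) \<Rightarrow> 'a set \<Rightarrow> ('k \<Rightarrow> 'b::ab_group_add \<Rightarrow> 'b) \<Rightarrow> 'b set \<Rightarrow>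
   ('k \<Rightarrow> 'c::ab_group_add \<Rightarrow> 'c) \<Rightarrow> 'c set \<Rightarrow> ('a \<Rightarrow> 'b \<Rightarrow> 'c) \<Rightarrow> bool"
  where "bilinear_on sA A sB B sC C h \<longleftrightarrow>
    (\<forall>y\<in>B. linear_on sA A sC C (\<lambda>x. h x y)) \<and>
    (\<forall>x\<in>A. linear_on sB B sC C (h x))"

text \<open>The arguments of a multilinear map are passed as a list of length \<open>m\<close>.\<close>

definition multilinear_on ::
  "nat \<Rightarrow> ('k \<Rightarrow> 'a::ab_group_add \<Rightarrow> 'a) \<Rightarrow> 'a set \<Rightarrow> ('k \<Rightarrow> 'b::ab_group_add \<Rightarrow> 'b) \<Rightarrow> 'b set \<Rightarrow>
   ('a list \<Rightarrow> 'b) \<Rightarrow> bool"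
  where "multilinear_on m sA A sB B g \<longleftrightarrow>
    (\<forall>xs. length xs = m \<and> set xs \<subseteq> A \<longrightarrow>
       g xs \<in> B \<and> (\<forall>i<m. linear_on sA A sB B (\<lambda>x. g (xs[i := x]))))"

definition del :: "nat \<Rightarrow> 'a list \<Rightarrow> 'a list"
  where "del i xs = take i xs @ drop (Suc i) xs"


section \<open>Superspaces\<close>

text \<open>The underlying space is the whole type; only \<open>grade S 0\<close> and \<open>grade S 1\<close> are relevant.\<close>

record ('k, 'a) superspace =
  smult :: "'k \<Rightarrow> 'a \<Rightarrow> 'a"
  grade :: "nat \<Rightarrow> 'a set"

definition superspace :: "('k::field, 'a::ab_group_add, 'z) superspace_scheme \<Rightarrow> bool"
  where "superspace S \<longleftrightarrow>
    vector_space (smult S) \<and>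
    module.subspace (smult S) (grade S 0) \<and>
    module.subspace (smult S) (grade S 1) \<and>
    grade S 0 \<inter> grade S 1 = {0} \<and>
    (\<forall>x. \<exists>x0\<in>grade S 0. \<exists>x1\<in>grade S 1. x = x0 + x1)"

definition homog :: "('k, 'a, 'z) superspace_scheme \<Rightarrow> 'a set"
  where "homog S = grade S 0 \<union> grade S 1"

text \<open>Meaningful for homogeneous elements only. The vector \<open>0\<close> has both parities; \<open>par\<close> assigns
  it the even one, which is immaterial because in every formula below all terms vanish when
  one of the arguments does.\<close>

definition par :: "('k, 'a, 'z) superspace_scheme \<Rightarrow> 'a \<Rightarrow> nat"
  where "par S x = (if x \<in> grade S 0 then 0 else 1)"

definition parl :: "('k, 'a, 'z) superspace_scheme \<Rightarrow> 'a list \<Rightarrow> nat"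
  where "parl S xs = (\<Sum>x\<leftarrow>xs. par S x)"

text \<open>Lists of \<open>m\<close> homogeneous vectors.\<close>

definition hlists :: "nat \<Rightarrow> ('k, 'a, 'z) superspace_scheme \<Rightarrow> 'a list set"
  where "hlists m S = {xs. length xs = m \<and> set xs \<subseteq> homog S}"

definition super_skew ::
  "nat \<Rightarrow> ('k::field, 'a, 'z) superspace_scheme \<Rightarrow> ('k \<Rightarrow> 'b::ab_group_add \<Rightarrow> 'b) \<Rightarrow> ('a list \<Rightarrow> 'b) \<Rightarrow> bool"
  where "super_skew m S sB g \<longleftrightarrow>
    (\<forall>xs\<in>hlists m S. \<forall>i. Suc i < m \<longrightarrow>
       g xs = - sB ((-1) ^ (par S (xs ! i) * par S (xs ! Suc i)))
                 (g (xs[i := xs ! Suc i, Suc i := xs ! i])))"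

definition dsum ::
  "('k, 'a, 'y) superspace_scheme \<Rightarrow> ('k, 'b, 'z) superspace_scheme \<Rightarrow> ('k, 'a \<times> 'b) superspace"
  where "dsum S T = \<lparr> smult = (\<lambda>c (x, y). (smult S c x, smult T c y)),
                       grade = (\<lambda>p. grade S p \<times> grade T p) \<rparr>"


section \<open>Nambu-Lie superalgebras and their modules\<close>

record ('k, 'a) nary_superalgebra = "('k, 'a) superspace" +
  brk :: "'a list \<Rightarrow> 'a"

text \<open>List positions are counted from \<open>0\<close>, so that the index \<open>i\<close> of the customary formulas is
  \<open>i + 1\<close> here.\<close>

definition nambu_lie_superalgebra ::
  "nat \<Rightarrow> ('k::field, 'a::ab_group_add) nary_superalgebra \<Rightarrow> bool"
  where "nambu_lie_superalgebra n N \<longleftrightarrow>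
    superspace N \<and>
    multilinear_on n (smult N) UNIV (smult N) UNIV (brk N) \<and>
    (\<forall>xs\<in>hlists n N. brk N xs \<in> grade N (parl N xs mod 2)) \<and>
    super_skew n N (smult N) (brk N) \<and>
    (\<forall>ys\<in>hlists (n - 1) N. \<forall>xs\<in>hlists n N.
       brk N (ys @ [brk N xs]) =
       (\<Sum>i<n. smult N ((-1) ^ (parl N ys * parl N (take i xs)))
                 (brk N (xs[i := brk N (ys @ [xs ! i])]))))"

record ('k, 'a, 'v) nary_module = "('k, 'v) superspace" +
  act :: "'a list \<Rightarrow> 'v \<Rightarrow> 'v"

definition nambu_module ::
  "nat \<Rightarrow> ('k::field, 'a::ab_group_add) nary_superalgebra \<Rightarrow> ('k, 'a, 'v::ab_group_add) nary_module \<Rightarrow> bool"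
  where "nambu_module n N V \<longleftrightarrow>
    superspace V \<and>
    (\<forall>v. multilinear_on (n - 1) (smult N) UNIV (smult V) UNIV (\<lambda>xs. act V xs v)) \<and>
    (\<forall>xs. length xs = n - 1 \<longrightarrow> linear_on (smult V) UNIV (smult V) UNIV (act V xs)) \<and>
    (\<forall>xs\<in>hlists (n - 1) N. \<forall>v\<in>homog V. act V xs v \<in> grade V ((parl N xs + par V v) mod 2)) \<and>
    (\<forall>v. super_skew (n - 1) N (smult V) (\<lambda>xs. act V xs v)) \<and>
    (\<forall>xs\<in>hlists n N. \<forall>ys\<in>hlists (n - 2) N. \<forall>v.
       act V (brk N xs # ys) v =
       (\<Sum>i<n. smult V ((-1) ^ (n - Suc i + par N (xs ! i) * parl N (drop (Suc i) xs)))
                 (act V (del i xs) (act V (xs ! i # ys) v)))) \<and>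
    (\<forall>xs\<in>hlists (n - 1) N. \<forall>ys\<in>hlists (n - 1) N. \<forall>v.
       (\<Sum>i<n - 1. smult V ((-1) ^ (parl N ys * parl N (take i xs)))
                     (act V (xs[i := brk N (ys @ [xs ! i])]) v)) =
       act V ys (act V xs v) - smult V ((-1) ^ (parl N ys * parl N xs)) (act V xs (act V ys v)))"


section \<open>Super exterior powers\<close>

text \<open>The \<open>m\<close>-th super exterior power of \<open>S\<close> is the quotient of the free vector space on lists of
  vectors by the span of the relations below.\<close>

definition fscale :: "'k::field \<Rightarrow> ('w \<Rightarrow>\<^sub>0 'k) \<Rightarrow> ('w \<Rightarrow>\<^sub>0 'k)"
  where "fscale c u = Poly_Mapping.map ((*) c) u"

abbreviation word :: "'w \<Rightarrow> ('w \<Rightarrow>\<^sub>0 'k::field)"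
  where "word w \<equiv> Poly_Mapping.single w 1"

definition ext_rel ::
  "nat \<Rightarrow> ('k::field, 'a::ab_group_add, 'z) superspace_scheme \<Rightarrow> ('a list \<Rightarrow>\<^sub>0 'k) set"
  where "ext_rel m S =
    {word (xs[i := x + y]) - (word (xs[i := x]) + word (xs[i := y])) | xs i x y.
       length xs = m \<and> i < m} \<union>
    {word (xs[i := smult S c x]) - fscale c (word (xs[i := x])) | xs i c x.
       length xs = m \<and> i < m} \<union>
    {word xs + fscale ((-1) ^ (par S (xs ! i) * par S (xs ! Suc i)))
                 (word (xs[i := xs ! Suc i, Suc i := xs ! i])) | xs i.
       xs \<in> hlists m S \<and> Suc i < m}"

lemma fscale_lookup: "Poly_Mapping.lookup (fscale c u) w = c * Poly_Mapping.lookup u w"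
  by (simp add: fscale_def map.rep_eq when_def)

lemma vector_space_fscale: "vector_space (fscale :: 'k::field \<Rightarrow> ('w \<Rightarrow>\<^sub>0 'k) \<Rightarrow> _)"
  by unfold_locales
    (auto intro!: poly_mapping_eqI simp: fscale_lookup lookup_add algebra_simps)

text \<open>So that sums and signs in the quotient are ordinary arithmetic of a type, the quotient is
  realised on a complement of the relations: \<open>ext_proj\<close> is an (arbitrary) linear projection whose
  kernel is exactly the span of the relations, and its image is the quotient.\<close>

definition ext_proj ::
  "nat \<Rightarrow> ('k::field, 'a::ab_group_add, 'z) superspace_scheme \<Rightarrow> ('a list \<Rightarrow>\<^sub>0 'k) \<Rightarrow> ('a list \<Rightarrow>\<^sub>0 'k)"
  where "ext_proj m S = (SOME q. Vector_Spaces.linear fscale fscale q \<and> (\<forall>u. q (q u) = q u) \<and>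
    (\<forall>u. q u = 0 \<longleftrightarrow> u \<in> module.span fscale (ext_rel m S)))"

definition wedge ::
  "nat \<Rightarrow> ('k::field, 'a::ab_group_add, 'z) superspace_scheme \<Rightarrow> 'a list \<Rightarrow> ('a list \<Rightarrow>\<^sub>0 'k)"
  where "wedge m S xs = ext_proj m S (word xs)"

definition ext_power ::
  "nat \<Rightarrow> ('k::field, 'a::ab_group_add, 'z) superspace_scheme \<Rightarrow> ('a list \<Rightarrow>\<^sub>0 'k) set"
  where "ext_power m S = module.span fscale {wedge m S xs | xs. length xs = m}"

lemma (in vector_space) projection_along_exists:
  "\<exists>q. Vector_Spaces.linear scale scale q \<and> (\<forall>u. q (q u) = q u) \<and> (\<forall>u. q u = 0 \<longleftrightarrow> u \<in> span R)"
proof -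
  interpret p: vector_space_pair scale scale by unfold_locales
  obtain B where B: "B \<subseteq> span R" "independent B" "span R \<subseteq> span B"
    using maximal_independent_subset[of "span R"] by metis
  have spB: "span B = span R" using B span_mono[OF B(1)] by (simp add: span_span subset_antisym)
  define C where "C = extend_basis B"
  have C: "B \<subseteq> C" "independent C" "span C = UNIV"
    using extend_basis_superset[OF B(2)] independent_extend_basis[OF B(2)] span_extend_basis[OF B(2)]
    by (auto simp: C_def)
  obtain q where q: "Vector_Spaces.linear scale scale q" "\<forall>x\<in>C. q x = (if x \<in> B then 0 else x)"
    using p.linear_independent_extend[OF C(2), of "\<lambda>x. if x \<in> B then 0 else x"] by auto
  have q0: "q r = 0" if "r \<in> span B" for r
    by (rule p.linear_eq_0_on_span[OF q(1) _ that]) (use q(2) C(1) in auto)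
  have q1: "q w = w" if "w \<in> span (C - B)" for w
    using p.linear_eq_on[OF q(1) linear_ident that] q(2) by auto
  have split: "\<exists>r w. u = r + w \<and> r \<in> span B \<and> w \<in> span (C - B)" for u
  proof -
    have "B \<union> (C - B) = C" using C(1) by auto
    then have "u \<in> span (B \<union> (C - B))" using C(3) by auto
    then show ?thesis unfolding span_Un by auto
  qed
  have add: "q (r + w) = q r + q w" for r w
    using module_hom.add[OF Vector_Spaces.linear.axioms(3)[OF q(1)]] .
  have "q (q u) = q u \<and> (q u = 0 \<longleftrightarrow> u \<in> span R)" for u
  proof -
    obtain r w where u: "u = r + w" "r \<in> span B" "w \<in> span (C - B)" using split by blast
    then have "q u = w" using q0 q1 add by simp
    moreover have "u \<in> span R \<Longrightarrow> q u = 0" using q0 spB by auto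
    ultimately show ?thesis using u q1 spB by auto
  qed
  then show ?thesis using q(1) by blast
qed

lemma ext_proj:
  shows "Vector_Spaces.linear fscale fscale (ext_proj m S)"
    and "ext_proj m S (ext_proj m S u) = ext_proj m S u"
    and "ext_proj m S u = 0 \<longleftrightarrow> u \<in> module.span fscale (ext_rel m S)"
  using someI_ex[OF vector_space.projection_along_exists[OF vector_space_fscale, of "ext_rel m S"]]
  unfolding ext_proj_def[symmetric] by blast+


section \<open>The spaces \<open>L(N)\<close> and \<open>W = L(N,V)\<close>\<close>

context
  fixes n :: nat
    and N :: "('k::field, 'a::ab_group_add) nary_superalgebra"
begin

definition LN :: "('a list \<Rightarrow>\<^sub>0 'k) set"
  where "LN = ext_power (n - 1) N"

definition wL :: "'a list \<Rightarrow> ('a list \<Rightarrow>\<^sub>0 'k)"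
  where "wL xs = wedge (n - 1) N xs"

definition is_brL :: "(('a list \<Rightarrow>\<^sub>0 'k) \<Rightarrow> ('a list \<Rightarrow>\<^sub>0 'k) \<Rightarrow> ('a list \<Rightarrow>\<^sub>0 'k)) \<Rightarrow> bool"
  where "is_brL b \<longleftrightarrow>
    bilinear_on fscale LN fscale LN fscale LN b \<and>
    (\<forall>xs\<in>hlists (n - 1) N. \<forall>ys\<in>hlists (n - 1) N.
       b (wL xs) (wL ys) =
       (\<Sum>i<n - 1. fscale ((-1) ^ (parl N xs * parl N (take i ys)))
                     (wL (ys[i := brk N (xs @ [ys ! i])]))))"

text \<open>Maps given by a formula on homogeneous generators and extended linearly are introduced
  by choice; the formula determines them on the spaces concerned.\<close>

definition brL :: "('a list \<Rightarrow>\<^sub>0 'k) \<Rightarrow> ('a list \<Rightarrow>\<^sub>0 'k) \<Rightarrow> ('a list \<Rightarrow>\<^sub>0 'k)"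
  where "brL = (SOME b. is_brL b)"

context
  fixes V :: "('k, 'a, 'v::ab_group_add) nary_module"
begin

text \<open>Letters from \<open>N\<close> and from \<open>V\<close> are wedged inside the super exterior power of \<open>N \<oplus> V\<close>, where
  \<open>W\<close> is the span of the wedge words with exactly one letter from \<open>V\<close>.\<close>

definition wW :: "('a \<times> 'v) list \<Rightarrow> (('a \<times> 'v) list \<Rightarrow>\<^sub>0 'k)"
  where "wW us = wedge (n - 1) (dsum N V) us"

definition fromN :: "'a \<Rightarrow> 'a \<times> 'v" where "fromN x = (x, 0)"

definition fromV :: "'v \<Rightarrow> 'a \<times> 'v" where "fromV v = (0, v)"

definition genW :: "'a list \<Rightarrow> 'v \<Rightarrow> (('a \<times> 'v) list \<Rightarrow>\<^sub>0 'k)"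
  where "genW xs v = wW (map fromN xs @ [fromV v])"

text \<open>\<open>y\<^sub>1 \<and> \<dots> \<and> v \<and> \<dots> \<and> y\<^sub>n\<^sub>-\<^sub>1\<close> with \<open>v\<close> in place of the letter of \<open>ys\<close> at position \<open>i\<close>.\<close>

definition insW :: "'a list \<Rightarrow> nat \<Rightarrow> 'v \<Rightarrow> (('a \<times> 'v) list \<Rightarrow>\<^sub>0 'k)"
  where "insW ys i v = wW ((map fromN ys)[i := fromV v])"

definition WNV :: "(('a \<times> 'v) list \<Rightarrow>\<^sub>0 'k) set"
  where "WNV = module.span fscale {genW xs v | xs v. length xs = n - 2}"

definition gradeW :: "nat \<Rightarrow> (('a \<times> 'v) list \<Rightarrow>\<^sub>0 'k) set"
  where "gradeW p = module.span fscale
    {genW xs v | xs v. xs \<in> hlists (n - 2) N \<and> v \<in> homog V \<and> (parl N xs + par V v) mod 2 = p mod 2}"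

definition is_brW ::
  "(('a list \<Rightarrow>\<^sub>0 'k) \<Rightarrow> (('a \<times> 'v) list \<Rightarrow>\<^sub>0 'k) \<Rightarrow> (('a \<times> 'v) list \<Rightarrow>\<^sub>0 'k)) \<Rightarrow> bool"
  where "is_brW b \<longleftrightarrow>
    bilinear_on fscale LN fscale WNV fscale WNV b \<and>
    (\<forall>xs\<in>hlists (n - 1) N. \<forall>ys\<in>hlists (n - 2) N. \<forall>v\<in>homog V.
       b (wL xs) (genW ys v) =
       (\<Sum>i<n - 2. fscale ((-1) ^ (parl N xs * parl N (take i ys)))
                     (genW (ys[i := brk N (xs @ [ys ! i])]) v))
       + fscale ((-1) ^ (parl N xs * parl N ys)) (genW ys (act V xs v)))"

definition brW :: "('a list \<Rightarrow>\<^sub>0 'k) \<Rightarrow> (('a \<times> 'v) list \<Rightarrow>\<^sub>0 'k) \<Rightarrow> (('a \<times> 'v) list \<Rightarrow>\<^sub>0 'k)"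
  where "brW = (SOME b. is_brW b)"

definition is_brW' ::
  "((('a \<times> 'v) list \<Rightarrow>\<^sub>0 'k) \<Rightarrow> ('a list \<Rightarrow>\<^sub>0 'k) \<Rightarrow> (('a \<times> 'v) list \<Rightarrow>\<^sub>0 'k)) \<Rightarrow> bool"
  where "is_brW' b \<longleftrightarrow>
    bilinear_on fscale WNV fscale LN fscale WNV b \<and>
    (\<forall>xs\<in>hlists (n - 2) N. \<forall>v\<in>homog V. \<forall>ys\<in>hlists (n - 1) N.
       b (genW xs v) (wL ys) =
       - (\<Sum>i<n - 1. fscale ((-1) ^ ((parl N xs + par V v) * parl N (take i ys)
                                       + par V v * par N (ys ! i)))
                       (insW ys i (act V (xs @ [ys ! i]) v))))"

definition brW' :: "(('a \<times> 'v) list \<Rightarrow>\<^sub>0 'k) \<Rightarrow> ('a list \<Rightarrow>\<^sub>0 'k) \<Rightarrow> (('a \<times> 'v) list \<Rightarrow>\<^sub>0 'k)"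
  where "brW' = (SOME b. is_brW' b)"


section \<open>Cochains\<close>

text \<open>Cochains are set to \<open>0\<close> off their domain, so that they form a vector space of functions and
  equality of cochains is equality in the type.\<close>

definition CNV :: "nat \<Rightarrow> (('a list \<Rightarrow>\<^sub>0 'k) list \<Rightarrow> 'a \<Rightarrow> 'v) set"
  where "CNV k = {f.
    (\<forall>z. multilinear_on k fscale LN (smult V) UNIV (\<lambda>X. f X z)) \<and>
    (\<forall>X. length X = k \<and> set X \<subseteq> LN \<longrightarrow> linear_on (smult N) UNIV (smult V) UNIV (f X)) \<and>
    (\<forall>X. \<not> (length X = k \<and> set X \<subseteq> LN) \<longrightarrow> f X = 0)}"

definition CLW :: "nat \<Rightarrow> (('a list \<Rightarrow>\<^sub>0 'k) list \<Rightarrow> (('a \<times> 'v) list \<Rightarrow>\<^sub>0 'k)) set"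
  where "CLW k = {F.
    multilinear_on k fscale LN fscale WNV F \<and>
    (\<forall>X. \<not> (length X = k \<and> set X \<subseteq> LN) \<longrightarrow> F X = 0)}"

definition scaleNV ::
  "'k \<Rightarrow> (('a list \<Rightarrow>\<^sub>0 'k) list \<Rightarrow> 'a \<Rightarrow> 'v) \<Rightarrow> (('a list \<Rightarrow>\<^sub>0 'k) list \<Rightarrow> 'a \<Rightarrow> 'v)"
  where "scaleNV c f = (\<lambda>X z. smult V c (f X z))"

definition scaleLW ::
  "'k \<Rightarrow> (('a list \<Rightarrow>\<^sub>0 'k) list \<Rightarrow> (('a \<times> 'v) list \<Rightarrow>\<^sub>0 'k)) \<Rightarrow>
   (('a list \<Rightarrow>\<^sub>0 'k) list \<Rightarrow> (('a \<times> 'v) list \<Rightarrow>\<^sub>0 'k))"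
  where "scaleLW c F = (\<lambda>X. fscale c (F X))"

text \<open>A tuple of \<open>k\<close> homogeneous decomposable elements of \<open>L(N)\<close> is given by a list of \<open>k\<close> lists.\<close>

definition hargs :: "nat \<Rightarrow> 'a list list set"
  where "hargs k = {xss. length xss = k \<and> set xss \<subseteq> hlists (n - 1) N}"

definition homogNV :: "nat \<Rightarrow> nat \<Rightarrow> (('a list \<Rightarrow>\<^sub>0 'k) list \<Rightarrow> 'a \<Rightarrow> 'v) \<Rightarrow> bool"
  where "homogNV k p f \<longleftrightarrow>
    (\<forall>xss\<in>hargs k. \<forall>z\<in>homog N.
       f (map wL xss) z \<in> grade V ((p + (\<Sum>xs\<leftarrow>xss. parl N xs) + par N z) mod 2))"

definition homogLW :: "nat \<Rightarrow> nat \<Rightarrow> (('a list \<Rightarrow>\<^sub>0 'k) list \<Rightarrow> (('a \<times> 'v) list \<Rightarrow>\<^sub>0 'k)) \<Rightarrow> bool"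
  where "homogLW k p F \<longleftrightarrow>
    (\<forall>xss\<in>hargs k. F (map wL xss) \<in> gradeW (p + (\<Sum>xs\<leftarrow>xss. parl N xs)))"


section \<open>The maps \<open>d\<close>, \<open>\<Delta>\<close> and \<open>\<delta>\<close>\<close>

text \<open>In the following, \<open>X ! j\<close> is the argument \<open>x\<^sub>j\<close>, \<open>P j\<close> its parity, and \<open>p\<close> the parity
  of the cochain.\<close>

definition d_rhs ::
  "nat \<Rightarrow> nat \<Rightarrow> (('a list \<Rightarrow>\<^sub>0 'k) list \<Rightarrow> (('a \<times> 'v) list \<Rightarrow>\<^sub>0 'k)) \<Rightarrow> 'a list list \<Rightarrow>
   (('a \<times> 'v) list \<Rightarrow>\<^sub>0 'k)"
  where "d_rhs k p F xss =
    (let X = map wL xss; P = (\<lambda>j. parl N (xss ! j)) in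
      if k = 0 then - brW (X ! 0) (F [])
      else
        - (\<Sum>s\<le>k. \<Sum>t\<in>{s<..k}.
             fscale ((-1) ^ (s + P s * (\<Sum>j\<in>{s<..<t}. P j)))
               (F (del s (X[t := brL (X ! s) (X ! t)]))))
        + (\<Sum>s<k. fscale ((-1) ^ (s + P s * (p + (\<Sum>j<s. P j)))) (brW (X ! s) (F (del s X))))
        + fscale ((-1) ^ (k + 1)) (brW' (F (take k X)) (X ! k)))"

definition is_d ::
  "nat \<Rightarrow> ((('a list \<Rightarrow>\<^sub>0 'k) list \<Rightarrow> (('a \<times> 'v) list \<Rightarrow>\<^sub>0 'k)) \<Rightarrow>
          (('a list \<Rightarrow>\<^sub>0 'k) list \<Rightarrow> (('a \<times> 'v) list \<Rightarrow>\<^sub>0 'k))) \<Rightarrow> bool"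
  where "is_d k D \<longleftrightarrow>
    linear_on scaleLW (CLW k) scaleLW (CLW (k + 1)) D \<and>
    (\<forall>p\<in>{0,1}. \<forall>F\<in>CLW k. homogLW k p F \<longrightarrow>
       (\<forall>xss\<in>hargs (k + 1). D F (map wL xss) = d_rhs k p F xss))"

definition dLW ::
  "nat \<Rightarrow> (('a list \<Rightarrow>\<^sub>0 'k) list \<Rightarrow> (('a \<times> 'v) list \<Rightarrow>\<^sub>0 'k)) \<Rightarrow>
   (('a list \<Rightarrow>\<^sub>0 'k) list \<Rightarrow> (('a \<times> 'v) list \<Rightarrow>\<^sub>0 'k))"
  where "dLW k = (SOME D. is_d k D)"

definition Delta_rhs ::
  "nat \<Rightarrow> nat \<Rightarrow> (('a list \<Rightarrow>\<^sub>0 'k) list \<Rightarrow> 'a \<Rightarrow> 'v) \<Rightarrow> 'a list list \<Rightarrow> (('a \<times> 'v) list \<Rightarrow>\<^sub>0 'k)"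
  where "Delta_rhs k p f xss =
    (let X = map wL xss; P = (\<lambda>j. parl N (xss ! j)); xk = xss ! k in
      (\<Sum>i<n - 1. fscale ((-1) ^ ((p + (\<Sum>j<k. P j)) * parl N (take i xk)))
                    (insW xk i (f (take k X) (xk ! i)))))"

definition is_Delta ::
  "nat \<Rightarrow> ((('a list \<Rightarrow>\<^sub>0 'k) list \<Rightarrow> 'a \<Rightarrow> 'v) \<Rightarrow>
          (('a list \<Rightarrow>\<^sub>0 'k) list \<Rightarrow> (('a \<times> 'v) list \<Rightarrow>\<^sub>0 'k))) \<Rightarrow> bool"
  where "is_Delta k D \<longleftrightarrow>
    linear_on scaleNV (CNV k) scaleLW (CLW (k + 1)) D \<and>
    (\<forall>p\<in>{0,1}. \<forall>f\<in>CNV k. homogNV k p f \<longrightarrow>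
       (\<forall>xss\<in>hargs (k + 1). D f (map wL xss) = Delta_rhs k p f xss))"

definition Delta ::
  "nat \<Rightarrow> (('a list \<Rightarrow>\<^sub>0 'k) list \<Rightarrow> 'a \<Rightarrow> 'v) \<Rightarrow>
   (('a list \<Rightarrow>\<^sub>0 'k) list \<Rightarrow> (('a \<times> 'v) list \<Rightarrow>\<^sub>0 'k))"
  where "Delta k = (SOME D. is_Delta k D)"

text \<open>The sign \<open>k - i\<close> for \<open>1 \<le> i \<le> n - 1\<close> appears as \<open>k + i + 1\<close> with \<open>i\<close> counted from \<open>0\<close>.\<close>

definition delta_rhs ::
  "nat \<Rightarrow> nat \<Rightarrow> (('a list \<Rightarrow>\<^sub>0 'k) list \<Rightarrow> 'a \<Rightarrow> 'v) \<Rightarrow> 'a list list \<Rightarrow> 'a \<Rightarrow> 'v"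
  where "delta_rhs k p f xss z =
    (let X = map wL xss; P = (\<lambda>j. parl N (xss ! j)); xk = xss ! k;
         \<epsilon> = (\<lambda>i. (p + (\<Sum>j<k. P j) + parl N (drop (Suc i) xk)) * (par N (xk ! i) + P k)
                   + par N z * (p + (\<Sum>j\<le>k. P j))
                   + P k * parl N (drop (Suc i) xk))
     in
      - (\<Sum>s\<le>k. \<Sum>t\<in>{s<..k}.
           smult V ((-1) ^ (s + P s * (\<Sum>j\<in>{s<..<t}. P j)))
             (f (del s (X[t := brL (X ! s) (X ! t)])) z))
      - (\<Sum>s\<le>k. smult V ((-1) ^ (s + P s * (\<Sum>j\<in>{s<..k}. P j)))
                   (f (del s X) (brk N (xss ! s @ [z]))))
      + (\<Sum>s\<le>k. smult V ((-1) ^ (s + P s * (p + (\<Sum>j<s. P j))))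
                   (act V (xss ! s) (f (del s X) z)))
      + (\<Sum>i<n - 1. smult V ((-1) ^ (k + i + 1 + \<epsilon> i))
                       (act V (z # del i xk) (f (take k X) (xk ! i)))))"

text \<open>\<open>is_delta k\<close> and \<open>delta k\<close> refer to \<open>\<delta>\<^sup>k\<^sup>+\<^sup>1\<close>, defined on \<open>k\<close>-cochains.\<close>

definition is_delta ::
  "nat \<Rightarrow> ((('a list \<Rightarrow>\<^sub>0 'k) list \<Rightarrow> 'a \<Rightarrow> 'v) \<Rightarrow> (('a list \<Rightarrow>\<^sub>0 'k) list \<Rightarrow> 'a \<Rightarrow> 'v)) \<Rightarrow> bool"
  where "is_delta k D \<longleftrightarrow>
    linear_on scaleNV (CNV k) scaleNV (CNV (k + 1)) D \<and>
    (\<forall>p\<in>{0,1}. \<forall>f\<in>CNV k. homogNV k p f \<longrightarrow>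
       (\<forall>xss\<in>hargs (k + 1). \<forall>z\<in>homog N. D f (map wL xss) z = delta_rhs k p f xss z))"

definition delta ::
  "nat \<Rightarrow> (('a list \<Rightarrow>\<^sub>0 'k) list \<Rightarrow> 'a \<Rightarrow> 'v) \<Rightarrow> (('a list \<Rightarrow>\<^sub>0 'k) list \<Rightarrow> 'a \<Rightarrow> 'v)"
  where "delta k = (SOME D. is_delta k D)"

end

end

end

theory Submission
  imports Defs
begin

text \<open>By leaving the argument \<open>z\<close> free, a cochain in \<open>C\<^sup>k(N,V)\<close> becomes a \<open>k\<close>-cochain of the Leibniz
  superalgebra \<open>L(N)\<close> with values in \<open>Hom(N,V)\<close>. Both \<open>\<delta>\<close> and \<open>d\<close> satisfy a Cartan formula: contracting
  the first argument of a coboundary with \<open>x\<close> gives, up to sign, the Lie derivative along \<open>x\<close> minus the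
  coboundary of the contraction. Since the Lie derivatives represent \<open>L(N)\<close>, and \<open>\<Delta>\<close> commutes with them
  and with contractions, \<open>\<delta>\<delta> = 0\<close> and \<open>d\<Delta> = \<Delta>\<delta>\<close> follow by induction on the number of arguments from the
  lowest degrees. There, \<open>\<Delta>\<close> sends \<open>\<phi>\<close> in \<open>Hom(N,V)\<close> to the derivation of the exterior algebra that
  extends \<open>\<phi>\<close>, and a supercommutator of two derivations is a derivation; together with the identity
  \<open>[w,y]' = - \<Delta>(ad(w))(y)\<close>, where \<open>ad(w)\<close> in \<open>Hom(N,V)\<close> is the action of \<open>w\<close> in \<open>W\<close>, this reduces everything
  to the Nambu identity and the two module axioms.

  The maps themselves exist because every cochain is the sum of its even and its odd part, and because
  all the formulas factor through the super exterior powers.\<close>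

definition sign :: "nat \<Rightarrow> 'b::ab_group_add \<Rightarrow> 'b"
  where "sign e x = (if even e then x else - x)"

lemma sign_add: "sign e (x + y) = sign e x + sign e y"
  and sign_diff: "sign e (x - y) = sign e x - sign e y"
  and sign_minus: "sign e (- x) = - sign e x"
  and sign_zero [simp]: "sign e 0 = 0"
  by (simp_all add: sign_def)

lemma sign_sign [simp]: "sign a (sign b x) = sign (a + b) x"
  by (cases "even a"; cases "even b") (simp_all add: sign_def)

lemma sign_fun: "(sign e f) z = sign e (f z)"
  by (simp add: sign_def)

lemma sign_0 [simp]: "sign 0 x = x"
  by (simp add: sign_def)

lemma sign_sum: "sign e (sum f A) = (\<Sum>i\<in>A. sign e (f i))"
  by (auto simp: sign_def sum_negf)

lemma sign_cong: "even a = even b \<Longrightarrow> sign a x = sign b x"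
  by (simp add: sign_def)

lemma sign_scale: "vector_space s \<Longrightarrow> s ((-1) ^ e) x = sign e x"
  using module.scale_minus_left[of s 1 x] module.scale_one[of s x]
  by (simp add: sign_def minus_one_power_iff module_iff_vector_space)

abbreviation lin :: "('k \<Rightarrow> 'a::ab_group_add \<Rightarrow> 'a) \<Rightarrow> ('k \<Rightarrow> 'b::ab_group_add \<Rightarrow> 'b) \<Rightarrow> ('a \<Rightarrow> 'b) \<Rightarrow> bool"
  where "lin sA sB h \<equiv> linear_on sA UNIV sB UNIV h"

lemma linI: "(\<And>x y. h (x + y) = h x + h y) \<Longrightarrow> (\<And>c x. h (sA c x) = sB c (h x)) \<Longrightarrow> lin sA sB h"
  by (simp add: linear_on_def)

lemma lin_add: "lin sA sB h \<Longrightarrow> h (x + y) = h x + h y"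
  and lin_scale: "lin sA sB h \<Longrightarrow> h (sA c x) = sB c (h x)"
  by (simp_all add: linear_on_def)

lemma lin_0: assumes "lin sA sB h" shows "h 0 = 0"
  using lin_add[OF assms, of 0 0] by simp

lemma lin_neg: assumes "lin sA sB h" shows "h (- x) = - h x"
  using lin_add[OF assms, of x "- x"] lin_0[OF assms] by (simp add: eq_neg_iff_add_eq_0 add.commute)

lemma lin_diff: assumes "lin sA sB h" shows "h (x - y) = h x - h y"
  using lin_add[OF assms, of x "- y"] lin_neg[OF assms, of y] by simp

lemma lin_sum: assumes "lin sA sB h" shows "h (sum f A) = (\<Sum>i\<in>A. h (f i))"
  by (induction A rule: infinite_finite_induct) (simp_all add: lin_0[OF assms] lin_add[OF assms])

lemma lin_sign: assumes "lin sA sB h" shows "h (sign e x) = sign e (h x)"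
  by (simp add: sign_def lin_neg[OF assms])

lemma vs_add: "vector_space s \<Longrightarrow> s c (x + y) = s c x + s c y"
  and vs_add_left: "vector_space s \<Longrightarrow> s (c + d) x = s c x + s d x"
  and vs_scale: "vector_space s \<Longrightarrow> s c (s d x) = s (c * d) x"
  and vs_one: "vector_space s \<Longrightarrow> s 1 x = x"
  by (simp_all add: vector_space_def)

lemma vs_lin: "vector_space s \<Longrightarrow> lin s s (s c)"
  by (rule linI) (simp_all add: vs_add vs_scale mult.commute)

lemma vs_zero: "vector_space s \<Longrightarrow> s c 0 = 0"
  and vs_neg: "vector_space s \<Longrightarrow> s c (- x) = - s c x"
  and vs_diff: "vector_space s \<Longrightarrow> s c (x - y) = s c x - s c y"
  and vs_sign: "vector_space s \<Longrightarrow> s c (sign e x) = sign e (s c x)"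
  and vs_sum: "vector_space s \<Longrightarrow> s c (sum f A) = (\<Sum>i\<in>A. s c (f i))"
  using lin_0[OF vs_lin] lin_neg[OF vs_lin] lin_diff[OF vs_lin] lin_sign[OF vs_lin] lin_sum[OF vs_lin] by blast+

lemma lin_id: "lin s s (\<lambda>x. x)"
  by (rule linI) simp_all

lemma lin_zeroI: "vector_space sB \<Longrightarrow> lin sA sB (\<lambda>x. 0)"
  by (rule linI) (simp_all add: vs_zero)

lemma lin_addI: "vector_space sB \<Longrightarrow> lin sA sB f \<Longrightarrow> lin sA sB g \<Longrightarrow> lin sA sB (\<lambda>x. f x + g x)"
  by (rule linI) (simp_all add: vs_add lin_add lin_scale)

lemma lin_negI: "vector_space sB \<Longrightarrow> lin sA sB f \<Longrightarrow> lin sA sB (\<lambda>x. - f x)"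
  by (rule linI) (simp_all add: vs_neg lin_add lin_scale)

lemma lin_diffI: "vector_space sB \<Longrightarrow> lin sA sB f \<Longrightarrow> lin sA sB g \<Longrightarrow> lin sA sB (\<lambda>x. f x - g x)"
  by (rule linI) (simp_all add: vs_diff lin_add lin_scale)

lemma lin_signI: "vector_space sB \<Longrightarrow> lin sA sB f \<Longrightarrow> lin sA sB (\<lambda>x. sign e (f x))"
  by (rule linI) (simp_all add: vs_sign lin_add lin_scale sign_add)

lemma lin_sumI: "vector_space sB \<Longrightarrow> (\<And>i. i \<in> A \<Longrightarrow> lin sA sB (f i)) \<Longrightarrow> lin sA sB (\<lambda>x. \<Sum>i\<in>A. f i x)"
  by (induction A rule: infinite_finite_induct) (simp_all add: lin_zeroI lin_addI)

lemma lin_comp: "lin sB sC g \<Longrightarrow> lin sA sB f \<Longrightarrow> lin sA sC (\<lambda>x. g (f x))"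
  by (rule linI) (simp_all add: lin_add lin_scale)

definition mlin :: "nat \<Rightarrow> ('k \<Rightarrow> 'a::ab_group_add \<Rightarrow> 'a) \<Rightarrow> ('k \<Rightarrow> 'b::ab_group_add \<Rightarrow> 'b) \<Rightarrow> ('a list \<Rightarrow> 'b) \<Rightarrow> bool"
  where "mlin k sA sB f \<longleftrightarrow> (\<forall>as bs. length as + length bs + 1 = k \<longrightarrow> lin sA sB (\<lambda>x. f (as @ x # bs)))"

lemma mlinD: "mlin k sA sB f \<Longrightarrow> length as + length bs + 1 = k \<Longrightarrow> lin sA sB (\<lambda>x. f (as @ x # bs))"
  by (simp add: mlin_def)

lemma mlin_hd: "mlin (Suc k) sA sB f \<Longrightarrow> length bs = k \<Longrightarrow> lin sA sB (\<lambda>x. f (x # bs))"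
  using mlinD[of "Suc k" sA sB f "[]" bs] by simp

lemma mlin_zero [simp]: "mlin 0 sA sB f"
  by (simp add: mlin_def)

lemma mlin_Cons: assumes "mlin (Suc k) sA sB f" shows "mlin k sA sB (\<lambda>X. f (x # X))"
  unfolding mlin_def using mlinD[OF assms, of "x # _"] by simp

lemma mlin_SucI:
  fixes f :: "'a::ab_group_add list \<Rightarrow> 'b::ab_group_add"
  assumes "\<And>X. length X = k \<Longrightarrow> lin sA sB (\<lambda>x. f (x # X))" and "\<And>x. mlin k sA sB (\<lambda>X. f (x # X))"
  shows "mlin (Suc k) sA sB f"
proof -
  have "lin sA sB (\<lambda>x. f (as @ x # bs))" if *: "length as + length bs + 1 = Suc k" for as bs
  proof (cases as)
    case Nil
    have "length bs = k" using Nil that by simp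
    from assms(1)[OF this] show ?thesis unfolding Nil append_Nil .
  next
    case (Cons a as')
    then have "length as' + length bs + 1 = k" using that by simp
    from mlinD[OF assms(2) this, of a] show ?thesis unfolding Cons append_Cons .
  qed
  then show ?thesis unfolding mlin_def by blast
qed

lemma mlin_cong:
  assumes "\<And>X. length X = k \<Longrightarrow> f X = g X" "mlin k sA sB f"
  shows "mlin k sA sB g"
proof -
  have "lin sA sB (\<lambda>x. g (as @ x # bs))" if *: "length as + length bs + 1 = k" for as bs
  proof -
    have "g (as @ x # bs) = f (as @ x # bs)" for x using assms(1)[of "as @ x # bs"] * by simp
    then show ?thesis using mlinD[OF assms(2) *] by simp
  qed
  then show ?thesis unfolding mlin_def by blast
qed

lemma mlin_addI: "vector_space sB \<Longrightarrow> mlin k sA sB f \<Longrightarrow> mlin k sA sB g \<Longrightarrow> mlin k sA sB (\<lambda>X. f X + g X)"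
  by (simp add: mlin_def lin_addI)

lemma mlin_negI: "vector_space sB \<Longrightarrow> mlin k sA sB f \<Longrightarrow> mlin k sA sB (\<lambda>X. - f X)"
  by (simp add: mlin_def lin_negI)

lemma mlin_diffI: "vector_space sB \<Longrightarrow> mlin k sA sB f \<Longrightarrow> mlin k sA sB g \<Longrightarrow> mlin k sA sB (\<lambda>X. f X - g X)"
  by (simp add: mlin_def lin_diffI)

lemma mlin_signI: "vector_space sB \<Longrightarrow> mlin k sA sB f \<Longrightarrow> mlin k sA sB (\<lambda>X. sign e (f X))"
  by (simp add: mlin_def lin_signI)

lemma mlin_comp:
  assumes "lin sB sC h" "mlin k sA sB f" shows "mlin k sA sC (\<lambda>X. h (f X))"
  unfolding mlin_def using lin_comp[OF assms(1) mlinD[OF assms(2)]] by blast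

lemma mlin_map:
  fixes h :: "'a::ab_group_add \<Rightarrow> 'b::ab_group_add"
  assumes "mlin k sB sC f" "lin sA sB h" shows "mlin k sA sC (\<lambda>X. f (map h X))"
  unfolding mlin_def
proof (intro allI impI)
  fix as bs :: "'a list" assume "length as + length bs + 1 = k"
  then have "lin sB sC (\<lambda>x. f (map h as @ x # map h bs))" by (intro mlinD[OF assms(1)]) simp
  from lin_comp[OF this assms(2)] show "lin sA sC (\<lambda>x. f (map h (as @ x # bs)))" by simp
qed

lemma mlin_slot_0: "mlin k sA sB f \<Longrightarrow> length as + length bs + 1 = k \<Longrightarrow> f (as @ 0 # bs) = 0"
  using lin_0[OF mlinD] by blast

lemma multilinear_on_iff_mlin:
  fixes g :: "'a::ab_group_add list \<Rightarrow> 'b::ab_group_add"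
  shows "multilinear_on m sA UNIV sB UNIV g \<longleftrightarrow> mlin m sA sB g"
proof
  assume *: "multilinear_on m sA UNIV sB UNIV g"
  show "mlin m sA sB g" unfolding mlin_def
  proof (intro allI impI)
    fix as bs :: "'a list" assume "length as + length bs + 1 = m"
    then have "length (as @ 0 # bs) = m" "length as < m" by auto
    then have "lin sA sB (\<lambda>x. g ((as @ 0 # bs)[length as := x]))"
      using * unfolding multilinear_on_def by blast
    then show "lin sA sB (\<lambda>x. g (as @ x # bs))" by simp
  qed
next
  assume *: "mlin m sA sB g"
  show "multilinear_on m sA UNIV sB UNIV g" unfolding multilinear_on_def
  proof (intro allI impI conjI)
    fix xs :: "'a list" and i assume "length xs = m \<and> set xs \<subseteq> UNIV" "i < m"
    then show "lin sA sB (\<lambda>x. g (xs[i := x]))"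
      using mlinD[OF *, of "take i xs" "drop (Suc i) xs"] by (simp add: upd_conv_take_nth_drop)
  qed simp
qed

definition fun_scale :: "('k \<Rightarrow> 'b \<Rightarrow> 'b) \<Rightarrow> 'k \<Rightarrow> ('a \<Rightarrow> 'b) \<Rightarrow> ('a \<Rightarrow> 'b)"
  where "fun_scale s c f = (\<lambda>z. s c (f z))"

lemma vector_space_fun_scale: "vector_space s \<Longrightarrow> vector_space (fun_scale s)"
  unfolding vector_space_def fun_scale_def by (simp add: fun_eq_iff)

lemma lin_fun_scale: "lin sA (fun_scale sB) h \<longleftrightarrow> (\<forall>z. lin sA sB (\<lambda>x. h x z))"
  by (auto simp: linear_on_def fun_scale_def fun_eq_iff)

lemma mlin_fun_scale: "mlin k sA (fun_scale sB) f \<longleftrightarrow> (\<forall>z. mlin k sA sB (\<lambda>X. f X z))"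
  by (auto simp: mlin_def lin_fun_scale)

lemma sum_fun: "(\<Sum>i\<in>A. f i) z = (\<Sum>i\<in>A. f i z)" for f :: "_ \<Rightarrow> _ \<Rightarrow> 'b::ab_group_add"
  by (induction A rule: infinite_finite_induct) simp_all

section \<open>Superspaces\<close>

abbreviation grd :: "('k, 'a, 'z) superspace_scheme \<Rightarrow> nat \<Rightarrow> 'a set"
  where "grd S q \<equiv> grade S (q mod 2)"

definition pr :: "('k, 'a::ab_group_add, 'z) superspace_scheme \<Rightarrow> nat \<Rightarrow> 'a \<Rightarrow> 'a"
  where "pr S q x = (let x0 = SOME x0. x0 \<in> grade S 0 \<and> x - x0 \<in> grade S 1 in if even q then x0 else x - x0)"

definition tw :: "('k, 'a::ab_group_add, 'z) superspace_scheme \<Rightarrow> nat \<Rightarrow> 'a \<Rightarrow> 'a"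
  where "tw S q x = pr S 0 x + sign q (pr S 1 x)"

locale sspace =
  fixes S :: "('k::field, 'a::ab_group_add, 'z) superspace_scheme"
  assumes superspace: "superspace S"
begin

lemma vsS: "vector_space (smult S)"
  using superspace by (simp add: superspace_def)

lemma subspace_grade: "module.subspace (smult S) (grd S q)"
  using superspace by (cases "even q") (auto simp: superspace_def mod2_eq_if)

lemma grd_add: "x \<in> grd S q \<Longrightarrow> y \<in> grd S q \<Longrightarrow> x + y \<in> grd S q"
  and grd_zero: "0 \<in> grd S q"
  and grd_scale: "x \<in> grd S q \<Longrightarrow> smult S c x \<in> grd S q"
  using subspace_grade[of q] vsS
  by (simp_all add: module.subspace_def module_iff_vector_space)

lemma grd_neg: "x \<in> grd S q \<Longrightarrow> - x \<in> grd S q"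
  and grd_diff: "x \<in> grd S q \<Longrightarrow> y \<in> grd S q \<Longrightarrow> x - y \<in> grd S q"
  using module.subspace_neg[OF _ subspace_grade] module.subspace_diff[OF _ subspace_grade] vsS
  by (simp_all add: module_iff_vector_space)

lemma grd_sign: "x \<in> grd S q \<Longrightarrow> sign e x \<in> grd S q"
  by (simp add: sign_def grd_neg)

lemma grd_Int: "x \<in> grade S 0 \<Longrightarrow> x \<in> grade S 1 \<Longrightarrow> x = 0"
  using superspace by (auto simp: superspace_def)

lemma pr0: "pr S 0 x \<in> grade S 0" and pr1: "x - pr S 0 x \<in> grade S 1"
proof -
  have "\<exists>x0. x0 \<in> grade S 0 \<and> x - x0 \<in> grade S 1"
    using superspace unfolding superspace_def by (metis add_diff_cancel_left')
  from someI_ex[OF this] show "pr S 0 x \<in> grade S 0" "x - pr S 0 x \<in> grade S 1"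
    by (simp_all add: pr_def)
qed

lemma pr_odd: "odd q \<Longrightarrow> pr S q x = x - pr S 0 x"
  and pr_even: "even q \<Longrightarrow> pr S q x = pr S 0 x"
  by (simp_all add: pr_def Let_def)

lemma pr_in: "pr S q x \<in> grd S q"
  using pr0[of x] pr1[of x] pr_even[of q x] pr_odd[of q x] by (cases "even q") (simp_all add: mod2_eq_if)

lemma pr_sum: "pr S 0 x + pr S (Suc 0) x = x"
  by (simp add: pr_odd)

lemma pr_unique: assumes "x0 \<in> grade S 0" "x - x0 \<in> grade S 1" shows "pr S 0 x = x0"
proof -
  have "pr S 0 x - x0 \<in> grade S 0" using grd_diff[of "pr S 0 x" 0 x0] pr0[of x] assms by simp
  moreover have "(x - x0) - (x - pr S 0 x) \<in> grade S 1" using grd_diff[of "x - x0" 1 "x - pr S 0 x"] pr1[of x] assms by simp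
  then have "pr S 0 x - x0 \<in> grade S 1" by (simp add: algebra_simps)
  ultimately show ?thesis using grd_Int by fastforce
qed

lemma pr_lin: "lin (smult S) (smult S) (pr S q)"
proof -
  have l0: "lin (smult S) (smult S) (pr S 0)"
  proof (rule linI)
    fix x y
    show "pr S 0 (x + y) = pr S 0 x + pr S 0 y"
      using grd_add[of "pr S 0 x" 0 "pr S 0 y"] grd_add[of "x - pr S 0 x" 1 "y - pr S 0 y"]
        pr0[of x] pr1[of x] pr0[of y] pr1[of y]
      by (intro pr_unique) (simp_all add: algebra_simps)
  next
    fix c x
    show "pr S 0 (smult S c x) = smult S c (pr S 0 x)"
      using grd_scale[of "pr S 0 x" 0] grd_scale[of "x - pr S 0 x" 1 c] pr0[of x] pr1[of x]
      by (intro pr_unique) (simp_all add: vs_diff[OF vsS])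
  qed
  then show ?thesis
    using lin_diffI[OF vsS lin_id l0] pr_even[of q] pr_odd[of q] by (cases "even q") presburger+
qed

lemma pr_grd: assumes "x \<in> grd S a" shows "pr S q x = (if even (q + a) then x else 0)"
proof (cases "even a")
  case True
  then have "x \<in> grade S 0" using assms by (simp add: mod2_eq_if)
  then have "pr S 0 x = x" using grd_zero[of 1] by (intro pr_unique) simp_all
  then show ?thesis using True pr_even[of q x] pr_odd[of q x] by (cases "even q") simp_all
next
  case False
  then have "x \<in> grade S 1" using assms by (simp add: mod2_eq_if)
  then have "pr S 0 x = 0" using grd_zero[of 0] by (intro pr_unique) simp_all
  then show ?thesis using False pr_even[of q x] pr_odd[of q x] by (cases "even q") simp_all
qed

lemma tw_lin: "lin (smult S) (smult S) (tw S q)"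
  unfolding tw_def by (intro lin_addI lin_signI vsS pr_lin)

lemma tw_grd: "x \<in> grd S a \<Longrightarrow> tw S q x = sign (q * a) x"
  using pr_grd[of x a 0] pr_grd[of x a "Suc 0"]
  by (cases "even a"; cases "even q") (simp_all add: tw_def sign_def)

lemma homog_iff: "x \<in> homog S \<longleftrightarrow> (\<exists>a. x \<in> grd S a)"
proof -
  have "x \<in> grade S 0 \<Longrightarrow> x \<in> grd S 0" "x \<in> grade S 1 \<Longrightarrow> x \<in> grd S 1" by simp_all
  then show ?thesis unfolding homog_def using mod2_eq_if by (metis Un_iff)
qed

lemma homog_par: "x \<in> homog S \<Longrightarrow> x \<in> grd S (par S x)"
  by (auto simp: homog_def par_def)

lemma par_grd: "x \<in> grd S a \<Longrightarrow> x \<noteq> 0 \<Longrightarrow> even (par S x) = even a"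
  using grd_Int[of x] by (auto simp: par_def mod2_eq_if split: if_splits)

lemma grd_homog: "x \<in> grd S a \<Longrightarrow> x \<in> homog S"
  using homog_iff by blast

lemma pr_homog: "pr S q x \<in> homog S"
  using grd_homog pr_in by blast

lemma grd_cong: "even a = even b \<Longrightarrow> grd S a = grd S b"
  by (simp add: mod2_eq_if)

lemma mlin_eq_homog:
  assumes "mlin m (smult S) sB f" "mlin m (smult S) sB g"
    and "\<And>xs. xs \<in> hlists m S \<Longrightarrow> f xs = g xs"
  shows "length xs = m \<Longrightarrow> f xs = g xs"
  using assms
proof (induction m arbitrary: xs f g)
  case 0 then show ?case by (simp add: hlists_def)
next
  case (Suc m)
  obtain x ys where xs: "xs = x # ys" "length ys = m" using Suc.prems(1) by (cases xs) auto
  have "f (pr S q x # ys) = g (pr S q x # ys)" for q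
  proof (rule Suc.IH[OF xs(2) mlin_Cons[OF Suc.prems(2)] mlin_Cons[OF Suc.prems(3)]])
    fix zs assume "zs \<in> hlists m S"
    then show "f (pr S q x # zs) = g (pr S q x # zs)"
      using pr_homog by (intro Suc.prems(4)) (auto simp: hlists_def)
  qed
  then show ?case
    using lin_add[OF mlin_hd[OF Suc.prems(2) xs(2)], of "pr S 0 x" "pr S 1 x"]
      lin_add[OF mlin_hd[OF Suc.prems(3) xs(2)], of "pr S 0 x" "pr S 1 x"]
    by (simp add: pr_sum xs(1))
qed

end

lemma sspace_dsum:
  assumes "superspace (S::('k::field,'a::ab_group_add,'z) superspace_scheme)"
    and "superspace (T::('k,'b::ab_group_add,'y) superspace_scheme)"
  shows "superspace (dsum S T)"
proof -
  interpret S: sspace S by unfold_locales fact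
  interpret T: sspace T by unfold_locales fact
  have vs: "vector_space (smult (dsum S T))"
    using S.vsS T.vsS by (auto simp: vector_space_def dsum_def)
  then have m: "module (smult (dsum S T))" by (simp add: module_iff_vector_space)
  have mS: "module (smult S)" "module (smult T)" using S.vsS T.vsS by (simp_all add: module_iff_vector_space)
  have sub: "module.subspace (smult (dsum S T)) (grade (dsum S T) p)"
    if "module.subspace (smult S) (grade S p)" "module.subspace (smult T) (grade T p)" for p
    using that unfolding module.subspace_def[OF m] module.subspace_def[OF mS(1)] module.subspace_def[OF mS(2)]
    by (auto simp: dsum_def zero_prod_def)
  have "\<exists>x0\<in>grade (dsum S T) 0. \<exists>x1\<in>grade (dsum S T) 1. x = x0 + x1" for x
    using S.pr0[of "fst x"] S.pr1[of "fst x"] T.pr0[of "snd x"] T.pr1[of "snd x"]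
    by (intro bexI[of _ "(pr S 0 (fst x), pr T 0 (snd x))"]
        bexI[of _ "(fst x - pr S 0 (fst x), snd x - pr T 0 (snd x))"]) (auto simp: dsum_def)
  moreover have "grade (dsum S T) 0 \<inter> grade (dsum S T) 1 = {0}"
    using assms by (auto simp: superspace_def dsum_def zero_prod_def)
  ultimately show ?thesis
    using vs sub assms unfolding superspace_def by blast
qed

section \<open>The universal property of super exterior powers\<close>

definition lift :: "nat \<Rightarrow> ('k::field \<Rightarrow> 'b::ab_group_add \<Rightarrow> 'b) \<Rightarrow> ('a list \<Rightarrow> 'b) \<Rightarrow> ('a list \<Rightarrow>\<^sub>0 'k) \<Rightarrow> 'b"
  where "lift m sB g u = (\<Sum>w\<in>{w \<in> Poly_Mapping.keys u. length w = m}. sB (Poly_Mapping.lookup u w) (g w))"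

lemma vs_left_0: "vector_space s \<Longrightarrow> s 0 x = 0"
  using module.scale_zero_left module_iff_vector_space by metis

lemma lift_superset:
  assumes "vector_space sB" "finite A" "{w \<in> Poly_Mapping.keys u. length w = m} \<subseteq> A" "\<And>w. w \<in> A \<Longrightarrow> length w = m"
  shows "lift m sB g u = (\<Sum>w\<in>A. sB (Poly_Mapping.lookup u w) (g w))"
  unfolding lift_def using assms
  by (intro sum.mono_neutral_left) (auto simp: in_keys_iff vs_left_0[OF assms(1)])

lemma lift_lin:
  fixes sB :: "'k::field \<Rightarrow> 'b::ab_group_add \<Rightarrow> 'b" and g :: "'c list \<Rightarrow> 'b"
  assumes "vector_space sB" shows "lin fscale sB (lift m sB g)"
proof (rule linI)
  fix u v :: "'c list \<Rightarrow>\<^sub>0 'k"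
  let ?A = "{w \<in> Poly_Mapping.keys u \<union> Poly_Mapping.keys v. length w = m}"
  have "lift m sB g x = (\<Sum>w\<in>?A. sB (Poly_Mapping.lookup x w) (g w))"
    if "Poly_Mapping.keys x \<subseteq> Poly_Mapping.keys u \<union> Poly_Mapping.keys v" for x
    using that by (intro lift_superset assms) auto
  from this[of u] this[of v] this[of "u + v"] Poly_Mapping.keys_add[of u v]
  show "lift m sB g (u + v) = lift m sB g u + lift m sB g v"
    by (simp add: lookup_add vs_add_left[OF assms] sum.distrib)
next
  fix c and u :: "'c list \<Rightarrow>\<^sub>0 'k"
  let ?A = "{w \<in> Poly_Mapping.keys u. length w = m}"
  have "Poly_Mapping.keys (fscale c u) \<subseteq> Poly_Mapping.keys u"
    by (auto simp: in_keys_iff fscale_lookup)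
  then have "lift m sB g (fscale c u) = (\<Sum>w\<in>?A. sB (Poly_Mapping.lookup (fscale c u) w) (g w))"
    by (intro lift_superset assms) auto
  then show "lift m sB g (fscale c u) = sB c (lift m sB g u)"
    by (simp add: lift_def fscale_lookup vs_sum[OF assms] vs_scale[OF assms])
qed

lemma lift_word: "vector_space sB \<Longrightarrow> length w = m \<Longrightarrow> lift m sB g (word w) = g w"
  by (simp add: lift_def vs_one Collect_conv_if)

lemma lift_lin_param:
  assumes "vector_space sB" "\<And>w. length w = m \<Longrightarrow> lin sX sB (\<lambda>x. g x w)"
  shows "lin sX sB (\<lambda>x. lift m sB (g x) u)"
  unfolding lift_def
proof (intro lin_sumI assms(1))
  fix w assume "w \<in> {w \<in> Poly_Mapping.keys u. length w = m}"
  then show "lin sX sB (\<lambda>x. sB (Poly_Mapping.lookup u w) (g x w))"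
    using lin_comp[OF vs_lin[OF assms(1)] assms(2)[of w]] by simp
qed

lemma lift_fun_scale: "lift m (fun_scale sB) g u z = lift m sB (\<lambda>w. g w z) u"
  unfolding lift_def sum_fun by (simp add: fun_scale_def)

definition sskew :: "('k::field, 'a, 'z) superspace_scheme \<Rightarrow> nat \<Rightarrow> ('a list \<Rightarrow> 'b::ab_group_add) \<Rightarrow> bool"
  where "sskew S m g \<longleftrightarrow> (\<forall>as bs x y a b. length as + length bs + 2 = m \<longrightarrow> x \<in> grd S a \<longrightarrow> y \<in> grd S b \<longrightarrow>
    g (as @ x # y # bs) = - sign (a * b) (g (as @ y # x # bs)))"

lemma sskewD: "sskew S m g \<Longrightarrow> length as + length bs + 2 = m \<Longrightarrow> x \<in> grd S a \<Longrightarrow> y \<in> grd S b \<Longrightarrow>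
    g (as @ x # y # bs) = - sign (a * b) (g (as @ y # x # bs))"
  unfolding sskew_def by blast

lemma sskew_Cons:
  fixes g :: "'a list \<Rightarrow> 'b::ab_group_add"
  assumes "sskew S (Suc m) g" shows "sskew S m (\<lambda>xs. g (x # xs))"
  unfolding sskew_def
proof (intro allI impI)
  fix as bs :: "'a list" and y z a b assume "length as + length bs + 2 = m" "y \<in> grd S a" "z \<in> grd S b"
  then show "g (x # as @ y # z # bs) = - sign (a * b) (g (x # as @ z # y # bs))"
    using sskewD[OF assms, of "x # as" bs y a z b] by simp
qed

lemma sskew_funI:
  fixes g :: "'a list \<Rightarrow> 'c \<Rightarrow> 'b::ab_group_add"
  assumes "\<And>z. sskew S m (\<lambda>xs. g xs z)" shows "sskew S m g"
  unfolding sskew_def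
proof (intro allI impI ext)
  fix as bs :: "'a list" and x y a b z assume "length as + length bs + 2 = m" "x \<in> grd S a" "y \<in> grd S b"
  from sskewD[OF assms this] show "g (as @ x # y # bs) z = (- sign (a * b) (g (as @ y # x # bs))) z"
    by (simp only: sign_fun uminus_apply)
qed

context sspace
begin

lemma sskewI_hom:
  fixes g :: "'a list \<Rightarrow> 'b::ab_group_add"
  assumes "vector_space sB" "mlin m (smult S) sB g"
    and h: "\<And>as bs x y a b. length as + length bs + 2 = m \<Longrightarrow> set as \<subseteq> homog S \<Longrightarrow> set bs \<subseteq> homog S \<Longrightarrow>
      x \<in> grd S a \<Longrightarrow> y \<in> grd S b \<Longrightarrow> x \<noteq> 0 \<Longrightarrow> y \<noteq> 0 \<Longrightarrow> g (as @ x # y # bs) = - sign (a * b) (g (as @ y # x # bs))"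
  shows "sskew S m g"
  unfolding sskew_def
proof (intro allI impI)
  fix as bs :: "'a list" and x y a b
  assume *: "length as + length bs + 2 = m" "x \<in> grd S a" "y \<in> grd S b"
  show "g (as @ x # y # bs) = - sign (a * b) (g (as @ y # x # bs))"
  proof (cases "x = 0 \<or> y = 0")
    case True
    then have "g (as @ x # y # bs) = 0" "g (as @ y # x # bs) = 0"
      using mlin_slot_0[OF assms(2), of as "_ # bs"] mlin_slot_0[OF assms(2), of "as @ [_]" bs] * by auto
    then show ?thesis by simp
  next
    case False
    define l where "l = length as"
    define F where "F x y zs = g (take l zs @ x # y # drop l zs)" for x y zs
    have ml: "mlin (m - 2) (smult S) sB (F x y)" for x y
      unfolding mlin_def
    proof (intro allI impI)
      fix cs ds :: "'a list" assume l: "length cs + length ds + 1 = m - 2"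
      show "lin (smult S) sB (\<lambda>z. F x y (cs @ z # ds))"
      proof (cases "length cs < l")
        case True
        have "F x y (cs @ z # ds) = g (cs @ z # (take (l - length cs - 1) ds @ x # y # drop (l - length cs - 1) ds))" for z
          using True by (simp add: F_def take_Cons' drop_Cons')
        then show ?thesis using l * True by (simp add: mlinD[OF assms(2)] l_def)
      next
        case False
        have "F x y (cs @ z # ds) = g ((take l cs @ x # y # drop l cs) @ z # ds)" for z
          using False by (simp add: F_def)
        moreover have "lin (smult S) sB (\<lambda>z. g ((take l cs @ x # y # drop l cs) @ z # ds))"
          using l * False by (intro mlinD[OF assms(2)]) (simp add: l_def)
        ultimately show ?thesis by simp
      qed
    qed
    have "F x y (as @ bs) = - sign (a * b) (F y x (as @ bs))"
    proof (rule mlin_eq_homog[OF ml])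
      show "mlin (m - 2) (smult S) sB (\<lambda>zs. - sign (a * b) (F y x zs))"
        by (intro mlin_negI mlin_signI ml assms(1))
      fix zs assume "zs \<in> hlists (m - 2) S"
      then show "F x y zs = - sign (a * b) (F y x zs)"
        using * False unfolding F_def l_def
        by (intro h) (auto simp: hlists_def dest!: in_set_takeD in_set_dropD)
    qed (use * in simp)
    then show ?thesis by (simp add: F_def l_def)
  qed
qed

lemma super_skew_sskew:
  assumes vs: "vector_space sB" and ml: "mlin m (smult S) sB g" and sk: "super_skew m S sB g"
  shows "sskew S m g"
proof (rule sskewI_hom[OF vs ml])
  fix as bs x y a b
  assume *: "length as + length bs + 2 = m" "set as \<subseteq> homog S" "set bs \<subseteq> homog S"
      "x \<in> grd S a" "y \<in> grd S b" "x \<noteq> 0" "y \<noteq> 0"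
  let ?xs = "as @ x # y # bs"
  have "?xs \<in> hlists m S" using * grd_homog by (auto simp: hlists_def)
  moreover have "Suc (length as) < m" using * by simp
  ultimately have "g ?xs = - sB ((-1) ^ (par S (?xs ! length as) * par S (?xs ! Suc (length as))))
     (g (?xs[length as := ?xs ! Suc (length as), Suc (length as) := ?xs ! length as]))"
    using sk unfolding super_skew_def by blast
  moreover have "?xs ! Suc (length as) = y" by (simp add: nth_append)
  moreover have "?xs[length as := y, Suc (length as) := x] = as @ y # x # bs"
    by (simp add: list_update_append)
  moreover have "?xs ! length as = x" by simp
  moreover have "even (par S x * par S y) = even (a * b)"
    using par_grd * by simp
  ultimately show "g ?xs = - sign (a * b) (g (as @ y # x # bs))"
    by (simp only: sign_scale[OF vs] sign_def)
qed

lemma lift_ext_rel: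
  assumes vs: "vector_space sB" and ml: "mlin m (smult S) sB g" and sk: "sskew S m g"
    and u: "u \<in> ext_rel m S"
  shows "lift m sB g u = 0"
proof -
  note l = lift_lin[OF vs, of m g]
  have upd: "xs[i := z] = take i xs @ z # drop (Suc i) xs" if "i < length xs" for xs :: "'a list" and i z
    using that by (simp add: upd_conv_take_nth_drop)
  consider (a) xs i x y where "length xs = m" "i < m" "u = word (xs[i := x + y]) - (word (xs[i := x]) + word (xs[i := y]))"
    | (b) xs i c x where "length xs = m" "i < m" "u = word (xs[i := smult S c x]) - fscale c (word (xs[i := x]))"
    | (c) xs i where "xs \<in> hlists m S" "Suc i < m" "u = word xs + fscale ((-1) ^ (par S (xs ! i) * par S (xs ! Suc i)))
                 (word (xs[i := xs ! Suc i, Suc i := xs ! i]))"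
    using u unfolding ext_rel_def by blast
  then show ?thesis
  proof cases
    case a
    then have "lin (smult S) sB (\<lambda>z. g (take i xs @ z # drop (Suc i) xs))" by (intro mlinD[OF ml]) simp
    from lin_add[OF this, of x y] show ?thesis unfolding a(3)
      using a(1,2) upd[of i xs] by (simp add: lin_diff[OF l] lin_add[OF l] lift_word[OF vs])
  next
    case b
    then have "lin (smult S) sB (\<lambda>z. g (take i xs @ z # drop (Suc i) xs))" by (intro mlinD[OF ml]) simp
    from lin_scale[OF this, of c x] show ?thesis unfolding b(3)
      using b(1,2) upd[of i xs] by (simp add: lin_diff[OF l] lin_scale[OF l] lift_word[OF vs])
  next
    case c
    then have l2: "length xs = m" "set xs \<subseteq> homog S" by (auto simp: hlists_def)
    have xs: "xs = take i xs @ xs ! i # xs ! Suc i # drop (Suc (Suc i)) xs"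
      using c l2 by (simp add: Cons_nth_drop_Suc)
    let ?e = "par S (xs ! i) * par S (xs ! Suc i)"
    have "g (take i xs @ xs ! i # xs ! Suc i # drop (Suc (Suc i)) xs) =
       - sign ?e (g (take i xs @ xs ! Suc i # xs ! i # drop (Suc (Suc i)) xs))"
      using c l2 by (intro sskewD[OF sk] homog_par) (auto simp: subset_iff)
    moreover have "xs[i := xs ! Suc i, Suc i := xs ! i] = take i xs @ xs ! Suc i # xs ! i # drop (Suc (Suc i)) xs"
    proof -
      have "(take i xs @ xs ! i # xs ! Suc i # drop (Suc (Suc i)) xs)[i := a, Suc i := b]
          = take i xs @ a # b # drop (Suc (Suc i)) xs" for a b
        using c l2 by (simp add: list_update_append)
      with xs show ?thesis by metis
    qed
    ultimately have "g xs = - sign ?e (g (xs[i := xs ! Suc i, Suc i := xs ! i]))" using xs by simp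
    moreover have "lift m sB g u = g xs + sign ?e (g (xs[i := xs ! Suc i, Suc i := xs ! i]))"
      using l2 by (simp add: c(3) lin_add[OF l] lin_scale[OF l] lift_word[OF vs] sign_scale[OF vs])
    ultimately show ?thesis by simp
  qed
qed

lemma lift_wedge:
  assumes vs: "vector_space sB" and ml: "mlin m (smult S) sB g" and sk: "sskew S m g" and len: "length xs = m"
  shows "lift m sB g (wedge m S xs) = g xs"
proof -
  note l = lift_lin[OF vs, of m g]
  interpret E: vector_space "fscale :: 'k \<Rightarrow> ('a list \<Rightarrow>\<^sub>0 'k) \<Rightarrow> _" by (rule vector_space_fscale)
  let ?q = "ext_proj m S"
  have add: "?q (u - v) = ?q u - ?q v" for u v
    using module_hom.diff[OF Vector_Spaces.linear.axioms(3)[OF ext_proj(1)]] .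
  have "?q (word xs - ?q (word xs)) = 0" by (simp add: add ext_proj(2))
  then have "word xs - wedge m S xs \<in> E.span (ext_rel m S)" by (simp add: ext_proj(3) wedge_def)
  then have "lift m sB g (word xs - wedge m S xs) = 0"
  proof (rule E.span_induct)
    show "E.subspace {u. lift m sB g u = 0}"
      by (rule E.subspaceI) (simp_all add: lin_0[OF l] lin_add[OF l] lin_scale[OF l] vs_zero[OF vs])
  qed (use lift_ext_rel[OF vs ml sk] in auto)
  then show ?thesis using lift_word[OF vs len, of g] by (simp add: lin_diff[OF l])
qed

lemma wedge_rel:
  fixes S' :: "('k::field, 'b::ab_group_add, 'z) superspace_scheme"
  shows "u \<in> ext_rel m S' \<Longrightarrow> ext_proj m S' u = 0"
  using ext_proj(3)[of m S' u] module.span_base[of fscale u "ext_rel m S'"]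
  by (simp add: module_iff_vector_space vector_space_fscale)

lemma ext_proj_lin: "lin fscale fscale (ext_proj m S)"
  by (intro linI module_hom.add[OF Vector_Spaces.linear.axioms(3)[OF ext_proj(1)]]
      module_hom.scale[OF Vector_Spaces.linear.axioms(3)[OF ext_proj(1)]])

lemma wedge_mlin: "mlin m (smult S) fscale (wedge m S)"
  unfolding mlin_def
proof (intro allI impI linI)
  fix as bs :: "'a list" and x y assume *: "length as + length bs + 1 = m"
  have "word ((as @ x # bs)[length as := x + y]) - (word ((as @ x # bs)[length as := x]) + word ((as @ x # bs)[length as := y])) \<in> ext_rel m S"
    unfolding ext_rel_def using * by (intro UnI1 CollectI exI[of _ "as @ x # bs"] exI[of _ "length as"] exI[of _ x] exI[of _ y]) simp
  from wedge_rel[OF this] show "wedge m S (as @ (x + y) # bs) = wedge m S (as @ x # bs) + wedge m S (as @ y # bs)"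
    by (simp add: lin_diff[OF ext_proj_lin] lin_add[OF ext_proj_lin] wedge_def)
next
  fix as bs :: "'a list" and c x assume *: "length as + length bs + 1 = m"
  have "word ((as @ x # bs)[length as := smult S c x]) - fscale c (word ((as @ x # bs)[length as := x])) \<in> ext_rel m S"
    unfolding ext_rel_def using * by (intro UnI1 UnI2 CollectI exI[of _ "as @ x # bs"] exI[of _ "length as"] exI[of _ c] exI[of _ x]) simp
  from wedge_rel[OF this] show "wedge m S (as @ smult S c x # bs) = fscale c (wedge m S (as @ x # bs))"
    by (simp add: lin_diff[OF ext_proj_lin] lin_scale[OF ext_proj_lin] wedge_def)
qed

lemma wedge_sskew: "sskew S m (wedge m S)"
proof (rule super_skew_sskew[OF vector_space_fscale wedge_mlin])
  show "super_skew m S fscale (wedge m S)" unfolding super_skew_def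
  proof (intro ballI allI impI)
    fix xs i assume "xs \<in> hlists m S" "Suc i < m"
    then have "word xs + fscale ((-1) ^ (par S (xs ! i) * par S (xs ! Suc i)))
                 (word (xs[i := xs ! Suc i, Suc i := xs ! i])) \<in> ext_rel m S"
      unfolding ext_rel_def by blast
    from wedge_rel[OF this] show "wedge m S xs = - fscale ((-1) ^ (par S (xs ! i) * par S (xs ! Suc i)))
                 (wedge m S (xs[i := xs ! Suc i, Suc i := xs ! i]))"
      by (simp add: lin_add[OF ext_proj_lin] lin_scale[OF ext_proj_lin] wedge_def eq_neg_iff_add_eq_0)
  qed
qed

lemma mlin_in_subspace:
  assumes "mlin m (smult S) sB g" "\<And>x y. x \<in> H \<Longrightarrow> y \<in> H \<Longrightarrow> x + y \<in> H"
    and "\<And>xs. xs \<in> hlists m S \<Longrightarrow> g xs \<in> H"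
  shows "length xs = m \<Longrightarrow> g xs \<in> H"
  using assms(1,3)
proof (induction m arbitrary: xs g)
  case 0 then show ?case by (simp add: hlists_def)
next
  case (Suc m)
  obtain x ys where xs: "xs = x # ys" "length ys = m" using Suc.prems(1) by (cases xs) auto
  have "g (pr S q x # ys) \<in> H" for q
  proof (rule Suc.IH[OF xs(2) mlin_Cons[OF Suc.prems(2)]])
    fix zs assume "zs \<in> hlists m S"
    then show "g (pr S q x # zs) \<in> H"
      using pr_homog by (intro Suc.prems(3)) (auto simp: hlists_def)
  qed
  then show ?case
    using lin_add[OF mlin_hd[OF Suc.prems(2) xs(2)], of "pr S 0 x" "pr S 1 x"] assms(2)
    by (simp add: pr_sum xs(1))
qed

lemma ext_power_hom: "ext_power m S = module.span fscale (wedge m S ` hlists m S)"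
proof -
  interpret E: vector_space "fscale :: 'k \<Rightarrow> ('a list \<Rightarrow>\<^sub>0 'k) \<Rightarrow> _" by (rule vector_space_fscale)
  have "wedge m S xs \<in> E.span (wedge m S ` hlists m S)" if "length xs = m" for xs
    by (rule mlin_in_subspace[OF wedge_mlin _ _ that]) (auto intro: E.span_add E.span_base)
  then have "ext_power m S \<subseteq> E.span (wedge m S ` hlists m S)"
    unfolding ext_power_def by (intro E.span_minimal E.subspace_span) auto
  moreover have "E.span (wedge m S ` hlists m S) \<subseteq> ext_power m S"
    unfolding ext_power_def by (intro E.span_mono) (auto simp: hlists_def)
  ultimately show ?thesis by blast
qed

lemma sskew_move_end:
  assumes sk: "sskew S m g" and "x \<in> grd S a"
  shows "set bs \<subseteq> homog S \<Longrightarrow> length as + length bs + 1 = m \<Longrightarrow>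
    g (as @ x # bs) = sign (length bs + a * parl S bs) (g (as @ bs @ [x]))"
proof (induction bs arbitrary: as)
  case Nil then show ?case by (simp add: parl_def)
next
  case (Cons b bs)
  have "g (as @ x # b # bs) = - sign (a * par S b) (g (as @ b # x # bs))"
    using Cons.prems assms(2) by (intro sskewD[OF sk] homog_par) auto
  also have "g (as @ b # x # bs) = sign (length bs + a * parl S bs) (g (as @ b # bs @ [x]))"
    using Cons.IH[of "as @ [b]"] Cons.prems by simp
  finally show ?case
    by (cases "even a"; cases "even (par S b)"; cases "even (parl S bs)"; cases "even (length bs)")
      (simp_all add: sign_def parl_def)
qed

end

lemma lin_eq_on_span:
  assumes "vector_space sA" "vector_space sB" "lin sA sB h1" "lin sA sB h2" "\<And>x. x \<in> G \<Longrightarrow> h1 x = h2 x" "u \<in> module.span sA G"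
  shows "h1 u = h2 u"
proof -
  interpret A: vector_space sA by fact
  show ?thesis
  proof (rule A.span_induct[OF assms(6)])
    show "A.subspace {x. h1 x = h2 x}"
      using assms(3,4) by (intro A.subspaceI) (simp_all add: lin_0 lin_add lin_scale)
  qed (use assms(5) in auto)
qed

lemma lin_span_in:
  assumes "vector_space sA" "vector_space sB" "lin sA sB h" "\<And>x. x \<in> G \<Longrightarrow> h x \<in> module.span sB H" "u \<in> module.span sA G"
  shows "h u \<in> module.span sB H"
proof -
  interpret A: vector_space sA by fact
  interpret B: vector_space sB by fact
  show ?thesis
  proof (rule A.span_induct[OF assms(5)])
    show "A.subspace {x. h x \<in> B.span H}"
      using assms(3) by (intro A.subspaceI) (simp_all add: lin_0 lin_add lin_scale B.span_zero B.span_add B.span_scale)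
  qed (use assms(4) in auto)
qed

section \<open>Derivations of words\<close>

text \<open>\<open>A\<close> is inserted in each position in turn; the letters to its left are twisted by \<open>t\<close>, which
  produces the Koszul signs, and all the other letters are carried along \<open>\<iota>\<close>.\<close>

fun word_der :: "('a \<Rightarrow> 'a) \<Rightarrow> ('a \<Rightarrow> 'b) \<Rightarrow> ('a \<Rightarrow> 'b) \<Rightarrow> ('m \<Rightarrow> 'm::ab_group_add) \<Rightarrow> ('b list \<Rightarrow> 'm) \<Rightarrow> 'a list \<Rightarrow> 'm" where
  "word_der t A \<iota> c f [] = c (f [])"
| "word_der t A \<iota> c f (x # xs) = f (A x # map \<iota> xs) + word_der t A \<iota> c (\<lambda>ys. f (\<iota> (t x) # ys)) xs"

lemma word_der_cong: "(\<And>ys. length ys = length xs \<Longrightarrow> f ys = g ys) \<Longrightarrow> word_der t A \<iota> c f xs = word_der t A \<iota> c g xs"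
proof (induction xs arbitrary: f g)
  case (Cons x xs)
  have "word_der t A \<iota> c (\<lambda>ys. f (\<iota> (t x) # ys)) xs = word_der t A \<iota> c (\<lambda>ys. g (\<iota> (t x) # ys)) xs"
    by (rule Cons.IH) (simp add: Cons.prems)
  then show ?case by (simp add: Cons.prems)
qed simp

lemma word_der_hom:
  assumes "\<And>x y. h (x + y) = h x + h y" "\<And>x. h (c x) = c' (h x)"
  shows "h (word_der t A \<iota> c f xs) = word_der t A \<iota> c' (\<lambda>ys. h (f ys)) xs"
  by (induction xs arbitrary: f) (simp_all add: assms)

lemma word_der_sign:
  assumes "lin sM sM c" shows "word_der t A \<iota> c (\<lambda>ys. sign e (f ys)) xs = sign e (word_der t A \<iota> c f xs)"
  by (rule word_der_hom[symmetric]) (simp_all add: sign_add lin_sign[OF assms])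

lemma word_der_add:
  assumes "\<And>x y. c (x + y) = c x + c y"
  shows "word_der t A \<iota> c (\<lambda>ys. f ys + g ys) xs = word_der t A \<iota> c f xs + word_der t A \<iota> c g xs"
  by (induction xs arbitrary: f g) (simp_all add: assms)

lemma word_der_lin_f:
  assumes vs: "vector_space sM" and c: "lin sM sM c"
  shows "(\<And>ys. length ys = length xs \<Longrightarrow> lin sX sM (\<lambda>p. f p ys)) \<Longrightarrow> lin sX sM (\<lambda>p. word_der t A \<iota> c (f p) xs)"
proof (induction xs arbitrary: f)
  case Nil then show ?case using lin_comp[OF c] by simp
next
  case (Cons x xs)
  have "lin sX sM (\<lambda>p. word_der t A \<iota> c (\<lambda>ys. f p (\<iota> (t x) # ys)) xs)" by (rule Cons.IH) (simp add: Cons.prems)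
  then show ?case by (simp add: lin_addI[OF vs] Cons.prems)
qed

lemma word_der_lin_A:
  assumes vs: "vector_space sM" and A: "\<And>x. lin sX sB (\<lambda>p. A p x)"
  shows "mlin (length xs) sB sM f \<Longrightarrow> (\<And>ys. length ys = length xs \<Longrightarrow> lin sX sM (\<lambda>p. c p (f ys))) \<Longrightarrow>
    lin sX sM (\<lambda>p. word_der t (A p) \<iota> (c p) f xs)"
proof (induction xs arbitrary: f)
  case Nil then show ?case by simp
next
  case (Cons x xs)
  have "lin sX sM (\<lambda>p. word_der t (A p) \<iota> (c p) (\<lambda>ys. f (\<iota> (t x) # ys)) xs)"
    using Cons.prems by (intro Cons.IH mlin_Cons) simp_all
  moreover have "lin sX sM (\<lambda>p. f (A p x # map \<iota> xs))"
    using Cons.prems by (intro lin_comp[OF mlin_hd A]) simp_all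
  ultimately show ?case by (simp add: lin_addI[OF vs])
qed

lemma word_der_mlin:
  fixes \<iota> :: "'a::ab_group_add \<Rightarrow> 'b::ab_group_add"
  assumes vs: "vector_space sM" and t: "lin sA sA t" and A: "lin sA sB A" and i: "lin sA sB \<iota>" and c: "lin sM sM c"
  shows "mlin m sB sM f \<Longrightarrow> mlin m sA sM (word_der t A \<iota> c f)"
proof (induction m arbitrary: f)
  case 0 then show ?case by simp
next
  case (Suc m)
  note hd = mlin_hd[OF Suc.prems]
  show ?case
  proof (rule mlin_SucI)
    fix X :: "'a list" assume X: "length X = m"
    have "lin sA sM (\<lambda>x. f (A x # map \<iota> X))" using X by (intro lin_comp[OF hd A]) simp
    moreover have "lin sA sM (\<lambda>x. word_der t A \<iota> c (\<lambda>ys. f (\<iota> (t x) # ys)) X)"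
      using X by (intro word_der_lin_f[OF vs c] lin_comp[OF hd lin_comp[OF i t]]) simp
    ultimately show "lin sA sM (\<lambda>x. word_der t A \<iota> c f (x # X))" by (simp add: lin_addI[OF vs])
  next
    fix x
    show "mlin m sA sM (\<lambda>X. word_der t A \<iota> c f (x # X))"
      using mlin_addI[OF vs mlin_map[OF mlin_Cons[OF Suc.prems] i] Suc.IH[OF mlin_Cons[OF Suc.prems]]] by simp
  qed
qed

context sspace
begin

lemma word_der_Cons_hom:
  assumes i: "lin (smult S) sB \<iota>" and c: "lin sM sM c" and f: "mlin (Suc (length xs)) sB sM f" and x: "x \<in> grd S a"
  shows "word_der (tw S q) A \<iota> c f (x # xs) = f (A x # map \<iota> xs) + sign (q * a) (word_der (tw S q) A \<iota> c (\<lambda>ys. f (\<iota> x # ys)) xs)"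
proof -
  have "word_der (tw S q) A \<iota> c (\<lambda>ys. f (\<iota> (tw S q x) # ys)) xs
      = word_der (tw S q) A \<iota> c (\<lambda>ys. sign (q * a) (f (\<iota> x # ys))) xs"
    by (rule word_der_cong) (simp add: tw_grd[OF x] lin_sign[OF i] lin_sign[OF mlin_hd[OF f]])
  then show ?thesis by (simp add: word_der_sign[OF c])
qed

lemma word_der_sum:
  assumes i: "lin (smult S) sB \<iota>" and c: "lin sM sM c"
  shows "mlin (length xs) sB sM f \<Longrightarrow> set xs \<subseteq> homog S \<Longrightarrow>
    word_der (tw S q) A \<iota> c f xs =
      (\<Sum>i<length xs. sign (q * parl S (take i xs)) (f ((map \<iota> xs)[i := A (xs ! i)])))
      + sign (q * parl S xs) (c (f (map \<iota> xs)))"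
proof (induction xs arbitrary: f)
  case Nil then show ?case by (simp add: parl_def)
next
  case (Cons x xs)
  have f: "mlin (Suc (length xs)) sB sM f" using Cons.prems by simp
  have x: "x \<in> grd S (par S x)" using Cons.prems homog_par by simp
  have IH: "word_der (tw S q) A \<iota> c (\<lambda>ys. f (\<iota> x # ys)) xs =
      (\<Sum>i<length xs. sign (q * parl S (take i xs)) (f (\<iota> x # (map \<iota> xs)[i := A (xs ! i)])))
      + sign (q * parl S xs) (c (f (\<iota> x # map \<iota> xs)))"
    using Cons.prems mlin_Cons[OF f] by (intro Cons.IH) simp_all
  show ?case
    unfolding word_der_Cons_hom[OF i c f x] IH
    by (simp add: sum.lessThan_Suc_shift sign_add sign_sum parl_def algebra_simps del: sum.lessThan_Suc)
qed

end

locale smap = S: sspace S + T: sspace T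
  for S :: "('k::field, 'a::ab_group_add, 'z) superspace_scheme"
  and T :: "('k::field, 'b::ab_group_add, 'y) superspace_scheme" +
  fixes \<iota> :: "'a \<Rightarrow> 'b"
  assumes i_lin: "lin (smult S) (smult T) \<iota>"
    and i_grd: "x \<in> grd S a \<Longrightarrow> \<iota> x \<in> grd T a"
begin

lemma word_der_sskew:
  assumes c: "lin sM sM c" and A: "\<And>x a. x \<in> grd S a \<Longrightarrow> A x \<in> grd T (q + a)"
    and f: "mlin m (smult T) sM f" "sskew T m f"
  shows "sskew S m (word_der (tw S q) A \<iota> c f)"
proof -
  have "word_der (tw S q) A \<iota> c f (as @ x # y # bs) = - sign (a * b) (word_der (tw S q) A \<iota> c f (as @ y # x # bs))"
    if xy: "x \<in> grd S a" "y \<in> grd S b" and "length as + length bs + 2 = m" "mlin m (smult T) sM f" "sskew T m f"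
    for as bs x y a b m f
    using that(3-)
  proof (induction as arbitrary: m f)
    case Nil
    let ?D = "word_der (tw S q) A \<iota> c"
    have m: "m = Suc (Suc (length bs))" using Nil by simp
    note f1 = Nil.prems(2)[unfolded m]
    have D: "?D f (x # y # bs) = f (A x # \<iota> y # map \<iota> bs) + sign (q * a) (f (\<iota> x # A y # map \<iota> bs)
        + sign (q * b) (?D (\<lambda>ys. f (\<iota> x # \<iota> y # ys)) bs))" if "x \<in> grd S a" "y \<in> grd S b" for x y a b
      using S.word_der_Cons_hom[OF i_lin c _ that(1), of "y # bs" f q A] f1
        S.word_der_Cons_hom[OF i_lin c mlin_Cons[OF f1, of "\<iota> x"] that(2), of q A] by simp
    have "?D (\<lambda>ys. f (\<iota> x # \<iota> y # ys)) bs = ?D (\<lambda>ys. sign (a * b + 1) (f (\<iota> y # \<iota> x # ys))) bs"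
    proof (rule word_der_cong)
      fix ys :: "'b list" assume "length ys = length bs"
      then show "f (\<iota> x # \<iota> y # ys) = sign (a * b + 1) (f (\<iota> y # \<iota> x # ys))"
        using sskewD[OF Nil.prems(3), of "[]" ys "\<iota> x" a "\<iota> y" b] m xy i_grd by (simp add: sign_def)
    qed
    then have 1: "?D (\<lambda>ys. f (\<iota> x # \<iota> y # ys)) bs = sign (a * b + 1) (?D (\<lambda>ys. f (\<iota> y # \<iota> x # ys)) bs)"
      by (simp only: word_der_sign[OF c])
    have 2: "f (A x # \<iota> y # map \<iota> bs) = - sign ((q + a) * b) (f (\<iota> y # A x # map \<iota> bs))"
      using sskewD[OF Nil.prems(3), of "[]" "map \<iota> bs" "A x" "q + a" "\<iota> y" b] m xy i_grd A by simp
    have 3: "f (\<iota> x # A y # map \<iota> bs) = - sign (a * (q + b)) (f (A y # \<iota> x # map \<iota> bs))"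
      using sskewD[OF Nil.prems(3), of "[]" "map \<iota> bs" "\<iota> x" a "A y" "q + b"] m xy i_grd A by simp
    show ?case
      unfolding append_Nil D[OF xy] D[OF xy(2,1)] 1 2 3
      by (cases "even q"; cases "even a"; cases "even b") (simp_all add: sign_def)
  next
    case (Cons z as)
    obtain m' where m: "m = Suc m'" "length as + length bs + 2 = m'" using Cons.prems(1) by (cases m) auto
    note f1 = Cons.prems(2,3)[unfolded m]
    have "f (A z # map \<iota> as @ \<iota> x # \<iota> y # map \<iota> bs) = - sign (a * b) (f (A z # map \<iota> as @ \<iota> y # \<iota> x # map \<iota> bs))"
      using sskewD[OF Cons.prems(3), of "A z # map \<iota> as" "map \<iota> bs" "\<iota> x" a "\<iota> y" b] m xy i_grd by simp
    moreover have "word_der (tw S q) A \<iota> c (\<lambda>ys. f (\<iota> (tw S q z) # ys)) (as @ x # y # bs) =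
        - sign (a * b) (word_der (tw S q) A \<iota> c (\<lambda>ys. f (\<iota> (tw S q z) # ys)) (as @ y # x # bs))"
      by (rule Cons.IH[OF m(2) mlin_Cons[OF f1(1)] sskew_Cons[OF f1(2)]])
    ultimately show ?case by (simp add: sign_add)
  qed
  then show ?thesis using f unfolding sskew_def by blast
qed

lemma i_tw: "\<iota> (tw S q x) = tw T q (\<iota> x)"
proof -
  have "\<iota> x = \<iota> (pr S 0 x) + \<iota> (pr S 1 x)" using lin_add[OF i_lin, of "pr S 0 x" "pr S 1 x"] S.pr_sum[of x] by simp
  moreover have "pr T r (\<iota> (pr S s x)) = (if even (r + s) then \<iota> (pr S s x) else 0)" for r s
    by (intro T.pr_grd i_grd S.pr_in)
  ultimately have "pr T 0 (\<iota> x) = \<iota> (pr S 0 x)" "pr T 1 (\<iota> x) = \<iota> (pr S 1 x)"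
    by (simp_all add: lin_add[OF T.pr_lin])
  then show ?thesis by (simp add: tw_def lin_add[OF i_lin] lin_sign[OF i_lin])
qed

lemma word_der_natural:
  assumes "\<And>x. A' (\<iota> x) = \<iota> (A x)"
  shows "word_der (tw S q) A (\<lambda>x. x) c (\<lambda>ys. g (map \<iota> ys)) xs = word_der (tw T q) A' (\<lambda>x. x) c g (map \<iota> xs)"
  by (induction xs arbitrary: g) (simp_all add: assms i_tw)

lemma word_der_commutator:
  fixes A :: "'a \<Rightarrow> 'a" and A' :: "'b \<Rightarrow> 'b" and \<Phi> :: "'a \<Rightarrow> 'b" and sM :: "'k \<Rightarrow> 'm::ab_group_add \<Rightarrow> 'm"
  assumes vs: "vector_space sM" and A: "\<And>x a. x \<in> grd S a \<Longrightarrow> A x \<in> grd S (q + a)"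
    and P: "\<And>x a. x \<in> grd S a \<Longrightarrow> \<Phi> x \<in> grd T (p + a)"
    and A'l: "lin (smult T) (smult T) A'" and Pl: "lin (smult S) (smult T) \<Phi>"
    and AA: "\<And>x. A' (\<iota> x) = \<iota> (A x)"
  shows "mlin (length xs) (smult T) sM g \<Longrightarrow> set xs \<subseteq> homog S \<Longrightarrow>
    word_der (tw S p) \<Phi> \<iota> (\<lambda>_. 0) (word_der (tw T q) A' (\<lambda>x. x) (\<lambda>_. 0) g) xs
    - sign (p * q) (word_der (tw S q) A (\<lambda>x. x) (\<lambda>_. 0) (word_der (tw S p) \<Phi> \<iota> (\<lambda>_. 0) g) xs)
    = word_der (tw S (p + q)) (\<lambda>x. A' (\<Phi> x) - sign (p * q) (\<Phi> (A x))) \<iota> (\<lambda>_. 0) g xs"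
proof (induction xs arbitrary: g)
  case Nil then show ?case by simp
next
  case (Cons x xs)
  let ?z = "\<lambda>_::'m. 0::'m"
  have z: "lin sM sM ?z" by (rule lin_zeroI[OF vs])
  have g: "mlin (Suc (length xs)) (smult T) sM g" using Cons.prems by simp
  obtain a where x: "x \<in> grd S a" using Cons.prems S.homog_iff by auto
  have ix: "\<iota> x \<in> grd T a" and Px: "\<Phi> x \<in> grd T (p + a)" and Ax: "A x \<in> grd S (q + a)"
    using x i_grd P A by auto
  let ?DA = "word_der (tw T q) A' (\<lambda>x. x) ?z" and ?DS = "word_der (tw S q) A (\<lambda>x. x) ?z" and ?DP = "word_der (tw S p) \<Phi> \<iota> ?z"
  let ?C = "\<lambda>x. A' (\<Phi> x) - sign (p * q) (\<Phi> (A x))"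
  have DA_eq: "?DA g (w # ys) = g (A' w # ys) + sign (q * b) (?DA (\<lambda>ys. g (w # ys)) ys)"
    if "length ys = length xs" "w \<in> grd T b" for w b ys
    using T.word_der_Cons_hom[OF lin_id z _ that(2), of ys g q A'] g that(1) by simp
  have DP_eq: "?DP g (w # ys) = g (\<Phi> w # map \<iota> ys) + sign (p * b) (?DP (\<lambda>ys. g (\<iota> w # ys)) ys)"
    if "length ys = length xs" "w \<in> grd S b" for w b ys
    using S.word_der_Cons_hom[OF i_lin z _ that(2), of ys g p \<Phi>] g that(1) by simp
  have "?DP (?DA g) (x # xs) = ?DA g (\<Phi> x # map \<iota> xs) + sign (p * a) (?DP (\<lambda>ys. ?DA g (\<iota> x # ys)) xs)"
    by (intro S.word_der_Cons_hom[OF i_lin z word_der_mlin[OF vs T.tw_lin A'l lin_id z g] x])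
  also have "?DP (\<lambda>ys. ?DA g (\<iota> x # ys)) xs
      = ?DP (\<lambda>ys. g (\<iota> (A x) # ys) + sign (q * a) (?DA (\<lambda>ys. g (\<iota> x # ys)) ys)) xs"
    by (rule word_der_cong) (simp only: DA_eq[OF _ ix] AA)
  also have "\<dots> = ?DP (\<lambda>ys. g (\<iota> (A x) # ys)) xs + sign (q * a) (?DP (?DA (\<lambda>ys. g (\<iota> x # ys))) xs)"
    by (simp only: word_der_add add_0 word_der_sign[OF z])
  finally have 1: "?DP (?DA g) (x # xs) = g (A' (\<Phi> x) # map \<iota> xs) + sign (q * (p + a)) (?DA (\<lambda>ys. g (\<Phi> x # ys)) (map \<iota> xs))
      + sign (p * a) (?DP (\<lambda>ys. g (\<iota> (A x) # ys)) xs + sign (q * a) (?DP (?DA (\<lambda>ys. g (\<iota> x # ys))) xs))"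
    by (simp only: DA_eq[of "map \<iota> xs", OF length_map Px])
  have "?DS (?DP g) (x # xs) = ?DP g (A x # map (\<lambda>x. x) xs) + sign (q * a) (?DS (\<lambda>ys. ?DP g (x # ys)) xs)"
    by (intro S.word_der_Cons_hom[OF lin_id z word_der_mlin[OF vs S.tw_lin Pl i_lin z g] x])
  also have "?DS (\<lambda>ys. ?DP g (x # ys)) xs
      = ?DS (\<lambda>ys. g (\<Phi> x # map \<iota> ys) + sign (p * a) (?DP (\<lambda>ys. g (\<iota> x # ys)) ys)) xs"
    by (rule word_der_cong) (simp only: DP_eq[OF _ x])
  also have "\<dots> = ?DA (\<lambda>ys. g (\<Phi> x # ys)) (map \<iota> xs) + sign (p * a) (?DS (?DP (\<lambda>ys. g (\<iota> x # ys))) xs)"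
    by (simp only: word_der_add add_0 word_der_sign[OF z] word_der_natural[where A' = A' and A = A and g = "\<lambda>ys. g (\<Phi> x # ys)", OF AA])
  finally have 2: "?DS (?DP g) (x # xs) = g (\<Phi> (A x) # map \<iota> xs) + sign (p * (q + a)) (?DP (\<lambda>ys. g (\<iota> (A x) # ys)) xs)
      + sign (q * a) (?DA (\<lambda>ys. g (\<Phi> x # ys)) (map \<iota> xs) + sign (p * a) (?DS (?DP (\<lambda>ys. g (\<iota> x # ys))) xs))"
    by (simp only: DP_eq[OF refl Ax] list.map_ident)
  have IH: "?DP (?DA (\<lambda>ys. g (\<iota> x # ys))) xs = sign (p * q) (?DS (?DP (\<lambda>ys. g (\<iota> x # ys))) xs)
      + word_der (tw S (p + q)) ?C \<iota> ?z (\<lambda>ys. g (\<iota> x # ys)) xs"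
    using Cons.IH[of "\<lambda>ys. g (\<iota> x # ys)"] Cons.prems mlin_Cons[OF g] by (simp add: algebra_simps)
  have 3: "word_der (tw S (p + q)) ?C \<iota> ?z g (x # xs) = g (A' (\<Phi> x) # map \<iota> xs) - sign (p * q) (g (\<Phi> (A x) # map \<iota> xs))
      + sign ((p + q) * a) (word_der (tw S (p + q)) ?C \<iota> ?z (\<lambda>ys. g (\<iota> x # ys)) xs)"
    by (simp only: S.word_der_Cons_hom[OF i_lin z g x] lin_diff[OF mlin_hd[OF g]] lin_sign[OF mlin_hd[OF g]] length_map)
  show ?case
    unfolding 1 2 3 IH
    by (cases "even p"; cases "even q"; cases "even a") (simp_all add: sign_def)
qed

end

section \<open>Parity components and contraction of words\<close>

fun gproj :: "('k, 'a::ab_group_add, 'z) superspace_scheme \<Rightarrow> nat \<Rightarrow> ('a list \<Rightarrow> 'm::ab_group_add) \<Rightarrow> 'a list \<Rightarrow> 'm" where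
  "gproj S q f [] = (if even q then f [] else 0)"
| "gproj S q f (x # xs) = gproj S q (\<lambda>ys. f (pr S 0 x # ys)) xs + gproj S (Suc q) (\<lambda>ys. f (pr S 1 x # ys)) xs"

text \<open>The second factor of a letter is extracted from each position in turn and moved to the right
  end of the word; \<open>\<nu>\<close> and \<open>\<phi>\<close> are the two components of a letter.\<close>

fun contract :: "('k, 'a::ab_group_add, 'z) superspace_scheme \<Rightarrow> ('a \<Rightarrow> 'b) \<Rightarrow> ('a \<Rightarrow> 'v) \<Rightarrow> ('b list \<Rightarrow> 'v \<Rightarrow> 'm::ab_group_add) \<Rightarrow> 'a list \<Rightarrow> 'm" where
  "contract S \<nu> \<phi> G [] = 0"
| "contract S \<nu> \<phi> G (u # us) = sign (length us) (G (map \<nu> us) (\<phi> (pr S 0 u)) + G (map (\<lambda>w. \<nu> (tw S 1 w)) us) (\<phi> (pr S 1 u)))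
    + contract S \<nu> \<phi> (\<lambda>xs v. G (\<nu> u # xs) v) us"

lemma gproj_cong: "(\<And>ys. length ys = length xs \<Longrightarrow> f ys = g ys) \<Longrightarrow> gproj S q f xs = gproj S q g xs"
proof (induction xs arbitrary: f g q)
  case (Cons x xs)
  have "gproj S r (\<lambda>ys. f (w # ys)) xs = gproj S r (\<lambda>ys. g (w # ys)) xs" for r w
    by (rule Cons.IH) (simp add: Cons.prems)
  then show ?case by simp
qed simp

lemma gproj_zero: "gproj S q (\<lambda>_. 0) xs = 0"
  by (induction xs arbitrary: q) simp_all

lemma gproj_lin_f:
  assumes vs: "vector_space sM"
  shows "(\<And>ys. length ys = length xs \<Longrightarrow> lin sX sM (\<lambda>p. f p ys)) \<Longrightarrow> lin sX sM (\<lambda>p. gproj S q (f p) xs)"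
proof (induction xs arbitrary: f q)
  case Nil then show ?case by (cases "even q") (simp_all add: lin_zeroI[OF vs])
next
  case (Cons x xs)
  have "lin sX sM (\<lambda>p. gproj S r (\<lambda>ys. f p (w # ys)) xs)" for r w by (rule Cons.IH) (simp add: Cons.prems)
  then show ?case by (simp add: lin_addI[OF vs] Cons.prems)
qed

context sspace
begin

lemma gproj_mlin:
  fixes f :: "'a list \<Rightarrow> 'm::ab_group_add"
  assumes vs: "vector_space sM"
  shows "mlin m (smult S) sM f \<Longrightarrow> mlin m (smult S) sM (gproj S q f)"
proof (induction m arbitrary: f q)
  case 0 then show ?case by simp
next
  case (Suc m)
  show ?case
  proof (rule mlin_SucI)
    fix X :: "'a list" assume X: "length X = m"
    have "lin (smult S) sM (\<lambda>x. gproj S r (\<lambda>ys. f (pr S s x # ys)) X)" for r s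
      using X by (intro gproj_lin_f[OF vs] lin_comp[OF mlin_hd[OF Suc.prems] pr_lin]) simp
    then show "lin (smult S) sM (\<lambda>x. gproj S q f (x # X))" by (simp add: lin_addI[OF vs])
  next
    fix x
    show "mlin m (smult S) sM (\<lambda>X. gproj S q f (x # X))"
      using mlin_addI[OF vs Suc.IH[OF mlin_Cons[OF Suc.prems]] Suc.IH[OF mlin_Cons[OF Suc.prems]]] by simp
  qed
qed

lemma gproj_hom:
  "mlin (length xs) (smult S) sM f \<Longrightarrow> set xs \<subseteq> homog S \<Longrightarrow>
    gproj S q f xs = (if even (q + parl S xs) then f xs else 0)"
proof (induction xs arbitrary: f q)
  case Nil then show ?case by (simp add: parl_def)
next
  case (Cons x xs)
  have f: "mlin (Suc (length xs)) (smult S) sM f" using Cons.prems by simp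
  have x: "x \<in> grd S (par S x)" using Cons.prems homog_par by simp
  have 0: "gproj S r (\<lambda>ys. f (0 # ys)) xs = 0" for r
    using gproj_cong[of xs "\<lambda>ys. f (0 # ys)" "\<lambda>_. 0"] lin_0[OF mlin_hd[OF f]] by (simp add: gproj_zero)
  have IH: "gproj S r (\<lambda>ys. f (x # ys)) xs = (if even (r + parl S xs) then f (x # xs) else 0)" for r
    using Cons.prems mlin_Cons[OF f] by (intro Cons.IH) simp_all
  show ?case
    using pr_grd[OF x, of 0] pr_grd[OF x, of 1] 0
    by (cases "even (par S x)") (simp_all add: IH parl_def)
qed

lemma gproj_sskew:
  fixes f :: "'a list \<Rightarrow> 'm::ab_group_add"
  assumes vs: "vector_space sM" and ml: "mlin m (smult S) sM f" and sk: "sskew S m f"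
  shows "sskew S m (gproj S q f)"
proof (rule sskewI_hom[OF vs gproj_mlin[OF vs ml]])
  fix as bs x y a b
  assume *: "length as + length bs + 2 = m" "set as \<subseteq> homog S" "set bs \<subseteq> homog S"
      "x \<in> grd S a" "y \<in> grd S b"
  have "gproj S q f (as @ x # y # bs) = (if even (q + parl S (as @ x # y # bs)) then f (as @ x # y # bs) else 0)"
    "gproj S q f (as @ y # x # bs) = (if even (q + parl S (as @ x # y # bs)) then f (as @ y # x # bs) else 0)"
    using * ml grd_homog[OF *(4)] grd_homog[OF *(5)]
    by (subst gproj_hom; simp add: parl_def algebra_simps)+
  then show "gproj S q f (as @ x # y # bs) = - sign (a * b) (gproj S q f (as @ y # x # bs))"
    using sskewD[OF sk *(1,4,5)] by (cases "even (q + parl S (as @ x # y # bs))") (simp_all only: if_True if_False sign_zero neg_0_equal_iff_equal minus_zero)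
qed

end

lemma contract_cong:
  "(\<And>xs v. length xs + 1 = length us \<Longrightarrow> G xs v = G' xs v) \<Longrightarrow> contract S \<nu> \<phi> G us = contract S \<nu> \<phi> G' us"
proof (induction us arbitrary: G G')
  case (Cons u us)
  have "contract S \<nu> \<phi> (\<lambda>xs v. G (\<nu> u # xs) v) us = contract S \<nu> \<phi> (\<lambda>xs v. G' (\<nu> u # xs) v) us"
    by (rule Cons.IH) (simp add: Cons.prems)
  then show ?case by (simp add: Cons.prems)
qed simp

lemma contract_sign: "contract S \<nu> \<phi> (\<lambda>xs v. sign e (G xs v)) us = sign e (contract S \<nu> \<phi> G us)"
  by (induction us arbitrary: G) (simp_all add: sign_add add.commute)

lemma contract_lin_G:
  assumes vs: "vector_space sM"
  shows "(\<And>xs v. length xs + 1 = length us \<Longrightarrow> lin sX sM (\<lambda>p. G p xs v)) \<Longrightarrow> lin sX sM (\<lambda>p. contract S \<nu> \<phi> (G p) us)"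
proof (induction us arbitrary: G)
  case Nil then show ?case by (simp add: lin_zeroI[OF vs])
next
  case (Cons u us)
  have "lin sX sM (\<lambda>p. contract S \<nu> \<phi> (\<lambda>xs v. G p (\<nu> u # xs) v) us)" by (rule Cons.IH) (simp add: Cons.prems)
  then show ?case by (simp add: lin_addI[OF vs] lin_signI[OF vs] Cons.prems)
qed

context smap
begin

lemma contract_mlin:
  fixes sM :: "'k \<Rightarrow> 'm::ab_group_add \<Rightarrow> 'm" and sV :: "'k \<Rightarrow> 'v::ab_group_add \<Rightarrow> 'v"
  assumes vs: "vector_space sM" and phi: "lin (smult S) sV \<phi>"
  shows "(\<And>v. mlin m (smult T) sM (\<lambda>xs. G xs v)) \<Longrightarrow> (\<And>xs. length xs = m \<Longrightarrow> lin sV sM (G xs)) \<Longrightarrow>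
    mlin (Suc m) (smult S) sM (contract S \<iota> \<phi> G)"
proof (induction m arbitrary: G)
  case 0
  have "mlin (Suc 0) (smult S) sM (\<lambda>us. contract S \<iota> \<phi> G us)"
  proof (rule mlin_SucI)
    fix X :: "'a list" assume X: "length X = 0"
    have "lin (smult S) sM (\<lambda>x. G [] (\<phi> (pr S q x)))" for q
      using lin_comp[OF 0(2) lin_comp[OF phi S.pr_lin]] by simp
    then show "lin (smult S) sM (\<lambda>x. contract S \<iota> \<phi> G (x # X))" using X by (simp add: lin_addI[OF vs])
  qed simp
  then show ?case .
next
  case (Suc m)
  show ?case
  proof (rule mlin_SucI)
    fix X :: "'a list" assume X: "length X = Suc m"
    have "lin (smult S) sM (\<lambda>x. G (map h X) (\<phi> (pr S q x)))" for q and h :: "'a \<Rightarrow> 'b"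
      using X by (intro lin_comp[OF Suc.prems(2) lin_comp[OF phi S.pr_lin]]) simp
    moreover have "lin (smult S) sM (\<lambda>x. contract S \<iota> \<phi> (\<lambda>xs v. G (\<iota> x # xs) v) X)"
      using X by (intro contract_lin_G[OF vs] lin_comp[OF mlin_hd[OF Suc.prems(1)] i_lin]) simp
    ultimately show "lin (smult S) sM (\<lambda>x. contract S \<iota> \<phi> G (x # X))"
      using X by (simp add: lin_addI[OF vs] lin_signI[OF vs])
  next
    fix u
    have "mlin (Suc m) (smult S) sM (\<lambda>us. G (map \<iota> us) v)" "mlin (Suc m) (smult S) sM (\<lambda>us. G (map (\<lambda>w. \<iota> (tw S 1 w)) us) v)" for v
      using mlin_map[OF Suc.prems(1)] i_lin lin_comp[OF i_lin S.tw_lin] by auto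
    then have "mlin (Suc m) (smult S) sM (\<lambda>us. sign (Suc m) (G (map \<iota> us) (\<phi> (pr S 0 u)) + G (map (\<lambda>w. \<iota> (tw S 1 w)) us) (\<phi> (pr S 1 u))))"
      by (intro mlin_signI mlin_addI vs)
    moreover have "mlin (Suc m) (smult S) sM (contract S \<iota> \<phi> (\<lambda>xs v. G (\<iota> u # xs) v))"
      by (intro Suc.IH mlin_Cons Suc.prems) simp
    ultimately have "mlin (Suc m) (smult S) sM (\<lambda>us. sign (Suc m) (G (map \<iota> us) (\<phi> (pr S 0 u)) + G (map (\<lambda>w. \<iota> (tw S 1 w)) us) (\<phi> (pr S 1 u)))
      + contract S \<iota> \<phi> (\<lambda>xs v. G (\<iota> u # xs) v) us)"
      by (intro mlin_addI vs)
    then show "mlin (Suc m) (smult S) sM (\<lambda>us. contract S \<iota> \<phi> G (u # us))"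
      by (rule mlin_cong[rotated]) simp
  qed
qed

lemma contract_Cons_hom:
  assumes "u \<in> grd S a" "\<phi> 0 = 0" "\<And>xs. length xs = length us \<Longrightarrow> G xs 0 = 0"
  shows "contract S \<iota> \<phi> G (u # us) = sign (length us) (G (map (\<lambda>w. \<iota> (tw S a w)) us) (\<phi> u))
    + contract S \<iota> \<phi> (\<lambda>xs v. G (\<iota> u # xs) v) us"
proof -
  have "tw S a w = (if even a then w else tw S 1 w)" for w
    using S.pr_sum[of w] by (simp add: tw_def sign_def)
  then show ?thesis
    using S.pr_grd[OF assms(1), of 0] S.pr_grd[OF assms(1), of 1] assms(2,3) by (simp cong: map_cong)
qed

lemma contract_sskew:
  fixes sM :: "'k \<Rightarrow> 'm::ab_group_add \<Rightarrow> 'm" and sV :: "'k \<Rightarrow> 'v::ab_group_add \<Rightarrow> 'v"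
  assumes phi: "\<phi> 0 = 0"
    and G: "\<And>v. mlin m (smult T) sM (\<lambda>xs. G xs v)" "\<And>xs. length xs = m \<Longrightarrow> lin sV sM (G xs)"
      "\<And>v. sskew T m (\<lambda>xs. G xs v)"
  shows "sskew S (Suc m) (contract S \<iota> \<phi> G)"
proof -
  have "contract S \<iota> \<phi> G (as @ x # y # bs) = - sign (a * b) (contract S \<iota> \<phi> G (as @ y # x # bs))"
    if xy: "x \<in> grd S a" "y \<in> grd S b" and "length as + length bs + 2 = Suc m"
      "\<And>v. mlin m (smult T) sM (\<lambda>xs. G xs v)" "\<And>xs. length xs = m \<Longrightarrow> lin sV sM (G xs)"
      "\<And>v. sskew T m (\<lambda>xs. G xs v)"
    for as bs x y a b m and G :: "'b list \<Rightarrow> 'v \<Rightarrow> 'm"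
    using that(3-)
  proof (induction as arbitrary: m G)
    case Nil
    have m: "m = Suc (length bs)" using Nil by simp
    note f1 = Nil.prems(2)[unfolded m]
    have G0: "G xs 0 = 0" if "length xs = m" for xs using lin_0[OF Nil.prems(3)[OF that]] .
    have D: "contract S \<iota> \<phi> G (x # y # bs) = sign (Suc (length bs) + a * b) (G (\<iota> y # map (\<lambda>w. \<iota> (tw S a w)) bs) (\<phi> x))
       + (sign (length bs) (G (\<iota> x # map (\<lambda>w. \<iota> (tw S b w)) bs) (\<phi> y)) + contract S \<iota> \<phi> (\<lambda>xs v. G (\<iota> x # \<iota> y # xs) v) bs)"
      if "x \<in> grd S a" "y \<in> grd S b" for x y a b
    proof -
      have "G (\<iota> (tw S a y) # map (\<lambda>w. \<iota> (tw S a w)) bs) v = sign (a * b) (G (\<iota> y # map (\<lambda>w. \<iota> (tw S a w)) bs) v)" for v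
        by (simp add: S.tw_grd[OF that(2)] lin_sign[OF i_lin] lin_sign[OF mlin_hd[OF f1]])
      then show ?thesis
        using contract_Cons_hom[where u = x and \<phi> = \<phi> and G = G and us = "y # bs", OF that(1) phi]
          contract_Cons_hom[where u = y and \<phi> = \<phi> and G = "\<lambda>xs v. G (\<iota> x # xs) v" and us = bs, OF that(2) phi] G0 m
        by simp
    qed
    have "contract S \<iota> \<phi> (\<lambda>xs v. G (\<iota> x # \<iota> y # xs) v) bs = contract S \<iota> \<phi> (\<lambda>xs v. sign (a * b + 1) (G (\<iota> y # \<iota> x # xs) v)) bs"
    proof (rule contract_cong)
      fix xs :: "'b list" and v assume "length xs + 1 = length bs"
      then show "G (\<iota> x # \<iota> y # xs) v = sign (a * b + 1) (G (\<iota> y # \<iota> x # xs) v)"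
        using sskewD[OF Nil.prems(4), of "[]" xs "\<iota> x" a "\<iota> y" b] m xy i_grd by (simp add: sign_def)
    qed
    then have 1: "contract S \<iota> \<phi> (\<lambda>xs v. G (\<iota> x # \<iota> y # xs) v) bs = sign (a * b + 1) (contract S \<iota> \<phi> (\<lambda>xs v. G (\<iota> y # \<iota> x # xs) v) bs)"
      by (simp only: contract_sign)
    show ?case
      unfolding append_Nil D[OF xy] D[OF xy(2,1)] 1
      by (cases "even (length bs)"; cases "even a"; cases "even b") (simp_all add: sign_def)
  next
    case (Cons z as)
    obtain m' where m: "m = Suc m'" "length as + length bs + 2 = Suc m'" using Cons.prems(1) by (cases m) auto
    have 1: "G (map \<iota> as @ \<iota> x # \<iota> y # map \<iota> bs) v = - sign (a * b) (G (map \<iota> as @ \<iota> y # \<iota> x # map \<iota> bs) v)" for v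
      using sskewD[OF Cons.prems(4), of "map \<iota> as" "map \<iota> bs" "\<iota> x" a "\<iota> y" b] m xy i_grd by simp
    let ?t = "\<lambda>w. \<iota> (tw S 1 w)"
    have t: "?t w \<in> grd T c" if "w \<in> grd S c" for w c
      using that by (intro i_grd) (simp only: S.tw_grd S.grd_sign)
    have 2: "G (map ?t as @ ?t x # ?t y # map ?t bs) v = - sign (a * b) (G (map ?t as @ ?t y # ?t x # map ?t bs) v)" for v
      using sskewD[OF Cons.prems(4), of "map ?t as" "map ?t bs" "?t x" a "?t y" b] m xy t by simp
    have 3: "contract S \<iota> \<phi> (\<lambda>xs v. G (\<iota> z # xs) v) (as @ x # y # bs) =
        - sign (a * b) (contract S \<iota> \<phi> (\<lambda>xs v. G (\<iota> z # xs) v) (as @ y # x # bs))"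
      using Cons.prems(2-4)[unfolded m(1)] by (intro Cons.IH[OF m(2)] mlin_Cons sskew_Cons) simp_all
    have 4: "contract S \<iota> \<phi> G (z # as @ x # y # bs) = sign (length as + length bs + 2)
        (G (map \<iota> as @ \<iota> x # \<iota> y # map \<iota> bs) (\<phi> (pr S 0 z)) + G (map ?t as @ ?t x # ?t y # map ?t bs) (\<phi> (pr S 1 z)))
        + contract S \<iota> \<phi> (\<lambda>xs v. G (\<iota> z # xs) v) (as @ x # y # bs)" for x y
      by simp
    show ?case
      unfolding append_Cons 4 1 2 3
      by (cases "even (length as + length bs)"; cases "even (a * b)") (simp_all add: sign_def)
  qed
  from this[OF _ _ _ G] show ?thesis unfolding sskew_def by blast
qed

lemma contract_last:
  assumes phi: "lin (smult S) sV \<phi>"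
  shows "(\<And>w q. w \<in> set ws \<Longrightarrow> \<phi> (pr S q w) = 0) \<Longrightarrow> (\<And>xs. length xs = length ws \<Longrightarrow> lin sV sM (G xs)) \<Longrightarrow>
    contract S \<iota> \<phi> G (ws @ [u]) = G (map \<iota> ws) (\<phi> u)"
proof (induction ws arbitrary: G)
  case Nil
  have "G [] (\<phi> u) = G [] (\<phi> (pr S 0 u + pr S (Suc 0) u))" by (simp only: S.pr_sum)
  then show ?case using lin_add[OF Nil(2)[of "[]"]] by (simp add: lin_add[OF phi])
next
  case (Cons w ws)
  have "contract S \<iota> \<phi> (\<lambda>xs v. G (\<iota> w # xs) v) (ws @ [u]) = G (\<iota> w # map \<iota> ws) (\<phi> u)"
    using Cons.prems by (intro Cons.IH) simp_all
  moreover have "\<phi> (pr S q w) = 0" for q using Cons.prems(1) by simp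
  moreover have "G xs 0 = 0" if "length xs = Suc (length ws)" for xs using lin_0[OF Cons.prems(2)] that by simp
  ultimately show ?case by simp
qed

end

section \<open>Graded exterior powers and their derivations\<close>

definition EG :: "nat \<Rightarrow> ('k::field, 'a::ab_group_add, 'z) superspace_scheme \<Rightarrow> nat \<Rightarrow> ('a list \<Rightarrow>\<^sub>0 'k) set"
  where "EG m S q = module.span fscale {wedge m S xs | xs. xs \<in> hlists m S \<and> even (parl S xs) = even q}"

definition piE :: "nat \<Rightarrow> ('k::field, 'a::ab_group_add, 'z) superspace_scheme \<Rightarrow> nat \<Rightarrow> ('a list \<Rightarrow>\<^sub>0 'k) \<Rightarrow> ('a list \<Rightarrow>\<^sub>0 'k)"
  where "piE m S q = lift m fscale (gproj S q (wedge m S))"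

definition superhom :: "('k, 'a::ab_group_add, 'z) superspace_scheme \<Rightarrow> ('k, 'b::ab_group_add, 'y) superspace_scheme \<Rightarrow> nat \<Rightarrow> ('a \<Rightarrow> 'b) \<Rightarrow> bool"
  where "superhom S T q h \<longleftrightarrow> lin (smult S) (smult T) h \<and> (\<forall>x a. x \<in> grd S a \<longrightarrow> h x \<in> grd T (q + a))"

definition der :: "nat \<Rightarrow> ('k::field, 'a::ab_group_add, 'z) superspace_scheme \<Rightarrow> ('k, 'b::ab_group_add, 'y) superspace_scheme \<Rightarrow>
    ('a \<Rightarrow> 'b) \<Rightarrow> nat \<Rightarrow> ('a \<Rightarrow> 'b) \<Rightarrow> ('a list \<Rightarrow>\<^sub>0 'k) \<Rightarrow> ('b list \<Rightarrow>\<^sub>0 'k)"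
  where "der m S T \<iota> q h = lift m fscale (word_der (tw S q) h \<iota> (\<lambda>_. 0) (wedge m T))"

interpretation E: vector_space "fscale :: 'k::field \<Rightarrow> ('w \<Rightarrow>\<^sub>0 'k) \<Rightarrow> _"
  by (rule vector_space_fscale)

lemmas vsE = vector_space_fscale

lemma superhom_lin: "superhom S T q h \<Longrightarrow> lin (smult S) (smult T) h"
  and superhom_grd: "superhom S T q h \<Longrightarrow> x \<in> grd S a \<Longrightarrow> h x \<in> grd T (q + a)"
  by (auto simp: superhom_def)

lemma lift_in_span:
  "vector_space sB \<Longrightarrow> (\<And>w. length w = m \<Longrightarrow> g w \<in> module.span sB H) \<Longrightarrow> lift m sB g u \<in> module.span sB H"
  unfolding lift_def by (intro module.span_sum module.span_scale) (auto simp: module_iff_vector_space)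

lemma EG_zero: "0 \<in> EG m S q"
  and EG_add: "x \<in> EG m S q \<Longrightarrow> y \<in> EG m S q \<Longrightarrow> x + y \<in> EG m S q"
  and EG_scale: "x \<in> EG m S q \<Longrightarrow> fscale c x \<in> EG m S q"
  and EG_sign: "x \<in> EG m S q \<Longrightarrow> sign e x \<in> EG m S q"
  by (auto simp: EG_def sign_def E.span_zero E.span_add E.span_scale E.span_neg E.span_diff)

lemma EG_sum: "(\<And>i. i \<in> A \<Longrightarrow> f i \<in> EG m S q) \<Longrightarrow> sum f A \<in> EG m S q"
  unfolding EG_def by (rule E.span_sum)

lemma EG_cong: "even q = even r \<Longrightarrow> EG m S q = EG m S r"
  by (simp add: EG_def)

context sspace
begin

lemma wedge_EG:
  assumes "list_all2 (\<lambda>x e. x \<in> grd S e) xs es" "length xs = m"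
  shows "wedge m S xs \<in> EG m S (sum_list es)"
proof (cases "0 \<in> set xs")
  case True
  then obtain as bs where "xs = as @ 0 # bs" using split_list by metis
  then have "wedge m S xs = 0" using mlin_slot_0[OF wedge_mlin, of as bs m] assms(2) by simp
  then show ?thesis by (simp add: EG_def E.span_zero)
next
  case False
  have "even (parl S xs) = even (sum_list es)" using assms(1) False
    by (induction xs es rule: list_all2_induct) (auto simp: parl_def par_grd)
  moreover have "set xs \<subseteq> homog S" using assms(1)
    by (induction xs es rule: list_all2_induct) (auto intro: grd_homog)
  ultimately show ?thesis unfolding EG_def using assms(2)
    by (intro E.span_base) (auto simp: hlists_def)
qed

lemma EG_hlists: "xs \<in> hlists m S \<Longrightarrow> wedge m S xs \<in> EG m S (parl S xs)"
  unfolding EG_def by (intro E.span_base) auto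

lemma EG_ext_power: "x \<in> EG m S q \<Longrightarrow> x \<in> ext_power m S"
  unfolding EG_def ext_power_hom by (rule subsetD[OF E.span_mono]) auto

lemma ext_lin_eq:
  "vector_space sB \<Longrightarrow> lin fscale sB h1 \<Longrightarrow> lin fscale sB h2 \<Longrightarrow> (\<And>xs. xs \<in> hlists m S \<Longrightarrow> h1 (wedge m S xs) = h2 (wedge m S xs)) \<Longrightarrow>
    x \<in> ext_power m S \<Longrightarrow> h1 x = h2 x"
  unfolding ext_power_hom by (rule lin_eq_on_span[OF vsE]) auto

lemma EG_lin_eq:
  "vector_space sB \<Longrightarrow> lin fscale sB h1 \<Longrightarrow> lin fscale sB h2 \<Longrightarrow>
    (\<And>xs. xs \<in> hlists m S \<Longrightarrow> even (parl S xs) = even q \<Longrightarrow> h1 (wedge m S xs) = h2 (wedge m S xs)) \<Longrightarrow>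
    x \<in> EG m S q \<Longrightarrow> h1 x = h2 x"
  unfolding EG_def by (rule lin_eq_on_span[OF vsE]) auto

lemma piE_lin: "lin fscale fscale (piE m S q)"
  unfolding piE_def by (rule lift_lin[OF vsE])

lemma piE_wedge: "xs \<in> hlists m S \<Longrightarrow> piE m S q (wedge m S xs) = (if even (q + parl S xs) then wedge m S xs else 0)"
  unfolding piE_def
  by (subst lift_wedge) (auto simp: hlists_def gproj_hom[OF wedge_mlin] intro: vsE gproj_mlin gproj_sskew wedge_mlin wedge_sskew)

lemma piE_EG: assumes "x \<in> EG m S a" shows "piE m S q x = (if even (q + a) then x else 0)"
proof (rule EG_lin_eq[OF vsE piE_lin _ _ assms])
  show "lin fscale fscale (\<lambda>x. if even (q + a) then x else 0)"
    by (cases "even (q + a)") (simp_all only: if_True if_False lin_id lin_zeroI[OF vsE])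
qed (simp add: piE_wedge)

lemma piE_in: "piE m S q u \<in> EG m S q"
  unfolding piE_def EG_def
proof (rule lift_in_span[OF vsE])
  fix w :: "'a list" assume "length w = m"
  then show "gproj S q (wedge m S) w \<in> E.span {wedge m S xs |xs. xs \<in> hlists m S \<and> even (parl S xs) = even q}"
  proof (rule mlin_in_subspace[OF gproj_mlin[OF vsE wedge_mlin] E.span_add, rotated 3])
    fix xs assume xs: "xs \<in> hlists m S"
    then show "gproj S q (wedge m S) xs \<in> E.span {wedge m S xs |xs. xs \<in> hlists m S \<and> even (parl S xs) = even q}"
      by (subst gproj_hom) (auto simp: hlists_def E.span_zero intro!: wedge_mlin E.span_base)
  qed
qed

lemma piE_sum: assumes "x \<in> ext_power m S" shows "piE m S 0 x + piE m S (Suc 0) x = x"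
  using assms by (rule ext_lin_eq[OF vsE lin_addI[OF vsE piE_lin piE_lin] lin_id, rotated]) (simp add: piE_wedge)

end

context smap
begin

lemma der_lin: "lin fscale fscale (der m S T \<iota> q h)"
  unfolding der_def by (rule lift_lin[OF vsE])

lemma word_der_wedge_mlin: "lin (smult S) (smult T) h \<Longrightarrow> mlin m (smult S) fscale (word_der (tw S q) h \<iota> (\<lambda>_. 0) (wedge m T))"
  by (rule word_der_mlin[OF vsE S.tw_lin _ i_lin lin_zeroI[OF vsE] T.wedge_mlin])

lemma der_wedge:
  assumes "superhom S T q h" "length xs = m"
  shows "der m S T \<iota> q h (wedge m S xs) = word_der (tw S q) h \<iota> (\<lambda>_. 0) (wedge m T) xs"
  unfolding der_def
  by (rule S.lift_wedge[OF vsE word_der_wedge_mlin[OF superhom_lin[OF assms(1)]] _ assms(2)])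
    (rule word_der_sskew[OF lin_zeroI[OF vsE] superhom_grd[OF assms(1)] T.wedge_mlin T.wedge_sskew])

lemma der_wedge_sum:
  assumes "superhom S T q h" "xs \<in> hlists m S"
  shows "der m S T \<iota> q h (wedge m S xs) = (\<Sum>i<m. sign (q * parl S (take i xs)) (wedge m T ((map \<iota> xs)[i := h (xs ! i)])))"
  using assms der_wedge[OF assms(1), of xs m] S.word_der_sum[OF i_lin lin_zeroI[OF vsE], of xs "wedge m T" q h]
  by (simp add: hlists_def T.wedge_mlin)

lemma der_lin_h: "(\<And>x. lin sX (smult T) (\<lambda>p. h p x)) \<Longrightarrow> lin sX fscale (\<lambda>p. der m S T \<iota> q (h p) u)"
  unfolding der_def by (intro lift_lin_param vsE word_der_lin_A) (auto intro: T.wedge_mlin lin_zeroI[OF vsE])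

lemma der_parity: "even q = even r \<Longrightarrow> der m S T \<iota> q h = der m S T \<iota> r h"
proof -
  assume "even q = even r"
  then have "tw S q = tw S r" by (intro ext) (simp add: tw_def cong: sign_cong)
  then show ?thesis by (simp add: der_def)
qed

lemma der_EG:
  assumes h: "superhom S T q h" and "x \<in> EG m S a"
  shows "der m S T \<iota> q h x \<in> EG m T (q + a)"
  unfolding EG_def[of m T]
proof (rule lin_span_in[OF vsE vsE der_lin])
  show "x \<in> E.span {wedge m S xs | xs. xs \<in> hlists m S \<and> even (parl S xs) = even a}"
    using assms(2) by (simp add: EG_def)
  fix w assume "w \<in> {wedge m S xs | xs. xs \<in> hlists m S \<and> even (parl S xs) = even a}"
  then obtain xs where xs: "w = wedge m S xs" "xs \<in> hlists m S" "even (parl S xs) = even a" by blast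
  have "wedge m T ((map \<iota> xs)[i := h (xs ! i)]) \<in> EG m T (q + a)" if "i < m" for i
  proof -
    let ?es = "(map (par S) xs)[i := q + par S (xs ! i)]"
    have p: "xs ! j \<in> grd S (par S (xs ! j))" if "j < m" for j
      using xs(2) that by (intro S.homog_par) (auto simp: hlists_def)
    then have "list_all2 (\<lambda>x e. x \<in> grd T e) ((map \<iota> xs)[i := h (xs ! i)]) ?es"
      using xs(2) \<open>i < m\<close> by (auto simp: list_all2_conv_all_nth hlists_def nth_list_update intro: i_grd superhom_grd[OF h])
    moreover have "sum_list ?es = q + parl S xs"
      using that xs(2) by (subst sum_list_update) (auto simp: hlists_def parl_def intro!: trans[OF _ add.commute] member_le_sum_list)
    ultimately have "wedge m T ((map \<iota> xs)[i := h (xs ! i)]) \<in> EG m T (q + parl S xs)"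
      using T.wedge_EG[of _ ?es m] xs(2) by (simp add: hlists_def)
    then show ?thesis using EG_cong[of "q + parl S xs" "q + a" m T] xs(3) by simp
  qed
  then show "der m S T \<iota> q h w \<in> E.span {wedge m T xs |xs. xs \<in> hlists m T \<and> even (parl T xs) = even (q + a)}"
    unfolding xs(1) der_wedge_sum[OF h xs(2)] EG_def[symmetric]
    by (intro EG_sum EG_sign) simp
qed

lemma der_commutator:
  assumes A: "superhom S S q A" and A': "superhom T T q A'" and P: "superhom S T p \<Phi>" and AA: "\<And>x. A' (\<iota> x) = \<iota> (A x)"
    and C: "superhom S T (p + q) (\<lambda>x. A' (\<Phi> x) - sign (p * q) (\<Phi> (A x)))" and x: "x \<in> ext_power m S"
  shows "der m T T (\<lambda>x. x) q A' (der m S T \<iota> p \<Phi> x) - sign (p * q) (der m S T \<iota> p \<Phi> (der m S S (\<lambda>x. x) q A x))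
    = der m S T \<iota> (p + q) (\<lambda>x. A' (\<Phi> x) - sign (p * q) (\<Phi> (A x))) x"
proof -
  interpret TT: smap T T "\<lambda>x. x" by unfold_locales (simp_all add: lin_id)
  interpret SS: smap S S "\<lambda>x. x" by unfold_locales (simp_all add: lin_id)
  let ?A' = "der m T T (\<lambda>x. x) q A'" and ?A = "der m S S (\<lambda>x. x) q A" and ?P = "der m S T \<iota> p \<Phi>"
  show ?thesis
  proof (rule S.ext_lin_eq[OF vsE _ der_lin _ x])
    show "lin fscale fscale (\<lambda>x. ?A' (?P x) - sign (p * q) (?P (?A x)))"
      by (intro lin_diffI lin_signI vsE lin_comp[OF TT.der_lin der_lin] lin_comp[OF der_lin SS.der_lin])
    fix xs assume xs: "xs \<in> hlists m S"
    then have l: "length xs = m" by (simp add: hlists_def)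
    have "?A' (?P (wedge m S xs)) = word_der (tw S p) \<Phi> \<iota> (\<lambda>_. 0) (\<lambda>ys. ?A' (wedge m T ys)) xs"
      unfolding der_wedge[OF P l] by (rule word_der_hom) (simp_all add: lin_add[OF TT.der_lin] lin_0[OF TT.der_lin])
    also have "\<dots> = word_der (tw S p) \<Phi> \<iota> (\<lambda>_. 0) (word_der (tw T q) A' (\<lambda>x. x) (\<lambda>_. 0) (wedge m T)) xs"
      by (rule word_der_cong) (simp add: TT.der_wedge[OF A'] l)
    finally have 1: "?A' (?P (wedge m S xs)) = \<dots>" .
    have "?P (?A (wedge m S xs)) = word_der (tw S q) A (\<lambda>x. x) (\<lambda>_. 0) (\<lambda>ys. ?P (wedge m S ys)) xs"
      unfolding SS.der_wedge[OF A l] by (rule word_der_hom) (simp_all add: lin_add[OF der_lin] lin_0[OF der_lin])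
    also have "\<dots> = word_der (tw S q) A (\<lambda>x. x) (\<lambda>_. 0) (word_der (tw S p) \<Phi> \<iota> (\<lambda>_. 0) (wedge m T)) xs"
      by (rule word_der_cong) (simp add: der_wedge[OF P] l)
    finally have 2: "?P (?A (wedge m S xs)) = \<dots>" .
    show "?A' (?P (wedge m S xs)) - sign (p * q) (?P (?A (wedge m S xs)))
        = der m S T \<iota> (p + q) (\<lambda>x. A' (\<Phi> x) - sign (p * q) (\<Phi> (A x))) (wedge m S xs)"
      unfolding 1 2 der_wedge[OF C l]
      using xs l
      by (intro word_der_commutator[OF vsE superhom_grd[OF A] superhom_grd[OF P] superhom_lin[OF A'] superhom_lin[OF P] AA])
        (auto simp: T.wedge_mlin hlists_def)
  qed
qed

end

lemma smap_id: "sspace S \<Longrightarrow> smap S S (\<lambda>x. x)"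
  by (simp add: smap_def smap_axioms_def lin_id)

section \<open>The concrete brackets\<close>

lemma mlin_snoc:
  fixes f :: "'a::ab_group_add list \<Rightarrow> 'b::ab_group_add"
  assumes "mlin (Suc k) sA sB f" shows "mlin k sA sB (\<lambda>xs. f (xs @ [z]))"
  unfolding mlin_def
proof (intro allI impI)
  fix as bs :: "'a list" assume "length as + length bs + 1 = k"
  then show "lin sA sB (\<lambda>x. f ((as @ x # bs) @ [z]))" using mlinD[OF assms, of as "bs @ [z]"] by simp
qed

lemma sskew_snoc:
  fixes g :: "'a list \<Rightarrow> 'b::ab_group_add"
  assumes "sskew S (Suc m) g" shows "sskew S m (\<lambda>xs. g (xs @ [z]))"
  unfolding sskew_def
proof (intro allI impI)
  fix as bs :: "'a list" and x y a b assume "length as + length bs + 2 = m" "x \<in> grd S a" "y \<in> grd S b"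
  then show "g ((as @ x # y # bs) @ [z]) = - sign (a * b) (g ((as @ y # x # bs) @ [z]))"
    using sskewD[OF assms, of as "bs @ [z]" x a y b] by simp
qed

lemma EG_induct [consumes 1, case_names wedge zero add scale]:
  assumes "x \<in> EG m S q" "\<And>xs. xs \<in> hlists m S \<Longrightarrow> even (parl S xs) = even q \<Longrightarrow> P (wedge m S xs)"
    "P 0" "\<And>x y. P x \<Longrightarrow> P y \<Longrightarrow> P (x + y)" "\<And>c x. P x \<Longrightarrow> P (fscale c x)"
  shows "P x"
  by (rule E.span_induct[OF assms(1)[unfolded EG_def]]) (auto intro!: E.subspaceI assms(2-5))

lemma (in sspace) lin_eq_homog:
  assumes "lin (smult S) sB f" "lin (smult S) sB g" "\<And>z a. z \<in> grd S a \<Longrightarrow> f z = g z"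
  shows "f z = g z"
proof -
  have "f (pr S 0 z + pr S (Suc 0) z) = g (pr S 0 z + pr S (Suc 0) z)"
    by (simp only: lin_add[OF assms(1)] lin_add[OF assms(2)] assms(3)[OF pr_in])
  then show ?thesis by (simp only: pr_sum)
qed

locale nambu =
  fixes n :: nat
    and N :: "('k::field, 'a::ab_group_add) nary_superalgebra"
    and V :: "('k, 'a, 'v::ab_group_add) nary_module"
  assumes n2: "n \<ge> 2" and NL: "nambu_lie_superalgebra n N" and NM: "nambu_module n N V"
begin

definition m where "m = n - 1"
definition m0 where "m0 = n - 2"
abbreviation T where "T \<equiv> dsum N V"
abbreviation sN where "sN \<equiv> smult N"
abbreviation sV where "sV \<equiv> smult V"

lemma m_simps [simp]: "n - 1 = m" "n - Suc 0 = m" "n - 2 = m0"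
  by (simp_all add: m_def m0_def)

lemma n_eq: "n = Suc m" and m_eq: "m = Suc m0"
  using n2 unfolding m_def m0_def by linarith+

sublocale N: sspace N
  using NL by unfold_locales (simp add: nambu_lie_superalgebra_def)

sublocale V: sspace V
  using NM by unfold_locales (simp add: nambu_module_def)

sublocale T: sspace T
  using sspace_dsum[OF N.superspace V.superspace] by unfold_locales

lemma T_simps: "smult T c (x, v) = (sN c x, sV c v)" "(x, v) \<in> grd T q \<longleftrightarrow> x \<in> grd N q \<and> v \<in> grd V q"
  by (simp_all add: dsum_def)

sublocale NN: smap N N "\<lambda>x. x"
  by (rule smap_id) unfold_locales

sublocale TT: smap T T "\<lambda>x. x"
  by (rule smap_id) unfold_locales

sublocale NT: smap N T fromN
  by unfold_locales (auto simp: fromN_def T_simps N.grd_zero V.grd_zero vs_zero[OF V.vsS] intro!: linI)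

sublocale TN: smap T N fst
  by unfold_locales (auto simp: T_simps intro!: linI)

lemma fromV_lin: "lin sV (smult T) fromV"
  by (auto simp: fromV_def T_simps vs_zero[OF N.vsS] intro!: linI)

lemma snd_lin: "lin (smult T) sV snd"
  by (auto simp: T_simps intro!: linI)

lemma fromV_grd: "v \<in> grd V a \<Longrightarrow> fromV v \<in> grd T a"
  by (simp add: fromV_def T_simps N.grd_zero)

lemma brk_mlin: "mlin (Suc m) sN sN (brk N)" and brk_sskew: "sskew N (Suc m) (brk N)"
proof -
  have 1: "mlin n sN sN (brk N)"
    using NL by (simp add: nambu_lie_superalgebra_def multilinear_on_iff_mlin)
  have "sskew N n (brk N)"
    using NL by (intro N.super_skew_sskew[OF N.vsS 1]) (simp add: nambu_lie_superalgebra_def)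
  with 1 show "mlin (Suc m) sN sN (brk N)" "sskew N (Suc m) (brk N)" by (simp_all flip: n_eq)
qed

lemma act_mlin: "mlin m sN sV (\<lambda>xs. act V xs v)" and act_sskew: "sskew N m (\<lambda>xs. act V xs v)"
proof -
  show 1: "mlin m sN sV (\<lambda>xs. act V xs v)"
    using NM by (simp add: nambu_module_def multilinear_on_iff_mlin)
  show "sskew N m (\<lambda>xs. act V xs v)"
    using NM by (intro N.super_skew_sskew[OF V.vsS 1]) (simp add: nambu_module_def)
qed

lemma act_lin: "length xs = m \<Longrightarrow> lin sV sV (act V xs)"
  using NM by (simp add: nambu_module_def)

lemma brk_grd:
  assumes xs: "xs \<in> hlists m N" and z: "z \<in> grd N a" shows "brk N (xs @ [z]) \<in> grd N (parl N xs + a)"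
proof (cases "z = 0")
  case True
  then show ?thesis using mlin_slot_0[OF brk_mlin, of xs "[]"] xs n_eq by (simp add: hlists_def N.grd_zero)
next
  case False
  have "xs @ [z] \<in> hlists n N" using xs N.grd_homog[OF z] n_eq by (auto simp: hlists_def)
  then have "brk N (xs @ [z]) \<in> grd N (parl N (xs @ [z]))" using NL by (simp add: nambu_lie_superalgebra_def)
  moreover have "even (parl N (xs @ [z])) = even (parl N xs + a)" using N.par_grd[OF z False] by (simp add: parl_def)
  ultimately show ?thesis using N.grd_cong by blast
qed

lemma act_grd:
  assumes xs: "xs \<in> hlists m N" and v: "v \<in> grd V a" shows "act V xs v \<in> grd V (parl N xs + a)"
proof (cases "v = 0")
  case True
  then show ?thesis using lin_0[OF act_lin] xs by (simp add: hlists_def V.grd_zero)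
next
  case False
  have "act V xs v \<in> grd V (parl N xs + par V v)" using xs V.grd_homog[OF v] NM by (simp add: nambu_module_def)
  moreover have "even (parl N xs + par V v) = even (parl N xs + a)" using V.par_grd[OF v False] by simp
  ultimately show ?thesis using V.grd_cong by blast
qed

definition adL :: "('a list \<Rightarrow>\<^sub>0 'k) \<Rightarrow> 'a \<Rightarrow> 'a"
  where "adL = lift m (fun_scale sN) (\<lambda>xs z. brk N (xs @ [z]))"

definition actL :: "('a list \<Rightarrow>\<^sub>0 'k) \<Rightarrow> 'v \<Rightarrow> 'v"
  where "actL = lift m (fun_scale sV) (act V)"

definition adT :: "('a list \<Rightarrow>\<^sub>0 'k) \<Rightarrow> 'a \<times> 'v \<Rightarrow> 'a \<times> 'v"
  where "adT x u = (adL x (fst u), actL x (snd u))"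

definition pi :: "nat \<Rightarrow> ('a list \<Rightarrow>\<^sub>0 'k) \<Rightarrow> ('a list \<Rightarrow>\<^sub>0 'k)"
  where "pi = piE m N"

definition piT :: "nat \<Rightarrow> (('a \<times> 'v) list \<Rightarrow>\<^sub>0 'k) \<Rightarrow> (('a \<times> 'v) list \<Rightarrow>\<^sub>0 'k)"
  where "piT = piE m T"

definition br :: "('a list \<Rightarrow>\<^sub>0 'k) \<Rightarrow> ('a list \<Rightarrow>\<^sub>0 'k) \<Rightarrow> ('a list \<Rightarrow>\<^sub>0 'k)"
  where "br x y = der m N N (\<lambda>x. x) 0 (adL (pi 0 x)) y + der m N N (\<lambda>x. x) 1 (adL (pi 1 x)) y"

definition brT :: "('a list \<Rightarrow>\<^sub>0 'k) \<Rightarrow> (('a \<times> 'v) list \<Rightarrow>\<^sub>0 'k) \<Rightarrow> (('a \<times> 'v) list \<Rightarrow>\<^sub>0 'k)"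
  where "brT x w = der m T T (\<lambda>x. x) 0 (adT (pi 0 x)) w + der m T T (\<lambda>x. x) 1 (adT (pi 1 x)) w"

definition derV :: "nat \<Rightarrow> ('a \<Rightarrow> 'v) \<Rightarrow> ('a list \<Rightarrow>\<^sub>0 'k) \<Rightarrow> (('a \<times> 'v) list \<Rightarrow>\<^sub>0 'k)"
  where "derV p \<phi> = der m N T fromN p (\<lambda>z. fromV (\<phi> z))"

definition ad_word :: "'a list \<Rightarrow> 'v \<Rightarrow> 'a \<Rightarrow> 'v"
  where "ad_word xs v = (\<lambda>z. act V (xs @ [tw N 0 z]) (pr V 0 v) + act V (xs @ [tw N 1 z]) (pr V 1 v))"

text \<open>\<open>ad_map w\<close> is the map from \<open>N\<close> to \<open>V\<close> that sends \<open>z\<close> to \<open>ad(x\<^sub>1 \<and> \<dots> \<and> x\<^sub>n\<^sub>-\<^sub>2 \<and> z)(v)\<close>, up to the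
  sign for moving \<open>v\<close> past \<open>z\<close>, if \<open>w\<close> is \<open>x\<^sub>1 \<and> \<dots> \<and> x\<^sub>n\<^sub>-\<^sub>2 \<and> v\<close>.\<close>

definition ad_map :: "(('a \<times> 'v) list \<Rightarrow>\<^sub>0 'k) \<Rightarrow> 'a \<Rightarrow> 'v"
  where "ad_map = lift m (fun_scale sV) (contract T fst snd ad_word)"

text \<open>The right bracket \<open>[w,y]'\<close> is \<open>- \<Delta>(ad(w))(y)\<close>, since \<open>derV p\<close> is \<open>\<Delta>\<close> in degree 0.\<close>

definition brT' :: "(('a \<times> 'v) list \<Rightarrow>\<^sub>0 'k) \<Rightarrow> ('a list \<Rightarrow>\<^sub>0 'k) \<Rightarrow> (('a \<times> 'v) list \<Rightarrow>\<^sub>0 'k)"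
  where "brT' w y = - (derV 0 (ad_map (piT 0 w)) y + derV 1 (ad_map (piT 1 w)) y)"

abbreviation Lg where "Lg \<equiv> EG m N"
abbreviation Wg where "Wg \<equiv> gradeW n N V"

lemma adL_lin1: "lin fscale (fun_scale sN) adL"
  unfolding adL_def by (rule lift_lin[OF vector_space_fun_scale[OF N.vsS]])

lemma actL_lin1: "lin fscale (fun_scale sV) actL"
  unfolding actL_def by (rule lift_lin[OF vector_space_fun_scale[OF V.vsS]])

lemma ad_map_lin1: "lin fscale (fun_scale sV) ad_map"
  unfolding ad_map_def by (rule lift_lin[OF vector_space_fun_scale[OF V.vsS]])

lemma adL_lin: "lin sN sN (adL x)"
proof -
  have "lin sN sN (\<lambda>z. lift m sN (\<lambda>xs. brk N (xs @ [z])) x)"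
    by (intro lift_lin_param N.vsS mlinD[OF brk_mlin]) simp
  then show ?thesis unfolding adL_def lift_fun_scale .
qed

lemma actL_lin: "lin sV sV (actL x)"
proof -
  have "lin sV sV (\<lambda>z. lift m sV (\<lambda>xs. act V xs z) x)"
    by (intro lift_lin_param V.vsS act_lin)
  then show ?thesis unfolding actL_def lift_fun_scale .
qed

lemma adL_wedge: assumes "length xs = m" shows "adL (wedge m N xs) z = brk N (xs @ [z])"
  unfolding adL_def
  by (subst N.lift_wedge[OF vector_space_fun_scale[OF N.vsS] _ sskew_funI assms])
    (auto simp: mlin_fun_scale intro!: mlin_snoc sskew_snoc brk_mlin brk_sskew)

lemma actL_wedge: assumes "length xs = m" shows "actL (wedge m N xs) z = act V xs z"
  unfolding actL_def
  by (subst N.lift_wedge[OF vector_space_fun_scale[OF V.vsS] _ sskew_funI assms])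
    (auto simp: mlin_fun_scale intro: act_mlin act_sskew)

lemma adL_superhom: assumes "x \<in> Lg q" shows "superhom N N q (adL x)"
  unfolding superhom_def
proof (intro conjI allI impI adL_lin)
  fix z a assume z: "z \<in> grd N a"
  from assms show "adL x z \<in> grd N (q + a)"
  proof (induction rule: EG_induct)
    case (wedge xs)
    then show ?case using brk_grd[OF wedge(1) z] N.grd_cong[of "parl N xs + a" "q + a"] by (simp add: adL_wedge hlists_def)
  qed (simp_all add: lin_0[OF adL_lin1] lin_add[OF adL_lin1] lin_scale[OF adL_lin1] fun_scale_def N.grd_zero N.grd_add N.grd_scale)
qed

lemma actL_superhom: assumes "x \<in> Lg q" shows "superhom V V q (actL x)"
  unfolding superhom_def
proof (intro conjI allI impI actL_lin)
  fix z a assume z: "z \<in> grd V a"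
  from assms show "actL x z \<in> grd V (q + a)"
  proof (induction rule: EG_induct)
    case (wedge xs)
    then show ?case using act_grd[OF wedge(1) z] V.grd_cong[of "parl N xs + a" "q + a"] by (simp add: actL_wedge hlists_def)
  qed (simp_all add: lin_0[OF actL_lin1] lin_add[OF actL_lin1] lin_scale[OF actL_lin1] fun_scale_def V.grd_zero V.grd_add V.grd_scale)
qed

lemma adT_lin1: "lin fscale (fun_scale (smult T)) adT"
  by (rule linI) (simp_all add: adT_def fun_eq_iff fun_scale_def T_simps lin_add[OF adL_lin1] lin_add[OF actL_lin1]
      lin_scale[OF adL_lin1] lin_scale[OF actL_lin1])

lemma adT_superhom: assumes "x \<in> Lg q" shows "superhom T T q (adT x)"
  using superhom_grd[OF adL_superhom[OF assms]] superhom_grd[OF actL_superhom[OF assms]]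
  by (auto simp: superhom_def adT_def T_simps lin_add[OF adL_lin] lin_add[OF actL_lin] lin_scale[OF adL_lin] lin_scale[OF actL_lin]
      intro!: linI)

lemma pi_lin: "lin fscale fscale (pi q)" and piT_lin: "lin fscale fscale (piT q)"
  unfolding pi_def piT_def by (rule N.piE_lin T.piE_lin)+

lemma pi_EG: "x \<in> Lg a \<Longrightarrow> pi q x = (if even (q + a) then x else 0)"
  unfolding pi_def by (rule N.piE_EG)

lemma pi_in: "pi q x \<in> Lg q"
  unfolding pi_def by (rule N.piE_in)

lemma fun_scale_lin_at: "lin sA (fun_scale sB) h \<Longrightarrow> lin sA sB (\<lambda>x. h x z)"
  by (simp add: lin_fun_scale)

lemma br_lin1: "lin fscale fscale (\<lambda>x. br x y)"
  unfolding br_def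
  by (intro lin_addI[OF vsE] NN.der_lin_h fun_scale_lin_at[OF lin_comp[OF adL_lin1 pi_lin]])

lemma br_lin2: "lin fscale fscale (br x)"
  unfolding br_def by (intro lin_addI[OF vsE] NN.der_lin)

lemma brT_lin1: "lin fscale fscale (\<lambda>x. brT x y)"
  unfolding brT_def
  by (intro lin_addI[OF vsE] TT.der_lin_h fun_scale_lin_at[OF lin_comp[OF adT_lin1 pi_lin]])

lemma brT_lin2: "lin fscale fscale (brT x)"
  unfolding brT_def by (intro lin_addI[OF vsE] TT.der_lin)

lemma derV_lin1: "lin (fun_scale sV) fscale (\<lambda>\<phi>. derV p \<phi> y)"
  unfolding derV_def
  by (rule NT.der_lin_h) (auto intro!: linI simp: fun_scale_def lin_add[OF fromV_lin] lin_scale[OF fromV_lin])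

lemma derV_lin2: "lin fscale fscale (derV p \<phi>)"
  unfolding derV_def by (rule NT.der_lin)

lemma brT'_lin1: "lin fscale fscale (\<lambda>w. brT' w y)"
  unfolding brT'_def by (intro lin_negI lin_addI vsE lin_comp[OF derV_lin1 lin_comp[OF ad_map_lin1 piT_lin]])

lemma brT'_lin2: "lin fscale fscale (brT' w)"
  unfolding brT'_def by (intro lin_negI lin_addI vsE derV_lin2)

lemma der_hom:
  assumes x: "x \<in> Lg q" and h: "lin fscale (fun_scale (smult S)) h" and S: "sspace S"
  shows "der m S S (\<lambda>x. x) 0 (h (pi 0 x)) y + der m S S (\<lambda>x. x) 1 (h (pi 1 x)) y = der m S S (\<lambda>x. x) q (h x) y"
proof -
  interpret SS: smap S S "\<lambda>x. x" by (rule smap_id[OF S])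
  have l: "lin fscale fscale (\<lambda>x. der m S S (\<lambda>x. x) r (h x) y)" for r
    using lin_comp[OF _ h, of fscale "\<lambda>h. der m S S (\<lambda>x. x) r h y"] SS.der_lin_h[of "fun_scale (smult S)" "\<lambda>h. h"]
    by (auto simp: linear_on_def fun_scale_def)
  show ?thesis
    using pi_EG[OF x, of 0] pi_EG[OF x, of 1] lin_0[OF l] SS.der_parity[of q 0] SS.der_parity[of q 1]
    by (cases "even q") simp_all
qed

lemma br_hom: "x \<in> Lg q \<Longrightarrow> br x y = der m N N (\<lambda>x. x) q (adL x) y"
  unfolding br_def by (rule der_hom[OF _ adL_lin1]) unfold_locales

lemma brT_hom: "x \<in> Lg q \<Longrightarrow> brT x y = der m T T (\<lambda>x. x) q (adT x) y"
  unfolding brT_def by (rule der_hom[OF _ adT_lin1]) unfold_locales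

lemma br_EG: "x \<in> Lg q \<Longrightarrow> y \<in> Lg r \<Longrightarrow> br x y \<in> Lg (q + r)"
  by (simp only: br_hom NN.der_EG[OF adL_superhom])

lemma br_wedge:
  assumes "x \<in> Lg q" "ys \<in> hlists m N"
  shows "br x (wedge m N ys) = (\<Sum>i<m. sign (q * parl N (take i ys)) (wedge m N (ys[i := adL x (ys ! i)])))"
  using NN.der_wedge_sum[OF adL_superhom[OF assms(1)] assms(2)] by (simp add: br_hom[OF assms(1)])

end

context nambu
begin

lemma genW_eq: "genW n N V xs v = wedge m T (map fromN xs @ [fromV v])"
  by (simp add: genW_def wW_def)

lemma insW_eq: "insW n N V xs i v = wedge m T ((map fromN xs)[i := fromV v])"
  by (simp add: insW_def wW_def)

lemma parl_fromN: "parl T (map fromN xs) = parl N xs"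
  by (simp add: parl_def par_def fromN_def dsum_def V.grd_zero[of 0, simplified] comp_def)

lemma homog_fromN: "set xs \<subseteq> homog N \<Longrightarrow> set (map fromN xs) \<subseteq> homog T"
  using NT.i_grd N.homog_iff T.homog_iff by fastforce

lemma homog_fromV: "v \<in> homog V \<Longrightarrow> fromV v \<in> homog T"
  using fromV_grd V.homog_iff T.homog_iff by blast

lemma parl_append: "parl S (xs @ ys) = parl S xs + parl S ys"
  by (simp add: parl_def)

lemma parl_Cons: "parl S (x # ys) = par S x + parl S ys"
  by (simp add: parl_def)

lemma parl_Nil: "parl S [] = 0"
  by (simp add: parl_def)

lemma genW_lin: "length xs = m0 \<Longrightarrow> lin sV fscale (genW n N V xs)"
  unfolding genW_eq using m_eq
  by (intro lin_comp[OF _ fromV_lin] mlinD[OF T.wedge_mlin, of _ "[]", simplified append_Nil2]) simp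

lemma genW_Wg:
  assumes "xs \<in> hlists m0 N" "v \<in> grd V c" "even (parl N xs + c) = even q"
  shows "genW n N V xs v \<in> Wg q"
proof (cases "v = 0")
  case True
  then show ?thesis using lin_0[OF genW_lin] assms by (simp add: hlists_def gradeW_def E.span_zero)
next
  case False
  have "(parl N xs + par V v) mod 2 = q mod 2"
    using V.par_grd[OF assms(2) False] assms(3) by (auto simp: mod2_eq_if)
  then show ?thesis unfolding gradeW_def using assms V.grd_homog[OF assms(2)]
    by (intro E.span_base) auto
qed

lemma Wg_zero: "0 \<in> Wg q"
  and Wg_add: "x \<in> Wg q \<Longrightarrow> y \<in> Wg q \<Longrightarrow> x + y \<in> Wg q"
  and Wg_scale: "x \<in> Wg q \<Longrightarrow> fscale c x \<in> Wg q"
  and Wg_neg: "x \<in> Wg q \<Longrightarrow> - x \<in> Wg q"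
  and Wg_sign: "x \<in> Wg q \<Longrightarrow> sign e x \<in> Wg q"
  by (auto simp: gradeW_def sign_def E.span_zero E.span_add E.span_scale E.span_neg E.span_diff)

lemma Wg_sum: "(\<And>i. i \<in> A \<Longrightarrow> f i \<in> Wg q) \<Longrightarrow> sum f A \<in> Wg q"
  unfolding gradeW_def by (rule E.span_sum)

lemma Wg_cong: "even q = even r \<Longrightarrow> Wg q = Wg r"
  by (simp add: gradeW_def mod2_eq_if)

lemma Wg_induct [consumes 1, case_names gen zero add scale]:
  assumes "w \<in> Wg q" "\<And>xs v c. xs \<in> hlists m0 N \<Longrightarrow> v \<in> grd V c \<Longrightarrow> even (parl N xs + c) = even q \<Longrightarrow> P (genW n N V xs v)"
    "P 0" "\<And>x y. P x \<Longrightarrow> P y \<Longrightarrow> P (x + y)" "\<And>c x. P x \<Longrightarrow> P (fscale c x)"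
  shows "P w"
proof (rule E.span_induct[OF assms(1)[unfolded gradeW_def]])
  show "E.subspace (Collect P)" by (auto intro!: E.subspaceI assms(3-5))
  fix w assume "w \<in> {genW n N V xs v | xs v. xs \<in> hlists (n - 2) N \<and> v \<in> homog V \<and> (parl N xs + par V v) mod 2 = q mod 2}"
  then obtain xs v where w: "w = genW n N V xs v" "xs \<in> hlists m0 N" "v \<in> homog V" "(parl N xs + par V v) mod 2 = q mod 2" by auto
  have "even (parl N xs + par V v) = even q" using w(4) by presburger
  with w(2,3) show "P w" unfolding w(1) by (intro assms(2)) (auto intro: V.homog_par)
qed

lemma genW_hlists: "xs \<in> hlists m0 N \<Longrightarrow> v \<in> homog V \<Longrightarrow> map fromN xs @ [fromV v] \<in> hlists m T"
  using homog_fromN homog_fromV m_eq by (auto simp: hlists_def)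

lemma Wg_EG: "w \<in> Wg q \<Longrightarrow> w \<in> EG m T q"
proof (induction rule: Wg_induct)
  case (gen xs v c)
  have "list_all2 (\<lambda>x e. x \<in> grd T e) (map fromN xs @ [fromV v]) (map (par N) xs @ [c])"
    using gen by (auto simp: list_all2_append list_all2_map1 list_all2_map2 hlists_def list_all2_same
        intro!: NT.i_grd N.homog_par fromV_grd)
  from T.wedge_EG[OF this, of m] show ?case
    using gen m_eq EG_cong[of "parl N xs + c" q m T] by (simp add: genW_eq hlists_def parl_def)
qed (auto intro: EG_zero EG_add EG_scale)

lemma insW_gen:
  assumes "xs \<in> hlists m N" "i < m" "v \<in> grd V c"
  shows "insW n N V xs i v = sign (m - Suc i + c * parl N (drop (Suc i) xs)) (genW n N V (del i xs) v)"
proof -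
  have "(map fromN xs)[i := fromV v] = map fromN (take i xs) @ fromV v # map fromN (drop (Suc i) xs)"
    using assms by (simp add: upd_conv_take_nth_drop hlists_def take_map drop_map)
  moreover have "set (drop (Suc i) xs) \<subseteq> homog N"
    using assms by (auto simp: hlists_def dest: in_set_dropD)
  ultimately show ?thesis
    using T.sskew_move_end[OF T.wedge_sskew fromV_grd[OF assms(3)], of "map fromN (drop (Suc i) xs)" "map fromN (take i xs)" m] assms
    by (simp add: insW_eq genW_eq del_def parl_fromN homog_fromN hlists_def del: set_map)
qed

lemma del_hlists: "xs \<in> hlists m N \<Longrightarrow> i < m \<Longrightarrow> del i xs \<in> hlists m0 N"
  using m_eq by (auto simp: hlists_def del_def dest: in_set_dropD in_set_takeD)

lemma parl_split: "xs \<in> hlists m N \<Longrightarrow> i < m \<Longrightarrow> parl N xs = parl N (take i xs) + par N (xs ! i) + parl N (drop (Suc i) xs)"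
  by (subst id_take_nth_drop[of i xs]) (simp_all add: hlists_def parl_append parl_Cons)

lemma parl_del: "parl N (del i xs) = parl N (take i xs) + parl N (drop (Suc i) xs)"
  by (simp add: del_def parl_append)

lemma insW_Wg:
  assumes "xs \<in> hlists m N" "i < m" "v \<in> grd V (p + par N (xs ! i))"
  shows "insW n N V xs i v \<in> Wg (p + parl N xs)"
  unfolding insW_gen[OF assms]
  by (intro Wg_sign genW_Wg[OF del_hlists assms(3)] assms) (auto simp: parl_split[OF assms(1,2)] parl_del)

lemma nth_grd: "xs \<in> hlists m N \<Longrightarrow> i < m \<Longrightarrow> xs ! i \<in> grd N (par N (xs ! i))"
  by (intro N.homog_par) (auto simp: hlists_def)

lemma fromV_superhom: "superhom N V p \<phi> \<Longrightarrow> superhom N T p (\<lambda>z. fromV (\<phi> z))"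
  by (auto simp: superhom_def intro: fromV_grd lin_comp[OF fromV_lin])

lemma derV_wedge:
  assumes "superhom N V p \<phi>" "xs \<in> hlists m N"
  shows "derV p \<phi> (wedge m N xs) = (\<Sum>i<m. sign (p * parl N (take i xs)) (insW n N V xs i (\<phi> (xs ! i))))"
  unfolding derV_def insW_eq by (rule NT.der_wedge_sum[OF fromV_superhom[OF assms(1)] assms(2)])

lemma derV_Wg:
  assumes "superhom N V p \<phi>" "x \<in> Lg q" shows "derV p \<phi> x \<in> Wg (p + q)"
  using assms(2)
proof (induction rule: EG_induct)
  case (wedge xs)
  have "derV p \<phi> (wedge m N xs) \<in> Wg (p + parl N xs)"
    unfolding derV_wedge[OF assms(1) wedge(1)] using assms(1) wedge(1)
    by (intro Wg_sum Wg_sign insW_Wg superhom_grd[OF assms(1)] nth_grd) auto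
  then show ?case using Wg_cong[of "p + parl N xs" "p + q"] wedge(2) by simp
qed (auto simp: lin_0[OF derV_lin2] lin_add[OF derV_lin2] lin_scale[OF derV_lin2] intro: Wg_zero Wg_add Wg_scale)

lemma adT_fromN: "adT x (fromN z) = fromN (adL x z)" and adT_fromV: "adT x (fromV v) = fromV (actL x v)"
  by (simp_all add: adT_def fromN_def fromV_def lin_0[OF adL_lin] lin_0[OF actL_lin])

lemma brT_gen:
  assumes "x \<in> Lg q" "ys \<in> hlists m0 N" "v \<in> homog V"
  shows "brT x (genW n N V ys v) = (\<Sum>i<m0. sign (q * parl N (take i ys)) (genW n N V (ys[i := adL x (ys ! i)]) v))
    + sign (q * parl N ys) (genW n N V ys (actL x v))"
proof -
  have l: "length ys = m0" using assms(2) by (simp add: hlists_def)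
  let ?us = "map fromN ys @ [fromV v]"
  have "brT x (genW n N V ys v) = (\<Sum>i<Suc m0. sign (q * parl T (take i ?us)) (wedge m T (?us[i := adT x (?us ! i)])))"
    unfolding brT_hom[OF assms(1)] genW_eq
    using TT.der_wedge_sum[OF adT_superhom[OF assms(1)] genW_hlists[OF assms(2,3)]] by (simp add: m_eq)
  also have "\<dots> = (\<Sum>i<m0. sign (q * parl N (take i ys)) (genW n N V (ys[i := adL x (ys ! i)]) v))
      + sign (q * parl N ys) (genW n N V ys (actL x v))"
  proof -
    have "parl T (take i ?us) = parl N (take i ys)" "?us[i := adT x (?us ! i)] = map fromN (ys[i := adL x (ys ! i)]) @ [fromV v]"
      if "i < m0" for i
      using that l by (simp_all add: take_map parl_fromN nth_append list_update_append map_update adT_fromN)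
    moreover have "parl T (take m0 ?us) = parl N ys" "?us[m0 := adT x (?us ! m0)] = map fromN ys @ [fromV (actL x v)]"
      using l by (simp_all add: parl_fromN nth_append list_update_append adT_fromV)
    ultimately show ?thesis by (simp add: genW_eq)
  qed
  finally show ?thesis .
qed

lemma upd_hlists: "ys \<in> hlists m0 N \<Longrightarrow> z \<in> homog N \<Longrightarrow> ys[i := z] \<in> hlists m0 N"
  using set_update_subset_insert by (fastforce simp: hlists_def)

lemma upd_hlists': "ys \<in> hlists m N \<Longrightarrow> z \<in> homog N \<Longrightarrow> ys[i := z] \<in> hlists m N"
  using set_update_subset_insert by (fastforce simp: hlists_def)

lemma genW_eq_0: assumes "length xs = m0" "0 \<in> set xs" shows "genW n N V xs v = 0"
proof -
  obtain as bs where "xs = as @ 0 # bs" using assms(2) split_list by metis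
  then show ?thesis
    using mlin_slot_0[OF T.wedge_mlin, of "map fromN as" "map fromN bs @ [fromV v]" m] m_eq assms(1)
    by (simp add: genW_eq lin_0[OF NT.i_lin])
qed

lemma parl_upd:
  assumes "ys \<in> hlists k N" "i < k" "z \<in> grd N (q + par N (ys ! i))" "z \<noteq> 0"
  shows "even (parl N (ys[i := z])) = even (q + parl N ys)"
proof -
  have l: "i < length ys" using assms by (simp add: hlists_def)
  have "parl N (ys[i := z]) = parl N (take i ys) + par N z + parl N (drop (Suc i) ys)"
    using l by (simp add: upd_conv_take_nth_drop parl_append parl_Cons)
  moreover have "parl N ys = parl N (take i ys) + par N (ys ! i) + parl N (drop (Suc i) ys)"
    using l by (subst id_take_nth_drop[of i ys]) (simp_all add: parl_append parl_Cons)
  ultimately show ?thesis using N.par_grd[OF assms(3,4)] by auto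
qed

lemma brT_Wg:
  assumes "x \<in> Lg q" "w \<in> Wg r" shows "brT x w \<in> Wg (q + r)"
  using assms(2)
proof (induction rule: Wg_induct)
  case (gen ys v c)
  have l: "length ys = m0" using gen(1) by (simp add: hlists_def)
  have "genW n N V (ys[i := adL x (ys ! i)]) v \<in> Wg (q + r)" if i: "i < m0" for i
  proof (cases "adL x (ys ! i) = 0")
    case True
    then have "0 \<in> set (ys[i := adL x (ys ! i)])" using i l set_update_memI[of i ys 0] by simp
    then show ?thesis using genW_eq_0 l by (simp add: Wg_zero)
  next
    case False
    have z: "adL x (ys ! i) \<in> grd N (q + par N (ys ! i))"
      using gen(1) i l by (intro superhom_grd[OF adL_superhom[OF assms(1)]] N.homog_par) (auto simp: hlists_def)
    show ?thesis using parl_upd[OF gen(1) i z False] gen(3)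
      by (intro genW_Wg[OF upd_hlists[OF gen(1) N.grd_homog[OF z]] gen(2)]) auto
  qed
  moreover have "genW n N V ys (actL x v) \<in> Wg (q + r)"
    using gen by (intro genW_Wg[OF gen(1) superhom_grd[OF actL_superhom[OF assms(1)] gen(2)]]) auto
  ultimately show ?case
    unfolding brT_gen[OF assms(1) gen(1) V.grd_homog[OF gen(2)]] by (intro Wg_add Wg_sum Wg_sign) auto
qed (auto simp: lin_0[OF brT_lin2] lin_add[OF brT_lin2] lin_scale[OF brT_lin2] intro: Wg_zero Wg_add Wg_scale)

lemma ad_word_mlin: "mlin m0 sN (fun_scale sV) (\<lambda>xs. ad_word xs v)"
  unfolding mlin_fun_scale ad_word_def using act_mlin m_eq by (auto intro!: mlin_addI V.vsS mlin_snoc)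

lemma ad_word_lin: "length xs = m0 \<Longrightarrow> lin sV (fun_scale sV) (ad_word xs)"
  unfolding lin_fun_scale ad_word_def using m_eq by (auto intro!: lin_addI V.vsS lin_comp[OF act_lin V.pr_lin])

lemma ad_word_sskew: "sskew N m0 (\<lambda>xs. ad_word xs v)"
proof (rule sskew_funI)
  fix z
  have s: "sskew N m0 (\<lambda>xs. act V (xs @ [y]) u)" for y u
    using act_sskew m_eq by (intro sskew_snoc) simp
  show "sskew N m0 (\<lambda>xs. ad_word xs v z)"
    unfolding sskew_def ad_word_def
  proof (intro allI impI)
    fix as bs :: "'a list" and x y a b assume *: "length as + length bs + 2 = m0" "x \<in> grd N a" "y \<in> grd N b"
    show "act V ((as @ x # y # bs) @ [tw N 0 z]) (pr V 0 v) + act V ((as @ x # y # bs) @ [tw N 1 z]) (pr V 1 v) =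
       - sign (a * b) (act V ((as @ y # x # bs) @ [tw N 0 z]) (pr V 0 v) + act V ((as @ y # x # bs) @ [tw N 1 z]) (pr V 1 v))"
      unfolding sskewD[OF s *] by (simp add: sign_add)
  qed
qed

lemma ad_map_gen:
  assumes l: "length xs = m0" and v: "v \<in> grd V c" and z: "z \<in> grd N a"
  shows "ad_map (genW n N V xs v) z = sign (c * a) (act V (xs @ [z]) v)"
proof -
  let ?us = "map fromN xs @ [fromV v]"
  have us: "length ?us = m" using l m_eq by simp
  have "mlin (Suc m0) (smult T) (fun_scale sV) (contract T fst snd ad_word)"
    by (rule TN.contract_mlin[OF vector_space_fun_scale[OF V.vsS] snd_lin ad_word_mlin ad_word_lin])
  moreover have "sskew T (Suc m0) (contract T fst snd ad_word)"
    by (rule TN.contract_sskew[OF _ ad_word_mlin ad_word_lin ad_word_sskew]) simp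
  ultimately have "ad_map (genW n N V xs v) = contract T fst snd ad_word ?us"
    unfolding ad_map_def genW_eq by (intro T.lift_wedge[OF vector_space_fun_scale[OF V.vsS] _ _ us]) (simp_all flip: m_eq)
  also have "\<dots> = ad_word (map fst (map fromN xs :: ('a \<times> 'v) list)) (snd (fromV v :: 'a \<times> 'v))"
  proof (rule TN.contract_last[where ws = "map fromN xs" and u = "fromV v" and G = ad_word and sM = "fun_scale sV", OF snd_lin])
    fix w :: "'a \<times> 'v" and q assume "w \<in> set (map fromN xs)"
    then obtain x where "w = fromN x" by auto
    then have "w = fromN (pr N 0 x + pr N (Suc 0) x)" by (simp only: N.pr_sum)
    then have "w = fromN (pr N 0 x) + fromN (pr N (Suc 0) x)" by (simp only: lin_add[OF NT.i_lin])
    then have "pr T q w = pr T q (fromN (pr N 0 x)) + pr T q (fromN (pr N (Suc 0) x))" by (simp add: lin_add[OF T.pr_lin])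
    also have "snd \<dots> = 0" by (simp add: T.pr_grd[OF NT.i_grd[OF N.pr_in]]) (simp add: fromN_def)
    finally show "snd (pr T q w) = 0" .
  qed (use ad_word_lin l in simp)
  also have "\<dots> = ad_word xs v" by (simp add: comp_def fromN_def fromV_def)
  finally have "ad_map (genW n N V xs v) z = ad_word xs v z" by simp
  also have "\<dots> = act V (xs @ [sign (c * a) z]) v"
    using V.pr_grd[OF v, of 0] V.pr_grd[OF v, of 1] lin_0[OF act_lin] l m_eq N.tw_grd[OF z, of 0] N.tw_grd[OF z, of 1]
    by (cases "even c"; cases "even a") (simp_all add: ad_word_def sign_def)
  also have "\<dots> = sign (c * a) (act V (xs @ [z]) v)"
    using lin_sign[OF mlinD[OF act_mlin, of xs "[]"]] l m_eq by simp
  finally show ?thesis .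
qed

lemma ad_map_lin: "lin sN sV (ad_map w)"
proof -
  have c: "lin sN sV (\<lambda>z. contract T fst snd G us z)" if "\<And>xs v. length xs + 1 = length us \<Longrightarrow> lin sN sV (G xs v)"
    for us and G :: "'a list \<Rightarrow> 'v \<Rightarrow> 'a \<Rightarrow> 'v"
    using that
  proof (induction us arbitrary: G)
    case Nil then show ?case by (simp add: lin_zeroI[OF V.vsS])
  next
    case (Cons u us)
    have "lin sN sV (contract T fst snd (\<lambda>xs v. G (fst u # xs) v) us)" by (rule Cons.IH) (simp add: Cons.prems)
    then show ?case using Cons.prems by (auto simp: sign_fun intro!: lin_addI lin_signI V.vsS)
  qed
  have "lin sN sV (\<lambda>z. contract T fst snd ad_word us z)" if "length us = m" for us
  proof (rule c)
    fix xs :: "'a list" and v assume "length xs + 1 = length us"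
    then have "lin sN sV (\<lambda>z. act V (xs @ [tw N q z]) u)" for q u
      using that lin_comp[OF mlinD[OF act_mlin, of xs "[]"] N.tw_lin] by simp
    then show "lin sN sV (ad_word xs v)" unfolding ad_word_def by (intro lin_addI V.vsS)
  qed
  then have "lin sN sV (\<lambda>z. lift m sV (\<lambda>us. contract T fst snd ad_word us z) w)"
    by (intro lift_lin_param V.vsS)
  then show ?thesis unfolding ad_map_def lift_fun_scale .
qed

lemma ad_map_superhom: assumes "w \<in> Wg r" shows "superhom N V r (ad_map w)"
  unfolding superhom_def
proof (intro conjI allI impI ad_map_lin)
  fix z a assume z: "z \<in> grd N a"
  from assms show "ad_map w z \<in> grd V (r + a)"
  proof (induction rule: Wg_induct)
    case (gen xs v c)
    have l: "length xs = m0" using gen by (simp add: hlists_def)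
    show ?case
    proof (cases "z = 0")
      case True then show ?thesis by (simp add: lin_0[OF ad_map_lin] V.grd_zero)
    next
      case False
      have "xs @ [z] \<in> hlists m N" using gen z m_eq N.grd_homog by (auto simp: hlists_def)
      from act_grd[OF this gen(2)] show ?thesis
        using V.grd_cong[of "parl N (xs @ [z]) + c" "r + a"] gen(3) N.par_grd[OF z False]
        by (auto simp: ad_map_gen[OF l gen(2) z] parl_append parl_Cons parl_Nil intro: V.grd_sign)
    qed
  qed (simp_all add: lin_0[OF ad_map_lin1] lin_add[OF ad_map_lin1] lin_scale[OF ad_map_lin1] fun_scale_def V.grd_zero V.grd_add V.grd_scale)
qed

lemma brT'_hom: assumes "w \<in> Wg q" shows "brT' w y = - derV q (ad_map w) y"
proof -
  have l: "derV r (ad_map 0) y = 0" for r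
    using lin_0[OF lin_comp[OF derV_lin1 ad_map_lin1]] by simp
  have "derV r = derV s" if "even r = even s" for r s
    using NT.der_parity[OF that] by (simp add: derV_def fun_eq_iff)
  from this[of q 0] this[of q 1] show ?thesis
    using T.piE_EG[OF Wg_EG[OF assms], of 0] T.piE_EG[OF Wg_EG[OF assms], of 1] l
    by (cases "even q") (simp_all add: brT'_def piT_def)
qed

end

context nambu
begin

lemma module_law1:
  "xs \<in> hlists n N \<Longrightarrow> ys \<in> hlists m0 N \<Longrightarrow> act V (brk N xs # ys) v =
    (\<Sum>i<n. sV ((-1) ^ (n - Suc i + par N (xs ! i) * parl N (drop (Suc i) xs))) (act V (del i xs) (act V (xs ! i # ys) v)))"
  and module_law2:
  "us \<in> hlists m N \<Longrightarrow> xs \<in> hlists m N \<Longrightarrow>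
    (\<Sum>i<m. sV ((-1) ^ (parl N xs * parl N (take i us))) (act V (us[i := brk N (xs @ [us ! i])]) v)) =
    act V xs (act V us v) - sV ((-1) ^ (parl N xs * parl N us)) (act V us (act V xs v))"
  using NM unfolding nambu_module_def m_simps by blast+

lemma sign_inj: "sign e x = sign e y \<longleftrightarrow> x = y"
  by (simp add: sign_def)

lemma wl_ext: "x \<in> Lg q \<Longrightarrow> x \<in> ext_power m N"
  by (rule N.EG_ext_power)

lemma adL_br:
  assumes "x \<in> Lg q" "y \<in> Lg r"
  shows "adL (br x y) z = adL x (adL y z) - sign (q * r) (adL y (adL x z))"
proof -
  note l1 = fun_scale_lin_at[OF adL_lin1]
  have w: "adL (br (wedge m N xs) (wedge m N ys)) z = adL (wedge m N xs) (adL (wedge m N ys) z)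
      - sign (parl N xs * parl N ys) (adL (wedge m N ys) (adL (wedge m N xs) z))"
    if xs: "xs \<in> hlists m N" and ys: "ys \<in> hlists m N" and z: "z \<in> grd N a" for xs ys z a
  proof -
    have l: "length xs = m" "length ys = m" using xs ys by (simp_all add: hlists_def)
    have "ys @ [z] \<in> hlists n N" using ys N.grd_homog[OF z] n_eq by (auto simp: hlists_def)
    then have "brk N (xs @ [brk N (ys @ [z])]) =
       (\<Sum>i<Suc m. sN ((-1) ^ (parl N xs * parl N (take i (ys @ [z])))) (brk N ((ys @ [z])[i := brk N (xs @ [(ys @ [z]) ! i])])))"
      using NL xs unfolding nambu_lie_superalgebra_def by (simp flip: n_eq)
    also have "\<dots> = (\<Sum>i<m. sign (parl N xs * parl N (take i ys)) (brk N (ys[i := brk N (xs @ [ys ! i])] @ [z])))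
       + sign (parl N xs * parl N ys) (brk N (ys @ [brk N (xs @ [z])]))"
      using l by (simp add: sign_scale[OF N.vsS] nth_append list_update_append)
    finally show ?thesis
      unfolding br_wedge[OF N.EG_hlists[OF xs] ys] using l
      by (simp add: lin_sum[OF l1] lin_sign[OF l1] adL_wedge)
  qed
  have h: "adL (br x y) z = adL x (adL y z) - sign (q * r) (adL y (adL x z))" if z: "z \<in> grd N a" for z a
    using assms(1)
  proof (rule N.EG_lin_eq[OF N.vsS, rotated 3])
    show "lin fscale sN (\<lambda>x. adL (br x y) z)" by (rule lin_comp[OF l1 br_lin1])
    show "lin fscale sN (\<lambda>x. adL x (adL y z) - sign (q * r) (adL y (adL x z)))"
      by (intro lin_diffI lin_signI N.vsS l1 lin_comp[OF adL_lin])
    fix xs assume xs: "xs \<in> hlists m N" "even (parl N xs) = even q"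
    show "adL (br (wedge m N xs) y) z = adL (wedge m N xs) (adL y z) - sign (q * r) (adL y (adL (wedge m N xs) z))"
      using assms(2)
    proof (rule N.EG_lin_eq[OF N.vsS, rotated 3])
      show "lin fscale sN (\<lambda>y. adL (br (wedge m N xs) y) z)" by (rule lin_comp[OF l1 br_lin2])
      show "lin fscale sN (\<lambda>y. adL (wedge m N xs) (adL y z) - sign (q * r) (adL y (adL (wedge m N xs) z)))"
        by (intro lin_diffI lin_signI N.vsS l1 lin_comp[OF adL_lin])
      fix ys assume ys: "ys \<in> hlists m N" "even (parl N ys) = even r"
      show "adL (br (wedge m N xs) (wedge m N ys)) z = adL (wedge m N xs) (adL (wedge m N ys) z)
         - sign (q * r) (adL (wedge m N ys) (adL (wedge m N xs) z))"
        unfolding w[OF xs(1) ys(1) z] using sign_cong[of "parl N xs * parl N ys" "q * r"] xs ys by simp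
    qed
  qed
  show ?thesis
    by (rule N.lin_eq_homog[where sB = sN, OF _ _ h])
      (assumption | intro adL_lin lin_diffI lin_signI N.vsS lin_comp[OF adL_lin adL_lin])+
qed

lemma actL_br:
  assumes "x \<in> Lg q" "y \<in> Lg r"
  shows "actL (br x y) v = actL x (actL y v) - sign (q * r) (actL y (actL x v))"
proof -
  note l1 = fun_scale_lin_at[OF actL_lin1]
  have w: "actL (br (wedge m N xs) (wedge m N ys)) v = actL (wedge m N xs) (actL (wedge m N ys) v)
      - sign (parl N xs * parl N ys) (actL (wedge m N ys) (actL (wedge m N xs) v))"
    if xs: "xs \<in> hlists m N" and ys: "ys \<in> hlists m N" for xs ys
  proof -
    have l: "length xs = m" "length ys = m" using xs ys by (simp_all add: hlists_def)
    have "(\<Sum>i<m. sV ((-1) ^ (parl N xs * parl N (take i ys))) (act V (ys[i := brk N (xs @ [ys ! i])]) v))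
        = act V xs (act V ys v) - sV ((-1) ^ (parl N xs * parl N ys)) (act V ys (act V xs v))"
      using NM xs ys unfolding nambu_module_def by simp
    then show ?thesis
      unfolding br_wedge[OF N.EG_hlists[OF xs] ys] using l
      by (simp add: lin_sum[OF l1] lin_sign[OF l1] adL_wedge actL_wedge sign_scale[OF V.vsS])
  qed
  show ?thesis using assms(1)
  proof (rule N.EG_lin_eq[OF V.vsS, rotated 3])
    show "lin fscale sV (\<lambda>x. actL (br x y) v)" by (rule lin_comp[OF l1 br_lin1])
    show "lin fscale sV (\<lambda>x. actL x (actL y v) - sign (q * r) (actL y (actL x v)))"
      by (intro lin_diffI lin_signI V.vsS l1 lin_comp[OF actL_lin])
    fix xs assume xs: "xs \<in> hlists m N" "even (parl N xs) = even q"
    show "actL (br (wedge m N xs) y) v = actL (wedge m N xs) (actL y v) - sign (q * r) (actL y (actL (wedge m N xs) v))"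
      using assms(2)
    proof (rule N.EG_lin_eq[OF V.vsS, rotated 3])
      show "lin fscale sV (\<lambda>y. actL (br (wedge m N xs) y) v)" by (rule lin_comp[OF l1 br_lin2])
      show "lin fscale sV (\<lambda>y. actL (wedge m N xs) (actL y v) - sign (q * r) (actL y (actL (wedge m N xs) v)))"
        by (intro lin_diffI lin_signI V.vsS l1 lin_comp[OF actL_lin])
      fix ys assume ys: "ys \<in> hlists m N" "even (parl N ys) = even r"
      show "actL (br (wedge m N xs) (wedge m N ys)) v = actL (wedge m N xs) (actL (wedge m N ys) v)
         - sign (q * r) (actL (wedge m N ys) (actL (wedge m N xs) v))"
        unfolding w[OF xs(1) ys(1)] using sign_cong[of "parl N xs * parl N ys" "q * r"] xs ys by simp
    qed
  qed
qed

lemma br_leibniz: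
  assumes x: "x \<in> Lg q" and y: "y \<in> Lg r" and z: "z \<in> ext_power m N"
  shows "br x (br y z) = br (br x y) z + sign (q * r) (br y (br x z))"
proof -
  have e: "(\<lambda>z. adL x (adL y z) - sign (r * q) (adL y (adL x z))) = adL (br x y)"
    by (simp add: adL_br[OF x y] fun_eq_iff mult.commute)
  have c: "br (br x y) z = der m N N (\<lambda>x. x) (r + q) (adL (br x y)) z"
    using br_hom[OF br_EG[OF x y]] by (simp add: add.commute)
  have "superhom N N (r + q) (\<lambda>z. adL x (adL y z) - sign (r * q) (adL y (adL x z)))"
    unfolding e using adL_superhom[OF br_EG[OF x y]] by (simp add: add.commute)
  from NN.der_commutator[OF adL_superhom[OF x] adL_superhom[OF x] adL_superhom[OF y] refl this z] show ?thesis
    unfolding e br_hom[OF x, symmetric] br_hom[OF y, symmetric] c[symmetric]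
    by (simp add: algebra_simps)
qed

text \<open>Here \<open>q\<close> is the parity of \<open>x\<close> and \<open>p\<close> that of \<open>\<phi>\<close>.\<close>

definition hom_act :: "nat \<Rightarrow> nat \<Rightarrow> ('a list \<Rightarrow>\<^sub>0 'k) \<Rightarrow> ('a \<Rightarrow> 'v) \<Rightarrow> 'a \<Rightarrow> 'v"
  where "hom_act p q x \<phi> = (\<lambda>z. actL x (\<phi> z) - sign (p * q) (\<phi> (adL x z)))"

lemma hom_act_lin: "lin sN sV \<phi> \<Longrightarrow> lin sN sV (hom_act p q x \<phi>)"
  unfolding hom_act_def by (intro lin_diffI lin_signI V.vsS lin_comp[OF actL_lin] lin_comp[OF _ adL_lin])

lemma hom_act_superhom:
  assumes "x \<in> Lg q" "superhom N V p \<phi>" shows "superhom N V (p + q) (hom_act p q x \<phi>)"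
  unfolding superhom_def
proof (intro conjI allI impI hom_act_lin superhom_lin[OF assms(2)])
  fix z a assume z: "z \<in> grd N a"
  have "actL x (\<phi> z) \<in> grd V (q + (p + a))" "\<phi> (adL x z) \<in> grd V (p + (q + a))"
    by (intro superhom_grd[OF actL_superhom[OF assms(1)]] superhom_grd[OF assms(2)] superhom_grd[OF adL_superhom[OF assms(1)]] z)+
  then show "hom_act p q x \<phi> z \<in> grd V (p + q + a)"
    unfolding hom_act_def by (intro V.grd_diff V.grd_sign) (simp_all add: ac_simps)
qed

lemma brT_derV:
  assumes x: "x \<in> Lg q" and \<phi>: "superhom N V p \<phi>" and y: "y \<in> ext_power m N"
  shows "brT x (derV p \<phi> y) - sign (p * q) (derV p \<phi> (br x y)) = derV (p + q) (hom_act p q x \<phi>) y"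
proof -
  have C: "(\<lambda>z. adT x (fromV (\<phi> z)) - sign (p * q) (fromV (\<phi> (adL x z)))) = (\<lambda>z. fromV (hom_act p q x \<phi> z))"
    by (simp add: hom_act_def adT_fromV lin_diff[OF fromV_lin] lin_sign[OF fromV_lin])
  have "superhom N T (p + q) (\<lambda>z. adT x (fromV (\<phi> z)) - sign (p * q) (fromV (\<phi> (adL x z))))"
    unfolding C by (rule fromV_superhom[OF hom_act_superhom[OF x \<phi>]])
  from NT.der_commutator[OF adL_superhom[OF x] adT_superhom[OF x] fromV_superhom[OF \<phi>] adT_fromN this y] show ?thesis
    unfolding C by (simp add: derV_def brT_hom[OF x] br_hom[OF x])
qed

lemma ad_map_equivariant:
  assumes "x \<in> Lg q" "w \<in> Wg r"
  shows "actL x (ad_map w z) = ad_map (brT x w) z + sign (q * r) (ad_map w (adL x z))"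
proof -
  note l1 = fun_scale_lin_at[OF ad_map_lin1]
  have g: "actL (wedge m N xs) (ad_map (genW n N V us v) z) =
      ad_map (brT (wedge m N xs) (genW n N V us v)) z + sign (q * r) (ad_map (genW n N V us v) (adL (wedge m N xs) z))"
    if xs: "xs \<in> hlists m N" "even (parl N xs) = even q" and us: "us \<in> hlists m0 N" and v: "v \<in> grd V c"
      and r: "even (parl N us + c) = even r" and z: "z \<in> grd N a" for xs us v c z a
  proof (cases "z = 0")
    case True
    then show ?thesis by (simp add: lin_0[OF ad_map_lin] lin_0[OF actL_lin] lin_0[OF adL_lin])
  next
    case False
    have l: "length xs = m" "length us = m0" using xs us by (simp_all add: hlists_def)
    have x: "wedge m N xs \<in> Lg (parl N xs)" by (rule N.EG_hlists[OF xs(1)])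
    let ?X = "parl N xs" and ?U = "parl N us"
    define s where "s = (\<Sum>i<m0. sign (?X * parl N (take i us)) (act V (us[i := brk N (xs @ [us ! i])] @ [z]) v))"
    define A1 where "A1 = act V xs (act V (us @ [z]) v)"
    define A2 where "A2 = act V (us @ [z]) (act V xs v)"
    define A3 where "A3 = act V (us @ [brk N (xs @ [z])]) v"
    have "us @ [z] \<in> hlists m N" using us N.grd_homog[OF z] m_eq by (auto simp: hlists_def)
    then have "(\<Sum>i<Suc m0. sV ((-1) ^ (?X * parl N (take i (us @ [z])))) (act V ((us @ [z])[i := brk N (xs @ [(us @ [z]) ! i])]) v))
        = act V xs (act V (us @ [z]) v) - sV ((-1) ^ (?X * parl N (us @ [z]))) (act V (us @ [z]) (act V xs v))"
      unfolding m_eq[symmetric] by (rule module_law2[OF _ xs(1)])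
    moreover have "sign (?X * parl N (us @ [z])) A2 = sign (?X * (?U + a)) A2"
      using N.par_grd[OF z False] by (intro sign_cong) (simp add: parl_append parl_Cons parl_Nil)
    ultimately have ax: "A1 = s + sign (?X * ?U) A3 + sign (?X * (?U + a)) A2"
      using l by (simp add: sign_scale[OF V.vsS] nth_append list_update_append s_def A1_def A2_def A3_def algebra_simps)
    have 1: "actL (wedge m N xs) (ad_map (genW n N V us v) z) = sign (c * a) A1"
      by (simp add: ad_map_gen[OF l(2) v z] actL_wedge[OF l(1)] lin_sign[OF act_lin[OF l(1)]] A1_def)
    have av: "act V xs v \<in> grd V (?X + c)" by (rule act_grd[OF xs(1) v])
    have 2: "ad_map (brT (wedge m N xs) (genW n N V us v)) z = sign (c * a) s + sign (?X * ?U + (?X + c) * a) A2"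
      unfolding brT_gen[OF x us V.grd_homog[OF v]] using l
      by (simp add: lin_add[OF l1] lin_sum[OF l1] lin_sign[OF l1] ad_map_gen[OF _ v z] ad_map_gen[OF l(2) av z]
          actL_wedge adL_wedge A2_def s_def sign_sum add.commute)
    have 3: "ad_map (genW n N V us v) (adL (wedge m N xs) z) = sign (c * (?X + a)) A3"
      using ad_map_gen[OF l(2) v brk_grd[OF xs(1) z]] l by (simp add: adL_wedge A3_def)
    show ?thesis unfolding 1 2 3 ax using xs(2) r
      by (cases "even a"; cases "even c"; cases "even ?U"; cases "even ?X"; simp add: sign_def)
  qed
  have h: "actL x (ad_map w z) = ad_map (brT x w) z + sign (q * r) (ad_map w (adL x z))" if z: "z \<in> grd N a" for z a
    using assms(1)
  proof (rule N.EG_lin_eq[OF V.vsS, rotated 3])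
    show "lin fscale sV (\<lambda>x. actL x (ad_map w z))" by (rule fun_scale_lin_at[OF actL_lin1])
    show "lin fscale sV (\<lambda>x. ad_map (brT x w) z + sign (q * r) (ad_map w (adL x z)))"
      by (intro lin_addI lin_signI V.vsS lin_comp[OF l1 brT_lin1] lin_comp[OF ad_map_lin fun_scale_lin_at[OF adL_lin1]])
    fix xs assume xs: "xs \<in> hlists m N" "even (parl N xs) = even q"
    show "actL (wedge m N xs) (ad_map w z) = ad_map (brT (wedge m N xs) w) z + sign (q * r) (ad_map w (adL (wedge m N xs) z))"
      using assms(2)
    proof (induction rule: Wg_induct)
      case (gen us v c) then show ?case by (intro g[OF xs _ _ _ z])
    next
      case (add w w')
      then show ?case by (simp add: lin_add[OF l1] lin_add[OF brT_lin2] lin_add[OF actL_lin] sign_add)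
    next
      case (scale c w)
      then show ?case by (simp add: lin_scale[OF l1] lin_scale[OF brT_lin2] lin_scale[OF actL_lin] vs_add[OF V.vsS] vs_sign[OF V.vsS])
    qed (simp add: lin_0[OF l1] lin_0[OF brT_lin2] lin_0[OF actL_lin])
  qed
  show ?thesis
    by (rule N.lin_eq_homog[where sB = sV, OF _ _ h])
      (assumption | intro lin_addI lin_signI V.vsS lin_comp[OF actL_lin ad_map_lin] ad_map_lin lin_comp[OF ad_map_lin adL_lin])+
qed

lemma act_front:
  assumes "us \<in> hlists m0 N" "u \<in> grd N b"
  shows "act V (u # us) v = sign (m0 + b * parl N us) (act V (us @ [u]) v)"
  using N.sskew_move_end[OF act_sskew assms(2), of us "[]" v] assms(1) m_eq by (simp add: hlists_def)

lemma ad_map_insW: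
  assumes ys: "ys \<in> hlists m N" and i: "i < m" and v: "v \<in> grd V c" and z: "z \<in> grd N a"
  shows "ad_map (insW n N V ys i v) z = sign (m - Suc i + c * (parl N (drop (Suc i) ys) + a)) (act V (del i ys @ [z]) v)"
  unfolding insW_gen[OF ys i v] using del_hlists[OF ys i]
  by (simp add: lin_sign[OF fun_scale_lin_at[OF ad_map_lin1]] ad_map_gen[OF _ v z] hlists_def algebra_simps)

text \<open>This is a reformulation of the first module axiom.\<close>

lemma ad_map_derivation:
  assumes "w \<in> Wg s" "y \<in> Lg r"
  shows "ad_map (derV s (ad_map w) y) z = sign (r * s) (actL y (ad_map w z)) - ad_map w (adL y z)"
proof -
  note l1 = fun_scale_lin_at[OF ad_map_lin1]
  have g: "ad_map (derV s (ad_map (genW n N V us v)) (wedge m N ys)) z =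
      sign (r * s) (actL (wedge m N ys) (ad_map (genW n N V us v) z)) - ad_map (genW n N V us v) (adL (wedge m N ys) z)"
    if ys: "ys \<in> hlists m N" "even (parl N ys) = even r" and us: "us \<in> hlists m0 N" and v: "v \<in> grd V c"
      and s: "even (parl N us + c) = even s" and z: "z \<in> grd N a" for ys us v c z a
  proof (cases "z = 0")
    case True
    then show ?thesis by (simp add: lin_0[OF ad_map_lin] lin_0[OF actL_lin] lin_0[OF adL_lin])
  next
    case False
    have l: "length ys = m" "length us = m0" using ys us by (simp_all add: hlists_def)
    let ?w = "genW n N V us v" and ?X = "parl N us" and ?R = "parl N ys"
    let ?A = "\<lambda>i. parl N (drop (Suc i) ys)" and ?B = "\<lambda>i. parl N (take i ys)" and ?e = "\<lambda>i. par N (ys ! i)"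
    define t where "t = (\<lambda>i. act V (del i ys @ [z]) (act V (us @ [ys ! i]) v))"
    define P1 where "P1 = act V ys (act V (us @ [z]) v)"
    define P3 where "P3 = act V (us @ [brk N (ys @ [z])]) v"
    define Q where "Q = (\<Sum>i<m. sign (m - i + ?e i * (?A i + a + ?X)) (t i))"
    have w: "?w \<in> Wg s" by (rule genW_Wg[OF us v s])
    have yi: "ys ! i \<in> grd N (?e i)" if "i < m" for i by (rule nth_grd[OF ys(1) that])
    have "ys @ [z] \<in> hlists n N" using ys N.grd_homog[OF z] n_eq by (auto simp: hlists_def)
    then have "act V (brk N (ys @ [z]) # us) v = (\<Sum>i<Suc m. sV ((-1) ^ (Suc m - Suc i + par N ((ys @ [z]) ! i) * parl N (drop (Suc i) (ys @ [z]))))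
                 (act V (del i (ys @ [z])) (act V ((ys @ [z]) ! i # us) v)))"
      unfolding n_eq[symmetric] by (rule module_law1[OF _ us])
    also have "\<dots> = (\<Sum>i<m. sign (m - i + ?e i * (?A i + par N z)) (act V (del i ys @ [z]) (act V (ys ! i # us) v)))
        + act V ys (act V (z # us) v)"
      using l by (simp add: sign_scale[OF V.vsS] nth_append del_def parl_append parl_Cons parl_Nil)
    also have "(\<Sum>i<m. sign (m - i + ?e i * (?A i + par N z)) (act V (del i ys @ [z]) (act V (ys ! i # us) v))) = sign m0 Q"
      unfolding Q_def sign_sum
    proof (rule sum.cong[OF refl])
      fix i assume "i \<in> {..<m}"
      then have i: "i < m" by simp
      have "act V (del i ys @ [z]) (act V (ys ! i # us) v) = sign (m0 + ?e i * ?X) (t i)"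
        unfolding act_front[OF us yi[OF i]] t_def using del_hlists[OF ys(1) i] m_eq
        by (simp add: lin_sign[OF act_lin] hlists_def)
      then show "sign (m - i + ?e i * (?A i + par N z)) (act V (del i ys @ [z]) (act V (ys ! i # us) v))
          = sign m0 (sign (m - i + ?e i * (?A i + a + ?X)) (t i))"
        using N.par_grd[OF z False] by (simp, intro sign_cong) auto
    qed
    also have "act V ys (act V (z # us) v) = sign (m0 + a * ?X) P1"
      unfolding act_front[OF us z] P1_def by (simp add: lin_sign[OF act_lin[OF l(1)]])
    also have "act V (brk N (ys @ [z]) # us) v = sign (m0 + (?R + a) * ?X) P3"
      unfolding P3_def by (rule act_front[OF us brk_grd[OF ys(1) z]])
    finally have "sign m0 (sign ((?R + a) * ?X) P3) = sign m0 (Q + sign (a * ?X) P1)" by (simp add: sign_add)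
    then have ax: "Q = sign ((?R + a) * ?X) P3 - sign (a * ?X) P1" by (simp only: sign_inj add_diff_cancel)
    have 1: "actL (wedge m N ys) (ad_map ?w z) = sign (c * a) P1"
      by (simp add: ad_map_gen[OF l(2) v z] actL_wedge[OF l(1)] lin_sign[OF act_lin[OF l(1)]] P1_def)
    have 3: "ad_map ?w (adL (wedge m N ys) z) = sign (c * (?R + a)) P3"
      using ad_map_gen[OF l(2) v brk_grd[OF ys(1) z]] l by (simp add: adL_wedge P3_def)
    have "ad_map (derV s (ad_map ?w) (wedge m N ys)) z = (\<Sum>i<m. sign (s * ?B i) (ad_map (insW n N V ys i (ad_map ?w (ys ! i))) z))"
      unfolding derV_wedge[OF ad_map_superhom[OF w] ys(1)] by (simp add: lin_sum[OF l1] lin_sign[OF l1])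
    also have "\<dots> = (\<Sum>i<m. sign (s * (?R + a) + 1) (sign (m - i + ?e i * (?A i + a + ?X)) (t i)))"
    proof (rule sum.cong[OF refl])
      fix i assume "i \<in> {..<m}"
      then have i: "i < m" by simp
      have "ad_map (insW n N V ys i (ad_map ?w (ys ! i))) z
          = sign (m - Suc i + (s + ?e i) * (?A i + a)) (act V (del i ys @ [z]) (ad_map ?w (ys ! i)))"
        by (rule ad_map_insW[OF ys(1) i superhom_grd[OF ad_map_superhom[OF w] yi[OF i]] z])
      also have "act V (del i ys @ [z]) (ad_map ?w (ys ! i)) = sign (c * ?e i) (t i)"
        unfolding t_def ad_map_gen[OF l(2) v yi[OF i]] using del_hlists[OF ys(1) i] m_eq
        by (simp add: lin_sign[OF act_lin] hlists_def)
      finally have "sign (s * ?B i) (ad_map (insW n N V ys i (ad_map ?w (ys ! i))) z)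
          = sign (s * ?B i + (m - Suc i + (s + ?e i) * (?A i + a) + c * ?e i)) (t i)" by simp
      also have "\<dots> = sign (s * (?R + a) + 1 + (m - i + ?e i * (?A i + a + ?X))) (t i)"
      proof (rule sign_cong)
        define j where "j = m - Suc i"
        have j: "m - i = Suc j" unfolding j_def using i by simp
        have R: "?R = ?B i + ?e i + ?A i" by (rule parl_split[OF ys(1) i])
        show "even (s * ?B i + (m - Suc i + (s + ?e i) * (?A i + a) + c * ?e i)) =
            even (s * (?R + a) + 1 + (m - i + ?e i * (?A i + a + ?X)))"
          unfolding j_def[symmetric] j R using s by (cases "even ?X"; cases "even c"; cases "even (?e i)"; cases "even (?A i)"; cases "even a"; simp)
      qed
      finally show "sign (s * ?B i) (ad_map (insW n N V ys i (ad_map ?w (ys ! i))) z)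
          = sign (s * (?R + a) + 1) (sign (m - i + ?e i * (?A i + a + ?X)) (t i))" by simp
    qed
    also have "\<dots> = sign (s * (?R + a) + 1) Q" by (simp only: Q_def sign_sum)
    finally show ?thesis unfolding 1 3 ax using ys(2) s
      by (cases "even a"; cases "even c"; cases "even ?X"; cases "even ?R"; simp add: sign_def)
  qed
  have h: "ad_map (derV s (ad_map w) y) z = sign (r * s) (actL y (ad_map w z)) - ad_map w (adL y z)" if z: "z \<in> grd N a" for z a
    using assms(2)
  proof (rule N.EG_lin_eq[OF V.vsS, rotated 3])
    show "lin fscale sV (\<lambda>y. ad_map (derV s (ad_map w) y) z)" by (rule lin_comp[OF l1 derV_lin2])
    show "lin fscale sV (\<lambda>y. sign (r * s) (actL y (ad_map w z)) - ad_map w (adL y z))"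
      by (intro lin_diffI lin_signI V.vsS fun_scale_lin_at[OF actL_lin1] lin_comp[OF ad_map_lin fun_scale_lin_at[OF adL_lin1]])
    fix ys assume ys: "ys \<in> hlists m N" "even (parl N ys) = even r"
    note d = lin_comp[OF derV_lin1 ad_map_lin1]
    show "ad_map (derV s (ad_map w) (wedge m N ys)) z = sign (r * s) (actL (wedge m N ys) (ad_map w z)) - ad_map w (adL (wedge m N ys) z)"
      using assms(1)
    proof (induction rule: Wg_induct)
      case (gen us v c) then show ?case by (intro g[OF ys _ _ _ z])
    next
      case (add w w')
      then show ?case by (simp only: lin_add[OF d]) (simp add: lin_add[OF l1] lin_add[OF actL_lin] sign_add)
    next
      case (scale c w)
      then show ?case by (simp only: lin_scale[OF d])
        (simp add: lin_scale[OF l1] lin_scale[OF actL_lin] vs_diff[OF V.vsS] vs_sign[OF V.vsS])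
    qed (simp only: lin_0[OF d], simp add: lin_0[OF l1] lin_0[OF actL_lin])
  qed
  show ?thesis
    by (rule N.lin_eq_homog[where sB = sV, OF _ _ h])
      (assumption | intro lin_diffI lin_signI V.vsS lin_comp[OF actL_lin ad_map_lin] ad_map_lin lin_comp[OF ad_map_lin adL_lin])+
qed

lemma ad_map_derV_wedge:
  assumes \<phi>: "superhom N V p \<phi>" and ys: "ys \<in> hlists m N" and z: "z \<in> grd N a"
  shows "- ad_map (derV p \<phi> (wedge m N ys)) z = (\<Sum>i<m. sign (i + 1 + ((p + parl N (drop (Suc i) ys)) * (par N (ys ! i) + parl N ys)
     + a * (p + parl N ys) + parl N ys * parl N (drop (Suc i) ys))) (act V (z # del i ys) (\<phi> (ys ! i))))"
proof -
  note l1 = fun_scale_lin_at[OF ad_map_lin1]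
  have "- ad_map (derV p \<phi> (wedge m N ys)) z = (\<Sum>i<m. sign (1 + p * parl N (take i ys)) (ad_map (insW n N V ys i (\<phi> (ys ! i))) z))"
    unfolding derV_wedge[OF \<phi> ys] lin_sum[OF l1] lin_sign[OF l1] sum_negf[symmetric]
    by (intro sum.cong refl) (simp add: sign_def)
  also have "\<dots> = (\<Sum>i<m. sign (i + 1 + ((p + parl N (drop (Suc i) ys)) * (par N (ys ! i) + parl N ys)
     + a * (p + parl N ys) + parl N ys * parl N (drop (Suc i) ys))) (act V (z # del i ys) (\<phi> (ys ! i))))"
  proof (rule sum.cong[OF refl])
    fix i assume "i \<in> {..<m}"
    then have i: "i < m" by simp
    let ?A = "parl N (drop (Suc i) ys)" and ?B = "parl N (take i ys)" and ?e = "par N (ys ! i)"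
    have R: "parl N ys = ?B + ?e + ?A" by (rule parl_split[OF ys i])
    have 1: "ad_map (insW n N V ys i (\<phi> (ys ! i))) z = sign (m - Suc i + (p + ?e) * (?A + a)) (act V (del i ys @ [z]) (\<phi> (ys ! i)))"
      by (rule ad_map_insW[OF ys i superhom_grd[OF \<phi> nth_grd[OF ys i]] z])
    have 2: "act V (z # del i ys) (\<phi> (ys ! i)) = sign (m0 + a * (?B + ?A)) (act V (del i ys @ [z]) (\<phi> (ys ! i)))"
      using act_front[OF del_hlists[OF ys i] z] by (simp add: parl_del)
    define j where "j = m - Suc i"
    have j: "m0 = j + i" unfolding j_def using i m_eq by simp
    show "sign (1 + p * ?B) (ad_map (insW n N V ys i (\<phi> (ys ! i))) z)
      = sign (i + 1 + ((p + ?A) * (?e + parl N ys) + a * (p + parl N ys) + parl N ys * ?A)) (act V (z # del i ys) (\<phi> (ys ! i)))"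
      unfolding 1 2 R sign_sign j_def[symmetric] j
      by (intro sign_cong) (cases "even p"; cases "even ?e"; cases "even ?A"; cases "even ?B"; cases "even i"; cases "even a"; simp)
  qed
  finally show ?thesis .
qed

end

section \<open>Cochains of graded Leibniz algebras\<close>

lemma word_der_Cons_sign:
  assumes c: "lin sM sM c" and f: "mlin (Suc (length xs)) sL sM f" and x: "t x = sign e x"
  shows "word_der t A (\<lambda>x. x) c f (x # xs) = f (A x # xs) + sign e (word_der t A (\<lambda>x. x) c (\<lambda>ys. f (x # ys)) xs)"
proof -
  have "word_der t A (\<lambda>x. x) c (\<lambda>ys. f (t x # ys)) xs = word_der t A (\<lambda>x. x) c (\<lambda>ys. sign e (f (x # ys))) xs"
    by (rule word_der_cong) (simp add: x lin_sign[OF mlin_hd[OF f]])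
  then show ?thesis by (simp add: word_der_sign[OF c])
qed

text \<open>The parity projections \<open>pi 0\<close> and \<open>pi 1\<close> need not add up to the identity, because the algebra may
  be a proper subspace of the type.\<close>

locale leibniz_superalgebra =
  fixes sL :: "'k::field \<Rightarrow> 'l::ab_group_add \<Rightarrow> 'l" and Lg :: "nat \<Rightarrow> 'l set"
    and pi :: "nat \<Rightarrow> 'l \<Rightarrow> 'l" and b :: "'l \<Rightarrow> 'l \<Rightarrow> 'l"
  assumes vsL: "vector_space sL"
    and pi_lin: "lin sL sL (pi q)" and pi_in: "pi q x \<in> Lg q"
    and pi_hom: "x \<in> Lg a \<Longrightarrow> pi q x = (if even (q + a) then x else 0)"
    and b_lin1: "lin sL sL (\<lambda>x. b x y)" and b_lin2: "lin sL sL (b x)"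
    and b_in: "x \<in> Lg q \<Longrightarrow> y \<in> Lg s \<Longrightarrow> b x y \<in> Lg (q + s)"
    and leibniz: "x \<in> Lg q \<Longrightarrow> y \<in> Lg s \<Longrightarrow> z \<in> Lg e \<Longrightarrow> b x (b y z) = b (b x y) z + sign (q * s) (b y (b x z))"
begin

definition tau :: "nat \<Rightarrow> 'l \<Rightarrow> 'l"
  where "tau q x = pi 0 x + sign q (pi 1 x)"

lemma tau_lin: "lin sL sL (tau q)"
  unfolding tau_def by (intro lin_addI lin_signI vsL pi_lin)

lemma tau_hom: "x \<in> Lg a \<Longrightarrow> tau q x = sign (q * a) x"
  by (cases "even a"; cases "even q") (simp_all add: tau_def pi_hom sign_def)

lemma tau_parity: "even q = even q' \<Longrightarrow> tau q = tau q'"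
  by (simp add: tau_def fun_eq_iff cong: sign_cong)

abbreviation graded :: "'l list \<Rightarrow> nat list \<Rightarrow> bool"
  where "graded \<equiv> list_all2 (\<lambda>z e. z \<in> Lg e)"

end

text \<open>An element \<open>x\<close> of parity \<open>q\<close> acts on \<open>w\<close> of parity \<open>p\<close> from the left by \<open>l x w\<close> minus
  \<open>(-1)\<^sup>p\<^sup>q c x w\<close>, which on \<open>Hom(N,V)\<close> are the compositions with \<open>ad(x)\<close> on either side, and from the right by
  \<open>r p w x\<close>.\<close>

locale leibniz_premodule = leibniz_superalgebra sL Lg pi b
  for sL :: "'k::field \<Rightarrow> 'l::ab_group_add \<Rightarrow> 'l" and Lg pi b +
  fixes sM :: "'k \<Rightarrow> 'm::ab_group_add \<Rightarrow> 'm" and M0 :: "'m set" and Mh :: "nat \<Rightarrow> 'm set"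
    and l :: "'l \<Rightarrow> 'm \<Rightarrow> 'm" and c :: "'l \<Rightarrow> 'm \<Rightarrow> 'm" and r :: "nat \<Rightarrow> 'm \<Rightarrow> 'l \<Rightarrow> 'm"
  assumes vsM: "vector_space sM"
    and l_lin1: "lin sL sM (\<lambda>x. l x w)" and l_lin2: "lin sM sM (l x)"
    and c_lin1: "w \<in> M0 \<Longrightarrow> lin sL sM (\<lambda>x. c x w)" and c_lin2: "lin sM sM (c x)"
    and r_lin1: "w \<in> M0 \<Longrightarrow> lin sL sM (r p w)" and r_lin2: "lin sM sM (\<lambda>w. r p w x)"
    and r_parity: "even p = even p' \<Longrightarrow> r p = r p'"
    and M0_add: "v \<in> M0 \<Longrightarrow> w \<in> M0 \<Longrightarrow> v + w \<in> M0" and M0_neg: "w \<in> M0 \<Longrightarrow> - w \<in> M0" and M0_0: "0 \<in> M0"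
    and l_M0: "w \<in> M0 \<Longrightarrow> l x w \<in> M0" and c_M0: "w \<in> M0 \<Longrightarrow> c x w \<in> M0" and r_M0: "w \<in> M0 \<Longrightarrow> r p w x \<in> M0"
    and Mh_add: "v \<in> Mh p \<Longrightarrow> w \<in> Mh p \<Longrightarrow> v + w \<in> Mh p" and Mh_neg: "w \<in> Mh p \<Longrightarrow> - w \<in> Mh p"
    and Mh_cong: "even p = even p' \<Longrightarrow> Mh p = Mh p'"
    and l_Mh: "x \<in> Lg q \<Longrightarrow> w \<in> Mh p \<Longrightarrow> l x w \<in> Mh (p + q)"
    and c_Mh: "x \<in> Lg q \<Longrightarrow> w \<in> Mh p \<Longrightarrow> c x w \<in> Mh (p + q)"
    and r_Mh: "x \<in> Lg q \<Longrightarrow> w \<in> Mh p \<Longrightarrow> w \<in> M0 \<Longrightarrow> r p w x \<in> Mh (p + q)"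
begin

text \<open>Here \<open>q\<close> is the parity of \<open>x\<close> and \<open>p\<close> that of \<open>f\<close>.\<close>

definition lie_der :: "nat \<Rightarrow> nat \<Rightarrow> 'l \<Rightarrow> ('l list \<Rightarrow> 'm) \<Rightarrow> 'l list \<Rightarrow> 'm"
  where "lie_der p q x f X = l x (f X) - sign (q * p) (word_der (tau q) (b x) (\<lambda>x. x) (c x) f X)"

text \<open>The coboundary, defined by the Cartan formula: contracting its first argument with a homogeneous
  \<open>x\<close> gives the Lie derivative along \<open>x\<close> minus the coboundary of the contraction.\<close>

fun coboundary :: "nat \<Rightarrow> ('l list \<Rightarrow> 'm) \<Rightarrow> 'l list \<Rightarrow> 'm" where
  "coboundary p f [] = 0"
| "coboundary p f [x] = r p (f []) x"
| "coboundary p f (x # y # X) =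
    lie_der p 0 (pi 0 x) f (y # X) - coboundary p (\<lambda>Z. f (pi 0 x # Z)) (y # X)
    + (sign p (lie_der p 1 (pi 1 x) f (y # X)) - coboundary (Suc p) (\<lambda>Z. f (pi 1 x # Z)) (y # X))"

definition cochain :: "nat \<Rightarrow> ('l list \<Rightarrow> 'm) \<Rightarrow> bool"
  where "cochain k f \<longleftrightarrow> mlin k sL sM f \<and> (\<forall>Z. length Z = k \<longrightarrow> f Z \<in> M0)"

definition hom :: "nat \<Rightarrow> nat \<Rightarrow> ('l list \<Rightarrow> 'm) \<Rightarrow> bool"
  where "hom k p f \<longleftrightarrow> (\<forall>Z es. length Z = k \<longrightarrow> graded Z es \<longrightarrow> f Z \<in> Mh (p + sum_list es))"

lemma M0_sign: "w \<in> M0 \<Longrightarrow> sign e w \<in> M0" and M0_diff: "v \<in> M0 \<Longrightarrow> w \<in> M0 \<Longrightarrow> v - w \<in> M0"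
  using M0_neg M0_add[of v "- w"] by (auto simp: sign_def)

lemma Mh_sign: "w \<in> Mh p \<Longrightarrow> sign e w \<in> Mh p" and Mh_diff: "v \<in> Mh p \<Longrightarrow> w \<in> Mh p \<Longrightarrow> v - w \<in> Mh p"
  using Mh_neg Mh_add[of v p "- w"] by (auto simp: sign_def)

lemma cochain_mlin: "cochain k f \<Longrightarrow> mlin k sL sM f" and cochain_M0: "cochain k f \<Longrightarrow> length Z = k \<Longrightarrow> f Z \<in> M0"
  by (simp_all add: cochain_def)

lemma cochain_Cons: "cochain (Suc k) f \<Longrightarrow> cochain k (\<lambda>Z. f (x # Z))"
  by (simp add: cochain_def mlin_Cons)

lemma hom_Cons: "hom (Suc k) p f \<Longrightarrow> x \<in> Lg q \<Longrightarrow> hom k (p + q) (\<lambda>Z. f (x # Z))"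
  unfolding hom_def
proof (intro allI impI)
  fix Z es
  assume h: "\<forall>Z es. length Z = Suc k \<longrightarrow> graded Z es \<longrightarrow> f Z \<in> Mh (p + sum_list es)"
    and x: "x \<in> Lg q" and Z: "length Z = k" "graded Z es"
  have "graded (x # Z) (q # es)" "length (x # Z) = Suc k" using x Z by simp_all
  then have "f (x # Z) \<in> Mh (p + sum_list (q # es))" using h by blast
  then show "f (x # Z) \<in> Mh (p + q + sum_list es)" by (simp add: add.assoc)
qed

lemma hom_Nil: "hom 0 p f \<Longrightarrow> f [] \<in> Mh p"
  unfolding hom_def by (drule spec[of _ "[]"], drule spec[of _ "[]"]) simp

lemma lie_der_cong: "(\<And>Z. length Z = length X \<Longrightarrow> f Z = g Z) \<Longrightarrow> lie_der p q x f X = lie_der p q x g X"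
  unfolding lie_der_def using word_der_cong[of X f g] by simp

lemma lie_der_parity: "even p = even p' \<Longrightarrow> even q = even q' \<Longrightarrow> lie_der p q = lie_der p' q'"
  by (intro ext) (simp add: lie_der_def tau_parity[of q q'] sign_def)

lemma lie_der_diff: "lie_der p q x (\<lambda>Z. f Z - g Z) X = lie_der p q x f X - lie_der p q x g X"
  unfolding lie_der_def using word_der_add[of "c x" "tau q" "b x" "\<lambda>x. x" "\<lambda>Z. f Z - g Z" g X]
  by (simp add: lin_diff[OF l_lin2] lin_add[OF c_lin2] sign_add sign_diff algebra_simps)

lemma lie_der_sign: "lie_der p q x (\<lambda>Z. sign e (f Z)) X = sign e (lie_der p q x f X)"
  unfolding lie_der_def word_der_sign[OF c_lin2] by (simp add: lin_sign[OF l_lin2] sign_diff add.commute)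

lemma lie_der_lin1: assumes "cochain (length X) f" shows "lin sL sM (\<lambda>x. lie_der p q x f X)"
  unfolding lie_der_def using assms
  by (intro lin_diffI lin_signI vsM l_lin1 word_der_lin_A[OF vsM b_lin1] c_lin1) (auto simp: cochain_def)

lemma lie_der_mlin: "mlin k sL sM f \<Longrightarrow> mlin k sL sM (lie_der p q x f)"
  unfolding lie_der_def
  by (intro mlin_diffI mlin_signI vsM mlin_comp[OF l_lin2] word_der_mlin[OF vsM tau_lin b_lin2 lin_id c_lin2])

lemma lie_der_lin_f: "(\<And>Z. length Z = length X \<Longrightarrow> lin sX sM (\<lambda>p. f p Z)) \<Longrightarrow> lin sX sM (\<lambda>y. lie_der p q x (f y) X)"
  unfolding lie_der_def by (intro lin_diffI lin_signI vsM lin_comp[OF l_lin2] word_der_lin_f c_lin2) auto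

lemma lie_der_Cons:
  assumes "y \<in> Lg s" "mlin (Suc (length Z)) sL sM f"
  shows "lie_der p q x f (y # Z) = lie_der (p + s) q x (\<lambda>Z. f (y # Z)) Z - sign (q * p) (f (b x y # Z))"
  unfolding lie_der_def word_der_Cons_sign[where t = "tau q", OF c_lin2 assms(2) tau_hom[OF assms(1)]]
  by (simp add: sign_add algebra_simps)

lemma lie_der_M0: assumes "cochain (length X) f" shows "lie_der p q x f X \<in> M0"
proof -
  have "word_der (tau q) (b x) (\<lambda>x. x) (c x) f X \<in> M0" using assms
  proof (induction X arbitrary: f)
    case Nil then show ?case by (simp add: c_M0 cochain_M0)
  next
    case (Cons y X)
    have "word_der (tau q) (b x) (\<lambda>x. x) (c x) (\<lambda>Z. f (tau q y # Z)) X \<in> M0"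
      using Cons.prems by (intro Cons.IH cochain_Cons) simp
    moreover have "f (b x y # X) \<in> M0" using Cons.prems by (simp add: cochain_M0)
    ultimately show ?case by (simp add: M0_add)
  qed
  then show ?thesis unfolding lie_der_def using cochain_M0[OF assms refl] by (intro M0_diff M0_sign l_M0)
qed

lemma lie_der_cochain: "cochain k f \<Longrightarrow> cochain k (lie_der p q x f)"
  using lie_der_mlin lie_der_M0 by (auto simp: cochain_def)

lemma lie_der_hom:
  assumes x: "x \<in> Lg q"
  shows "cochain (length Z) f \<Longrightarrow> hom (length Z) p f \<Longrightarrow> graded Z es \<Longrightarrow> lie_der p q x f Z \<in> Mh (p + q + sum_list es)"
proof (induction Z arbitrary: f p es)
  case Nil
  then have "f [] \<in> Mh p" by (simp add: hom_Nil)
  then show ?case using Nil x by (auto simp: lie_der_def intro!: Mh_diff Mh_sign l_Mh c_Mh)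
next
  case (Cons z Z)
  obtain e es' where es: "es = e # es'" "z \<in> Lg e" "graded Z es'" using Cons.prems(3) by (auto simp: list_all2_Cons1)
  have "lie_der (p + e) q x (\<lambda>Z. f (z # Z)) Z \<in> Mh (p + e + q + sum_list es')"
    using Cons.prems es by (intro Cons.IH cochain_Cons hom_Cons) simp_all
  moreover have "f (b x z # Z) \<in> Mh (p + sum_list ((q + e) # es'))"
  proof -
    have "graded (b x z # Z) ((q + e) # es')" "length (b x z # Z) = length (z # Z)" using es b_in[OF x] by simp_all
    then show ?thesis using Cons.prems(2) unfolding hom_def by blast
  qed
  ultimately show ?case
    using Cons.prems es by (subst lie_der_Cons[OF es(2)]) (auto intro!: Mh_diff Mh_sign simp: cochain_mlin ac_simps)
qed

lemma coboundary_cong: "(\<And>Z. Suc (length Z) = length X \<Longrightarrow> f Z = g Z) \<Longrightarrow> coboundary p f X = coboundary p g X"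
proof (induction p f X arbitrary: g rule: coboundary.induct)
  case (3 p f x y X)
  have "lie_der p q z f (y # X) = lie_der p q z g (y # X)" for q z by (rule lie_der_cong) (simp add: 3(3))
  moreover have "coboundary p (\<lambda>Z. f (pi 0 x # Z)) (y # X) = coboundary p (\<lambda>Z. g (pi 0 x # Z)) (y # X)"
    "coboundary (Suc p) (\<lambda>Z. f (pi 1 x # Z)) (y # X) = coboundary (Suc p) (\<lambda>Z. g (pi 1 x # Z)) (y # X)"
    by (intro 3(1,2); simp add: 3(3))+
  ultimately show ?case by simp
qed simp_all

lemma coboundary_diff: "coboundary p (\<lambda>Z. f Z - g Z) X = coboundary p f X - coboundary p g X"
proof (induction p f X arbitrary: g rule: coboundary.induct)
  case (3 p f x y X)
  show ?case unfolding coboundary.simps lie_der_diff 3 by (simp add: sign_diff algebra_simps)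
qed (simp_all add: lin_diff[OF r_lin2])

lemma coboundary_sign: "coboundary p (\<lambda>Z. sign e (f Z)) X = sign e (coboundary p f X)"
proof (induction p f X rule: coboundary.induct)
  case (3 p f x y X)
  show ?case unfolding coboundary.simps lie_der_sign 3 by (simp add: sign_diff sign_add ac_simps)
qed (simp_all add: lin_sign[OF r_lin2])

lemma coboundary_lin_f: "(\<And>Z. Suc (length Z) = length X \<Longrightarrow> lin sX sM (\<lambda>y. f y Z)) \<Longrightarrow> lin sX sM (\<lambda>y. coboundary p (f y) X)"
proof (induction X arbitrary: f p rule: length_induct)
  case (1 X)
  show ?case
  proof (cases X)
    case Nil then show ?thesis by (simp add: lin_zeroI[OF vsM])
  next
    case (Cons x Y)
    show ?thesis
    proof (cases Y)
      case Nil then show ?thesis using Cons lin_comp[OF r_lin2 1(2)] by simp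
    next
      case (Cons y Z)
      have "lin sX sM (\<lambda>y'. coboundary p' (\<lambda>Z. f y' (w # Z)) (y # Z))" for p' w
        using 1 \<open>X = x # Y\<close> Cons by simp
      moreover have "lin sX sM (\<lambda>y'. lie_der p q w (f y') (y # Z))" for q w
        using 1(2) \<open>X = x # Y\<close> Cons by (intro lie_der_lin_f) simp
      ultimately show ?thesis unfolding \<open>X = x # Y\<close> Cons coboundary.simps by (intro lin_addI lin_diffI lin_signI vsM)
    qed
  qed
qed

lemma coboundary_mlin: "cochain k f \<Longrightarrow> mlin (Suc k) sL sM (coboundary p f)"
proof (induction k arbitrary: f p)
  case 0
  then have "f [] \<in> M0" by (simp add: cochain_M0)
  then show ?case by (intro mlin_SucI) (simp_all add: r_lin1)
next
  case (Suc k)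
  let ?F = "\<lambda>x Z. lie_der p 0 (pi 0 x) f Z - coboundary p (\<lambda>Z. f (pi 0 x # Z)) Z
    + (sign p (lie_der p 1 (pi 1 x) f Z) - coboundary (Suc p) (\<lambda>Z. f (pi 1 x # Z)) Z)"
  have F: "coboundary p f (x # Z) = ?F x Z" if "length Z = Suc k" for x Z
    using that by (cases Z) simp_all
  show ?case
  proof (rule mlin_SucI)
    fix X :: "'l list" assume X: "length X = Suc k"
    have "lin sL sM (\<lambda>x. lie_der p q (pi q x) f X)" for q
      using lin_comp[OF lie_der_lin1 pi_lin] Suc.prems X by simp
    moreover have "lin sL sM (\<lambda>x. coboundary p' (\<lambda>Z. f (pi q x # Z)) X)" for q p'
      using X by (intro coboundary_lin_f lin_comp[OF mlin_hd[OF cochain_mlin[OF Suc.prems]] pi_lin]) simp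
    ultimately have "lin sL sM (\<lambda>x. ?F x X)" by (intro lin_addI lin_diffI lin_signI vsM)
    then show "lin sL sM (\<lambda>x. coboundary p f (x # X))" by (simp only: F X)
  next
    fix x
    have "mlin (Suc k) sL sM (?F x)"
      using Suc.prems by (intro mlin_addI mlin_diffI mlin_signI vsM lie_der_mlin cochain_mlin Suc.IH cochain_Cons)
    then show "mlin (Suc k) sL sM (\<lambda>X. coboundary p f (x # X))" by (rule mlin_cong[rotated]) (simp only: F)
  qed
qed

lemma coboundary_M0: "cochain k f \<Longrightarrow> length X = Suc k \<Longrightarrow> coboundary p f X \<in> M0"
proof (induction k arbitrary: f p X)
  case 0
  then obtain x where "X = [x]" by (auto simp: length_Suc_conv)
  then show ?case using 0 by (simp add: r_M0 cochain_M0)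
next
  case (Suc k)
  then obtain x y Z where X: "X = x # y # Z" "length Z = k" by (auto simp: length_Suc_conv)
  have "lie_der p q w f (y # Z) \<in> M0" for q w using lie_der_M0[of "y # Z" f p q w] Suc.prems X by simp
  moreover have "coboundary p' (\<lambda>Z. f (w # Z)) (y # Z) \<in> M0" for p' w
    using Suc.prems X by (intro Suc.IH cochain_Cons) simp_all
  ultimately show ?case unfolding X(1) coboundary.simps by (intro M0_add M0_diff M0_sign)
qed

lemma coboundary_cochain: "cochain k f \<Longrightarrow> cochain (Suc k) (coboundary p f)"
  using coboundary_mlin coboundary_M0 by (auto simp: cochain_def)

lemma coboundary_parity: "even p = even p' \<Longrightarrow> coboundary p f X = coboundary p' f X"
proof (induction p f X arbitrary: p' rule: coboundary.induct)
  case (2 p f x) then show ?case using r_parity[of p p'] by simp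
next
  case (3 p f x y X)
  have "coboundary (Suc p) (\<lambda>Z. f (pi 1 x # Z)) (y # X) = coboundary (Suc p') (\<lambda>Z. f (pi 1 x # Z)) (y # X)"
    using 3(3) by (intro 3(2)) simp
  then show ?case using 3(1,3) lie_der_parity[OF 3(3) refl, of 0] lie_der_parity[OF 3(3) refl, of 1]
    by (simp add: sign_def)
qed simp

lemma coboundary_Cons:
  assumes f: "cochain (length Z) f" and x: "x \<in> Lg q" and Z: "Z \<noteq> []"
  shows "coboundary p f (x # Z) = sign (q * p) (lie_der p q x f Z) - coboundary (p + q) (\<lambda>Z. f (x # Z)) Z"
proof -
  obtain y Y where Y: "Z = y # Y" using Z by (cases Z) auto
  have 0: "lie_der p e 0 f (y # Y) = 0" for e
    using lin_0[OF lie_der_lin1, of "y # Y" f] f Y by simp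
  have 1: "coboundary p' (\<lambda>Z. f (0 # Z)) (y # Y) = 0" for p'
  proof -
    have "coboundary p' (\<lambda>Z. f (0 # Z)) (y # Y) = coboundary p' (\<lambda>Z. f (0 # Z) - f (0 # Z)) (y # Y)"
      using lin_0[OF mlin_hd[of _ sL sM f]] cochain_mlin[OF f] Y by (intro coboundary_cong) simp
    also have "\<dots> = 0" unfolding coboundary_diff by simp
    finally show ?thesis .
  qed
  show ?thesis
    using coboundary_parity[of "p + q" p "\<lambda>Z. f (x # Z)" Z] coboundary_parity[of "p + q" "Suc p" "\<lambda>Z. f (x # Z)" Z] lie_der_parity[OF refl, of q 0 p] lie_der_parity[OF refl, of q 1 p]
    unfolding Y coboundary.simps pi_hom[OF x] by (cases "even q") (simp_all add: 0 1 sign_def)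
qed

lemma coboundary_hom:
  "cochain k f \<Longrightarrow> hom k p f \<Longrightarrow> hom (Suc k) p (coboundary p f)"
proof (induction k arbitrary: f p)
  case 0
  have "coboundary p f Z \<in> Mh (p + sum_list es)" if lZ: "length Z = Suc 0" and gZ: "graded Z es" for Z es
  proof -
    obtain x where "Z = [x]" using lZ by (auto simp: length_Suc_conv)
    moreover from this obtain e where "es = [e]" "x \<in> Lg e" using gZ by (auto simp: list_all2_Cons1)
    moreover have "f [] \<in> Mh p" using 0 by (simp add: hom_Nil)
    ultimately show ?thesis using 0 by (simp add: r_Mh cochain_M0)
  qed
  then show ?case unfolding hom_def by blast
next
  case (Suc k)
  have "coboundary p f X \<in> Mh (p + sum_list es)" if l: "length X = Suc (Suc k)" and g: "graded X es" for X es
  proof -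
    obtain x Z e es' where X: "X = x # Z" "es = e # es'" "x \<in> Lg e" "graded Z es'" "length Z = Suc k"
      using l g by (cases X; cases es) auto
    have 1: "hom (Suc k) (p + e) (coboundary (p + e) (\<lambda>Z. f (x # Z)))"
      using Suc.prems X by (intro Suc.IH cochain_Cons hom_Cons)
    have "lie_der p e x f Z \<in> Mh (p + e + sum_list es')" using Suc.prems X by (intro lie_der_hom) simp_all
    moreover have "coboundary (p + e) (\<lambda>Z. f (x # Z)) Z \<in> Mh (p + e + sum_list es')"
      using 1 X unfolding hom_def by blast
    moreover have "Z \<noteq> []" "cochain (length Z) f" using X Suc.prems by auto
    ultimately show ?thesis unfolding X(1,2)
      by (subst coboundary_Cons[OF _ X(3)]) (auto intro!: Mh_diff Mh_sign simp: ac_simps)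
  qed
  then show ?case unfolding hom_def by blast
qed

end

text \<open>The assumptions are those needed in the lowest degrees; the identities are carried to all
  degrees by the Cartan formula.\<close>

locale leibniz_module = leibniz_premodule sL Lg pi b sM M0 Mh l c r
  for sL :: "'k::field \<Rightarrow> 'l::ab_group_add \<Rightarrow> 'l" and Lg pi b
    and sM :: "'k \<Rightarrow> 'm::ab_group_add \<Rightarrow> 'm" and M0 Mh l c r +
  assumes lc: "x \<in> Lg q \<Longrightarrow> y \<in> Lg s \<Longrightarrow> w \<in> M0 \<Longrightarrow>
      lie_der (p + s) q x (\<lambda>_. lie_der p s y (\<lambda>_. w) []) [] - sign (q * s) (lie_der (p + q) s y (\<lambda>_. lie_der p q x (\<lambda>_. w) []) [])
      = lie_der p (q + s) (b x y) (\<lambda>_. w) []"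
    and rc: "x \<in> Lg q \<Longrightarrow> y \<in> Lg s \<Longrightarrow> w \<in> M0 \<Longrightarrow> w \<in> Mh p \<Longrightarrow>
      lie_der (p + s) q x (\<lambda>_. r p w y) [] - sign (q * p) (r p w (b x y)) = r (p + q) (lie_der p q x (\<lambda>_. w) []) y"
    and rr: "x \<in> Lg q \<Longrightarrow> y \<in> Lg s \<Longrightarrow> w \<in> M0 \<Longrightarrow> w \<in> Mh p \<Longrightarrow>
      r (p + q) (r p w x - sign (q * p) (lie_der p q x (\<lambda>_. w) [])) y = 0"
begin

lemma lie_der_Nil: "lie_der p q x f [] = lie_der p q x (\<lambda>_. f []) []"
  by (rule lie_der_cong) simp

lemma lie_der_commutator:
  assumes x: "x \<in> Lg q" and y: "y \<in> Lg s"
  shows "cochain (length Z) f \<Longrightarrow> graded Z es \<Longrightarrow>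
    lie_der (p + s) q x (lie_der p s y f) Z - sign (q * s) (lie_der (p + q) s y (lie_der p q x f) Z) = lie_der p (q + s) (b x y) f Z"
proof (induction Z arbitrary: f p es)
  case Nil
  then show ?case using lc[OF x y cochain_M0[OF Nil(1)], of "[]" p]
    by (simp add: lie_der_Nil[of _ _ _ f] lie_der_Nil[of _ _ _ "lie_der _ _ _ f"])
next
  case (Cons z Z)
  obtain e es' where z: "z \<in> Lg e" "graded Z es'" using Cons.prems(2) by (auto simp: list_all2_Cons1)
  have f: "cochain (Suc (length Z)) f" using Cons.prems by simp
  note ml = cochain_mlin[OF f]
  have IH: "lie_der (p + e + s) q x (lie_der (p + e) s y (\<lambda>Z. f (z # Z))) Z - sign (q * s) (lie_der (p + e + q) s y (lie_der (p + e) q x (\<lambda>Z. f (z # Z))) Z)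
      = lie_der (p + e) (q + s) (b x y) (\<lambda>Z. f (z # Z)) Z"
    by (rule Cons.IH[OF cochain_Cons[OF f] z(2)])
  have two: "lie_der (p + s) q x (lie_der p s y f) (z # Z) =
      lie_der (p + e + s) q x (lie_der (p + e) s y (\<lambda>Z. f (z # Z))) Z
      - sign (s * p) (lie_der (p + e + s) q x (\<lambda>Z. f (b y z # Z)) Z)
      - sign (q * (p + s)) (lie_der (p + q + e) s y (\<lambda>Z. f (b x z # Z)) Z)
      + sign (q * (p + s) + s * p) (f (b y (b x z) # Z))" if x: "x \<in> Lg q" and y: "y \<in> Lg s" for x y q s
  proof -
    have "lie_der (p + s) q x (lie_der p s y f) (z # Z) = lie_der (p + s + e) q x (\<lambda>Z. lie_der p s y f (z # Z)) Z
       - sign (q * (p + s)) (lie_der p s y f (b x z # Z))"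
      by (rule lie_der_Cons[OF z(1) lie_der_mlin[OF ml]])
    also have "lie_der (p + s + e) q x (\<lambda>Z. lie_der p s y f (z # Z)) Z
        = lie_der (p + s + e) q x (\<lambda>Z. lie_der (p + e) s y (\<lambda>Z. f (z # Z)) Z - sign (s * p) (f (b y z # Z))) Z"
      by (rule lie_der_cong) (simp add: lie_der_Cons[OF z(1)] ml)
    also have "\<dots> = lie_der (p + e + s) q x (lie_der (p + e) s y (\<lambda>Z. f (z # Z))) Z - sign (s * p) (lie_der (p + e + s) q x (\<lambda>Z. f (b y z # Z)) Z)"
      by (simp only: lie_der_diff lie_der_sign ac_simps)
    also have "lie_der p s y f (b x z # Z) = lie_der (p + q + e) s y (\<lambda>Z. f (b x z # Z)) Z - sign (s * p) (f (b y (b x z) # Z))"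
      by (simp only: lie_der_Cons[OF b_in[OF x z(1)] ml] ac_simps)
    finally show ?thesis by (simp add: sign_diff)
  qed
  have one: "lie_der p (q + s) (b x y) f (z # Z) = lie_der (p + e) (q + s) (b x y) (\<lambda>Z. f (z # Z)) Z - sign ((q + s) * p) (f (b (b x y) z # Z))"
    by (rule lie_der_Cons[OF z(1) ml])
  have jac: "f (b x (b y z) # Z) = f (b (b x y) z # Z) + sign (q * s) (f (b y (b x z) # Z))"
    unfolding leibniz[OF x y z(1)] by (simp add: lin_add[OF mlin_hd[OF ml]] lin_sign[OF mlin_hd[OF ml]])
  have c1: "lie_der (p + q + e) s y (\<lambda>Z. f (b x z # Z)) Z = lie_der (p + e + q) s y (\<lambda>Z. f (b x z # Z)) Z"
    "lie_der (p + s + e) q x (\<lambda>Z. f (b y z # Z)) Z = lie_der (p + e + s) q x (\<lambda>Z. f (b y z # Z)) Z"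
    by (simp_all only: ac_simps)
  show ?case
    unfolding two[OF x y] two[OF y x] one IH[symmetric] c1 jac
    by (cases "even p"; cases "even q"; cases "even s") (simp_all add: sign_def)
qed

lemma lie_der_coboundary:
  assumes x: "x \<in> Lg q"
  shows "cochain k f \<Longrightarrow> hom k p f \<Longrightarrow> length Z = Suc k \<Longrightarrow> graded Z es \<Longrightarrow>
    lie_der p q x (coboundary p f) Z = coboundary (p + q) (lie_der p q x f) Z"
proof (induction k arbitrary: f p Z es)
  case 0
  obtain y s where y: "Z = [y]" "y \<in> Lg s" using 0 by (auto simp: length_Suc_conv list_all2_Cons1)
  have w: "f [] \<in> M0" "f [] \<in> Mh p" using 0(1,2) by (simp_all add: cochain_M0 hom_Nil)
  have "lie_der p q x (coboundary p f) [y] = lie_der (p + s) q x (\<lambda>_. r p (f []) y) [] - sign (q * p) (r p (f []) (b x y))"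
    using lie_der_Cons[OF y(2), of "[]" "coboundary p f" p q x] coboundary_mlin[OF 0(1)] lie_der_Nil[of "p + s" q x "\<lambda>Z. coboundary p f (y # Z)"] by simp
  then show ?case unfolding y(1) rc[OF x y(2) w] using lie_der_Nil[of p q x f] by simp
next
  case (Suc k)
  obtain y Y s es' where y: "Z = y # Y" "y \<in> Lg s" "graded Y es'" "length Y = Suc k"
    using Suc.prems(3,4) by (cases Z; cases es) auto
  note ml = cochain_mlin[OF Suc.prems(1)]
  have c: "coboundary p g (z # W) = sign (e * p) (lie_der p e z g W) - coboundary (p + e) (\<lambda>Z. g (z # Z)) W"
    if "cochain (Suc k) g" "z \<in> Lg e" "length W = Suc k" for p g z e W
    using that by (intro coboundary_Cons) auto
  have "lie_der p q x (coboundary p f) Z = lie_der (p + s) q x (\<lambda>Z. coboundary p f (y # Z)) Y - sign (q * p) (coboundary p f (b x y # Y))"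
    unfolding y(1) using coboundary_mlin[OF Suc.prems(1)] y by (intro lie_der_Cons) simp_all
  also have "lie_der (p + s) q x (\<lambda>Z. coboundary p f (y # Z)) Y
      = lie_der (p + s) q x (\<lambda>Z. sign (s * p) (lie_der p s y f Z) - coboundary (p + s) (\<lambda>Z. f (y # Z)) Z) Y"
    by (rule lie_der_cong) (simp add: c[OF Suc.prems(1) y(2)] y)
  also have "\<dots> = sign (s * p) (lie_der (p + s) q x (lie_der p s y f) Y) - lie_der (p + s) q x (coboundary (p + s) (\<lambda>Z. f (y # Z))) Y"
    by (simp only: lie_der_diff lie_der_sign)
  also have "lie_der (p + s) q x (coboundary (p + s) (\<lambda>Z. f (y # Z))) Y = coboundary (p + s + q) (lie_der (p + s) q x (\<lambda>Z. f (y # Z))) Y"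
    using Suc.prems y by (intro Suc.IH cochain_Cons hom_Cons)
  also have "lie_der (p + s) q x (lie_der p s y f) Y = sign (q * s) (lie_der (p + q) s y (lie_der p q x f) Y) + lie_der p (q + s) (b x y) f Y"
    using lie_der_commutator[OF x y(2) _ y(3), of f p] Suc.prems(1) y(4) by (simp add: algebra_simps)
  also have "coboundary p f (b x y # Y) = sign ((q + s) * p) (lie_der p (q + s) (b x y) f Y) - coboundary (p + (q + s)) (\<lambda>Z. f (b x y # Z)) Y"
    by (rule c[OF Suc.prems(1) b_in[OF x y(2)] y(4)])
  finally have 1: "lie_der p q x (coboundary p f) Z = sign (s * p + q * s) (lie_der (p + q) s y (lie_der p q x f) Y) + sign (s * p) (lie_der p (q + s) (b x y) f Y)
      - coboundary (p + s + q) (lie_der (p + s) q x (\<lambda>Z. f (y # Z))) Y - sign (q * p + (q + s) * p) (lie_der p (q + s) (b x y) f Y)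
      + sign (q * p) (coboundary (p + (q + s)) (\<lambda>Z. f (b x y # Z)) Y)"
    by (simp add: sign_add sign_diff)
  have "coboundary (p + q) (lie_der p q x f) Z = sign (s * (p + q)) (lie_der (p + q) s y (lie_der p q x f) Y) - coboundary (p + q + s) (\<lambda>Z. lie_der p q x f (y # Z)) Y"
    unfolding y(1) by (rule c[OF lie_der_cochain[OF Suc.prems(1)] y(2,4)])
  also have "coboundary (p + q + s) (\<lambda>Z. lie_der p q x f (y # Z)) Y
      = coboundary (p + q + s) (\<lambda>Z. lie_der (p + s) q x (\<lambda>Z. f (y # Z)) Z - sign (q * p) (f (b x y # Z))) Y"
    by (rule coboundary_cong) (simp add: lie_der_Cons[OF y(2)] ml y)
  also have "\<dots> = coboundary (p + s + q) (lie_der (p + s) q x (\<lambda>Z. f (y # Z))) Y - sign (q * p) (coboundary (p + (q + s)) (\<lambda>Z. f (b x y # Z)) Y)"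
    by (simp only: coboundary_diff coboundary_sign ac_simps)
  finally show ?case unfolding 1
    by (cases "even p"; cases "even q"; cases "even s") (simp_all add: sign_def)
qed

lemma coboundary_coboundary: "cochain k f \<Longrightarrow> hom k p f \<Longrightarrow> length Z = Suc (Suc k) \<Longrightarrow> graded Z es \<Longrightarrow> coboundary p (coboundary p f) Z = 0"
proof (induction k arbitrary: f p Z es)
  case 0
  obtain x y q s where z: "Z = [x, y]" "x \<in> Lg q" "y \<in> Lg s" "graded [y] [s]"
    using 0 by (auto simp: length_Suc_conv list_all2_Cons1)
  have w: "f [] \<in> M0" "f [] \<in> Mh p" using 0(1,2) by (simp_all add: cochain_M0 hom_Nil)
  have "coboundary p (coboundary p f) [x, y] = sign (q * p) (lie_der p q x (coboundary p f) [y]) - coboundary (p + q) (\<lambda>Z. coboundary p f (x # Z)) [y]"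
    using coboundary_cochain[OF 0(1)] by (intro coboundary_Cons z) simp_all
  also have "lie_der p q x (coboundary p f) [y] = coboundary (p + q) (lie_der p q x f) [y]"
    by (rule lie_der_coboundary[OF z(2) 0(1,2) _ z(4)]) simp
  finally have "coboundary p (coboundary p f) [x, y] = - r (p + q) (r p (f []) x - sign (q * p) (lie_der p q x (\<lambda>_. f []) [])) y"
    by (simp add: lin_diff[OF r_lin2] lin_sign[OF r_lin2] lie_der_Nil[of p q x f])
  then show ?case unfolding z(1) rr[OF z(2,3) w] by simp
next
  case (Suc k)
  obtain x Y q es' where z: "Z = x # Y" "x \<in> Lg q" "graded Y es'" "length Y = Suc (Suc k)"
    using Suc.prems(3,4) by (cases Z; cases es) auto
  have "coboundary p (coboundary p f) Z = sign (q * p) (lie_der p q x (coboundary p f) Y) - coboundary (p + q) (\<lambda>Z. coboundary p f (x # Z)) Y"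
    unfolding z(1) using coboundary_cochain[OF Suc.prems(1)] z by (intro coboundary_Cons) auto
  also have "lie_der p q x (coboundary p f) Y = coboundary (p + q) (lie_der p q x f) Y"
    by (rule lie_der_coboundary[OF z(2) Suc.prems(1,2) z(4,3)])
  also have "coboundary (p + q) (\<lambda>Z. coboundary p f (x # Z)) Y
      = coboundary (p + q) (\<lambda>Z. sign (q * p) (lie_der p q x f Z) - coboundary (p + q) (\<lambda>Z. f (x # Z)) Z) Y"
  proof (rule coboundary_cong)
    fix W :: "'l list" assume "Suc (length W) = length Y"
    then show "coboundary p f (x # W) = sign (q * p) (lie_der p q x f W) - coboundary (p + q) (\<lambda>Z. f (x # Z)) W"
      using z Suc.prems(1) by (intro coboundary_Cons) auto
  qed
  also have "\<dots> = sign (q * p) (coboundary (p + q) (lie_der p q x f) Y) - coboundary (p + q) (coboundary (p + q) (\<lambda>Z. f (x # Z))) Y"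
    by (simp only: coboundary_diff coboundary_sign)
  also have "coboundary (p + q) (coboundary (p + q) (\<lambda>Z. f (x # Z))) Y = 0"
    using Suc.prems z by (intro Suc.IH cochain_Cons hom_Cons)
  finally show ?case by simp
qed

end

lemma sum_gt_Suc: "sum h {Suc s<..Suc k} = (\<Sum>t\<in>{s<..k}. h (Suc t))"
  by (simp only: sum.shift_bounds_cl_Suc_ivl flip: atLeastSucAtMost_greaterThanAtMost)

lemma sum_gt_0: "sum h {0<..Suc k} = (\<Sum>t<Suc k. h (Suc t))"
  by (simp only: sum.shift_bounds_cl_Suc_ivl atLeast0AtMost lessThan_Suc_atMost flip: atLeastSucAtMost_greaterThanAtMost)

lemma sum_gl_Suc: "sum h {Suc s<..<Suc t} = (\<Sum>j\<in>{s<..<t}. h (Suc j))"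
  by (simp only: sum.shift_bounds_Suc_ivl flip: atLeastSucLessThan_greaterThanLessThan)

lemma sum_gl_0: "sum h {0<..<Suc t} = (\<Sum>j<t. h (Suc j))"
  by (simp only: sum.shift_bounds_Suc_ivl atLeast0LessThan flip: atLeastSucLessThan_greaterThanLessThan)

lemma sign_Suc: "sign (Suc e) x = - sign e x"
  by (simp add: sign_def)

lemma del_Cons: "del 0 (x # xs) = xs" "del (Suc i) (x # xs) = x # del i xs"
  by (simp_all add: del_def)

context leibniz_premodule
begin

lemma word_der_formula:
  assumes "\<forall>j<length Z. Z ! j \<in> Lg (P j)" "mlin (length Z) sL sM f"
  shows "word_der (tau q) (b x) (\<lambda>x. x) (c x) f Z = (\<Sum>t<length Z. sign (q * (\<Sum>j<t. P j)) (f (Z[t := b x (Z ! t)])))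
    + sign (q * (\<Sum>j<length Z. P j)) (c x (f Z))"
  using assms
proof (induction Z arbitrary: f P)
  case Nil then show ?case by simp
next
  case (Cons z Z)
  have z: "z \<in> Lg (P 0)" using Cons.prems(1) by auto
  have f: "mlin (Suc (length Z)) sL sM f" using Cons.prems by simp
  have "\<forall>j<length Z. Z ! j \<in> Lg (P (Suc j))" using Cons.prems(1) by auto
  note IH = Cons.IH[of "\<lambda>j. P (Suc j)" "\<lambda>Z. f (z # Z)", OF this mlin_Cons[OF f]]
  show ?case
    unfolding word_der_Cons_sign[where t = "tau q", OF c_lin2 f tau_hom[OF z]] IH list.size add_Suc_right add_0_right sum.lessThan_Suc_shift[of _ "length Z"]
    by (simp add: sign_add sign_sum sum.lessThan_Suc_shift algebra_simps del: sum.lessThan_Suc)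
qed

lemma coboundary_formula:
  assumes "length X = Suc k" "\<forall>j\<le>k. X ! j \<in> Lg (P j)" "cochain k f"
  shows "coboundary p f X =
      - (\<Sum>s\<le>k. \<Sum>t\<in>{s<..k}. sign (s + P s * (\<Sum>j\<in>{s<..<t}. P j)) (f (del s (X[t := b (X ! s) (X ! t)]))))
      - (\<Sum>s<k. sign (s + P s * (\<Sum>j\<in>{s<..k}. P j)) (c (X ! s) (f (del s X))))
      + (\<Sum>s<k. sign (s + P s * (p + (\<Sum>j<s. P j))) (l (X ! s) (f (del s X))))
      + sign k (r (p + (\<Sum>j<k. P j)) (f (take k X)) (X ! k))"
  using assms
proof (induction k arbitrary: X P p f)
  case 0
  then obtain x where "X = [x]" by (auto simp: length_Suc_conv)
  then show ?case by simp
next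
  case (Suc k)
  then obtain x Z where X: "X = x # Z" "length Z = Suc k" by (cases X) auto
  have x: "x \<in> Lg (P 0)" using Suc.prems(2) X by auto
  have P': "\<forall>j\<le>k. Z ! j \<in> Lg (P (Suc j))" using Suc.prems(2) X by auto
  have Z: "Z \<noteq> []" "cochain (length Z) f" using X Suc.prems by auto
  note IH = Suc.IH[of Z "\<lambda>j. P (Suc j)" "\<lambda>Z. f (x # Z)" "p + P 0", OF X(2) P' cochain_Cons[OF Suc.prems(3)]]
  have D: "word_der (tau q) (b x) (\<lambda>x. x) (c x) f Z = (\<Sum>t<Suc k. sign (q * (\<Sum>j<t. P (Suc j))) (f (Z[t := b x (Z ! t)])))
    + sign (q * (\<Sum>j<Suc k. P (Suc j))) (c x (f Z))" for q
    using word_der_formula[of Z "\<lambda>j. P (Suc j)" f q x] P' cochain_mlin[OF Z(2)] X(2) by (simp add: less_Suc_eq_le del: sum.lessThan_Suc)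
  have L: "sign (P 0 * p) (lie_der p (P 0) x f Z) = sign (P 0 * p) (l x (f Z))
      - ((\<Sum>t<Suc k. sign (P 0 * (\<Sum>j<t. P (Suc j))) (f (Z[t := b x (Z ! t)])))
      + sign (P 0 * (\<Sum>j<Suc k. P (Suc j))) (c x (f Z)))"
    unfolding lie_der_def D by (simp add: sign_diff sign_def del: sum.lessThan_Suc)
  have 1: "(\<Sum>s\<le>Suc k. \<Sum>t\<in>{s<..Suc k}. sign (s + P s * (\<Sum>j\<in>{s<..<t}. P j)) (f (del s (X[t := b (X ! s) (X ! t)]))))
     = (\<Sum>t<Suc k. sign (P 0 * (\<Sum>j<t. P (Suc j))) (f (Z[t := b x (Z ! t)])))
     - (\<Sum>s\<le>k. \<Sum>t\<in>{s<..k}. sign (s + P (Suc s) * (\<Sum>j\<in>{s<..<t}. P (Suc j))) (f (x # del s (Z[t := b (Z ! s) (Z ! t)]))))"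
    unfolding sum.atMost_Suc_shift[of _ k] sum_gt_Suc sum_gt_0 sum_gl_Suc sum_gl_0 X(1)
    by (simp add: del_Cons sign_Suc sum_negf del: sum.lessThan_Suc)
  have 2: "(\<Sum>s<Suc k. sign (s + P s * (\<Sum>j\<in>{s<..Suc k}. P j)) (c (X ! s) (f (del s X))))
     = sign (P 0 * (\<Sum>j<Suc k. P (Suc j))) (c x (f Z))
     - (\<Sum>s<k. sign (s + P (Suc s) * (\<Sum>j\<in>{s<..k}. P (Suc j))) (c (Z ! s) (f (x # del s Z))))"
    unfolding sum.lessThan_Suc_shift[of _ k] sum_gt_Suc sum_gt_0 X(1)
    by (simp add: del_Cons sign_Suc sum_negf del: sum.lessThan_Suc)
  have 3: "(\<Sum>s<Suc k. sign (s + P s * (p + (\<Sum>j<s. P j))) (l (X ! s) (f (del s X))))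
     = sign (P 0 * p) (l x (f Z))
     - (\<Sum>s<k. sign (s + P (Suc s) * (p + P 0 + (\<Sum>j<s. P (Suc j)))) (l (Z ! s) (f (x # del s Z))))"
    unfolding sum.lessThan_Suc_shift[of _ k] sum.lessThan_Suc_shift[of P] X(1)
    by (simp add: del_Cons sign_Suc sum_negf add.assoc del: sum.lessThan_Suc)
  have 4: "sign (Suc k) (r (p + (\<Sum>j<Suc k. P j)) (f (take (Suc k) X)) (X ! Suc k))
     = - sign k (r (p + P 0 + (\<Sum>j<k. P (Suc j))) (f (x # take k Z)) (Z ! k))"
    unfolding sum.lessThan_Suc_shift[of P] X(1) by (simp add: sign_Suc add.assoc)
  have "coboundary p f X = sign (P 0 * p) (lie_der p (P 0) x f Z) - coboundary (p + P 0) (\<lambda>Z. f (x # Z)) Z"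
    unfolding X(1) by (rule coboundary_Cons[OF Z(2) x Z(1)])
  then show ?case unfolding L IH 1 2 3 4 by (simp add: algebra_simps del: sum.lessThan_Suc)
qed

end

locale leibniz_module_map = V: leibniz_module sL Lg pi b sM M0 Mh l c r + W: leibniz_premodule sL Lg pi b sW W0 Wh lW cW rW
  for sL :: "'k::field \<Rightarrow> 'l::ab_group_add \<Rightarrow> 'l" and Lg pi b
    and sM :: "'k \<Rightarrow> 'm::ab_group_add \<Rightarrow> 'm" and M0 Mh l c r
    and sW :: "'k \<Rightarrow> 'w::ab_group_add \<Rightarrow> 'w" and W0 Wh lW cW rW +
  fixes D :: "nat \<Rightarrow> 'm \<Rightarrow> 'l \<Rightarrow> 'w"
  assumes cW0: "cW x w = 0" and W0: "W0 = UNIV"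
    and D_lin1: "lin sM sW (\<lambda>w. D p w y)" and D_lin2: "lin sL sW (D p v)"
    and D_parity: "even p = even p' \<Longrightarrow> D p = D p'"
    and D_Wh: "y \<in> Lg s \<Longrightarrow> v \<in> M0 \<Longrightarrow> v \<in> Mh p \<Longrightarrow> D p v y \<in> Wh (p + s)"
    and D_l: "x \<in> Lg q \<Longrightarrow> y \<in> Lg s \<Longrightarrow> v \<in> M0 \<Longrightarrow> v \<in> Mh p \<Longrightarrow>
      lW x (D p v y) - sign (q * p) (D p v (b x y)) = D (p + q) (V.lie_der p q x (\<lambda>_. v) []) y"
    and D_r: "x \<in> Lg q \<Longrightarrow> y \<in> Lg s \<Longrightarrow> v \<in> M0 \<Longrightarrow> v \<in> Mh p \<Longrightarrow>
      - rW (p + q) (D p v x) y = D (p + q) (r p v x - sign (q * p) (V.lie_der p q x (\<lambda>_. v) [])) y"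
begin

fun Dl :: "nat \<Rightarrow> ('l list \<Rightarrow> 'm) \<Rightarrow> 'l list \<Rightarrow> 'w" where
  "Dl p f [] = 0"
| "Dl p f [y] = D p (f []) y"
| "Dl p f (x # y # X) = Dl p (\<lambda>Z. f (pi 0 x # Z)) (y # X) + Dl (Suc p) (\<lambda>Z. f (pi 1 x # Z)) (y # X)"

lemma Dl_cong: "(\<And>Z. Suc (length Z) = length X \<Longrightarrow> f Z = g Z) \<Longrightarrow> Dl p f X = Dl p g X"
proof (induction p f X arbitrary: g rule: Dl.induct)
  case (3 p f x y X)
  have "Dl p (\<lambda>Z. f (pi 0 x # Z)) (y # X) = Dl p (\<lambda>Z. g (pi 0 x # Z)) (y # X)"
    "Dl (Suc p) (\<lambda>Z. f (pi 1 x # Z)) (y # X) = Dl (Suc p) (\<lambda>Z. g (pi 1 x # Z)) (y # X)"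
    by (intro 3(1,2); simp add: 3(3))+
  then show ?case by simp
qed simp_all

lemma Dl_diff: "Dl p (\<lambda>Z. f Z - g Z) X = Dl p f X - Dl p g X"
proof (induction p f X arbitrary: g rule: Dl.induct)
  case (3 p f x y X) show ?case unfolding Dl.simps 3 by simp
qed (simp_all add: lin_diff[OF D_lin1])

lemma Dl_sign: "Dl p (\<lambda>Z. sign e (f Z)) X = sign e (Dl p f X)"
proof (induction p f X rule: Dl.induct)
  case (3 p f x y X) show ?case unfolding Dl.simps 3 by (simp add: sign_add)
qed (simp_all add: lin_sign[OF D_lin1])

lemma Dl_lin_f: "(\<And>Z. Suc (length Z) = length X \<Longrightarrow> lin sX sM (\<lambda>y. f y Z)) \<Longrightarrow> lin sX sW (\<lambda>y. Dl p (f y) X)"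
proof (induction X arbitrary: f p rule: length_induct)
  case (1 X)
  show ?case
  proof (cases X)
    case Nil then show ?thesis by (simp add: lin_zeroI[OF W.vsM])
  next
    case (Cons x Y)
    show ?thesis
    proof (cases Y)
      case Nil then show ?thesis using Cons lin_comp[OF D_lin1 1(2)] by simp
    next
      case (Cons y Z)
      have "lin sX sW (\<lambda>y'. Dl p' (\<lambda>Z. f y' (w # Z)) (y # Z))" for p' w
        using 1 \<open>X = x # Y\<close> Cons by simp
      then show ?thesis unfolding \<open>X = x # Y\<close> Cons Dl.simps by (intro lin_addI W.vsM)
    qed
  qed
qed

lemma Dl_mlin: "mlin k sL sM f \<Longrightarrow> mlin (Suc k) sL sW (Dl p f)"
proof (induction k arbitrary: f p)
  case 0
  show ?case by (intro mlin_SucI) (simp_all add: D_lin2)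
next
  case (Suc k)
  let ?F = "\<lambda>x Z. Dl p (\<lambda>Z. f (pi 0 x # Z)) Z + Dl (Suc p) (\<lambda>Z. f (pi 1 x # Z)) Z"
  have F: "Dl p f (x # Z) = ?F x Z" if "length Z = Suc k" for x Z
    using that by (cases Z) simp_all
  show ?case
  proof (rule mlin_SucI)
    fix X :: "'l list" assume X: "length X = Suc k"
    have "lin sL sW (\<lambda>x. Dl p' (\<lambda>Z. f (pi q x # Z)) X)" for q p'
      using X by (intro Dl_lin_f lin_comp[OF mlin_hd[OF Suc.prems] V.pi_lin]) simp
    then have "lin sL sW (\<lambda>x. ?F x X)" by (intro lin_addI W.vsM)
    then show "lin sL sW (\<lambda>x. Dl p f (x # X))" by (simp only: F X)
  next
    fix x
    have "mlin (Suc k) sL sW (?F x)"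
      by (intro mlin_addI W.vsM Suc.IH mlin_Cons Suc.prems)
    then show "mlin (Suc k) sL sW (\<lambda>X. Dl p f (x # X))" by (rule mlin_cong[rotated]) (simp only: F)
  qed
qed

lemma Dl_cochain: "V.cochain k f \<Longrightarrow> W.cochain (Suc k) (Dl p f)"
  unfolding W.cochain_def using W0 Dl_mlin V.cochain_mlin by auto

lemma Dl_parity: "even p = even p' \<Longrightarrow> Dl p f X = Dl p' f X"
proof (induction p f X arbitrary: p' rule: Dl.induct)
  case (2 p f x) then show ?case using D_parity[of p p'] by simp
next
  case (3 p f x y X)
  have "Dl (Suc p) (\<lambda>Z. f (pi 1 x # Z)) (y # X) = Dl (Suc p') (\<lambda>Z. f (pi 1 x # Z)) (y # X)"
    using 3(3) by (intro 3(2)) simp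
  then show ?case using 3(1,3) by simp
qed simp

lemma Dl_Cons:
  assumes f: "mlin (length Z) sL sM f" and x: "x \<in> Lg q" and Z: "Z \<noteq> []"
  shows "Dl p f (x # Z) = Dl (p + q) (\<lambda>Z. f (x # Z)) Z"
proof -
  obtain y Y where Y: "Z = y # Y" using Z by (cases Z) auto
  have 1: "Dl p' (\<lambda>Z. f (0 # Z)) (y # Y) = 0" for p'
  proof -
    have "Dl p' (\<lambda>Z. f (0 # Z)) (y # Y) = Dl p' (\<lambda>Z. f (0 # Z) - f (0 # Z)) (y # Y)"
      using lin_0[OF mlin_hd[of _ sL sM f]] f Y by (intro Dl_cong) simp
    also have "\<dots> = 0" unfolding Dl_diff by simp
    finally show ?thesis .
  qed
  show ?thesis
    using Dl_parity[of "p + q" p "\<lambda>Z. f (x # Z)" Z] Dl_parity[of "p + q" "Suc p" "\<lambda>Z. f (x # Z)" Z]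
    unfolding Y Dl.simps V.pi_hom[OF x] by (cases "even q") (simp_all add: 1)
qed

lemma Dl_hom: "V.cochain k f \<Longrightarrow> V.hom k p f \<Longrightarrow> W.hom (Suc k) p (Dl p f)"
proof (induction k arbitrary: f p)
  case 0
  have "Dl p f Z \<in> Wh (p + sum_list es)" if lZ: "length Z = Suc 0" and gZ: "V.graded Z es" for Z es
  proof -
    obtain x where "Z = [x]" using lZ by (auto simp: length_Suc_conv)
    moreover from this obtain e where "es = [e]" "x \<in> Lg e" using gZ by (auto simp: list_all2_Cons1)
    ultimately show ?thesis using 0 by (simp add: D_Wh V.cochain_M0 V.hom_Nil)
  qed
  then show ?case unfolding W.hom_def by blast
next
  case (Suc k)
  have "Dl p f X \<in> Wh (p + sum_list es)" if l: "length X = Suc (Suc k)" and g: "V.graded X es" for X es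
  proof -
    obtain x Z e es' where X: "X = x # Z" "es = e # es'" "x \<in> Lg e" "V.graded Z es'" "length Z = Suc k"
      using l g by (cases X; cases es) auto
    have "W.hom (Suc k) (p + e) (Dl (p + e) (\<lambda>Z. f (x # Z)))"
      using Suc.prems X by (intro Suc.IH V.cochain_Cons V.hom_Cons)
    then have "Dl (p + e) (\<lambda>Z. f (x # Z)) Z \<in> Wh (p + e + sum_list es')"
      using X unfolding W.hom_def by blast
    moreover have "Z \<noteq> []" "mlin (length Z) sL sM f" using X V.cochain_mlin[OF Suc.prems(1)] by auto
    ultimately show ?thesis unfolding X(1,2)
      by (subst Dl_Cons[OF _ X(3)]) (simp_all add: ac_simps)
  qed
  then show ?case unfolding W.hom_def by blast
qed

lemma lie_der_Dl:
  assumes x: "x \<in> Lg q"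
  shows "V.cochain k f \<Longrightarrow> V.hom k p f \<Longrightarrow> length Z = Suc k \<Longrightarrow> V.graded Z es \<Longrightarrow>
    W.lie_der p q x (Dl p f) Z = Dl (p + q) (V.lie_der p q x f) Z"
proof (induction k arbitrary: f p Z es)
  case 0
  obtain y s where y: "Z = [y]" "y \<in> Lg s" using 0 by (auto simp: length_Suc_conv list_all2_Cons1)
  have w: "f [] \<in> M0" "f [] \<in> Mh p" using 0(1,2) by (simp_all add: V.cochain_M0 V.hom_Nil)
  have "W.lie_der p q x (Dl p f) [y] = lW x (D p (f []) y) - sign (q * p) (D p (f []) (b x y))"
    by (simp add: W.lie_der_def cW0)
  then show ?case unfolding y(1) D_l[OF x y(2) w] using V.lie_der_Nil[of p q x f] by simp
next
  case (Suc k)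
  obtain y Y s es' where y: "Z = y # Y" "y \<in> Lg s" "V.graded Y es'" "length Y = Suc k"
    using Suc.prems(3,4) by (cases Z; cases es) auto
  note ml = V.cochain_mlin[OF Suc.prems(1)]
  have "W.lie_der p q x (Dl p f) Z = W.lie_der (p + s) q x (\<lambda>Z. Dl p f (y # Z)) Y - sign (q * p) (Dl p f (b x y # Y))"
    unfolding y(1) using Dl_mlin[OF ml] y by (intro W.lie_der_Cons) simp_all
  also have "W.lie_der (p + s) q x (\<lambda>Z. Dl p f (y # Z)) Y = W.lie_der (p + s) q x (Dl (p + s) (\<lambda>Z. f (y # Z))) Y"
  proof (rule W.lie_der_cong)
    fix W :: "'l list" assume "length W = length Y"
    then show "Dl p f (y # W) = Dl (p + s) (\<lambda>Z. f (y # Z)) W" using y ml by (intro Dl_Cons) auto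
  qed
  also have "\<dots> = Dl (p + s + q) (V.lie_der (p + s) q x (\<lambda>Z. f (y # Z))) Y"
    using Suc.prems y by (intro Suc.IH V.cochain_Cons V.hom_Cons)
  also have "Dl p f (b x y # Y) = Dl (p + (q + s)) (\<lambda>Z. f (b x y # Z)) Y"
    using ml y by (intro Dl_Cons V.b_in[OF x]) auto
  finally have 1: "W.lie_der p q x (Dl p f) Z = Dl (p + q + s) (V.lie_der (p + s) q x (\<lambda>Z. f (y # Z))) Y
      - sign (q * p) (Dl (p + q + s) (\<lambda>Z. f (b x y # Z)) Y)"
    by (simp only: ac_simps)
  have "Dl (p + q) (V.lie_der p q x f) Z = Dl (p + q + s) (\<lambda>Z. V.lie_der p q x f (y # Z)) Y"
    unfolding y(1) using V.lie_der_mlin[OF ml] y by (intro Dl_Cons) auto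
  also have "\<dots> = Dl (p + q + s) (\<lambda>Z. V.lie_der (p + s) q x (\<lambda>Z. f (y # Z)) Z - sign (q * p) (f (b x y # Z))) Y"
    by (rule Dl_cong) (simp add: V.lie_der_Cons[OF y(2)] ml y)
  finally show ?case unfolding 1 by (simp only: Dl_diff Dl_sign)
qed

lemma coboundary_Dl: "V.cochain k f \<Longrightarrow> V.hom k p f \<Longrightarrow> length Z = Suc (Suc k) \<Longrightarrow> V.graded Z es \<Longrightarrow>
    W.coboundary p (Dl p f) Z = Dl p (V.coboundary p f) Z"
proof (induction k arbitrary: f p Z es)
  case 0
  obtain x y q s where z: "Z = [x, y]" "x \<in> Lg q" "y \<in> Lg s" "V.graded [y] [s]"
    using 0 by (auto simp: length_Suc_conv list_all2_Cons1)
  have w: "f [] \<in> M0" "f [] \<in> Mh p" using 0(1,2) by (simp_all add: V.cochain_M0 V.hom_Nil)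
  have "W.coboundary p (Dl p f) [x, y] = sign (q * p) (W.lie_der p q x (Dl p f) [y]) - W.coboundary (p + q) (\<lambda>Z. Dl p f (x # Z)) [y]"
    using Dl_cochain[OF 0(1)] by (intro W.coboundary_Cons z) simp_all
  also have "W.lie_der p q x (Dl p f) [y] = Dl (p + q) (V.lie_der p q x f) [y]"
    by (rule lie_der_Dl[OF z(2) 0(1,2) _ z(4)]) simp
  finally have "W.coboundary p (Dl p f) [x, y] = sign (q * p) (D (p + q) (V.lie_der p q x (\<lambda>_. f []) []) y)
      + D (p + q) (r p (f []) x - sign (q * p) (V.lie_der p q x (\<lambda>_. f []) [])) y"
    using D_r[OF z(2,3) w] by (simp add: V.lie_der_Nil[of p q x f])
  also have "\<dots> = D (p + q) (r p (f []) x) y"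
    by (simp add: lin_diff[OF D_lin1] lin_sign[OF D_lin1])
  also have "\<dots> = Dl p (V.coboundary p f) [x, y]"
    using V.coboundary_mlin[OF 0(1)] by (subst Dl_Cons[OF _ z(2)]) simp_all
  finally show ?case unfolding z(1) .
next
  case (Suc k)
  obtain x Y q es' where z: "Z = x # Y" "x \<in> Lg q" "V.graded Y es'" "length Y = Suc (Suc k)"
    using Suc.prems(3,4) by (cases Z; cases es) auto
  have Y: "Y \<noteq> []" using z by auto
  note ml = V.cochain_mlin[OF Suc.prems(1)]
  have "W.coboundary p (Dl p f) Z = sign (q * p) (W.lie_der p q x (Dl p f) Y) - W.coboundary (p + q) (\<lambda>Z. Dl p f (x # Z)) Y"
    unfolding z(1) using Dl_cochain[OF Suc.prems(1)] z Y by (intro W.coboundary_Cons) simp_all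
  also have "W.lie_der p q x (Dl p f) Y = Dl (p + q) (V.lie_der p q x f) Y"
    by (rule lie_der_Dl[OF z(2) Suc.prems(1,2) z(4,3)])
  also have "W.coboundary (p + q) (\<lambda>Z. Dl p f (x # Z)) Y = W.coboundary (p + q) (Dl (p + q) (\<lambda>Z. f (x # Z))) Y"
  proof (rule W.coboundary_cong)
    fix W :: "'l list" assume "Suc (length W) = length Y"
    then show "Dl p f (x # W) = Dl (p + q) (\<lambda>Z. f (x # Z)) W" using z ml by (intro Dl_Cons) auto
  qed
  also have "\<dots> = Dl (p + q) (V.coboundary (p + q) (\<lambda>Z. f (x # Z))) Y"
    using Suc.prems z by (intro Suc.IH V.cochain_Cons V.hom_Cons)
  finally have 1: "W.coboundary p (Dl p f) Z = sign (q * p) (Dl (p + q) (V.lie_der p q x f) Y) - Dl (p + q) (V.coboundary (p + q) (\<lambda>Z. f (x # Z))) Y" .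
  have "Dl p (V.coboundary p f) Z = Dl (p + q) (\<lambda>Z. V.coboundary p f (x # Z)) Y"
    unfolding z(1) using V.coboundary_mlin[OF Suc.prems(1)] z Y by (intro Dl_Cons) simp_all
  also have "\<dots> = Dl (p + q) (\<lambda>Z. sign (q * p) (V.lie_der p q x f Z) - V.coboundary (p + q) (\<lambda>Z. f (x # Z)) Z) Y"
  proof (rule Dl_cong)
    fix W :: "'l list" assume "Suc (length W) = length Y"
    then show "V.coboundary p f (x # W) = sign (q * p) (V.lie_der p q x f W) - V.coboundary (p + q) (\<lambda>Z. f (x # Z)) W"
      using z Suc.prems(1) by (intro V.coboundary_Cons) auto
  qed
  finally show ?case unfolding 1 by (simp only: Dl_diff Dl_sign)
qed

lemma Dl_formula:
  assumes "length X = Suc k" "\<forall>j<k. X ! j \<in> Lg (P j)" "mlin k sL sM f"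
  shows "Dl p f X = D (p + (\<Sum>j<k. P j)) (f (take k X)) (X ! k)"
  using assms
proof (induction k arbitrary: X P p f)
  case 0
  then obtain x where "X = [x]" by (auto simp: length_Suc_conv)
  then show ?case by simp
next
  case (Suc k)
  then obtain x Z where X: "X = x # Z" "length Z = Suc k" by (cases X) auto
  have x: "x \<in> Lg (P 0)" using Suc.prems(2) X by auto
  have P': "\<forall>j<k. Z ! j \<in> Lg (P (Suc j))" using Suc.prems(2) X by auto
  have "Dl p f X = Dl (p + P 0) (\<lambda>Z. f (x # Z)) Z"
    unfolding X(1) using X Suc.prems by (intro Dl_Cons x) auto
  also have "\<dots> = D (p + P 0 + (\<Sum>j<k. P (Suc j))) (f (x # take k Z)) (Z ! k)"
    by (rule Suc.IH[OF X(2) P' mlin_Cons[OF Suc.prems(3)]])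
  also have "p + P 0 + (\<Sum>j<k. P (Suc j)) = p + (\<Sum>j<Suc k. P j)"
    unfolding sum.lessThan_Suc_shift by simp
  finally show ?case unfolding X(1) by simp
qed

end

context nambu
begin

definition MV :: "('a \<Rightarrow> 'v) set" where "MV = {\<phi>. lin sN sV \<phi>}"
definition HV :: "nat \<Rightarrow> ('a \<Rightarrow> 'v) set" where "HV p = {\<phi>. superhom N V p \<phi>}"
definition lV :: "('a list \<Rightarrow>\<^sub>0 'k) \<Rightarrow> ('a \<Rightarrow> 'v) \<Rightarrow> 'a \<Rightarrow> 'v" where "lV x \<phi> = (\<lambda>z. actL x (\<phi> z))"
definition cV :: "('a list \<Rightarrow>\<^sub>0 'k) \<Rightarrow> ('a \<Rightarrow> 'v) \<Rightarrow> 'a \<Rightarrow> 'v" where "cV x \<phi> = (\<lambda>z. \<phi> (adL x z))"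
definition rV :: "nat \<Rightarrow> ('a \<Rightarrow> 'v) \<Rightarrow> ('a list \<Rightarrow>\<^sub>0 'k) \<Rightarrow> 'a \<Rightarrow> 'v"
  where "rV p \<phi> x = (\<lambda>z. hom_act p 0 (pi 0 x) \<phi> z + sign p (hom_act p 1 (pi 1 x) \<phi> z) - ad_map (derV p \<phi> x) z)"

lemma vs_fsV: "vector_space (fun_scale sV)"
  by (rule vector_space_fun_scale[OF V.vsS])

lemma hom_act_lin1: "\<phi> \<in> MV \<Longrightarrow> lin fscale sV (\<lambda>x. hom_act p q x \<phi> z)"
  unfolding hom_act_def MV_def
  by (intro lin_diffI lin_signI V.vsS fun_scale_lin_at[OF actL_lin1] lin_comp[OF _ fun_scale_lin_at[OF adL_lin1]]) simp

lemma hom_act_lin2: "lin (fun_scale sV) sV (\<lambda>\<phi>. hom_act p q x \<phi> z)"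
  by (rule linI) (simp_all add: hom_act_def fun_scale_def lin_add[OF actL_lin] lin_scale[OF actL_lin] sign_add
      vs_diff[OF V.vsS] vs_sign[OF V.vsS])

lemma rV_hom:
  assumes x: "x \<in> Lg q" and \<phi>: "\<phi> \<in> MV"
  shows "rV p \<phi> x = (\<lambda>z. sign (q * p) (hom_act p q x \<phi> z) - ad_map (derV p \<phi> x) z)"
proof -
  have "hom_act p e x \<phi> z = hom_act p e' x \<phi> z" if "even e = even e'" for e e' z
    using that by (simp add: hom_act_def sign_def)
  from this[of q 0] this[of q 1] show ?thesis
    unfolding rV_def pi_EG[OF x] by (cases "even q") (simp_all add: lin_0[OF hom_act_lin1[OF \<phi>]] sign_def fun_eq_iff)
qed

lemma superhom_add: "superhom N V p f \<Longrightarrow> superhom N V p g \<Longrightarrow> superhom N V p (f + g)"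
  using lin_addI[OF V.vsS] V.grd_add by (auto simp: superhom_def plus_fun_def)

lemma superhom_neg: "superhom N V p f \<Longrightarrow> superhom N V p (- f)"
  using lin_negI[OF V.vsS] V.grd_neg by (auto simp: superhom_def fun_Compl_def)

lemma superhom_parity: "even p = even p' \<Longrightarrow> superhom N V p = superhom N V p'"
  using V.grd_cong[of "p + _" "p' + _"] by (simp add: superhom_def fun_eq_iff)

lemma leibniz_superalgebra_LN: "leibniz_superalgebra fscale Lg pi br"
proof
  show "x \<in> Lg q \<Longrightarrow> y \<in> Lg s \<Longrightarrow> z \<in> Lg e \<Longrightarrow> br x (br y z) = br (br x y) z + sign (q * s) (br y (br x z))"
    for x q y s z e by (rule br_leibniz[OF _ _ wl_ext])
qed (use vsE pi_lin pi_in pi_EG br_lin1 br_lin2 br_EG in blast)+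

lemma leibniz_premodule_V: "leibniz_premodule fscale Lg pi br (fun_scale sV) MV HV lV cV rV"
proof (intro leibniz_premodule.intro leibniz_superalgebra_LN leibniz_premodule_axioms.intro vs_fsV)
  show "lin fscale (fun_scale sV) (\<lambda>x. lV x w)" for w
    unfolding lV_def lin_fun_scale by (intro allI fun_scale_lin_at[OF actL_lin1])
  show "lin (fun_scale sV) (fun_scale sV) (lV x)" for x
    by (rule linI) (simp_all add: lV_def fun_scale_def fun_eq_iff lin_add[OF actL_lin] lin_scale[OF actL_lin])
  show "lin fscale (fun_scale sV) (\<lambda>x. cV x w)" if "w \<in> MV" for w
    using that unfolding cV_def lin_fun_scale MV_def by (auto intro: lin_comp fun_scale_lin_at[OF adL_lin1])
  show "lin (fun_scale sV) (fun_scale sV) (cV x)" for x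
    by (rule linI) (simp_all add: cV_def fun_scale_def fun_eq_iff)
  show "lin fscale (fun_scale sV) (rV p w)" if w: "w \<in> MV" for w p
    unfolding rV_def lin_fun_scale
    by (intro allI lin_diffI lin_addI lin_signI V.vsS lin_comp[OF hom_act_lin1[OF w] pi_lin]
        lin_comp[OF fun_scale_lin_at[OF ad_map_lin1] derV_lin2])
  show "lin (fun_scale sV) (fun_scale sV) (\<lambda>w. rV p w x)" for p x
    unfolding rV_def lin_fun_scale
    by (intro allI lin_diffI lin_addI lin_signI V.vsS hom_act_lin2 lin_comp[OF fun_scale_lin_at[OF ad_map_lin1] derV_lin1])
  show "rV p = rV p'" if p: "even p = even p'" for p p'
  proof -
    have "derV p = derV p'" using NT.der_parity[OF p] by (simp add: derV_def fun_eq_iff)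
    then show ?thesis using p by (simp add: rV_def hom_act_def fun_eq_iff sign_def)
  qed
  show "v + w \<in> MV" if "v \<in> MV" "w \<in> MV" for v w
    using that lin_addI[OF V.vsS, of sN v w] by (simp add: MV_def plus_fun_def)
  show "- w \<in> MV" if "w \<in> MV" for w
    using that lin_negI[OF V.vsS, of sN w] by (simp add: MV_def fun_Compl_def)
  show "0 \<in> MV" using lin_zeroI[OF V.vsS, of sN] by (simp add: MV_def zero_fun_def)
  show "lV x w \<in> MV" if "w \<in> MV" for x w
    using that by (auto simp: MV_def lV_def intro: lin_comp[OF actL_lin])
  show "cV x w \<in> MV" if "w \<in> MV" for x w
    using that by (auto simp: MV_def cV_def intro: lin_comp[OF _ adL_lin])
  show "rV p w x \<in> MV" if "w \<in> MV" for p x w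
    using that by (auto simp: MV_def rV_def intro!: lin_diffI lin_addI lin_signI V.vsS hom_act_lin ad_map_lin)
  show "v + w \<in> HV p" if "v \<in> HV p" "w \<in> HV p" for v w p using that superhom_add by (simp add: HV_def)
  show "- w \<in> HV p" if "w \<in> HV p" for w p using that superhom_neg by (simp add: HV_def)
  show "HV p = HV p'" if "even p = even p'" for p p' using superhom_parity[OF that] by (simp add: HV_def)
  show "lV x w \<in> HV (p + q)" if x: "x \<in> Lg q" and w: "w \<in> HV p" for x q w p
    using w superhom_grd[OF actL_superhom[OF x] superhom_grd[of N V p w]]
    by (auto simp: HV_def lV_def superhom_def ac_simps intro: lin_comp[OF actL_lin])
  show "cV x w \<in> HV (p + q)" if x: "x \<in> Lg q" and w: "w \<in> HV p" for x q w p
    using w superhom_grd[of N V p w, OF _ superhom_grd[OF adL_superhom[OF x]]]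
    by (auto simp: HV_def cV_def superhom_def ac_simps intro: lin_comp[OF _ adL_lin])
  show "rV p w x \<in> HV (p + q)" if x: "x \<in> Lg q" and w: "w \<in> HV p" "w \<in> MV" for x q w p
  proof -
    have w': "superhom N V p w" using w by (simp add: HV_def)
    have "superhom N V (p + q) (\<lambda>z. ad_map (derV p w x) z)" using ad_map_superhom[OF derV_Wg[OF w' x]] by simp
    moreover have "superhom N V (p + q) (hom_act p q x w)" by (rule hom_act_superhom[OF x w'])
    ultimately show ?thesis unfolding rV_hom[OF x w(2)] HV_def
      by (auto simp: superhom_def intro!: lin_diffI lin_signI V.vsS V.grd_diff V.grd_sign)
  qed
qed

lemma lie_der_V: "leibniz_premodule.lie_der pi br lV cV p q x (\<lambda>_. w) [] = hom_act p q x w"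
  by (simp add: leibniz_premodule.lie_der_def[OF leibniz_premodule_V] lV_def cV_def hom_act_def fun_eq_iff sign_fun mult.commute)

lemma leibniz_module_V: "leibniz_module fscale Lg pi br (fun_scale sV) MV HV lV cV rV"
proof (intro leibniz_module.intro leibniz_premodule_V leibniz_module_axioms.intro, unfold lie_der_V)
  fix x y q s w p
  assume x: "x \<in> Lg q" and y: "y \<in> Lg s" and w: "w \<in> MV"
  then have wl: "lin sN sV w" by (simp add: MV_def)
  have lc: "hom_act (p + s) q x (hom_act p s y w) z - sign (q * s) (hom_act (p + q) s y (hom_act p q x w) z) = hom_act p (q + s) (br x y) w z" for z
    unfolding hom_act_def adL_br[OF x y] actL_br[OF x y] using wl
    by (cases "even p"; cases "even q"; cases "even s")
      (simp_all add: sign_def lin_diff[OF actL_lin] lin_add[OF actL_lin] lin_neg[OF actL_lin] lin_diff lin_add lin_neg)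
  then show "hom_act (p + s) q x (hom_act p s y w) - sign (q * s) (hom_act (p + q) s y (hom_act p q x w)) = hom_act p (q + s) (br x y) w"
    by (simp add: fun_eq_iff sign_fun)
  assume "w \<in> HV p"
  then have wh: "superhom N V p w" by (simp add: HV_def)
  have tw: "hom_act p q x w \<in> MV" using hom_act_lin[OF wl] by (simp add: MV_def)
  show "hom_act (p + s) q x (rV p w y) - sign (q * p) (rV p w (br x y)) = rV (p + q) (hom_act p q x w) y"
  proof
    fix z
    let ?w = "derV p w y"
    have 1: "hom_act (p + s) q x (rV p w y) z = sign (s * p) (hom_act (p + s) q x (hom_act p s y w) z)
        - (actL x (ad_map ?w z) - sign ((p + s) * q) (ad_map ?w (adL x z)))"
      unfolding rV_hom[OF y w] hom_act_def[of "p + s"] lin_diff[OF actL_lin] lin_sign[OF actL_lin] sign_diff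
      by (simp add: ac_simps)
    have 2: "actL x (ad_map ?w z) = ad_map (brT x ?w) z + sign (q * (p + s)) (ad_map ?w (adL x z))"
      by (rule ad_map_equivariant[OF x derV_Wg[OF wh y]])
    have 3: "ad_map (brT x ?w) z = sign (p * q) (ad_map (derV p w (br x y)) z) + ad_map (derV (p + q) (hom_act p q x w) y) z"
      unfolding brT_derV[OF x wh wl_ext[OF y], symmetric]
      by (simp add: lin_diff[OF fun_scale_lin_at[OF ad_map_lin1]] lin_sign[OF fun_scale_lin_at[OF ad_map_lin1]])
    have 4: "hom_act (p + s) q x (hom_act p s y w) z = sign (q * s) (hom_act (p + q) s y (hom_act p q x w) z) + hom_act p (q + s) (br x y) w z"
      using lc[of z] by (simp add: algebra_simps)
    show "(hom_act (p + s) q x (rV p w y) - sign (q * p) (rV p w (br x y))) z = rV (p + q) (hom_act p q x w) y z"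
      unfolding minus_apply sign_fun 1 2 3 4 rV_hom[OF br_EG[OF x y] w] rV_hom[OF y tw]
      by (cases "even p"; cases "even q"; cases "even s") (simp_all add: sign_def)
  qed
  have "rV (p + q) (ad_map (derV p w x)) y z = 0" for z
  proof -
    have W: "derV p w x \<in> Wg (p + q)" by (rule derV_Wg[OF wh x])
    have "ad_map (derV p w x) \<in> MV" by (simp add: MV_def ad_map_lin)
    from rV_hom[OF y this] show ?thesis
      by (simp add: ad_map_derivation[OF W y] hom_act_def sign_diff mult.commute) (simp add: sign_def)
  qed
  then have 0: "rV (p + q) (ad_map (derV p w x)) y = 0" by (simp add: fun_eq_iff)
  have l: "lin (fun_scale sV) (fun_scale sV) (\<lambda>w. rV (p + q) w y)" by (rule leibniz_premodule.r_lin2[OF leibniz_premodule_V])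
  have "rV p w x - sign (q * p) (hom_act p q x w) = - ad_map (derV p w x)"
    by (simp add: rV_hom[OF x w] fun_eq_iff sign_fun)
  then show "rV (p + q) (rV p w x - sign (q * p) (hom_act p q x w)) y = 0"
    by (simp only: lin_neg[OF l] 0 minus_zero)
qed

lemma leibniz_premodule_W: "leibniz_premodule fscale Lg pi br fscale UNIV Wg brT (\<lambda>_ _. 0) (\<lambda>_ w y. - brT' w y)"
proof (intro leibniz_premodule.intro leibniz_superalgebra_LN leibniz_premodule_axioms.intro vsE)
  show "Wg p = Wg p'" if "even p = even p'" for p p' by (rule Wg_cong[OF that])
  show "brT x w \<in> Wg (p + q)" if "x \<in> Lg q" "w \<in> Wg p" for x q w p
    using brT_Wg[OF that] by (simp add: add.commute)
  show "- brT' w x \<in> Wg (p + q)" if "x \<in> Lg q" "w \<in> Wg p" for x q w p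
    using brT'_hom[OF that(2), of x] derV_Wg[OF ad_map_superhom[OF that(2)] that(1)] by simp
qed (auto intro: brT_lin1 brT_lin2 lin_zeroI[OF vsE] lin_negI[OF vsE] brT'_lin1 brT'_lin2 Wg_add Wg_neg Wg_zero)

sublocale LM: leibniz_module_map fscale Lg pi br "fun_scale sV" MV HV lV cV rV fscale UNIV Wg brT "\<lambda>_ _. 0" "\<lambda>_ w y. - brT' w y" derV
proof (intro leibniz_module_map.intro leibniz_module_V leibniz_premodule_W leibniz_module_map_axioms.intro, unfold lie_der_V)
  show "lin (fun_scale sV) fscale (\<lambda>w. derV p w y)" for p y by (rule derV_lin1)
  show "lin fscale fscale (derV p v)" for p v by (rule derV_lin2)
  show "derV p = derV p'" if "even p = even p'" for p p'
    using NT.der_parity[OF that] by (simp add: derV_def fun_eq_iff)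
  fix x y q s v p
  assume x: "x \<in> Lg q" and y: "y \<in> Lg s" and v: "v \<in> MV" "v \<in> HV p"
  then have vh: "superhom N V p v" by (simp add: HV_def)
  show "derV p v y \<in> Wg (p + s)" by (rule derV_Wg[OF vh y])
  show "brT x (derV p v y) - sign (q * p) (derV p v (br x y)) = derV (p + q) (hom_act p q x v) y"
    using brT_derV[OF x vh wl_ext[OF y]] by (simp add: mult.commute)
  have "rV p v x - sign (q * p) (hom_act p q x v) = - ad_map (derV p v x)"
    by (simp add: rV_hom[OF x v(1)] fun_eq_iff sign_fun)
  then show "- (- brT' (derV p v x) y) = derV (p + q) (rV p v x - sign (q * p) (hom_act p q x v)) y"
    unfolding brT'_hom[OF derV_Wg[OF vh x]] by (simp only: lin_neg[OF derV_lin1] minus_minus)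
qed auto

end

section \<open>Cochains and their homogeneous components\<close>

lemma multilinear_onD:
  "multilinear_on k sA A sB B f \<Longrightarrow> length as + length bs + 1 = k \<Longrightarrow> set as \<subseteq> A \<Longrightarrow> set bs \<subseteq> A \<Longrightarrow> A \<noteq> {} \<Longrightarrow>
    linear_on sA A sB B (\<lambda>x. f (as @ x # bs))"
proof -
  assume *: "multilinear_on k sA A sB B f" "length as + length bs + 1 = k" "set as \<subseteq> A" "set bs \<subseteq> A" "A \<noteq> {}"
  obtain a where "a \<in> A" using *(5) by blast
  then have "length (as @ a # bs) = k \<and> set (as @ a # bs) \<subseteq> A" "length as < k" using * by auto
  then have "linear_on sA A sB B (\<lambda>x. f ((as @ a # bs)[length as := x]))"
    using *(1) unfolding multilinear_on_def by blast
  then show ?thesis by simp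
qed

lemma mlin_span_eq:
  assumes "vector_space sA" "vector_space sB"
  shows "mlin k sA sB f \<Longrightarrow> mlin k sA sB g \<Longrightarrow> (\<And>X. length X = k \<Longrightarrow> set X \<subseteq> G \<Longrightarrow> f X = g X) \<Longrightarrow>
    length X = k \<Longrightarrow> set X \<subseteq> module.span sA G \<Longrightarrow> f X = g X"
proof (induction k arbitrary: f g X)
  case 0 then show ?case by simp
next
  case (Suc k)
  then obtain x Z where X: "X = x # Z" "length Z = k" "set Z \<subseteq> module.span sA G" "x \<in> module.span sA G" by (cases X) auto
  have G: "f (y # Z) = g (y # Z)" if y: "y \<in> G" for y
  proof (rule Suc.IH[OF mlin_Cons[OF Suc.prems(1)] mlin_Cons[OF Suc.prems(2)] _ X(2,3)])
    fix W assume "length W = k" "set W \<subseteq> G"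
    then show "f (y # W) = g (y # W)" using y by (intro Suc.prems(3)) simp_all
  qed
  show ?case unfolding X(1)
    by (rule lin_eq_on_span[OF assms mlin_hd[OF Suc.prems(1) X(2)] mlin_hd[OF Suc.prems(2) X(2)] G X(4)])
qed

locale graded_cochains = leibniz_premodule sL Lg pi b sM M0 Mh l c r
  for sL :: "'k::field \<Rightarrow> 'l::ab_group_add \<Rightarrow> 'l" and Lg pi b
    and sM :: "'k \<Rightarrow> 'm::ab_group_add \<Rightarrow> 'm" and M0 Mh l c r +
  fixes LN :: "'l set" and Gr :: "nat \<Rightarrow> 'l set" and M1 :: "'m set" and h :: "nat \<Rightarrow> 'm \<Rightarrow> 'm"
  assumes Lg_span: "Lg q = module.span sL (Gr q)" and LN_span: "LN = module.span sL (\<Union>q. Gr q)"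
    and pi_sum: "x \<in> LN \<Longrightarrow> pi 0 x + pi 1 x = x"
    and M1_M0: "M1 \<subseteq> M0" and M1_0: "0 \<in> M1" and M1_add: "v \<in> M1 \<Longrightarrow> w \<in> M1 \<Longrightarrow> v + w \<in> M1"
    and Mh_M1: "Mh p \<subseteq> M1" and Mh_0: "0 \<in> Mh p" and Mh_scale: "w \<in> Mh p \<Longrightarrow> sM a w \<in> Mh p"
    and h_lin: "lin sM sM (h p)" and h_in: "w \<in> M1 \<Longrightarrow> h p w \<in> Mh p"
    and h_hom: "w \<in> Mh e \<Longrightarrow> h p w = (if even (p + e) then w else 0)"
    and h_sum: "w \<in> M1 \<Longrightarrow> h p w + h (Suc p) w = w"
begin

definition rho :: "'l \<Rightarrow> 'l" where "rho x = pi 0 x + pi 1 x"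

text \<open>An element of \<open>C k\<close> vanishes off \<open>LN\<close> and is therefore not multilinear on the whole type; \<open>pull\<close> makes
  it so by projecting the arguments.\<close>

definition pull :: "('l list \<Rightarrow> 'm) \<Rightarrow> 'l list \<Rightarrow> 'm" where "pull f X = f (map rho X)"

definition cut :: "nat \<Rightarrow> ('l list \<Rightarrow> 'm) \<Rightarrow> 'l list \<Rightarrow> 'm"
  where "cut k f X = (if length X = k \<and> set X \<subseteq> LN then f X else 0)"

definition C :: "nat \<Rightarrow> ('l list \<Rightarrow> 'm) set"
  where "C k = {f. multilinear_on k sL LN sM M1 f \<and> (\<forall>X. \<not> (length X = k \<and> set X \<subseteq> LN) \<longrightarrow> f X = 0)}"

text \<open>The component of parity \<open>p\<close>.\<close>

fun hcomp :: "nat \<Rightarrow> ('l list \<Rightarrow> 'm) \<Rightarrow> 'l list \<Rightarrow> 'm" where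
  "hcomp p f [] = h p (f [])"
| "hcomp p f (x # X) = hcomp p (\<lambda>Z. f (pi 0 x # Z)) X + hcomp (Suc p) (\<lambda>Z. f (pi 1 x # Z)) X"

definition good :: "nat \<Rightarrow> ('l list \<Rightarrow> 'm) \<Rightarrow> bool"
  where "good k f \<longleftrightarrow> mlin k sL sM f \<and> (\<forall>Z. length Z = k \<longrightarrow> f Z \<in> M1 \<and> f (map rho Z) = f Z)"

lemma Lg_LN: "Lg q \<subseteq> LN"
  unfolding Lg_span LN_span using vsL by (intro module.span_mono) (auto simp: module_iff_vector_space)

lemma LN_closed: "x \<in> LN \<Longrightarrow> y \<in> LN \<Longrightarrow> x + y \<in> LN" "x \<in> LN \<Longrightarrow> sL a x \<in> LN" "0 \<in> LN"
  using vsL unfolding LN_span by (auto simp: module_iff_vector_space intro: module.span_add module.span_scale module.span_zero)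

lemma rho_lin: "lin sL sL rho"
  unfolding rho_def by (intro lin_addI vsL pi_lin)

lemma rho_LN: "rho x \<in> LN"
  unfolding rho_def using pi_in Lg_LN by (intro LN_closed) blast+

lemma rho_id: "x \<in> LN \<Longrightarrow> rho x = x"
  by (simp add: rho_def pi_sum[unfolded One_nat_def])

lemma map_rho_id: "set X \<subseteq> LN \<Longrightarrow> map rho X = X"
  by (induction X) (simp_all add: rho_id)

lemma pull_eq: "set X \<subseteq> LN \<Longrightarrow> pull f X = f X"
  by (simp add: pull_def map_rho_id)

lemma goodD: "good k f \<Longrightarrow> mlin k sL sM f" "good k f \<Longrightarrow> length Z = k \<Longrightarrow> f Z \<in> M1"
    "good k f \<Longrightarrow> length Z = k \<Longrightarrow> f (map rho Z) = f Z"
  by (simp_all add: good_def)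

lemma good_cochain: "good k f \<Longrightarrow> cochain k f"
  using M1_M0 by (auto simp: good_def cochain_def)

lemma good_Cons: "good (Suc k) f \<Longrightarrow> good k (\<lambda>Z. f (pi q x # Z))"
proof -
  assume f: "good (Suc k) f"
  have "rho (pi q x) = pi q x" using pi_in Lg_LN by (intro rho_id) blast
  then have "f (pi q x # map rho Z) = f (pi q x # Z)" if "length Z = k" for Z
    using goodD(3)[OF f, of "pi q x # Z"] that by simp
  then show ?thesis using f mlin_Cons[OF goodD(1)[OF f]] by (simp add: good_def)
qed

lemma pull_good: assumes "f \<in> C k" shows "good k (pull f)"
proof -
  have ml: "multilinear_on k sL LN sM M1 f" using assms by (simp add: C_def)
  have "mlin k sL sM (pull f)" unfolding mlin_def
  proof (intro allI impI)
    fix as bs :: "'l list" assume "length as + length bs + 1 = k"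
    then have "linear_on sL LN sM M1 (\<lambda>x. f (map rho as @ x # map rho bs))"
      using rho_LN by (intro multilinear_onD[OF ml]) auto
    then show "lin sL sM (\<lambda>x. pull f (as @ x # bs))"
      using rho_LN by (auto simp: linear_on_def pull_def lin_add[OF rho_lin] lin_scale[OF rho_lin])
  qed
  moreover have "pull f Z \<in> M1" if "length Z = k" for Z
    using that ml rho_LN unfolding pull_def multilinear_on_def by (auto simp: image_subset_iff)
  moreover have "pull f (map rho Z) = pull f Z" for Z
    unfolding pull_def using rho_id[OF rho_LN] by (simp add: comp_def)
  ultimately show ?thesis by (simp add: good_def)
qed

lemma C_zero: "f \<in> C k \<Longrightarrow> \<not> (length X = k \<and> set X \<subseteq> LN) \<Longrightarrow> f X = 0"
  unfolding C_def by blast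

lemma cut_C:
  assumes f: "mlin k sL sM f" and v: "\<And>X. length X = k \<Longrightarrow> set X \<subseteq> LN \<Longrightarrow> f X \<in> M1"
  shows "cut k f \<in> C k"
proof -
  have "linear_on sL LN sM M1 (\<lambda>x. cut k f (X[i := x]))" if X: "length X = k" "set X \<subseteq> LN" "i < k" for X i
  proof -
    have "set (X[i := x]) \<subseteq> LN" if "x \<in> LN" for x using X that set_update_subset_insert[of X i x] by blast
    then have "cut k f (X[i := x]) = f (take i X @ x # drop (Suc i) X)" "f (take i X @ x # drop (Suc i) X) \<in> M1" if "x \<in> LN" for x
      using v[of "X[i := x]"] X that by (simp_all add: cut_def upd_conv_take_nth_drop)
    moreover have "lin sL sM (\<lambda>x. f (take i X @ x # drop (Suc i) X))" using X by (intro mlinD[OF f]) simp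
    ultimately show ?thesis by (simp add: linear_on_def LN_closed)
  qed
  then show ?thesis unfolding C_def multilinear_on_def using v by (auto simp: cut_def)
qed

lemma pull_cut: "length X = k \<Longrightarrow> set X \<subseteq> LN \<Longrightarrow> pull (cut k f) X = f X"
  by (simp add: pull_eq cut_def)

lemma hcomp_cong: "(\<And>Z. length Z = length X \<Longrightarrow> f Z = g Z) \<Longrightarrow> hcomp p f X = hcomp p g X"
proof (induction X arbitrary: p f g)
  case (Cons x X)
  have "hcomp p' (\<lambda>Z. f (y # Z)) X = hcomp p' (\<lambda>Z. g (y # Z)) X" for p' y
    by (rule Cons.IH) (simp add: Cons.prems)
  then show ?case by simp
qed simp

lemma hcomp_add: "hcomp p (\<lambda>Z. f Z + g Z) X = hcomp p f X + hcomp p g X"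
  by (induction X arbitrary: p f g) (simp_all add: lin_add[OF h_lin])

lemma hcomp_scale: "hcomp p (\<lambda>Z. sM a (f Z)) X = sM a (hcomp p f X)"
  by (induction X arbitrary: p f) (simp_all add: lin_scale[OF h_lin] vs_add[OF vsM])

lemma hcomp_lin_f: "(\<And>Z. length Z = length X \<Longrightarrow> lin sX sM (\<lambda>y. f y Z)) \<Longrightarrow> lin sX sM (\<lambda>y. hcomp p (f y) X)"
proof (induction X arbitrary: f p)
  case Nil then show ?case using lin_comp[OF h_lin] by simp
next
  case (Cons x X)
  have "lin sX sM (\<lambda>y. hcomp p' (\<lambda>Z. f y (w # Z)) X)" for p' w
    by (rule Cons.IH) (simp add: Cons.prems)
  then show ?case by (simp add: lin_addI[OF vsM])
qed

lemma hcomp_mlin: "mlin k sL sM f \<Longrightarrow> mlin k sL sM (hcomp p f)"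
proof (induction k arbitrary: f p)
  case 0 then show ?case by simp
next
  case (Suc k)
  show ?case
  proof (rule mlin_SucI)
    fix X :: "'l list" assume X: "length X = k"
    have "lin sL sM (\<lambda>x. hcomp p' (\<lambda>Z. f (pi q x # Z)) X)" for p' q
      using X by (intro hcomp_lin_f lin_comp[OF mlin_hd[OF Suc.prems] pi_lin]) simp
    then show "lin sL sM (\<lambda>x. hcomp p f (x # X))" by (simp add: lin_addI[OF vsM])
  next
    fix x
    show "mlin k sL sM (\<lambda>X. hcomp p f (x # X))"
      using mlin_addI[OF vsM Suc.IH[OF mlin_Cons[OF Suc.prems]] Suc.IH[OF mlin_Cons[OF Suc.prems]]] by simp
  qed
qed

lemma hcomp_M1: "good k f \<Longrightarrow> length Z = k \<Longrightarrow> hcomp p f Z \<in> M1"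
proof (induction Z arbitrary: f p k)
  case Nil then show ?case using h_in goodD(2) Mh_M1 by fastforce
next
  case (Cons x Z)
  then obtain k' where k: "k = Suc k'" by auto
  show ?case using Cons.IH[OF good_Cons] Cons.prems k by (auto intro: M1_add)
qed

lemma pi_pi: "pi q (pi s x) = (if even (q + s) then pi s x else 0)"
  by (rule pi_hom[OF pi_in])

lemma hcomp_good: assumes "good k f" shows "good k (hcomp p f)"
proof -
  have "hcomp p f (map rho Z) = hcomp p f Z" for Z p f
  proof (induction Z arbitrary: p f)
    case (Cons x Z)
    have "pi q (rho x) = pi q x" if "q < 2" for q
      using that by (cases q) (auto simp: rho_def lin_add[OF pi_lin] pi_pi less_Suc_eq)
    then show ?case using Cons.IH by simp
  qed simp
  then show ?thesis using assms hcomp_mlin hcomp_M1 by (simp add: good_def)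
qed

lemma hcomp_hom: "good k f \<Longrightarrow> hom k p (hcomp p f)"
proof (induction k arbitrary: f p)
  case 0
  have "hcomp p f Z \<in> Mh (p + sum_list es)" if "length Z = 0" "graded Z es" for Z es
    using that h_in[OF goodD(2)[OF 0, of "[]"]] by simp
  then show ?case unfolding hom_def by blast
next
  case (Suc k)
  have "hcomp p f X \<in> Mh (p + sum_list es)" if l: "length X = Suc k" and g: "graded X es" for X es
  proof -
    obtain x Z e es' where X: "X = x # Z" "es = e # es'" "x \<in> Lg e" "graded Z es'" "length Z = k"
      using l g by (cases X; cases es) auto
    have z: "hcomp p' (\<lambda>Z. f (0 # Z)) Z = 0" for p'
    proof -
      have "hcomp p' (\<lambda>Z. f (0 # Z)) Z = hcomp p' (\<lambda>Z. 0 + 0) Z"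
        using lin_0[OF mlin_hd[OF goodD(1)[OF Suc.prems]]] X by (intro hcomp_cong) simp
      moreover have "hcomp p' (\<lambda>Z. 0 + 0) Z = hcomp p' (\<lambda>_. 0) Z + hcomp p' (\<lambda>_. 0) Z" by (rule hcomp_add)
      ultimately show ?thesis by simp
    qed
    have IH: "hcomp p' (\<lambda>Z. f (pi q x # Z)) Z \<in> Mh (p' + sum_list es')" for p' q
      using Suc.IH[OF good_Cons[OF Suc.prems], of p' q x] X unfolding hom_def by blast
    show ?thesis
    proof (cases "even e")
      case True
      then show ?thesis using IH[of p 0] X Mh_cong[of "p + sum_list es'" "p + (e + sum_list es')"]
        by (simp add: pi_hom[OF X(3)] z)
    next
      case False
      then show ?thesis using IH[of "Suc p" 1] X Mh_cong[of "Suc p + sum_list es'" "p + (e + sum_list es')"]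
        by (simp add: pi_hom[OF X(3)] z)
    qed
  qed
  then show ?case unfolding hom_def by blast
qed

lemma good_split: assumes "good (Suc k) f" "length Z = k" shows "f (x # Z) = f (pi 0 x # Z) + f (pi 1 x # Z)"
proof -
  have "f (x # Z) = f (rho x # map rho Z)" using goodD(3)[OF assms(1), of "x # Z"] assms(2) by simp
  also have "\<dots> = f (pi 0 x # map rho Z) + f (pi 1 x # map rho Z)"
    using lin_add[OF mlin_hd[OF goodD(1)[OF assms(1)], of "map rho Z"]] assms(2) by (simp add: rho_def)
  also have "\<dots> = f (pi 0 x # Z) + f (pi 1 x # Z)"
    using goodD(3)[OF good_Cons[OF assms(1)], of Z] assms(2) by simp
  finally show ?thesis .
qed

lemma hcomp_sum: "good k f \<Longrightarrow> length Z = k \<Longrightarrow> hcomp p f Z + hcomp (Suc p) f Z = f Z"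
proof (induction Z arbitrary: f p k)
  case Nil then show ?case using goodD(2) by (simp add: h_sum)
next
  case (Cons x Z)
  then obtain k' where k: "k = Suc k'" "length Z = k'" by auto
  have "hcomp p' (\<lambda>Z. f (pi q x # Z)) Z + hcomp (Suc p') (\<lambda>Z. f (pi q x # Z)) Z = f (pi q x # Z)" for q p'
    using Cons.prems k by (intro Cons.IH[where k = k'] good_Cons) simp_all
  from this[of p 0] this[of "Suc p" 1] show ?case
    using good_split[of k' f Z x] Cons.prems k by (simp add: algebra_simps)
qed

lemma hcomp_id: "good k f \<Longrightarrow> hom k e f \<Longrightarrow> length Z = k \<Longrightarrow> hcomp p f Z = (if even (p + e) then f Z else 0)"
proof (induction Z arbitrary: f p k e)
  case Nil
  then have "f [] \<in> Mh e" by (simp add: hom_Nil)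
  then show ?case by (simp add: h_hom)
next
  case (Cons x Z)
  then obtain k' where k: "k = Suc k'" "length Z = k'" by auto
  have "hcomp p' (\<lambda>Z. f (pi q x # Z)) Z = (if even (p' + (e + q)) then f (pi q x # Z) else 0)" for p' q
    using Cons.prems k by (intro Cons.IH[where k = k'] good_Cons hom_Cons pi_in) simp_all
  then show ?case
    using good_split[of k' f Z x] Cons.prems k by simp
qed

lemma hom_M1: "mlin k sL sM f \<Longrightarrow> hom k p f \<Longrightarrow> length Z = k \<Longrightarrow> set Z \<subseteq> LN \<Longrightarrow> f Z \<in> M1"
proof (induction Z arbitrary: f p k)
  case Nil
  then have "f [] \<in> Mh p" by (simp add: hom_Nil)
  then show ?case using Mh_M1 by blast
next
  case (Cons x Z)
  then obtain k' where k: "k = Suc k'" "length Z = k'" by auto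
  have "f (pi q x # Z) \<in> M1" for q
    using Cons.prems k by (intro Cons.IH[of k' _ "p + q"] mlin_Cons hom_Cons pi_in) simp_all
  moreover have "f (x # Z) = f (pi 0 x # Z) + f (pi 1 x # Z)"
    using lin_add[OF mlin_hd[of k' sL sM f Z], of "pi 0 x" "pi 1 x"] Cons.prems k pi_sum[of x] by simp
  ultimately show ?case by (simp add: M1_add)
qed

lemma C_eqI:
  assumes "f \<in> C k" "g \<in> C k" "\<And>X. length X = k \<Longrightarrow> set X \<subseteq> (\<Union>q. Gr q) \<Longrightarrow> f X = g X"
  shows "f = g"
proof
  fix X
  have G: "(\<Union>q. Gr q) \<subseteq> LN" unfolding LN_span using vsL by (intro module.span_superset) (simp add: module_iff_vector_space)
  show "f X = g X"
  proof (cases "length X = k \<and> set X \<subseteq> LN")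
    case True
    then have X: "set X \<subseteq> LN" by blast
    have "pull f X = pull g X"
    proof (rule mlin_span_eq[OF vsL vsM goodD(1)[OF pull_good[OF assms(1)]] goodD(1)[OF pull_good[OF assms(2)]]])
      fix Y assume Y: "length Y = k" "set Y \<subseteq> (\<Union>q. Gr q)"
      then have "set Y \<subseteq> LN" using G by blast
      then show "pull f Y = pull g Y" using assms(3)[OF Y] by (simp add: pull_eq)
    qed (use True in \<open>simp_all flip: LN_span\<close>)
    then show ?thesis using X by (simp add: pull_eq)
  next
    case False then show ?thesis using C_zero[OF assms(1) False] C_zero[OF assms(2) False] by simp
  qed
qed

lemma hom_gens:
  "mlin k sL sM f \<Longrightarrow> (\<And>Z es. length Z = k \<Longrightarrow> list_all2 (\<lambda>z e. z \<in> Gr e) Z es \<Longrightarrow> f Z \<in> Mh (p + sum_list es)) \<Longrightarrow> hom k p f"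
proof (induction k arbitrary: f p)
  case 0 then show ?case unfolding hom_def by force
next
  case (Suc k)
  interpret L: vector_space sL by (rule vsL)
  have "f X \<in> Mh (p + sum_list es)" if l: "length X = Suc k" and g: "graded X es" for X es
  proof -
    obtain x Z e es' where X: "X = x # Z" "es = e # es'" "x \<in> Lg e" "graded Z es'" "length Z = k"
      using l g by (cases X; cases es) auto
    have G: "f (y # Z) \<in> Mh (p + e + sum_list es')" if y: "y \<in> Gr e" for y
    proof -
      have "hom k (p + e) (\<lambda>Z. f (y # Z))"
      proof (rule Suc.IH[OF mlin_Cons[OF Suc.prems(1)]])
        fix Z es assume "length Z = k" "list_all2 (\<lambda>z e. z \<in> Gr e) Z es"
        then have "f (y # Z) \<in> Mh (p + sum_list (e # es))" using y by (intro Suc.prems(2)) simp_all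
        then show "f (y # Z) \<in> Mh (p + e + sum_list es)" by (simp add: add.assoc)
      qed
      then show ?thesis using X unfolding hom_def by blast
    qed
    note l = mlin_hd[OF Suc.prems(1) X(5)]
    have "f (x # Z) \<in> Mh (p + e + sum_list es')"
    proof (rule L.span_induct[OF X(3)[unfolded Lg_span]])
      show "L.subspace {y. f (y # Z) \<in> Mh (p + e + sum_list es')}"
        by (auto intro!: L.subspaceI simp: lin_0[OF l] lin_add[OF l] lin_scale[OF l] Mh_0 Mh_add Mh_scale)
    qed (use G in auto)
    then show ?thesis using X by (simp add: add.assoc)
  qed
  then show ?case unfolding hom_def by blast
qed

lemma pull_add: "pull (f + g) = (\<lambda>Z. pull f Z + pull g Z)"
  by (simp add: pull_def fun_eq_iff)

lemma comp_C: assumes "f \<in> C k" shows "cut k (hcomp p (pull f)) \<in> C k"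
  using hcomp_good[OF pull_good[OF assms]] by (intro cut_C goodD) auto

lemma comp_sum: assumes "f \<in> C k" shows "cut k (hcomp 0 (pull f)) + cut k (hcomp 1 (pull f)) = f"
proof
  fix X
  show "(cut k (hcomp 0 (pull f)) + cut k (hcomp 1 (pull f))) X = f X"
    using hcomp_sum[OF pull_good[OF assms], of X 0] C_zero[OF assms, of X]
    by (simp add: cut_def pull_eq)
qed

lemma comp_hom: assumes "f \<in> C k" shows "hom k p (pull (cut k (hcomp p (pull f))))"
proof -
  have *: "hom k p (hcomp p (pull f))" by (rule hcomp_hom[OF pull_good[OF assms]])
  have "pull (cut k (hcomp p (pull f))) Z = hcomp p (pull f) Z" if "length Z = k" "graded Z es" for Z es
  proof -
    have "set Z \<subseteq> LN" using that(2) Lg_LN by (induction Z es rule: list_all2_induct) auto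
    then show ?thesis using that(1) by (rule pull_cut[rotated])
  qed
  then show ?thesis using * unfolding hom_def by metis
qed

end

locale cochain_operator = A: graded_cochains sL Lg pi b sM M0 Mh l c r LN Gr M1 h + B: graded_cochains sL Lg pi b sM' M0' Mh' l' c' r' LN Gr M1' h'
  for sL :: "'k::field \<Rightarrow> 'l::ab_group_add \<Rightarrow> 'l" and Lg pi b and LN and Gr
    and sM :: "'k \<Rightarrow> 'm::ab_group_add \<Rightarrow> 'm" and M0 Mh l c r M1 h
    and sM' :: "'k \<Rightarrow> 'w::ab_group_add \<Rightarrow> 'w" and M0' Mh' l' c' r' M1' h' +
  fixes Op :: "nat \<Rightarrow> ('l list \<Rightarrow> 'm) \<Rightarrow> 'l list \<Rightarrow> 'w" and k k' :: nat
  assumes Op_mlin: "A.cochain k f \<Longrightarrow> mlin k' sL sM' (Op p f)"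
    and Op_hom: "A.cochain k f \<Longrightarrow> A.hom k p f \<Longrightarrow> B.hom k' p (Op p f)"
    and Op_scale: "length X = k' \<Longrightarrow> Op p (\<lambda>Z. sM a (f Z)) X = sM' a (Op p f X)"
    and Op_cong: "(\<And>Z. length Z = k \<Longrightarrow> f Z = g Z) \<Longrightarrow> length X = k' \<Longrightarrow> Op p f X = Op p g X"
    and Op_diff: "Op p (\<lambda>Z. f Z - g Z) X = Op p f X - Op p g X"
begin

definition lin_ext :: "('l list \<Rightarrow> 'm) \<Rightarrow> 'l list \<Rightarrow> 'w"
  where "lin_ext f = B.cut k' (\<lambda>X. Op 0 (A.hcomp 0 (A.pull f)) X + Op 1 (A.hcomp 1 (A.pull f)) X)"

lemma Op_add: "Op p (\<lambda>Z. f Z + g Z) X = Op p f X + Op p g X"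
  using Op_diff[of p "\<lambda>Z. f Z + g Z" g X] by (simp add: algebra_simps)

lemma Op_zero: "Op p (\<lambda>_. 0) X = 0"
  using Op_diff[of p "\<lambda>_. 0" "\<lambda>_. 0" X] by simp

lemma lin_ext_C: assumes "f \<in> A.C k" shows "lin_ext f \<in> B.C k'"
proof -
  have g: "A.good k (A.hcomp p (A.pull f))" "A.hom k p (A.hcomp p (A.pull f))" for p
    using A.hcomp_good A.hcomp_hom A.pull_good[OF assms] by blast+
  note m = Op_mlin[OF A.good_cochain[OF g(1)]]
  show ?thesis unfolding lin_ext_def
    by (intro B.cut_C mlin_addI m B.vsM B.M1_add B.hom_M1[OF m Op_hom[OF A.good_cochain[OF g(1)] g(2)]])
qed

lemma lin_ext_hom:
  assumes f: "f \<in> A.C k" "A.hom k p (A.pull f)" and X: "length X = k'" "set X \<subseteq> LN" and p: "p \<in> {0, 1}"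
  shows "lin_ext f X = Op p (A.pull f) X"
proof -
  have "Op q (A.hcomp q (A.pull f)) X = (if even (q + p) then Op q (A.pull f) X else 0)" for q
  proof -
    have "Op q (A.hcomp q (A.pull f)) X = Op q (\<lambda>Z. if even (q + p) then A.pull f Z else 0) X"
      using A.hcomp_id[OF A.pull_good[OF f(1)] f(2)] by (intro Op_cong X) simp
    then show ?thesis by (simp add: Op_zero)
  qed
  then show ?thesis using X p by (auto simp: lin_ext_def B.cut_def)
qed

lemma lin_ext_linear: "linear_on (\<lambda>a f X. sM a (f X)) (A.C k) (\<lambda>a f X. sM' a (f X)) (B.C k') lin_ext"
  unfolding linear_on_def
proof (intro conjI ballI allI lin_ext_C ext)
  fix f g X
  show "lin_ext (f + g) X = (lin_ext f + lin_ext g) X"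
    by (simp add: lin_ext_def B.cut_def A.pull_add A.hcomp_add[abs_def] Op_add algebra_simps)
next
  fix a f X
  have "A.hcomp p (A.pull (\<lambda>X. sM a (f X))) = (\<lambda>X. sM a (A.hcomp p (A.pull f) X))" for p
    using A.hcomp_scale[of p a "A.pull f"] by (simp add: A.pull_def[abs_def] fun_eq_iff)
  then show "lin_ext (\<lambda>X. sM a (f X)) X = sM' a (lin_ext f X)"
    by (simp add: lin_ext_def B.cut_def Op_scale vs_add[OF B.vsM] vs_zero[OF B.vsM])
qed

lemma lin_ext_unique:
  assumes "linear_on (\<lambda>a f X. sM a (f X)) (A.C k) sc B' D'"
    and "\<And>p f. p \<in> {0, 1} \<Longrightarrow> f \<in> A.C k \<Longrightarrow> A.hom k p (A.pull f) \<Longrightarrow> D' f = lin_ext f" and "f \<in> A.C k"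
  shows "D' f = lin_ext f"
proof -
  let ?f = "\<lambda>p. A.cut k (A.hcomp p (A.pull f))"
  have "D' (?f 0 + ?f 1) = D' (?f 0) + D' (?f 1)"
    using assms(1) A.comp_C[OF assms(3)] unfolding linear_on_def by blast
  also have "\<dots> = lin_ext (?f 0) + lin_ext (?f 1)"
    using assms(2)[OF _ A.comp_C[OF assms(3)] A.comp_hom[OF assms(3)], of 0]
      assms(2)[OF _ A.comp_C[OF assms(3)] A.comp_hom[OF assms(3)], of 1] by simp
  also have "\<dots> = lin_ext (?f 0 + ?f 1)"
    using lin_ext_linear A.comp_C[OF assms(3)] unfolding linear_on_def by metis
  finally show ?thesis by (simp only: A.comp_sum[OF assms(3)])
qed

end

lemma set_del: "set (del s X) \<subseteq> set X"
  by (auto simp: del_def dest: in_set_takeD in_set_dropD)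

lemma (in leibniz_premodule) del_graded:
  assumes "length X = Suc k" "set X \<subseteq> (\<Union>q. Lg q)" "s \<le> k" "t \<le> k"
  shows "set (del s (X[t := b (X ! s) (X ! t)])) \<subseteq> (\<Union>q. Lg q)" "length (del s (X[t := b (X ! s) (X ! t)])) = k"
    "set (del s X) \<subseteq> (\<Union>q. Lg q)" "length (del s X) = k"
proof -
  have "X ! s \<in> set X" "X ! t \<in> set X" using assms by simp_all
  then obtain q q' where "X ! s \<in> Lg q" "X ! t \<in> Lg q'" using assms(2) by blast
  then have "b (X ! s) (X ! t) \<in> (\<Union>q. Lg q)" using b_in by blast
  then show "set (del s (X[t := b (X ! s) (X ! t)])) \<subseteq> (\<Union>q. Lg q)"
    using set_del[of s "X[t := b (X ! s) (X ! t)]"] set_update_subset_insert[of X t "b (X ! s) (X ! t)"] assms(2) by blast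
  show "set (del s X) \<subseteq> (\<Union>q. Lg q)" using set_del[of s X] assms(2) by blast
qed (use assms in \<open>auto simp: del_def\<close>)

lemma (in leibniz_premodule) coboundary_cong_graded:
  assumes f: "cochain k f" and g: "cochain k g" and X: "length X = Suc k" "set X \<subseteq> (\<Union>q. Lg q)"
    and eq: "\<And>Z. length Z = k \<Longrightarrow> set Z \<subseteq> (\<Union>q. Lg q) \<Longrightarrow> f Z = g Z"
  shows "coboundary p f X = coboundary p g X"
proof -
  have "\<forall>j\<le>k. \<exists>q. X ! j \<in> Lg q"
  proof (intro allI impI)
    fix j assume "j \<le> k"
    then have "X ! j \<in> set X" using X by simp
    then show "\<exists>q. X ! j \<in> Lg q" using X(2) by blast
  qed
  then obtain P where P: "\<forall>j\<le>k. X ! j \<in> Lg (P j)" by metis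
  have "set (take k X) \<subseteq> (\<Union>q. Lg q)" "length (take k X) = k" using X by (auto dest: in_set_takeD)
  then have e: "f (take k X) = g (take k X)" by (intro eq)
  have e1: "f (del s (X[t := b (X ! s) (X ! t)])) = g (del s (X[t := b (X ! s) (X ! t)]))" if "s \<le> k" "t \<le> k" for s t
    by (intro eq del_graded[OF X that])
  have e2: "f (del s X) = g (del s X)" if "s \<le> k" for s
    by (intro eq del_graded[OF X that that])
  show ?thesis
    unfolding coboundary_formula[OF X(1) P f] coboundary_formula[OF X(1) P g] e
    by (intro arg_cong2[where f = "(+)"] arg_cong2[where f = "(-)"] arg_cong[where f = uminus] sum.cong refl)
      (simp_all add: e1 e2)
qed

context leibniz_module_map
begin

lemma Dl_cong_graded:
  assumes f: "mlin k sL sM f" and g: "mlin k sL sM g" and X: "length X = Suc k" "set X \<subseteq> (\<Union>q. Lg q)"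
    and eq: "\<And>Z. length Z = k \<Longrightarrow> set Z \<subseteq> (\<Union>q. Lg q) \<Longrightarrow> f Z = g Z"
  shows "Dl p f X = Dl p g X"
proof -
  have "\<forall>j<k. \<exists>q. X ! j \<in> Lg q"
  proof (intro allI impI)
    fix j assume "j < k"
    then have "X ! j \<in> set X" using X by simp
    then show "\<exists>q. X ! j \<in> Lg q" using X(2) by blast
  qed
  then obtain P where P: "\<forall>j<k. X ! j \<in> Lg (P j)" by metis
  have "set (take k X) \<subseteq> (\<Union>q. Lg q)" "length (take k X) = k" using X by (auto dest: in_set_takeD)
  then show ?thesis unfolding Dl_formula[OF X(1) P f] Dl_formula[OF X(1) P g] using eq by simp
qed

end

context nambu
begin

definition Gr :: "nat \<Rightarrow> ('a list \<Rightarrow>\<^sub>0 'k) set"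
  where "Gr q = {wedge m N xs | xs. xs \<in> hlists m N \<and> even (parl N xs) = even q}"

definition hV :: "nat \<Rightarrow> ('a \<Rightarrow> 'v) \<Rightarrow> 'a \<Rightarrow> 'v"
  where "hV p \<phi> = (\<lambda>z. pr V p (\<phi> (pr N 0 z)) + pr V (Suc p) (\<phi> (pr N 1 z)))"

abbreviation WN where "WN \<equiv> WNV n N V"

lemma LN_eq: "LN n N = ext_power m N"
  by (simp add: LN_def)

lemma wL_eq: "wL n N xs = wedge m N xs"
  by (simp add: wL_def)

lemma LN_Gr: "LN n N = E.span (\<Union>q. Gr q)"
proof -
  have "wedge m N ` hlists m N = (\<Union>q. Gr q)" by (auto simp: Gr_def)
  then show ?thesis unfolding LN_eq N.ext_power_hom by simp
qed

lemma genW_span: "length xs = m0 \<Longrightarrow> genW n N V xs v \<in> E.span {genW n N V xs v | xs v. xs \<in> hlists m0 N \<and> v \<in> homog V}"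
proof (rule N.mlin_in_subspace[where sB = fscale, OF _ E.span_add])
  show "mlin m0 sN fscale (\<lambda>xs. genW n N V xs v)"
    unfolding genW_eq using T.wedge_mlin[of m] m_eq NT.i_lin by (intro mlin_map[where f = "\<lambda>us. wedge m T (us @ [fromV v])"] mlin_snoc) auto
  fix xs assume xs: "xs \<in> hlists m0 N"
  then have e: "genW n N V xs v = genW n N V xs (pr V 0 v) + genW n N V xs (pr V (Suc 0) v)"
    using lin_add[OF genW_lin, of xs "pr V 0 v" "pr V (Suc 0) v"] by (simp add: V.pr_sum hlists_def)
  have "genW n N V xs (pr V q v) \<in> {genW n N V xs v | xs v. xs \<in> hlists m0 N \<and> v \<in> homog V}" for q
    using xs V.pr_homog by blast
  then show "genW n N V xs v \<in> E.span {genW n N V xs v | xs v. xs \<in> hlists m0 N \<and> v \<in> homog V}"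
    unfolding e by (intro E.span_add E.span_base)
qed

lemma WN_eq: "WN = E.span {genW n N V xs v | xs v. xs \<in> hlists m0 N \<and> v \<in> homog V}"
proof
  show "WN \<subseteq> E.span {genW n N V xs v | xs v. xs \<in> hlists m0 N \<and> v \<in> homog V}"
    unfolding WNV_def m_simps by (intro E.span_minimal E.subspace_span) (auto intro: genW_span)
  show "E.span {genW n N V xs v | xs v. xs \<in> hlists m0 N \<and> v \<in> homog V} \<subseteq> WN"
    unfolding WNV_def m_simps by (intro E.span_mono) (auto simp: hlists_def)
qed

lemma Wg_WN: "Wg q \<subseteq> WN"
  unfolding WN_eq gradeW_def m_simps by (intro E.span_mono) auto

lemma genW_Wg': "xs \<in> hlists m0 N \<Longrightarrow> v \<in> homog V \<Longrightarrow> genW n N V xs v \<in> Wg (parl N xs + par V v)"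
  by (rule genW_Wg[OF _ V.homog_par refl])

lemma piT_Wg: "w \<in> Wg e \<Longrightarrow> piT q w = (if even (q + e) then w else 0)"
  unfolding piT_def by (rule T.piE_EG[OF Wg_EG])

lemma piT_WN: assumes "w \<in> WN" shows "piT q w \<in> Wg q" and "piT q w + piT (Suc q) w = w"
proof -
  have w: "w \<in> E.span {genW n N V xs v | xs v. xs \<in> hlists m0 N \<and> v \<in> homog V}" using assms by (simp add: WN_eq)
  have s: "E.subspace {w. piT q w \<in> Wg q}"
    by (auto intro!: E.subspaceI simp: lin_0[OF piT_lin] lin_add[OF piT_lin] lin_scale[OF piT_lin] Wg_zero Wg_add Wg_scale)
  show "piT q w \<in> Wg q"
  proof (rule E.span_induct[OF w s])
    fix u assume "u \<in> {genW n N V xs v | xs v. xs \<in> hlists m0 N \<and> v \<in> homog V}"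
    then obtain e where u: "u \<in> Wg e" using genW_Wg' by blast
    show "piT q u \<in> Wg q" using u Wg_cong[of q e] by (auto simp: piT_Wg[OF u] Wg_zero)
  qed
  show "piT q w + piT (Suc q) w = w"
  proof (rule lin_eq_on_span[OF vsE vsE lin_addI[OF vsE piT_lin piT_lin] lin_id _ w])
    fix u assume "u \<in> {genW n N V xs v | xs v. xs \<in> hlists m0 N \<and> v \<in> homog V}"
    then obtain e where u: "u \<in> Wg e" using genW_Wg' by blast
    show "piT q u + piT (Suc q) u = u" by (simp add: piT_Wg[OF u])
  qed
qed

lemma prV_sum: "pr V p u + pr V (Suc p) u = u"
  using V.pr_sum[of u] V.pr_even[of p] V.pr_odd[of p] V.pr_even[of "Suc p"] V.pr_odd[of "Suc p"]
  by (cases "even p") simp_all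

lemma graded_cochains_V: "graded_cochains fscale Lg pi br (fun_scale sV) MV HV lV cV rV (LN n N) Gr MV hV"
proof (intro graded_cochains.intro leibniz_premodule_V graded_cochains_axioms.intro)
  show "Lg q = E.span (Gr q)" for q by (simp add: EG_def Gr_def)
  show "LN n N = E.span (\<Union>q. Gr q)" by (rule LN_Gr)
  show "x \<in> LN n N \<Longrightarrow> pi 0 x + pi 1 x = x" for x using N.piE_sum[of x m] by (simp add: LN_eq pi_def)
  show "HV p \<subseteq> MV" for p by (auto simp: HV_def MV_def superhom_def)
  show "0 \<in> HV p" for p using lin_zeroI[OF V.vsS] by (auto simp: HV_def superhom_def zero_fun_def V.grd_zero)
  show "fun_scale sV a w \<in> HV p" if "w \<in> HV p" for a w p
    using that lin_comp[OF vs_lin[OF V.vsS], of sN w a] V.grd_scale by (auto simp: HV_def superhom_def fun_scale_def)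
  show "lin (fun_scale sV) (fun_scale sV) (hV p)" for p
    by (rule linI) (simp_all add: hV_def fun_scale_def fun_eq_iff lin_add[OF V.pr_lin] lin_scale[OF V.pr_lin] vs_add[OF V.vsS])
  show "hV p w \<in> HV p" if w: "w \<in> MV" for w p
  proof -
    have wl: "lin sN sV w" using w by (simp add: MV_def)
    have "lin sN sV (hV p w)" unfolding hV_def
      by (intro lin_addI V.vsS lin_comp[OF V.pr_lin] lin_comp[OF wl] N.pr_lin)
    moreover have "hV p w z \<in> grd V (p + a)" if z: "z \<in> grd N a" for z a
      using V.pr_in[of p "w z"] V.pr_in[of "Suc p" "w z"] V.grd_cong[of p "p + a"] V.grd_cong[of "Suc p" "p + a"]
        lin_0[OF wl] lin_0[OF V.pr_lin] N.pr_grd[OF z, of 0] N.pr_grd[OF z, of 1]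
      by (cases "even a") (simp_all add: hV_def)
    ultimately show ?thesis by (simp add: HV_def superhom_def)
  qed
  show "hV p w = (if even (p + e) then w else 0)" if w: "w \<in> HV e" for w e p
  proof
    fix z
    have wh: "superhom N V e w" using w by (simp add: HV_def)
    have "w (pr N 0 z) + w (pr N 1 z) = w z"
      using lin_add[OF superhom_lin[OF wh], of "pr N 0 z" "pr N 1 z"] N.pr_sum[of z] by simp
    then show "hV p w z = (if even (p + e) then w else 0) z"
      using V.pr_grd[OF superhom_grd[OF wh N.pr_in[of 0 z]], of p] V.pr_grd[OF superhom_grd[OF wh N.pr_in[of 1 z]], of "Suc p"]
      by (simp add: hV_def)
  qed
  show "hV p w + hV (Suc p) w = w" if "w \<in> MV" for w p
  proof
    fix z
    have wl: "lin sN sV w" using that by (simp add: MV_def)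
    have "(hV p w + hV (Suc p) w) z = (pr V p (w (pr N 0 z)) + pr V (Suc p) (w (pr N 0 z)))
        + (pr V (Suc p) (w (pr N 1 z)) + pr V (Suc (Suc p)) (w (pr N 1 z)))"
      by (simp add: hV_def algebra_simps)
    also have "\<dots> = w (pr N 0 z + pr N (Suc 0) z)" by (simp only: prV_sum lin_add[OF wl] One_nat_def)
    finally show "(hV p w + hV (Suc p) w) z = w z" by (simp add: N.pr_sum)
  qed
qed (use leibniz_premodule.M0_add[OF leibniz_premodule_V] leibniz_premodule.M0_0[OF leibniz_premodule_V] in auto)

lemma graded_cochains_W: "graded_cochains fscale Lg pi br fscale UNIV Wg brT (\<lambda>_ _. 0) (\<lambda>_ w y. - brT' w y) (LN n N) Gr WN piT"
proof (intro graded_cochains.intro leibniz_premodule_W graded_cochains_axioms.intro)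
  show "Lg q = E.span (Gr q)" for q by (simp add: EG_def Gr_def)
  show "LN n N = E.span (\<Union>q. Gr q)" by (rule LN_Gr)
  show "x \<in> LN n N \<Longrightarrow> pi 0 x + pi 1 x = x" for x using N.piE_sum[of x m] by (simp add: LN_eq pi_def)
qed (auto simp: piT_Wg piT_WN piT_lin Wg_zero Wg_scale WN_eq[symmetric] intro: subsetD[OF Wg_WN],
    auto simp: WN_eq E.span_zero E.span_add E.span_scale)

sublocale GV: graded_cochains fscale Lg pi br "fun_scale sV" MV HV lV cV rV "LN n N" Gr MV hV
  by (rule graded_cochains_V)

sublocale GW: graded_cochains fscale Lg pi br fscale UNIV Wg brT "\<lambda>_ _. 0" "\<lambda>_ w y. - brT' w y" "LN n N" Gr WN piT
  by (rule graded_cochains_W)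

lemma CNV_eq: "CNV n N V k = GV.C k"
  unfolding CNV_def GV.C_def
proof (intro Collect_cong iffI; elim conjE; intro conjI)
  fix f :: "('a list \<Rightarrow>\<^sub>0 'k) list \<Rightarrow> 'a \<Rightarrow> 'v"
  assume *: "\<forall>z. multilinear_on k fscale (LN n N) sV UNIV (\<lambda>X. f X z)"
    "\<forall>X. length X = k \<and> set X \<subseteq> LN n N \<longrightarrow> lin sN sV (f X)"
  show "multilinear_on k fscale (LN n N) (fun_scale sV) MV f"
    unfolding multilinear_on_def
  proof (intro allI impI conjI)
    fix X i assume X: "length X = k \<and> set X \<subseteq> LN n N"
    then show "f X \<in> MV" using *(2) by (simp add: MV_def)
    assume i: "i < k"
    have "f (X[i := x]) \<in> MV" if "x \<in> LN n N" for x
    proof -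
      have "set (X[i := x]) \<subseteq> LN n N" using X that set_update_subset_insert[of X i x] by blast
      then show ?thesis using *(2) X by (simp add: MV_def)
    qed
    moreover have "linear_on fscale (LN n N) sV UNIV (\<lambda>x. f (X[i := x]) z)" for z
      using *(1) X i unfolding multilinear_on_def by blast
    ultimately show "linear_on fscale (LN n N) (fun_scale sV) MV (\<lambda>x. f (X[i := x]))"
      by (simp add: linear_on_def fun_eq_iff fun_scale_def)
  qed
next
  fix f :: "('a list \<Rightarrow>\<^sub>0 'k) list \<Rightarrow> 'a \<Rightarrow> 'v"
  assume *: "multilinear_on k fscale (LN n N) (fun_scale sV) MV f"
  then show "\<forall>z. multilinear_on k fscale (LN n N) sV UNIV (\<lambda>X. f X z)"
    unfolding multilinear_on_def by (simp add: linear_on_def fun_scale_def fun_eq_iff)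
  show "\<forall>X. length X = k \<and> set X \<subseteq> LN n N \<longrightarrow> lin sN sV (f X)"
    using * unfolding multilinear_on_def MV_def by blast
qed auto

lemma CLW_eq: "CLW n N V k = GW.C k"
  unfolding CLW_def GW.C_def by simp

lemma scaleNV_eq: "scaleNV V = (\<lambda>a f X. fun_scale sV a (f X))"
  by (simp add: scaleNV_def fun_scale_def fun_eq_iff)

lemma scaleLW_eq: "scaleLW = (\<lambda>a f X. fscale a (f X))"
  by (simp add: scaleLW_def fun_eq_iff)

lemma hargs_gens:
  assumes "list_all2 (\<lambda>z e. z \<in> Gr e) Z es"
  shows "\<exists>xss. xss \<in> hargs n N (length Z) \<and> Z = map (wL n N) xss \<and> even (\<Sum>xs\<leftarrow>xss. parl N xs) = even (sum_list es)"
  using assms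
proof (induction Z es rule: list_all2_induct)
  case Nil then show ?case by (simp add: hargs_def)
next
  case (Cons z Z e es)
  then obtain xss xs where "xss \<in> hargs n N (length Z)" "Z = map (wL n N) xss" "even (\<Sum>xs\<leftarrow>xss. parl N xs) = even (sum_list es)"
    "z = wedge m N xs" "xs \<in> hlists m N" "even (parl N xs) = even e" by (auto simp: Gr_def)
  then show ?case by (intro exI[of _ "xs # xss"]) (auto simp: hargs_def wL_eq)
qed

lemma hargs_graded:
  "xss \<in> hargs n N k \<Longrightarrow> LM.V.graded (map (wL n N) xss) (map (parl N) xss)"
  unfolding hargs_def by (auto simp: list_all2_map1 list_all2_map2 wL_eq list_all2_same intro!: N.EG_hlists)

lemma hargs_LN:
  assumes "xss \<in> hargs n N k" shows "length (map (wL n N) xss) = k" "set (map (wL n N) xss) \<subseteq> LN n N"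
    "set (map (wL n N) xss) \<subseteq> (\<Union>q. Lg q)"
proof -
  show "length (map (wL n N) xss) = k" using assms by (simp add: hargs_def)
  have "wL n N xs \<in> Lg (parl N xs)" if "xs \<in> set xss" for xs
    using assms that N.EG_hlists[of xs m] by (auto simp: hargs_def wL_eq)
  then show "set (map (wL n N) xss) \<subseteq> (\<Union>q. Lg q)" by auto
  then show "set (map (wL n N) xss) \<subseteq> LN n N" using GV.Lg_LN by blast
qed

lemma gens_hargs:
  assumes "length X = k" "set X \<subseteq> (\<Union>q. Gr q)" obtains xss where "xss \<in> hargs n N k" "X = map (wL n N) xss"
proof -
  have "\<exists>es. list_all2 (\<lambda>z e. z \<in> Gr e) X es" using assms(2)
  proof (induction X)
    case Nil show ?case by (intro exI[of _ "[]"]) simp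
  next
    case (Cons x X)
    then obtain es e where "list_all2 (\<lambda>z e. z \<in> Gr e) X es" "x \<in> Gr e" by auto
    then show ?case by (intro exI[of _ "e # es"]) simp
  qed
  then show thesis using hargs_gens assms(1) that by blast
qed

lemma homogNV_hom:
  assumes f: "f \<in> CNV n N V k" shows "homogNV n N V k p f \<longleftrightarrow> LM.V.hom k p (GV.pull f)"
proof
  have fC: "f \<in> GV.C k" using f by (simp add: CNV_eq)
  assume h: "homogNV n N V k p f"
  show "LM.V.hom k p (GV.pull f)"
  proof (rule GV.hom_gens[OF GV.goodD(1)[OF GV.pull_good[OF fC]]])
    fix Z es assume Z: "length Z = k" "list_all2 (\<lambda>z e. z \<in> Gr e) Z es"
    obtain xss where xss: "xss \<in> hargs n N k" "Z = map (wL n N) xss" "even (\<Sum>xs\<leftarrow>xss. parl N xs) = even (sum_list es)"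
      using hargs_gens[OF Z(2)] Z(1) by blast
    have ZL: "set Z \<subseteq> LN n N" using hargs_LN[OF xss(1)] xss(2) by simp
    have l: "lin sN sV (f Z)" using f Z(1) ZL unfolding CNV_def by blast
    have "f Z z \<in> grd V (p + sum_list es + a)" if z: "z \<in> grd N a" for z a
    proof (cases "z = 0")
      case True then show ?thesis by (simp add: lin_0[OF l] V.grd_zero)
    next
      case False
      have "f Z z \<in> grd V (p + (\<Sum>xs\<leftarrow>xss. parl N xs) + par N z)"
        using h xss N.grd_homog[OF z] unfolding homogNV_def by blast
      moreover have "grd V (p + (\<Sum>xs\<leftarrow>xss. parl N xs) + par N z) = grd V (p + sum_list es + a)"
        using xss(3) N.par_grd[OF z False] by (intro V.grd_cong) simp
      ultimately show ?thesis by simp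
    qed
    then show "GV.pull f Z \<in> HV (p + sum_list es)"
      using l by (simp add: GV.pull_eq[OF ZL] HV_def superhom_def)
  qed
next
  assume h: "LM.V.hom k p (GV.pull f)"
  show "homogNV n N V k p f" unfolding homogNV_def
  proof (intro ballI)
    fix xss z assume xss: "xss \<in> hargs n N k" and z: "z \<in> homog N"
    have "GV.pull f (map (wL n N) xss) \<in> HV (p + sum_list (map (parl N) xss))"
      using h hargs_graded[OF xss] hargs_LN[OF xss] unfolding LM.V.hom_def by blast
    then show "f (map (wL n N) xss) z \<in> grd V (p + (\<Sum>xs\<leftarrow>xss. parl N xs) + par N z)"
      using N.homog_par[OF z] by (auto simp: GV.pull_eq[OF hargs_LN(2)[OF xss]] HV_def superhom_def)
  qed
qed

lemma homogLW_hom: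
  assumes F: "F \<in> CLW n N V k" shows "homogLW n N V k p F \<longleftrightarrow> LM.W.hom k p (GW.pull F)"
proof
  have FC: "F \<in> GW.C k" using F by (simp add: CLW_eq)
  assume h: "homogLW n N V k p F"
  show "LM.W.hom k p (GW.pull F)"
  proof (rule GW.hom_gens[OF GW.goodD(1)[OF GW.pull_good[OF FC]]])
    fix Z es assume Z: "length Z = k" "list_all2 (\<lambda>z e. z \<in> Gr e) Z es"
    obtain xss where xss: "xss \<in> hargs n N k" "Z = map (wL n N) xss" "even (\<Sum>xs\<leftarrow>xss. parl N xs) = even (sum_list es)"
      using hargs_gens[OF Z(2)] Z(1) by blast
    have ZL: "set Z \<subseteq> LN n N" using hargs_LN[OF xss(1)] xss(2) by simp
    have "F Z \<in> Wg (p + (\<Sum>xs\<leftarrow>xss. parl N xs))"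
      using h xss unfolding homogLW_def by blast
    moreover have "Wg (p + (\<Sum>xs\<leftarrow>xss. parl N xs)) = Wg (p + sum_list es)"
      using xss(3) by (intro Wg_cong) simp
    ultimately show "GW.pull F Z \<in> Wg (p + sum_list es)" by (simp add: GW.pull_eq[OF ZL])
  qed
next
  assume h: "LM.W.hom k p (GW.pull F)"
  show "homogLW n N V k p F" unfolding homogLW_def
  proof
    fix xss assume xss: "xss \<in> hargs n N k"
    have "GW.pull F (map (wL n N) xss) \<in> Wg (p + sum_list (map (parl N) xss))"
      using h hargs_graded[OF xss] hargs_LN[OF xss] unfolding LM.W.hom_def by blast
    then show "F (map (wL n N) xss) \<in> Wg (p + (\<Sum>xs\<leftarrow>xss. parl N xs))"
      by (simp add: GW.pull_eq[OF hargs_LN(2)[OF xss]])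
  qed
qed

end

context nambu
begin

lemma LN_bilinear_eq:
  assumes "linear_on fscale (E.span A) sB B f" "linear_on fscale (E.span A) sB B g"
    and "vector_space sB" "\<And>x. x \<in> A \<Longrightarrow> f x = g x" "x \<in> E.span A"
  shows "f x = g x"
proof -
  have "x \<in> E.span A \<and> f x = g x"
  proof (rule E.span_induct_alt[OF assms(5)])
    have "f (fscale 0 0) = g (fscale 0 0)"
      using assms(1,2,3) E.span_zero[of A] unfolding linear_on_def by (metis vs_left_0)
    then show "0 \<in> E.span A \<and> f 0 = g 0" by (simp add: E.span_zero)
  next
    fix c y z assume y: "y \<in> A" and z: "z \<in> E.span A \<and> f z = g z"
    have *: "y \<in> E.span A" "fscale c y \<in> E.span A" using y by (simp_all add: E.span_base E.span_scale)
    then show "fscale c y + z \<in> E.span A \<and> f (fscale c y + z) = g (fscale c y + z)"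
      using assms(1,2,4) y z unfolding linear_on_def by (simp add: E.span_add)
  qed
  then show ?thesis by simp
qed

lemma LN_gens: "LN n N = E.span (wedge m N ` hlists m N)"
  unfolding LN_eq by (rule N.ext_power_hom)

lemma LN_split: "x \<in> LN n N \<Longrightarrow> x = pi 0 x + pi 1 x"
  using GV.pi_sum by simp

lemma LN_add: "x \<in> LN n N \<Longrightarrow> y \<in> LN n N \<Longrightarrow> x + y \<in> LN n N"
  by (rule GV.LN_closed)

lemma br_LN: assumes "x \<in> LN n N" "y \<in> LN n N" shows "br x y \<in> LN n N"
proof -
  have "br (pi q x) (pi s y) \<in> LN n N" for q s
    using br_EG[OF pi_in pi_in] GV.Lg_LN by blast
  moreover have "br x y = br (pi 0 x) (pi 0 y) + br (pi 0 x) (pi 1 y) + (br (pi 1 x) (pi 0 y) + br (pi 1 x) (pi 1 y))"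
    by (subst LN_split[OF assms(1)], subst LN_split[OF assms(2)]) (simp only: lin_add[OF br_lin1] lin_add[OF br_lin2] ac_simps)
  ultimately show ?thesis by (simp add: LN_add)
qed

lemma WN_split: "w \<in> WN \<Longrightarrow> w = piT 0 w + piT 1 w"
  using piT_WN(2)[of w 0] by simp

lemma WN_add: "x \<in> WN \<Longrightarrow> y \<in> WN \<Longrightarrow> x + y \<in> WN"
  by (rule GW.M1_add)

lemma brT_WN: assumes "x \<in> LN n N" "w \<in> WN" shows "brT x w \<in> WN"
proof -
  have "brT (pi q x) (piT s w) \<in> WN" for q s
    using brT_Wg[OF pi_in piT_WN(1)[OF assms(2)]] Wg_WN by blast
  moreover have "brT x w = brT (pi 0 x) (piT 0 w) + brT (pi 0 x) (piT 1 w) + (brT (pi 1 x) (piT 0 w) + brT (pi 1 x) (piT 1 w))"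
    by (subst LN_split[OF assms(1)], subst WN_split[OF assms(2)]) (simp only: lin_add[OF brT_lin1] lin_add[OF brT_lin2] ac_simps)
  ultimately show ?thesis by (simp add: WN_add)
qed

lemma brT'_WN: assumes "x \<in> LN n N" "w \<in> WN" shows "brT' w x \<in> WN"
proof -
  have "brT' (piT s w) (pi q x) \<in> WN" for q s
  proof -
    have W: "piT s w \<in> Wg s" by (rule piT_WN(1)[OF assms(2)])
    have "brT' (piT s w) (pi q x) \<in> Wg (s + q)"
      unfolding brT'_hom[OF W] by (intro Wg_neg derV_Wg ad_map_superhom[OF W] pi_in)
    then show ?thesis using Wg_WN by blast
  qed
  moreover have "brT' w x = brT' (piT 0 w) (pi 0 x) + brT' (piT 0 w) (pi 1 x) + (brT' (piT 1 w) (pi 0 x) + brT' (piT 1 w) (pi 1 x))"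
    by (subst LN_split[OF assms(1)], subst WN_split[OF assms(2)]) (simp only: lin_add[OF brT'_lin1] lin_add[OF brT'_lin2] ac_simps)
  ultimately show ?thesis by (simp add: WN_add)
qed

lemma bilinear_onI:
  assumes "\<And>y. lin sA sC (\<lambda>x. f x y)" "\<And>x. lin sB sC (f x)" "\<And>x y. x \<in> A \<Longrightarrow> y \<in> B \<Longrightarrow> f x y \<in> C"
  shows "bilinear_on sA A sB B sC C f"
  using assms unfolding bilinear_on_def linear_on_def by simp

lemma brL_eq: assumes "x \<in> LN n N" "y \<in> LN n N" shows "brL n N x y = br x y"
proof -
  have b: "is_brL n N br" unfolding is_brL_def m_simps
  proof (intro conjI ballI)
    show "bilinear_on fscale (LN n N) fscale (LN n N) fscale (LN n N) br"
      by (rule bilinear_onI[OF br_lin1 br_lin2 br_LN])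
    fix xs ys assume xs: "xs \<in> hlists m N" and ys: "ys \<in> hlists m N"
    then show "br (wL n N xs) (wL n N ys) = (\<Sum>i<m. fscale ((-1) ^ (parl N xs * parl N (take i ys))) (wL n N (ys[i := brk N (xs @ [ys ! i])])))"
      by (simp add: wL_eq br_wedge[OF N.EG_hlists[OF xs] ys] sign_scale[OF vsE] adL_wedge hlists_def)
  qed
  then have b': "is_brL n N (brL n N)" unfolding brL_def by (rule someI[where P = "is_brL n N"])
  have lin: "linear_on fscale (LN n N) fscale (LN n N) (\<lambda>x. f x y)" "linear_on fscale (LN n N) fscale (LN n N) (f x)"
    if "is_brL n N f" "x \<in> LN n N" "y \<in> LN n N" for f x y
    using that unfolding is_brL_def bilinear_on_def by blast+
  have w: "wedge m N xs \<in> LN n N" if "xs \<in> hlists m N" for xs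
    unfolding LN_gens using that by (intro E.span_base imageI)
  have "brL n N (wedge m N xs) y = br (wedge m N xs) y" if xs: "xs \<in> hlists m N" for xs
  proof (rule LN_bilinear_eq[OF lin(2)[OF b' w[OF xs] assms(2), unfolded LN_gens] lin(2)[OF b w[OF xs] assms(2), unfolded LN_gens] vsE _ assms(2)[unfolded LN_gens]])
    fix u assume "u \<in> wedge m N ` hlists m N"
    then obtain ys where ys: "u = wL n N ys" "ys \<in> hlists m N" by (auto simp: wL_eq)
    have "f (wL n N xs) (wL n N ys) = (\<Sum>i<m. fscale ((-1) ^ (parl N xs * parl N (take i ys))) (wL n N (ys[i := brk N (xs @ [ys ! i])])))"
      if "is_brL n N f" for f using that xs ys(2) unfolding is_brL_def m_simps by blast
    from this[OF b] this[OF b'] show "brL n N (wedge m N xs) u = br (wedge m N xs) u"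
      by (simp only: wL_eq ys(1))
  qed
  then show ?thesis
    by (intro LN_bilinear_eq[OF lin(1)[OF b' assms, unfolded LN_gens] lin(1)[OF b assms, unfolded LN_gens] vsE _ assms(1)[unfolded LN_gens]]) auto
qed

lemma brW_eq: assumes "x \<in> LN n N" "y \<in> WN" shows "brW n N V x y = brT x y"
proof -
  let ?G = "{genW n N V xs v | xs v. xs \<in> hlists m0 N \<and> v \<in> homog V}"
  have b: "is_brW n N V brT" unfolding is_brW_def m_simps
  proof (intro conjI ballI)
    show "bilinear_on fscale (LN n N) fscale WN fscale WN brT"
      by (rule bilinear_onI[OF brT_lin1 brT_lin2 brT_WN])
    fix xs ys v assume xs: "xs \<in> hlists m N" and ys: "ys \<in> hlists m0 N" and v: "v \<in> homog V"
    then show "brT (wL n N xs) (genW n N V ys v) = (\<Sum>i<m0. fscale ((-1) ^ (parl N xs * parl N (take i ys))) (genW n N V (ys[i := brk N (xs @ [ys ! i])]) v))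
       + fscale ((-1) ^ (parl N xs * parl N ys)) (genW n N V ys (act V xs v))"
      by (simp add: wL_eq brT_gen[OF N.EG_hlists[OF xs] ys v] sign_scale[OF vsE] adL_wedge actL_wedge hlists_def)
  qed
  then have b': "is_brW n N V (brW n N V)" unfolding brW_def by (rule someI[where P = "is_brW n N V"])
  have lin: "linear_on fscale (LN n N) fscale WN (\<lambda>x. f x y)" "linear_on fscale WN fscale WN (f x)"
    if "is_brW n N V f" "x \<in> LN n N" "y \<in> WN" for f x y
    using that unfolding is_brW_def bilinear_on_def by blast+
  have w: "wedge m N xs \<in> LN n N" if "xs \<in> hlists m N" for xs
    unfolding LN_gens using that by (intro E.span_base imageI)
  have "brW n N V (wedge m N xs) y = brT (wedge m N xs) y" if xs: "xs \<in> hlists m N" for xs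
  proof (rule LN_bilinear_eq[OF lin(2)[OF b' w[OF xs] assms(2), unfolded WN_eq] lin(2)[OF b w[OF xs] assms(2), unfolded WN_eq] vsE _ assms(2)[unfolded WN_eq]])
    fix u assume "u \<in> ?G"
    then obtain ys v where u: "u = genW n N V ys v" "ys \<in> hlists m0 N" "v \<in> homog V" by blast
    have "f (wL n N xs) (genW n N V ys v) = (\<Sum>i<m0. fscale ((-1) ^ (parl N xs * parl N (take i ys))) (genW n N V (ys[i := brk N (xs @ [ys ! i])]) v))
       + fscale ((-1) ^ (parl N xs * parl N ys)) (genW n N V ys (act V xs v))"
      if "is_brW n N V f" for f using that xs u(2,3) unfolding is_brW_def m_simps by blast
    from this[OF b] this[OF b'] show "brW n N V (wedge m N xs) u = brT (wedge m N xs) u"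
      by (simp only: wL_eq u(1))
  qed
  then show ?thesis
    by (intro LN_bilinear_eq[OF lin(1)[OF b' assms, unfolded LN_gens] lin(1)[OF b assms, unfolded LN_gens] vsE _ assms(1)[unfolded LN_gens]]) auto
qed

lemma brW'_eq: assumes "x \<in> LN n N" "y \<in> WN" shows "brW' n N V y x = brT' y x"
proof -
  let ?G = "{genW n N V xs v | xs v. xs \<in> hlists m0 N \<and> v \<in> homog V}"
  have b: "is_brW' n N V brT'" unfolding is_brW'_def m_simps
  proof (intro conjI ballI)
    show "bilinear_on fscale WN fscale (LN n N) fscale WN brT'"
      by (rule bilinear_onI[OF brT'_lin1 brT'_lin2]) (rule brT'_WN)
    fix us v ys assume us: "us \<in> hlists m0 N" and v: "v \<in> homog V" and ys: "ys \<in> hlists m N"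
    have vg: "v \<in> grd V (par V v)" by (rule V.homog_par[OF v])
    have W: "genW n N V us v \<in> Wg (parl N us + par V v)" by (rule genW_Wg'[OF us v])
    have l: "length us = m0" using us by (simp add: hlists_def)
    have i: "insW n N V ys i (sign e u) = sign e (insW n N V ys i u)" if "i < m" for i e u
    proof -
      have "(map fromN ys)[i := fromV u] = map fromN (take i ys) @ fromV u # map fromN (drop (Suc i) ys)" for u :: 'v
        using that ys by (simp add: upd_conv_take_nth_drop hlists_def take_map drop_map)
      moreover have "lin sV fscale (\<lambda>u. wedge m T (map fromN (take i ys) @ fromV u # map fromN (drop (Suc i) ys)))"
        using that ys by (intro lin_comp[OF _ fromV_lin] mlinD[OF T.wedge_mlin]) (simp add: hlists_def)
      ultimately show ?thesis unfolding insW_eq using lin_sign by fastforce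
    qed
    have "brT' (genW n N V us v) (wL n N ys) = - (\<Sum>i<m. sign ((parl N us + par V v) * parl N (take i ys)) (insW n N V ys i (ad_map (genW n N V us v) (ys ! i))))"
      unfolding brT'_hom[OF W] wL_eq derV_wedge[OF ad_map_superhom[OF W] ys] by simp
    also have "\<dots> = - (\<Sum>i<m. fscale ((-1) ^ ((parl N us + par V v) * parl N (take i ys) + par V v * par N (ys ! i))) (insW n N V ys i (act V (us @ [ys ! i]) v)))"
      by (intro arg_cong[where f = uminus] sum.cong refl)
        (simp add: ad_map_gen[OF l vg nth_grd[OF ys]] i sign_scale[OF vsE])
    finally show "brT' (genW n N V us v) (wL n N ys) = \<dots>" .
  qed
  then have b': "is_brW' n N V (brW' n N V)" unfolding brW'_def by (rule someI[where P = "is_brW' n N V"])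
  have lin: "linear_on fscale (LN n N) fscale WN (\<lambda>x. f y x)" "linear_on fscale WN fscale WN (\<lambda>y. f y x)"
    if "is_brW' n N V f" "x \<in> LN n N" "y \<in> WN" for f x y
    using that unfolding is_brW'_def bilinear_on_def by blast+
  have w: "wedge m N xs \<in> LN n N" if "xs \<in> hlists m N" for xs
    unfolding LN_gens using that by (intro E.span_base imageI)
  have "brW' n N V y (wedge m N xs) = brT' y (wedge m N xs)" if xs: "xs \<in> hlists m N" for xs
  proof (rule LN_bilinear_eq[OF lin(2)[OF b' w[OF xs] assms(2), unfolded WN_eq] lin(2)[OF b w[OF xs] assms(2), unfolded WN_eq] vsE _ assms(2)[unfolded WN_eq]])
    fix u assume "u \<in> ?G"
    then obtain ys v where u: "u = genW n N V ys v" "ys \<in> hlists m0 N" "v \<in> homog V" by blast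
    have "f (genW n N V ys v) (wL n N xs) = - (\<Sum>i<m. fscale ((-1) ^ ((parl N ys + par V v) * parl N (take i xs) + par V v * par N (xs ! i))) (insW n N V xs i (act V (ys @ [xs ! i]) v)))"
      if "is_brW' n N V f" for f using that xs u(2,3) unfolding is_brW'_def m_simps by blast
    from this[OF b] this[OF b'] show "brW' n N V u (wedge m N xs) = brT' u (wedge m N xs)"
      by (simp only: wL_eq u(1))
  qed
  then show ?thesis
    by (intro LN_bilinear_eq[OF lin(1)[OF b' assms, unfolded LN_gens] lin(1)[OF b assms, unfolded LN_gens] vsE _ assms(1)[unfolded LN_gens]]) auto
qed

end

lemma (in leibniz_premodule) coboundary_scale:
  "sM a (coboundary p f X) = coboundary p (\<lambda>Z. sM a (f Z)) X"
proof -
  have "lin (*) sM (\<lambda>y. coboundary p (\<lambda>Z. sM y (f Z)) X)"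
    using vsM by (intro coboundary_lin_f linI) (simp_all add: vs_add_left vs_scale)
  from lin_scale[OF this, of a 1] show ?thesis by (simp add: vs_one[OF vsM])
qed

lemma (in leibniz_module_map) Dl_scale:
  "sW a (Dl p f X) = Dl p (\<lambda>Z. sM a (f Z)) X"
proof -
  have "lin (*) sW (\<lambda>y. Dl p (\<lambda>Z. sM y (f Z)) X)"
    using V.vsM by (intro Dl_lin_f linI) (simp_all add: vs_add_left vs_scale)
  from lin_scale[OF this, of a 1] show ?thesis by (simp add: vs_one[OF V.vsM])
qed

context nambu
begin

lemma cochain_operator_VV: "cochain_operator fscale Lg pi br (LN n N) Gr (fun_scale sV) MV HV lV cV rV MV hV (fun_scale sV) MV HV lV cV rV MV hV LM.V.coboundary k (Suc k)"
  by (intro cochain_operator.intro graded_cochains_V cochain_operator_axioms.intro LM.V.coboundary_mlin LM.V.coboundary_hom LM.V.coboundary_scale[symmetric] LM.V.coboundary_cong LM.V.coboundary_diff) simp_all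

lemma cochain_operator_VW: "cochain_operator fscale Lg pi br (LN n N) Gr (fun_scale sV) MV HV lV cV rV MV hV
    fscale UNIV Wg brT (\<lambda>_ _. 0) (\<lambda>_ w y. - brT' w y) WN piT LM.Dl k (Suc k)"
  by (intro cochain_operator.intro graded_cochains_V graded_cochains_W cochain_operator_axioms.intro LM.Dl_mlin LM.V.cochain_mlin LM.Dl_hom LM.Dl_scale[symmetric] LM.Dl_cong LM.Dl_diff) simp_all

lemma cochain_operator_WW: "cochain_operator fscale Lg pi br (LN n N) Gr fscale UNIV Wg brT (\<lambda>_ _. 0) (\<lambda>_ w y. - brT' w y) WN piT
    fscale UNIV Wg brT (\<lambda>_ _. 0) (\<lambda>_ w y. - brT' w y) WN piT LM.W.coboundary k (Suc k)"
  by (intro cochain_operator.intro graded_cochains_W cochain_operator_axioms.intro LM.W.coboundary_mlin LM.W.coboundary_hom LM.W.coboundary_scale[symmetric] LM.W.coboundary_cong LM.W.coboundary_diff) simp_all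

sublocale DV: cochain_operator fscale Lg pi br "LN n N" Gr "fun_scale sV" MV HV lV cV rV MV hV "fun_scale sV" MV HV lV cV rV MV hV LM.V.coboundary k "Suc k" for k
  by (rule cochain_operator_VV)

sublocale DD: cochain_operator fscale Lg pi br "LN n N" Gr "fun_scale sV" MV HV lV cV rV MV hV
    fscale UNIV Wg brT "\<lambda>_ _. 0" "\<lambda>_ w y. - brT' w y" WN piT LM.Dl k "Suc k" for k
  by (rule cochain_operator_VW)

sublocale DW: cochain_operator fscale Lg pi br "LN n N" Gr fscale UNIV Wg brT "\<lambda>_ _. 0" "\<lambda>_ w y. - brT' w y" WN piT
    fscale UNIV Wg brT "\<lambda>_ _. 0" "\<lambda>_ w y. - brT' w y" WN piT LM.W.coboundary k "Suc k" for k
  by (rule cochain_operator_WW)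

lemma hargs_nth:
  assumes "xss \<in> hargs n N (Suc k)" "j \<le> k"
  shows "xss ! j \<in> hlists m N" "map (wL n N) xss ! j = wedge m N (xss ! j)" "map (wL n N) xss ! j \<in> Lg (parl N (xss ! j))"
    "map (wL n N) xss ! j \<in> LN n N"
proof -
  have l: "j < length xss" using assms by (simp add: hargs_def)
  then show h: "xss ! j \<in> hlists m N" using assms nth_mem[OF l] by (auto simp: hargs_def)
  show e: "map (wL n N) xss ! j = wedge m N (xss ! j)" using l by (simp add: wL_eq)
  show "map (wL n N) xss ! j \<in> Lg (parl N (xss ! j))" unfolding e by (rule N.EG_hlists[OF h])
  then show "map (wL n N) xss ! j \<in> LN n N" using GV.Lg_LN by blast
qed

lemma hargs_del:
  assumes "xss \<in> hargs n N (Suc k)"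
  defines "X \<equiv> map (wL n N) xss"
  shows "s \<le> k \<Longrightarrow> t \<le> k \<Longrightarrow> set (del s (X[t := br (X ! s) (X ! t)])) \<subseteq> LN n N"
    "s \<le> k \<Longrightarrow> set (del s X) \<subseteq> LN n N" "set (take k X) \<subseteq> LN n N"
    "s \<le> k \<Longrightarrow> t \<le> k \<Longrightarrow> brL n N (X ! s) (X ! t) = br (X ! s) (X ! t)"
proof -
  have X: "length X = Suc k" "set X \<subseteq> LN n N" "set X \<subseteq> (\<Union>q. Lg q)" using hargs_LN[OF assms(1)] by (simp_all add: X_def)
  show "set (del s (X[t := br (X ! s) (X ! t)])) \<subseteq> LN n N" if "s \<le> k" "t \<le> k"
    using LM.V.del_graded(1)[OF X(1,3) that] GV.Lg_LN by blast
  show "set (del s X) \<subseteq> LN n N" if "s \<le> k" using set_del[of s X] X by blast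
  show "set (take k X) \<subseteq> LN n N" using X(2) by (auto dest: in_set_takeD)
  show "brL n N (X ! s) (X ! t) = br (X ! s) (X ! t)" if "s \<le> k" "t \<le> k"
    using that unfolding X_def by (intro brL_eq hargs_nth(4)[OF assms(1)])
qed

lemma minus_fun_at: "(- f) z = - f z" "(f - g) z = f z - g z" "(f + g) z = f z + g z"
  for f g :: "'x \<Rightarrow> 'y::ab_group_add"
  by simp_all

lemma take_superhom:
  assumes f: "f \<in> CNV n N V k" and h: "LM.V.hom k p (GV.pull f)" and xss: "xss \<in> hargs n N (Suc k)"
  shows "superhom N V (p + (\<Sum>j<k. parl N (xss ! j))) (f (take k (map (wL n N) xss)))"
proof -
  let ?X = "take k (map (wL n N) xss)" and ?es = "take k (map (parl N) xss)"
  have l: "length xss = Suc k" using xss by (simp add: hargs_def)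
  have "LM.V.graded ?X ?es"
    by (rule list_all2_takeI[OF hargs_graded[OF xss]])
  then have "GV.pull f ?X \<in> HV (p + sum_list ?es)"
    using h l unfolding LM.V.hom_def by simp
  moreover have "?es = map (\<lambda>j. parl N (xss ! j)) [0..<k]"
    using l by (intro nth_equalityI) simp_all
  then have "sum_list ?es = (\<Sum>j<k. parl N (xss ! j))"
    by (simp add: sum_list_distinct_conv_sum_set atLeast0LessThan)
  ultimately show ?thesis
    using GV.pull_eq[OF hargs_del(3)[OF xss], of f] by (simp add: HV_def)
qed

lemma delta_formula:
  assumes f: "f \<in> CNV n N V k" and h: "LM.V.hom k p (GV.pull f)" and xss: "xss \<in> hargs n N (Suc k)" and z: "z \<in> homog N"
  shows "LM.V.coboundary p (GV.pull f) (map (wL n N) xss) z = delta_rhs n N V k p f xss z"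
proof -
  define X where "X = map (wL n N) xss"
  define P where "P = (\<lambda>j. parl N (xss ! j))"
  have fC: "f \<in> GV.C k" using f by (simp add: CNV_eq)
  note good = GV.pull_good[OF fC]
  have Xk: "length X = Suc k" using hargs_LN[OF xss] by (simp add: X_def)
  have XP: "\<forall>j\<le>k. X ! j \<in> Lg (P j)" using hargs_nth(3)[OF xss] by (simp add: X_def P_def)
  have xk: "xss ! k \<in> hlists m N" by (rule hargs_nth(1)[OF xss]) simp
  have d1: "GV.pull f (del s (X[t := br (X ! s) (X ! t)])) = f (del s (X[t := brL n N (X ! s) (X ! t)]))" if "s \<le> k" "t \<le> k" for s t
    using GV.pull_eq[OF hargs_del(1)[OF xss that]] hargs_del(4)[OF xss that] by (simp add: X_def)
  have d2: "GV.pull f (del s X) = f (del s X)" if "s \<le> k" for s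
    using GV.pull_eq[OF hargs_del(2)[OF xss that]] by (simp add: X_def)
  have d3: "GV.pull f (take k X) = f (take k X)"
    using GV.pull_eq[OF hargs_del(3)[OF xss]] by (simp add: X_def)
  have ad: "adL (X ! s) z = brk N (xss ! s @ [z])" "actL (X ! s) v = act V (xss ! s) v" if "s \<le> k" for s z v
    using hargs_nth(1,2)[OF xss that] by (simp_all add: X_def adL_wedge actL_wedge hlists_def)
  define p' where "p' = p + (\<Sum>j<k. P j)"
  define \<phi> where "\<phi> = f (take k X)"
  have \<phi>: "superhom N V p' \<phi>"
    unfolding \<phi>_def p'_def X_def P_def by (rule take_superhom[OF f h xss])
  have \<phi>M: "\<phi> \<in> MV" using superhom_lin[OF \<phi>] by (simp add: MV_def)
  have last: "rV p' \<phi> (X ! k) z = sign (P k * p') (act V (xss ! k) (\<phi> z)) - \<phi> (brk N (xss ! k @ [z]))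
      + (\<Sum>i<m. sign (i + 1 + ((p' + parl N (drop (Suc i) (xss ! k))) * (par N (xss ! k ! i) + P k)
     + par N z * (p' + P k) + P k * parl N (drop (Suc i) (xss ! k)))) (act V (z # del i (xss ! k)) (\<phi> (xss ! k ! i))))"
  proof -
    have e: "X ! k = wedge m N (xss ! k)" using hargs_nth(2)[OF xss, of k] by (simp add: X_def)
    have 1: "rV p' \<phi> (X ! k) z = sign (P k * p') (hom_act p' (P k) (X ! k) \<phi> z) - ad_map (derV p' \<phi> (wedge m N (xss ! k))) z"
    proof -
      have "X ! k \<in> Lg (P k)" using XP by simp
      from fun_cong[OF rV_hom[OF this \<phi>M], of p' z] show ?thesis by (simp only: e)
    qed
    have 2: "sign (P k * p') (hom_act p' (P k) (X ! k) \<phi> z) = sign (P k * p') (act V (xss ! k) (\<phi> z)) - \<phi> (brk N (xss ! k @ [z]))"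
      unfolding hom_act_def ad[OF order_refl] by (cases "even (P k)"; cases "even p'") (simp_all add: sign_def)
    show ?thesis unfolding 1 2 diff_conv_add_uminus ad_map_derV_wedge[OF \<phi> xk N.homog_par[OF z]] by (simp add: P_def)
  qed
  have sums: "(\<Sum>j\<le>k. P j) = (\<Sum>j<k. P j) + P k"
    by (simp flip: lessThan_Suc_atMost)
  have "LM.V.coboundary p (GV.pull f) X z =
      - (\<Sum>s\<le>k. \<Sum>t\<in>{s<..k}. sign (s + P s * (\<Sum>j\<in>{s<..<t}. P j)) (f (del s (X[t := brL n N (X ! s) (X ! t)])) z))
      - (\<Sum>s<k. sign (s + P s * (\<Sum>j\<in>{s<..k}. P j)) (f (del s X) (brk N (xss ! s @ [z]))))
      + (\<Sum>s<k. sign (s + P s * (p + (\<Sum>j<s. P j))) (act V (xss ! s) (f (del s X) z)))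
      + sign k (rV p' \<phi> (X ! k) z)"
    unfolding LM.V.coboundary_formula[OF Xk XP GV.good_cochain[OF good]] minus_fun_at sum_fun sign_fun d3 p'_def[symmetric] \<phi>_def[symmetric]
    by (intro arg_cong2[where f = "(+)"] arg_cong2[where f = "(-)"] arg_cong[where f = uminus] sum.cong refl)
      (simp_all add: d1 d2 lV_def cV_def ad)
  also have "\<dots> = delta_rhs n N V k p f xss z"
  proof -
    have at: "(\<Sum>s\<le>k. g s) = (\<Sum>s<k. g s) + g k" for g :: "nat \<Rightarrow> 'v"
      by (simp flip: lessThan_Suc_atMost)
    have del: "del k X = take k X" using Xk by (simp add: del_def)
    show ?thesis
      unfolding delta_rhs_def Let_def X_def[symmetric] P_def[symmetric] sign_scale[OF V.vsS] m_simps sums p'_def[symmetric]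
        at[of "\<lambda>s. sign (s + P s * (\<Sum>j\<in>{s<..k}. P j)) (f (del s X) (brk N (xss ! s @ [z])))"]
        at[of "\<lambda>s. sign (s + P s * (p + (\<Sum>j<s. P j))) (act V (xss ! s) (f (del s X) z))"] del \<phi>_def[symmetric] last
      by (simp add: sign_add sign_diff sign_sum p'_def algebra_simps)
  qed
  finally show ?thesis by (simp add: X_def)
qed

lemma Delta_formula:
  assumes f: "f \<in> CNV n N V k" and h: "LM.V.hom k p (GV.pull f)" and xss: "xss \<in> hargs n N (Suc k)"
  shows "LM.Dl p (GV.pull f) (map (wL n N) xss) = Delta_rhs n N V k p f xss"
proof -
  define X where "X = map (wL n N) xss"
  have fC: "f \<in> GV.C k" using f by (simp add: CNV_eq)
  have Xk: "length X = Suc k" using hargs_LN[OF xss] by (simp add: X_def)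
  have XP: "\<forall>j<k. X ! j \<in> Lg (parl N (xss ! j))" using hargs_nth(3)[OF xss] by (simp add: X_def)
  have xk: "xss ! k \<in> hlists m N" by (rule hargs_nth(1)[OF xss]) simp
  have e: "X ! k = wedge m N (xss ! k)" using hargs_nth(2)[OF xss, of k] by (simp add: X_def)
  have d3: "GV.pull f (take k X) = f (take k X)"
    using GV.pull_eq[OF hargs_del(3)[OF xss]] by (simp add: X_def)
  have "LM.Dl p (GV.pull f) X = derV (p + (\<Sum>j<k. parl N (xss ! j))) (f (take k X)) (X ! k)"
    using LM.Dl_formula[OF Xk XP GV.goodD(1)[OF GV.pull_good[OF fC]], of p] by (simp only: d3)
  also have "\<dots> = Delta_rhs n N V k p f xss"
    unfolding e derV_wedge[OF take_superhom[OF f h xss, folded X_def] xk] Delta_rhs_def Let_def X_def[symmetric] m_simps sign_scale[OF vsE] ..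
  finally show ?thesis by (simp add: X_def)
qed

lemma d_formula:
  assumes F: "F \<in> CLW n N V k" and k: "k > 0" and xss: "xss \<in> hargs n N (Suc k)"
  shows "LM.W.coboundary p (GW.pull F) (map (wL n N) xss) = d_rhs n N V k p F xss"
proof -
  define X where "X = map (wL n N) xss"
  define P where "P = (\<lambda>j. parl N (xss ! j))"
  have FC: "F \<in> GW.C k" using F by (simp add: CLW_eq)
  have Xk: "length X = Suc k" using hargs_LN[OF xss] by (simp add: X_def)
  have XP: "\<forall>j\<le>k. X ! j \<in> Lg (P j)" using hargs_nth(3)[OF xss] by (simp add: X_def P_def)
  have FW: "F Z \<in> WN" if "length Z = k" "set Z \<subseteq> LN n N" for Z
    using GW.goodD(2)[OF GW.pull_good[OF FC] that(1)] by (simp add: GW.pull_eq[OF that(2)])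
  have d1: "GW.pull F (del s (X[t := br (X ! s) (X ! t)])) = F (del s (X[t := brL n N (X ! s) (X ! t)]))" if "s \<le> k" "t \<le> k" for s t
    using GW.pull_eq[OF hargs_del(1)[OF xss that]] hargs_del(4)[OF xss that] by (simp add: X_def)
  have d2: "brT (X ! s) (GW.pull F (del s X)) = brW n N V (X ! s) (F (del s X))" if s: "s \<le> k" for s
  proof -
    have "F (del s X) \<in> WN" using hargs_del(2)[OF xss s] Xk s by (intro FW) (auto simp: X_def del_def)
    then show ?thesis
      using GW.pull_eq[OF hargs_del(2)[OF xss s]] brW_eq[OF hargs_nth(4)[OF xss s]] by (simp add: X_def)
  qed
  have d3: "brT' (GW.pull F (take k X)) (X ! k) = brW' n N V (F (take k X)) (X ! k)"
  proof -
    have "F (take k X) \<in> WN" using hargs_del(3)[OF xss] Xk by (intro FW) (auto simp: X_def)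
    then show ?thesis
      using GW.pull_eq[OF hargs_del(3)[OF xss]] brW'_eq[OF hargs_nth(4)[OF xss order_refl]] by (simp add: X_def)
  qed
  have "LM.W.coboundary p (GW.pull F) X =
      - (\<Sum>s\<le>k. \<Sum>t\<in>{s<..k}. sign (s + P s * (\<Sum>j\<in>{s<..<t}. P j)) (F (del s (X[t := brL n N (X ! s) (X ! t)]))))
      + (\<Sum>s<k. sign (s + P s * (p + (\<Sum>j<s. P j))) (brW n N V (X ! s) (F (del s X))))
      + sign (k + 1) (brW' n N V (F (take k X)) (X ! k))"
    unfolding LM.W.coboundary_formula[OF Xk XP GW.good_cochain[OF GW.pull_good[OF FC]]] sign_zero sum.neutral_const diff_zero d3
    by (intro arg_cong2[where f = "(+)"] arg_cong[where f = uminus] sum.cong refl)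
      (simp_all add: d1 d2 sign_Suc sign_minus)
  also have "\<dots> = d_rhs n N V k p F xss"
    using k unfolding d_rhs_def Let_def X_def[symmetric] P_def[symmetric] sign_scale[OF vsE] by simp
  finally show ?thesis by (simp add: X_def)
qed

lemma delta_exists: "is_delta n N V k (DV.lin_ext k)"
  unfolding is_delta_def scaleNV_eq
proof (intro conjI ballI impI)
  show "linear_on (\<lambda>a f X. fun_scale sV a (f X)) (CNV n N V k) (\<lambda>a f X. fun_scale sV a (f X)) (CNV n N V (k + 1)) (DV.lin_ext k)"
    using DV.lin_ext_linear[of k] by (simp add: CNV_eq)
  fix p f xss z assume *: "p \<in> {0, 1::nat}" "f \<in> CNV n N V k" "homogNV n N V k p f" "xss \<in> hargs n N (k + 1)" "z \<in> homog N"
  have h: "LM.V.hom k p (GV.pull f)" and xss: "xss \<in> hargs n N (Suc k)" using * homogNV_hom by auto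
  show "DV.lin_ext k f (map (wL n N) xss) z = delta_rhs n N V k p f xss z"
    using DV.lin_ext_hom[OF _ h hargs_LN(1,2)[OF xss] *(1)] delta_formula[OF *(2) h xss *(5)] *(2) by (simp add: CNV_eq)
qed

lemma Delta_exists: "is_Delta n N V k (DD.lin_ext k)"
  unfolding is_Delta_def scaleNV_eq scaleLW_eq
proof (intro conjI ballI impI)
  show "linear_on (\<lambda>a f X. fun_scale sV a (f X)) (CNV n N V k) (\<lambda>a f X. fscale a (f X)) (CLW n N V (k + 1)) (DD.lin_ext k)"
    using DD.lin_ext_linear[of k] by (simp add: CNV_eq CLW_eq)
  fix p f xss assume *: "p \<in> {0, 1::nat}" "f \<in> CNV n N V k" "homogNV n N V k p f" "xss \<in> hargs n N (k + 1)"
  have h: "LM.V.hom k p (GV.pull f)" and xss: "xss \<in> hargs n N (Suc k)" using * homogNV_hom by auto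
  show "DD.lin_ext k f (map (wL n N) xss) = Delta_rhs n N V k p f xss"
    using DD.lin_ext_hom[OF _ h hargs_LN(1,2)[OF xss] *(1)] Delta_formula[OF *(2) h xss] *(2) by (simp add: CNV_eq)
qed

lemma d_exists: assumes "k > 0" shows "is_d n N V k (DW.lin_ext k)"
  unfolding is_d_def scaleLW_eq
proof (intro conjI ballI impI)
  show "linear_on (\<lambda>a f X. fscale a (f X)) (CLW n N V k) (\<lambda>a f X. fscale a (f X)) (CLW n N V (k + 1)) (DW.lin_ext k)"
    using DW.lin_ext_linear[of k] by (simp add: CLW_eq)
  fix p F xss assume *: "p \<in> {0, 1::nat}" "F \<in> CLW n N V k" "homogLW n N V k p F" "xss \<in> hargs n N (k + 1)"
  have h: "LM.W.hom k p (GW.pull F)" and xss: "xss \<in> hargs n N (Suc k)" using * homogLW_hom by auto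
  show "DW.lin_ext k F (map (wL n N) xss) = d_rhs n N V k p F xss"
    using DW.lin_ext_hom[OF _ h hargs_LN(1,2)[OF xss] *(1)] d_formula[OF *(2) assms xss] *(2) by (simp add: CLW_eq)
qed

lemma delta_is_delta: "is_delta n N V k (delta n N V k)"
  unfolding delta_def by (rule someI[where P = "is_delta n N V k", OF delta_exists])

lemma delta_eq: assumes "f \<in> CNV n N V k" shows "delta n N V k f = DV.lin_ext k f"
proof (rule DV.lin_ext_unique[of k])
  note D = delta_is_delta[of k, unfolded is_delta_def scaleNV_eq] and E = delta_exists[of k, unfolded is_delta_def]
  show "linear_on (\<lambda>a f X. fun_scale sV a (f X)) (GV.C k) (\<lambda>a f X. fun_scale sV a (f X)) (CNV n N V (k + 1)) (delta n N V k)"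
    using D by (simp add: CNV_eq)
  show "f \<in> GV.C k" using assms by (simp add: CNV_eq)
  fix p f assume p: "p \<in> {0, 1}" and fC: "f \<in> GV.C k" and h: "LM.V.hom k p (GV.pull f)"
  have f: "f \<in> CNV n N V k" "homogNV n N V k p f" using fC h homogNV_hom by (simp_all add: CNV_eq)
  have C: "delta n N V k f \<in> CNV n N V (Suc k)" "DV.lin_ext k f \<in> CNV n N V (Suc k)"
    using D E f(1) by (auto simp: linear_on_def)
  show "delta n N V k f = DV.lin_ext k f"
  proof (rule GV.C_eqI[of _ "Suc k"])
    fix X assume "length X = Suc k" "set X \<subseteq> (\<Union>q. Gr q)"
    then obtain xss where xss: "xss \<in> hargs n N (Suc k)" "X = map (wL n N) xss" by (rule gens_hargs)
    have X: "length X = Suc k \<and> set X \<subseteq> LN n N" using hargs_LN[OF xss(1)] xss(2) by simp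
    have l: "lin sN sV (delta n N V k f X)" "lin sN sV (DV.lin_ext k f X)"
      using C X unfolding CNV_def by blast+
    have "delta n N V k f X z = DV.lin_ext k f X z" for z
    proof (rule N.lin_eq_homog[OF l])
      fix z a assume "z \<in> grd N a"
      then have z: "z \<in> homog N" by (rule N.grd_homog)
      have x: "xss \<in> hargs n N (k + 1)" using xss by simp
      show "delta n N V k f X z = DV.lin_ext k f X z"
        unfolding xss(2) D[THEN conjunct2, rule_format, OF p f x z] E[THEN conjunct2, rule_format, OF p f x z] ..
    qed
    then show "delta n N V k f X = DV.lin_ext k f X" by (rule ext)
  qed (use C in \<open>simp_all add: CNV_eq\<close>)
qed

lemma Delta_eq: assumes "f \<in> CNV n N V k" shows "Delta n N V k f = DD.lin_ext k f"
proof (rule DD.lin_ext_unique[of k])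
  have "is_Delta n N V k (Delta n N V k)"
    unfolding Delta_def by (rule someI[where P = "is_Delta n N V k", OF Delta_exists])
  note D = this[unfolded is_Delta_def scaleNV_eq scaleLW_eq] and E = Delta_exists[of k, unfolded is_Delta_def]
  show "linear_on (\<lambda>a f X. fun_scale sV a (f X)) (GV.C k) (\<lambda>a f X. fscale a (f X)) (CLW n N V (k + 1)) (Delta n N V k)"
    using D by (simp add: CNV_eq)
  show "f \<in> GV.C k" using assms by (simp add: CNV_eq)
  fix p f assume p: "p \<in> {0, 1}" and fC: "f \<in> GV.C k" and h: "LM.V.hom k p (GV.pull f)"
  have f: "f \<in> CNV n N V k" "homogNV n N V k p f" using fC h homogNV_hom by (simp_all add: CNV_eq)
  show "Delta n N V k f = DD.lin_ext k f"
  proof (rule GW.C_eqI[of _ "Suc k"])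
    show "Delta n N V k f \<in> GW.C (Suc k)" "DD.lin_ext k f \<in> GW.C (Suc k)"
      using D E f(1) by (auto simp: linear_on_def CLW_eq)
    fix X assume "length X = Suc k" "set X \<subseteq> (\<Union>q. Gr q)"
    then obtain xss where xss: "xss \<in> hargs n N (Suc k)" "X = map (wL n N) xss" by (rule gens_hargs)
    then have x: "xss \<in> hargs n N (k + 1)" by simp
    show "Delta n N V k f X = DD.lin_ext k f X"
      unfolding xss(2) D[THEN conjunct2, rule_format, OF p f x] E[THEN conjunct2, rule_format, OF p f x] ..
  qed
qed

lemma dLW_eq: assumes "F \<in> CLW n N V k" "k > 0" shows "dLW n N V k F = DW.lin_ext k F"
proof (rule DW.lin_ext_unique[of k])
  have "is_d n N V k (dLW n N V k)"
    unfolding dLW_def by (rule someI[where P = "is_d n N V k", OF d_exists[OF assms(2)]])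
  note D = this[unfolded is_d_def scaleLW_eq] and E = d_exists[OF assms(2), unfolded is_d_def]
  show "linear_on (\<lambda>a f X. fscale a (f X)) (GW.C k) (\<lambda>a f X. fscale a (f X)) (CLW n N V (k + 1)) (dLW n N V k)"
    using D by (simp add: CLW_eq)
  show "F \<in> GW.C k" using assms by (simp add: CLW_eq)
  fix p F assume p: "p \<in> {0, 1}" and FC: "F \<in> GW.C k" and h: "LM.W.hom k p (GW.pull F)"
  have F: "F \<in> CLW n N V k" "homogLW n N V k p F" using FC h homogLW_hom by (simp_all add: CLW_eq)
  show "dLW n N V k F = DW.lin_ext k F"
  proof (rule GW.C_eqI[of _ "Suc k"])
    show "dLW n N V k F \<in> GW.C (Suc k)" "DW.lin_ext k F \<in> GW.C (Suc k)"
      using D E F(1) by (auto simp: linear_on_def CLW_eq)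
    fix X assume "length X = Suc k" "set X \<subseteq> (\<Union>q. Gr q)"
    then obtain xss where xss: "xss \<in> hargs n N (Suc k)" "X = map (wL n N) xss" by (rule gens_hargs)
    then have x: "xss \<in> hargs n N (k + 1)" by simp
    show "dLW n N V k F X = DW.lin_ext k F X"
      unfolding xss(2) D[THEN conjunct2, rule_format, OF p F x] E[THEN conjunct2, rule_format, OF p F x] ..
  qed
qed

lemma lin_ext_add:
  assumes "linear_on sF A sG B h" "x \<in> A" "y \<in> A" shows "h (x + y) = h x + h y"
  using assms by (simp add: linear_on_def)

lemma Gr_Lg: "set X \<subseteq> (\<Union>q. Gr q) \<Longrightarrow> set X \<subseteq> (\<Union>q. Lg q)"
proof -
  have "Gr q \<subseteq> Lg q" for q unfolding EG_def Gr_def by (rule E.span_superset)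
  then show "set X \<subseteq> (\<Union>q. Gr q) \<Longrightarrow> set X \<subseteq> (\<Union>q. Lg q)" by blast
qed

lemma Lg_LN: "set X \<subseteq> (\<Union>q. Lg q) \<Longrightarrow> set X \<subseteq> LN n N"
  using GV.Lg_LN by blast

lemma graded_exists:
  assumes "set X \<subseteq> (\<Union>q. Lg q)" obtains es where "LM.V.graded X es"
proof -
  have "\<exists>es. LM.V.graded X es" using assms
  proof (induction X)
    case Nil show ?case by (intro exI[of _ "[]"]) simp
  next
    case (Cons x X)
    then obtain es e where "LM.V.graded X es" "x \<in> Lg e" by auto
    then show ?case by (intro exI[of _ "e # es"]) simp
  qed
  then show thesis using that by blast
qed

lemma hom_lin_ext_V:
  assumes f: "f \<in> GV.C k" and h: "LM.V.hom k p (GV.pull f)" and p: "p \<in> {0, 1}"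
  shows "LM.V.hom (Suc k) p (GV.pull (DV.lin_ext k f))"
  unfolding LM.V.hom_def
proof (intro allI impI)
  fix Z es assume Z: "length Z = Suc k" "LM.V.graded Z es"
  have ZL: "set Z \<subseteq> LN n N"
    using Z(2) GV.Lg_LN by (induction Z es rule: list_all2_induct) auto
  have "LM.V.hom (Suc k) p (LM.V.coboundary p (GV.pull f))"
    by (rule LM.V.coboundary_hom[OF GV.good_cochain[OF GV.pull_good[OF f]] h])
  then show "GV.pull (DV.lin_ext k f) Z \<in> HV (p + sum_list es)"
    using Z unfolding GV.pull_eq[OF ZL] DV.lin_ext_hom[OF f h Z(1) ZL p] LM.V.hom_def by blast
qed

lemma hom_lin_ext_D:
  assumes f: "f \<in> GV.C k" and h: "LM.V.hom k p (GV.pull f)" and p: "p \<in> {0, 1}"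
  shows "LM.W.hom (Suc k) p (GW.pull (DD.lin_ext k f))"
  unfolding LM.W.hom_def
proof (intro allI impI)
  fix Z es assume Z: "length Z = Suc k" "LM.V.graded Z es"
  have ZL: "set Z \<subseteq> LN n N"
    using Z(2) GV.Lg_LN by (induction Z es rule: list_all2_induct) auto
  have "LM.W.hom (Suc k) p (LM.Dl p (GV.pull f))"
    by (rule LM.Dl_hom[OF GV.good_cochain[OF GV.pull_good[OF f]] h])
  then show "GW.pull (DD.lin_ext k f) Z \<in> Wg (p + sum_list es)"
    using Z unfolding GW.pull_eq[OF ZL] DD.lin_ext_hom[OF f h Z(1) ZL p] LM.W.hom_def by blast
qed

lemma homogeneous_identities:
  assumes f: "f \<in> GV.C k" and h: "LM.V.hom k p (GV.pull f)" and p: "p \<in> {0, 1}"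
  shows "DV.lin_ext (Suc k) (DV.lin_ext k f) = 0"
    and "DW.lin_ext (Suc k) (DD.lin_ext k f) = DD.lin_ext (Suc k) (DV.lin_ext k f)"
proof -
  note good = GV.pull_good[OF f]
  note cochain = GV.good_cochain[OF good]
  have g: "DV.lin_ext k f \<in> GV.C (Suc k)" by (rule DV.lin_ext_C[OF f])
  have G: "DD.lin_ext k f \<in> GW.C (Suc k)" by (rule DD.lin_ext_C[OF f])
  have tg: "GV.pull (DV.lin_ext k f) Z = LM.V.coboundary p (GV.pull f) Z" if "length Z = Suc k" "set Z \<subseteq> (\<Union>q. Lg q)" for Z
    using GV.pull_eq[OF Lg_LN[OF that(2)]] DV.lin_ext_hom[OF f h that(1) Lg_LN[OF that(2)] p] by simp
  have tG: "GW.pull (DD.lin_ext k f) Z = LM.Dl p (GV.pull f) Z" if "length Z = Suc k" "set Z \<subseteq> (\<Union>q. Lg q)" for Z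
    using GW.pull_eq[OF Lg_LN[OF that(2)]] DD.lin_ext_hom[OF f h that(1) Lg_LN[OF that(2)] p] by simp
  have V: "DV.lin_ext (Suc k) (DV.lin_ext k f) X = 0"
    "DW.lin_ext (Suc k) (DD.lin_ext k f) X = DD.lin_ext (Suc k) (DV.lin_ext k f) X"
    if X: "length X = Suc (Suc k)" "set X \<subseteq> (\<Union>q. Gr q)" for X
  proof -
    note XL = Gr_Lg[OF X(2)]
    obtain es where es: "LM.V.graded X es" by (rule graded_exists[OF XL])
    have "DV.lin_ext (Suc k) (DV.lin_ext k f) X = LM.V.coboundary p (GV.pull (DV.lin_ext k f)) X"
      by (rule DV.lin_ext_hom[OF g hom_lin_ext_V[OF f h p] X(1) Lg_LN[OF XL] p])
    also have "\<dots> = LM.V.coboundary p (LM.V.coboundary p (GV.pull f)) X"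
      by (rule LM.V.coboundary_cong_graded[OF GV.good_cochain[OF GV.pull_good[OF g]] LM.V.coboundary_cochain[OF cochain] X(1) XL tg])
    also have "\<dots> = 0" by (rule LM.V.coboundary_coboundary[OF cochain h X(1) es])
    finally show "DV.lin_ext (Suc k) (DV.lin_ext k f) X = 0" .
    have "DW.lin_ext (Suc k) (DD.lin_ext k f) X = LM.W.coboundary p (GW.pull (DD.lin_ext k f)) X"
      by (rule DW.lin_ext_hom[OF G hom_lin_ext_D[OF f h p] X(1) Lg_LN[OF XL] p])
    also have "\<dots> = LM.W.coboundary p (LM.Dl p (GV.pull f)) X"
      by (rule LM.W.coboundary_cong_graded[OF GW.good_cochain[OF GW.pull_good[OF G]] LM.Dl_cochain[OF cochain] X(1) XL tG])
    also have "\<dots> = LM.Dl p (LM.V.coboundary p (GV.pull f)) X" by (rule LM.coboundary_Dl[OF cochain h X(1) es])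
    also have "\<dots> = LM.Dl p (GV.pull (DV.lin_ext k f)) X"
      by (rule LM.Dl_cong_graded[OF LM.V.coboundary_mlin[OF cochain] GV.goodD(1)[OF GV.pull_good[OF g]] X(1) XL tg[symmetric]])
    also have "\<dots> = DD.lin_ext (Suc k) (DV.lin_ext k f) X"
      by (rule DD.lin_ext_hom[OF g hom_lin_ext_V[OF f h p] X(1) Lg_LN[OF XL] p, symmetric])
    finally show "DW.lin_ext (Suc k) (DD.lin_ext k f) X = DD.lin_ext (Suc k) (DV.lin_ext k f) X" .
  qed
  show "DV.lin_ext (Suc k) (DV.lin_ext k f) = 0"
  proof (rule GV.C_eqI[OF DV.lin_ext_C[OF g]])

    show "0 \<in> GV.C (Suc (Suc k))"
      unfolding GV.C_def multilinear_on_def using GV.M1_0 by (auto simp: linear_on_def fun_scale_def vs_zero[OF V.vsS] zero_fun_def)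
  qed (simp add: V(1))
  show "DW.lin_ext (Suc k) (DD.lin_ext k f) = DD.lin_ext (Suc k) (DV.lin_ext k f)"
    by (rule GW.C_eqI[OF DW.lin_ext_C[OF G] DD.lin_ext_C[OF g] V(2)])
qed

lemma identities:
  assumes f: "f \<in> GV.C k"
  shows "DV.lin_ext (Suc k) (DV.lin_ext k f) = 0"
    and "DW.lin_ext (Suc k) (DD.lin_ext k f) = DD.lin_ext (Suc k) (DV.lin_ext k f)"
proof -
  let ?f = "\<lambda>p. GV.cut k (GV.hcomp p (GV.pull f))"
  have C: "?f p \<in> GV.C k" for p by (rule GV.comp_C[OF f])
  have h: "LM.V.hom k p (GV.pull (?f p))" for p by (rule GV.comp_hom[OF f])

  note a = lin_ext_add[OF DV.lin_ext_linear] lin_ext_add[OF DD.lin_ext_linear] lin_ext_add[OF DW.lin_ext_linear]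
  have v: "DV.lin_ext k f = DV.lin_ext k (?f 0) + DV.lin_ext k (?f 1)"
    using a(1)[OF C C, of 0 1] unfolding GV.comp_sum[OF f] .
  have d: "DD.lin_ext k f = DD.lin_ext k (?f 0) + DD.lin_ext k (?f 1)"
    using a(2)[OF C C, of 0 1] unfolding GV.comp_sum[OF f] .
  have "0 \<in> {0, 1::nat}" "1 \<in> {0, 1::nat}" by simp_all
  note I0 = homogeneous_identities[OF C h this(1)] and I1 = homogeneous_identities[OF C h this(2)]
  show "DV.lin_ext (Suc k) (DV.lin_ext k f) = 0"
    unfolding v a(1)[OF DV.lin_ext_C[OF C] DV.lin_ext_C[OF C]] I0(1) I1(1) by (rule add_0)
  show "DW.lin_ext (Suc k) (DD.lin_ext k f) = DD.lin_ext (Suc k) (DV.lin_ext k f)"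
    unfolding v d a(2)[OF DV.lin_ext_C[OF C] DV.lin_ext_C[OF C]] a(3)[OF DD.lin_ext_C[OF C] DD.lin_ext_C[OF C]] I0(2) I1(2) ..
qed

end

theorem theorem4p6:
  fixes n :: nat
    and N :: "('k::field, 'a::ab_group_add) nary_superalgebra"
    and V :: "('k, 'a, 'v::ab_group_add) nary_module"
  assumes "n \<ge> 2"
    and "nambu_lie_superalgebra n N"
    and "nambu_module n N V"
  shows "(\<forall>k. is_delta n N V k (delta n N V k)) \<and>
    (\<forall>k. \<forall>f\<in>CNV n N V k. delta n N V (k + 1) (delta n N V k f) = 0) \<and>
    (\<forall>k. \<forall>f\<in>CNV n N V k.
       dLW n N V (k + 1) (Delta n N V k f) = Delta n N V (k + 1) (delta n N V k f))"
proof -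
  interpret nambu n N V using assms by unfold_locales
  have "delta n N V (k + 1) (delta n N V k f) = 0 \<and>
      dLW n N V (k + 1) (Delta n N V k f) = Delta n N V (k + 1) (delta n N V k f)" if f: "f \<in> CNV n N V k" for k f
  proof -
    have fC: "f \<in> GV.C k" using f by (simp add: CNV_eq)
    have C: "DV.lin_ext k f \<in> CNV n N V (Suc k)" "DD.lin_ext k f \<in> CLW n N V (Suc k)"
      using DV.lin_ext_C[OF fC] DD.lin_ext_C[OF fC] by (simp_all add: CNV_eq CLW_eq)
    show ?thesis
      unfolding Suc_eq_plus1[symmetric] delta_eq[OF f] Delta_eq[OF f] delta_eq[OF C(1)] Delta_eq[OF C(1)]
        dLW_eq[OF C(2) zero_less_Suc] identities[OF fC] by simp
  qed
  then show ?thesis using delta_is_delta by blast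
qed

end
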